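(* Let $(\mathcal{M},\otimes,\mathbf{1},\sigma)$ be a braided monoidal category which has equalizers and coequalizers that are preserved by $\otimes$, and let $A$ be an object in $\mathsf{Hopf}_{\mathrm{coc}}(\mathcal{M})$. Consider the mutually inverse bijections $\phi_A,\psi_A$ between subobjects $i:K\to A$ of $A$ in $\mathsf{Hopf}_{\mathrm{coc}}(\mathcal{M})$ which are the equalizer in $\mathcal{M}$ of $q_{A,A}(u_A\otimes\mathrm{Id}_A),\ q_{A,A}(\mathrm{Id}_A\otimes u_A):A\to A\otimes_K A$, and quotients $\pi:A\to Q$ of $A$ in $\mathsf{Comon}_{\mathrm{coc}}({}_A\mathcal{M})$ which are the coequalizer in $\mathcal{M}$ of $(\varepsilon_A\otimes\mathrm{Id}_A)e_{A,A},\ (\mathrm{Id}_A\otimes\varepsilon_A)e_{A,A}:A\square_Q A\to A$; here $\phi_A(i)$ is the coequalizer in $\mathcal{M}$ of $m_A(\mathrm{Id}_A\otimes i),\ \mathrm{Id}_A\otimes\varepsilon_K:A\otimes K\to A$ and $\psi_A(\pi)$ is the equalizer in $\mathcal{M}$ of $(\pi\otimes\mathrm{Id}_A)\Delta_A,\ \pi u_A\otimes\mathrm{Id}_A:A\to Q\otimes A$. This bijective correspondence restricts to a bijective correspondence between subobjects of $A$ which are kernels in $\mathsf{Hopf}_{\mathrm{coc}}(\mathcal{M})$ and quotients of $A$ in $\mathsf{Comon}_{\mathrm{coc}}({}_A\mathcal{M})$ which are regular epimorphisms in $\mathsf{Hopf}_{\mathrm{coc}}(\mathcal{M})$.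
   Context: Associativity and unit constraints are suppressed. "Preserved by $\otimes$" means preserved by $M\otimes(-)$ and $(-)\otimes M$ for every object $M$. $\mathsf{Hopf}_{\mathrm{coc}}(\mathcal{M})$ is the category of Hopf monoids $(A,m_A,u_A,\Delta_A,\varepsilon_A,S_A)$ in $\mathcal{M}$ with $\sigma_{A,A}\Delta_A=\Delta_A$ and Hopf monoid morphisms; it is pointed with zero object $\mathbf{1}$ (zero morphism $A\to B$: $u_B\varepsilon_A$), and kernels are taken with respect to it. $\mathsf{Comon}_{\mathrm{coc}}({}_A\mathcal{M})$: objects are cocommutative comonoids $Q$ in $\mathcal{M}$ with a left $A$-action $\mu_Q:A\otimes Q\to Q$ such that $\Delta_Q$ and $\varepsilon_Q$ are left $A$-linear, where $Q\otimes Q$ has action $(\mu_Q\otimes\mu_Q)(\mathrm{Id}_A\otimes\sigma_{A,Q}\otimes\mathrm{Id}_Q)(\Delta_A\otimes\mathrm{Id}_{Q\otimes Q})$ and $\mathbf{1}$ has action $\varepsilon_A$; morphisms are left $A$-linear comonoid morphisms. $A$ is an object of it with action $m_A$. A subobject of $A$ in $\mathsf{Hopf}_{\mathrm{coc}}(\mathcal{M})$ is an isomorphism class of monomorphisms $i:K\to A$ there; a quotient of $A$ in $\mathsf{Comon}_{\mathrm{coc}}({}_A\mathcal{M})$ is an isomorphism class of epimorphisms $\pi:A\to Q$ there. Such a quotient is a regular epimorphism in $\mathsf{Hopf}_{\mathrm{coc}}(\mathcal{M})$ if the comonoid $Q$ carries a cocommutative Hopf monoid structure for which $\pi$ is a morphism,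 and a coequalizer of some pair of morphisms, in $\mathsf{Hopf}_{\mathrm{coc}}(\mathcal{M})$. $q_{A,A}:A\otimes A\to A\otimes_K A$ is the coequalizer in $\mathcal{M}$ of $m_A(\mathrm{Id}_A\otimes i)\otimes\mathrm{Id}_A$ and $\mathrm{Id}_A\otimes m_A(i\otimes\mathrm{Id}_A)$, $A\otimes K\otimes A\to A\otimes A$. $e_{A,A}:A\square_Q A\to A\otimes A$ is the equalizer in $\mathcal{M}$ of $(\mathrm{Id}_A\otimes\pi)\Delta_A\otimes\mathrm{Id}_A$ and $\mathrm{Id}_A\otimes(\pi\otimes\mathrm{Id}_A)\Delta_A$, $A\otimes A\to A\otimes Q\otimes A$. The codomain of $\phi_A(i)$ has the unique structure in $\mathsf{Comon}_{\mathrm{coc}}({}_A\mathcal{M})$ making $\phi_A(i)$ a morphism there; the domain of $\psi_A(\pi)$ has the unique structure in $\mathsf{Hopf}_{\mathrm{coc}}(\mathcal{M})$ making $\psi_A(\pi)$ a morphism there. *)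

theory Defs
  imports Main
begin

section \<open>Categories\<close>

record ('o, 'm) cat =
  Obj :: "'o set"
  Arr :: "'m set"
  Dom :: "'m \<Rightarrow> 'o"
  Cod :: "'m \<Rightarrow> 'o"
  Ident :: "'o \<Rightarrow> 'm"  ("\<I>\<index>")
  Comp :: "'m \<Rightarrow> 'm \<Rightarrow> 'm"  (infixl "\<cdot>\<index>" 70)

definition hom :: "('o, 'm, 'z) cat_scheme \<Rightarrow> 'o \<Rightarrow> 'o \<Rightarrow> 'm set" where
  "hom C X Y = {f \<in> Arr C. Dom C f = X \<and> Cod C f = Y}"

locale category =
  fixes C :: "('o, 'm, 'z) cat_scheme" (structure)
  assumes Dom_Obj: "f \<in> Arr C \<Longrightarrow> Dom C f \<in> Obj C"
    and Cod_Obj: "f \<in> Arr C \<Longrightarrow> Cod C f \<in> Obj C"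
    and Ident_hom: "X \<in> Obj C \<Longrightarrow> \<I> X \<in> hom C X X"
    and Comp_hom: "f \<in> hom C X Y \<Longrightarrow> g \<in> hom C Y Z \<Longrightarrow> g \<cdot> f \<in> hom C X Z"
    and Comp_Ident: "f \<in> hom C X Y \<Longrightarrow> f \<cdot> \<I> X = f"
    and Ident_Comp: "f \<in> hom C X Y \<Longrightarrow> \<I> Y \<cdot> f = f"
    and Comp_assoc: "f \<in> hom C W X \<Longrightarrow> g \<in> hom C X Y \<Longrightarrow> h \<in> hom C Y Z
           \<Longrightarrow> h \<cdot> (g \<cdot> f) = (h \<cdot> g) \<cdot> f"

context
  fixes C :: "('o, 'm, 'z) cat_scheme" (structure)
begin

definition inverse_arrows :: "'m \<Rightarrow> 'm \<Rightarrow> bool" where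
  "inverse_arrows f g \<longleftrightarrow>
     f \<in> Arr C \<and> g \<in> hom C (Cod C f) (Dom C f) \<and>
     g \<cdot> f = \<I> (Dom C f) \<and> f \<cdot> g = \<I> (Cod C f)"

definition iso_arrow :: "'m \<Rightarrow> bool" where
  "iso_arrow f \<longleftrightarrow> (\<exists>g. inverse_arrows f g)"

definition inv_arrow :: "'m \<Rightarrow> 'm" where
  "inv_arrow f = (THE g. inverse_arrows f g)"

definition monic :: "'m \<Rightarrow> bool" where
  "monic i \<longleftrightarrow> i \<in> Arr C \<and>
     (\<forall>X g h. g \<in> hom C X (Dom C i) \<and> h \<in> hom C X (Dom C i) \<and> i \<cdot> g = i \<cdot> h \<longrightarrow> g = h)"

definition epic :: "'m \<Rightarrow> bool" where
  "epic p \<longleftrightarrow> p \<in> Arr C \<and>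
     (\<forall>Y g h. g \<in> hom C (Cod C p) Y \<and> h \<in> hom C (Cod C p) Y \<and> g \<cdot> p = h \<cdot> p \<longrightarrow> g = h)"

definition parallel :: "'m \<Rightarrow> 'm \<Rightarrow> bool" where
  "parallel f g \<longleftrightarrow> f \<in> Arr C \<and> g \<in> Arr C \<and> Dom C f = Dom C g \<and> Cod C f = Cod C g"

definition is_equalizer :: "'m \<Rightarrow> 'm \<Rightarrow> 'm \<Rightarrow> bool" where
  "is_equalizer f g e \<longleftrightarrow>
     parallel f g \<and> e \<in> Arr C \<and> Cod C e = Dom C f \<and> f \<cdot> e = g \<cdot> e \<and>
     (\<forall>h \<in> Arr C. Cod C h = Dom C f \<and> f \<cdot> h = g \<cdot> h \<longrightarrow>
        (\<exists>!k. k \<in> hom C (Dom C h) (Dom C e) \<and> e \<cdot> k = h))"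

definition is_coequalizer :: "'m \<Rightarrow> 'm \<Rightarrow> 'm \<Rightarrow> bool" where
  "is_coequalizer f g q \<longleftrightarrow>
     parallel f g \<and> q \<in> Arr C \<and> Dom C q = Cod C f \<and> q \<cdot> f = q \<cdot> g \<and>
     (\<forall>h \<in> Arr C. Dom C h = Cod C f \<and> h \<cdot> f = h \<cdot> g \<longrightarrow>
        (\<exists>!k. k \<in> hom C (Cod C q) (Cod C h) \<and> k \<cdot> q = h))"

definition has_equalizers :: bool where
  "has_equalizers \<longleftrightarrow> (\<forall>f g. parallel f g \<longrightarrow> (\<exists>e. is_equalizer f g e))"

definition has_coequalizers :: bool where
  "has_coequalizers \<longleftrightarrow> (\<forall>f g. parallel f g \<longrightarrow> (\<exists>q. is_coequalizer f g q))"

definition regular_epi :: "'m \<Rightarrow> bool" where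
  "regular_epi p \<longleftrightarrow> (\<exists>f g. is_coequalizer f g p)"

definition subobject_class :: "'m \<Rightarrow> 'm set" where
  "subobject_class i =
     {j. monic j \<and> (\<exists>h. iso_arrow h \<and> h \<in> hom C (Dom C i) (Dom C j) \<and> j \<cdot> h = i)}"

definition subobjects :: "'o \<Rightarrow> 'm set set" where
  "subobjects A = {subobject_class i | i. monic i \<and> Cod C i = A}"

definition quotient_class :: "'m \<Rightarrow> 'm set" where
  "quotient_class p =
     {q. epic q \<and> (\<exists>h. iso_arrow h \<and> h \<in> hom C (Cod C p) (Cod C q) \<and> h \<cdot> p = q)}"

definition quotients :: "'o \<Rightarrow> 'm set set" where
  "quotients A = {quotient_class p | p. epic p \<and> Dom C p = A}"

end

section \<open>Braided monoidal categories\<close>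

record ('o, 'm) braided_cat = "('o, 'm) cat" +
  TenO :: "'o \<Rightarrow> 'o \<Rightarrow> 'o"  (infixr "\<otimes>\<index>" 75)
  TenA :: "'m \<Rightarrow> 'm \<Rightarrow> 'm"  (infixr "\<boxtimes>\<index>" 75)
  TUnit :: 'o  ("\<one>\<index>")
  Assoc :: "'o \<Rightarrow> 'o \<Rightarrow> 'o \<Rightarrow> 'm"  ("\<alpha>\<index>")
  LUnit :: "'o \<Rightarrow> 'm"  ("\<lambda>\<^bold>l\<index>")
  RUnit :: "'o \<Rightarrow> 'm"  ("\<rho>\<index>")
  Braid :: "'o \<Rightarrow> 'o \<Rightarrow> 'm"  ("\<sigma>\<index>")

locale braided_monoidal_category = category C
  for C :: "('o, 'm) braided_cat" (structure) +
  assumes TenO_Obj: "X \<in> Obj C \<Longrightarrow> Y \<in> Obj C \<Longrightarrow> X \<otimes> Y \<in> Obj C"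
    and TenA_hom: "f \<in> hom C X Y \<Longrightarrow> g \<in> hom C Z W \<Longrightarrow> f \<boxtimes> g \<in> hom C (X \<otimes> Z) (Y \<otimes> W)"
    and TenA_Ident: "X \<in> Obj C \<Longrightarrow> Y \<in> Obj C \<Longrightarrow> \<I> X \<boxtimes> \<I> Y = \<I> (X \<otimes> Y)"
    and TenA_Comp: "f \<in> hom C X Y \<Longrightarrow> f' \<in> hom C Y Z \<Longrightarrow> g \<in> hom C U V \<Longrightarrow> g' \<in> hom C V W
           \<Longrightarrow> (f' \<cdot> f) \<boxtimes> (g' \<cdot> g) = (f' \<boxtimes> g') \<cdot> (f \<boxtimes> g)"
    and TUnit_Obj: "\<one> \<in> Obj C"
    and Assoc_hom: "X \<in> Obj C \<Longrightarrow> Y \<in> Obj C \<Longrightarrow> Z \<in> Obj C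
           \<Longrightarrow> \<alpha> X Y Z \<in> hom C ((X \<otimes> Y) \<otimes> Z) (X \<otimes> (Y \<otimes> Z))"
    and Assoc_iso: "X \<in> Obj C \<Longrightarrow> Y \<in> Obj C \<Longrightarrow> Z \<in> Obj C \<Longrightarrow> iso_arrow C (\<alpha> X Y Z)"
    and Assoc_nat: "f \<in> hom C X X' \<Longrightarrow> g \<in> hom C Y Y' \<Longrightarrow> h \<in> hom C Z Z'
           \<Longrightarrow> \<alpha> X' Y' Z' \<cdot> ((f \<boxtimes> g) \<boxtimes> h) = (f \<boxtimes> (g \<boxtimes> h)) \<cdot> \<alpha> X Y Z"
    and LUnit_hom: "X \<in> Obj C \<Longrightarrow> \<lambda>\<^bold>l X \<in> hom C (\<one> \<otimes> X) X"
    and LUnit_iso: "X \<in> Obj C \<Longrightarrow> iso_arrow C (\<lambda>\<^bold>l X)"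
    and LUnit_nat: "f \<in> hom C X Y \<Longrightarrow> \<lambda>\<^bold>l Y \<cdot> (\<I> \<one> \<boxtimes> f) = f \<cdot> \<lambda>\<^bold>l X"
    and RUnit_hom: "X \<in> Obj C \<Longrightarrow> \<rho> X \<in> hom C (X \<otimes> \<one>) X"
    and RUnit_iso: "X \<in> Obj C \<Longrightarrow> iso_arrow C (\<rho> X)"
    and RUnit_nat: "f \<in> hom C X Y \<Longrightarrow> \<rho> Y \<cdot> (f \<boxtimes> \<I> \<one>) = f \<cdot> \<rho> X"
    and pentagon: "W \<in> Obj C \<Longrightarrow> X \<in> Obj C \<Longrightarrow> Y \<in> Obj C \<Longrightarrow> Z \<in> Obj C
           \<Longrightarrow> \<alpha> W X (Y \<otimes> Z) \<cdot> \<alpha> (W \<otimes> X) Y Z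
             = (\<I> W \<boxtimes> \<alpha> X Y Z) \<cdot> \<alpha> W (X \<otimes> Y) Z \<cdot> (\<alpha> W X Y \<boxtimes> \<I> Z)"
    and triangle: "X \<in> Obj C \<Longrightarrow> Y \<in> Obj C
           \<Longrightarrow> (\<I> X \<boxtimes> \<lambda>\<^bold>l Y) \<cdot> \<alpha> X \<one> Y = \<rho> X \<boxtimes> \<I> Y"
    and Braid_hom: "X \<in> Obj C \<Longrightarrow> Y \<in> Obj C \<Longrightarrow> \<sigma> X Y \<in> hom C (X \<otimes> Y) (Y \<otimes> X)"
    and Braid_iso: "X \<in> Obj C \<Longrightarrow> Y \<in> Obj C \<Longrightarrow> iso_arrow C (\<sigma> X Y)"
    and Braid_nat: "f \<in> hom C X X' \<Longrightarrow> g \<in> hom C Y Y'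
           \<Longrightarrow> \<sigma> X' Y' \<cdot> (f \<boxtimes> g) = (g \<boxtimes> f) \<cdot> \<sigma> X Y"
    and hexagon1: "X \<in> Obj C \<Longrightarrow> Y \<in> Obj C \<Longrightarrow> Z \<in> Obj C
           \<Longrightarrow> \<alpha> Y Z X \<cdot> \<sigma> X (Y \<otimes> Z) \<cdot> \<alpha> X Y Z
             = (\<I> Y \<boxtimes> \<sigma> X Z) \<cdot> \<alpha> Y X Z \<cdot> (\<sigma> X Y \<boxtimes> \<I> Z)"
    and hexagon2: "X \<in> Obj C \<Longrightarrow> Y \<in> Obj C \<Longrightarrow> Z \<in> Obj C
           \<Longrightarrow> inv_arrow C (\<alpha> Z X Y) \<cdot> \<sigma> (X \<otimes> Y) Z \<cdot> inv_arrow C (\<alpha> X Y Z)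
             = (\<sigma> X Z \<boxtimes> \<I> Y) \<cdot> inv_arrow C (\<alpha> X Z Y) \<cdot> (\<I> X \<boxtimes> \<sigma> Y Z)"

section \<open>Monoids, comonoids and modules in a braided monoidal category\<close>

record ('o, 'm) comonoid =
  carr :: 'o
  comult :: 'm
  counit :: 'm

record ('o, 'm) hopf = "('o, 'm) comonoid" +
  mult :: 'm
  munit :: 'm
  antipode :: 'm

record ('o, 'm) modcomon = "('o, 'm) comonoid" +
  act :: 'm

text \<open>Arrows of the two derived categories carry their domain and codomain, since one arrow of the
  base category may be a morphism for several structures on its domain and codomain.\<close>

type_synonym ('o, 'm) hopf_arrow = "('o, 'm) hopf \<times> 'm \<times> ('o, 'm) hopf"
type_synonym ('o, 'm) modcomon_arrow = "('o, 'm) modcomon \<times> 'm \<times> ('o, 'm) modcomon"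

text \<open>The module comonoid given by a Hopf monoid acting on itself by multiplication.\<close>

definition regular_module :: "('o, 'm) hopf \<Rightarrow> ('o, 'm) modcomon" where
  "regular_module A = \<lparr>carr = carr A, comult = comult A, counit = counit A, act = mult A\<rparr>"

context
  fixes C :: "('o, 'm) braided_cat" (structure)
begin

definition tensor_preserves_equalizers :: bool where
  "tensor_preserves_equalizers \<longleftrightarrow>
     (\<forall>f g e. is_equalizer C f g e \<longrightarrow>
       (\<forall>Z \<in> Obj C. is_equalizer C (\<I> Z \<boxtimes> f) (\<I> Z \<boxtimes> g) (\<I> Z \<boxtimes> e) \<and>
                    is_equalizer C (f \<boxtimes> \<I> Z) (g \<boxtimes> \<I> Z) (e \<boxtimes> \<I> Z)))"

definition tensor_preserves_coequalizers :: bool where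
  "tensor_preserves_coequalizers \<longleftrightarrow>
     (\<forall>f g q. is_coequalizer C f g q \<longrightarrow>
       (\<forall>Z \<in> Obj C. is_coequalizer C (\<I> Z \<boxtimes> f) (\<I> Z \<boxtimes> g) (\<I> Z \<boxtimes> q) \<and>
                    is_coequalizer C (f \<boxtimes> \<I> Z) (g \<boxtimes> \<I> Z) (q \<boxtimes> \<I> Z)))"

text \<open>The middle interchange, i.e. \<open>\<I> X \<boxtimes> \<sigma> Y Z \<boxtimes> \<I> W\<close> with associativity constraints inserted,
  from \<open>(X \<otimes> Y) \<otimes> (Z \<otimes> W)\<close> to \<open>(X \<otimes> Z) \<otimes> (Y \<otimes> W)\<close>.\<close>

definition middle :: "'o \<Rightarrow> 'o \<Rightarrow> 'o \<Rightarrow> 'o \<Rightarrow> 'm" where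
  "middle X Y Z W =
     inv_arrow C (\<alpha> X Z (Y \<otimes> W)) \<cdot>
     (\<I> X \<boxtimes> (\<alpha> Z Y W \<cdot> (\<sigma> Y Z \<boxtimes> \<I> W) \<cdot> inv_arrow C (\<alpha> Y Z W))) \<cdot>
     \<alpha> X Y (Z \<otimes> W)"

definition coc_comonoid :: "('o, 'm, 'y) comonoid_scheme \<Rightarrow> bool" where
  "coc_comonoid Q \<longleftrightarrow> (let X = carr Q; \<Delta> = comult Q; \<epsilon> = counit Q in
     X \<in> Obj C \<and> \<Delta> \<in> hom C X (X \<otimes> X) \<and> \<epsilon> \<in> hom C X \<one> \<and>
     \<alpha> X X X \<cdot> (\<Delta> \<boxtimes> \<I> X) \<cdot> \<Delta> = (\<I> X \<boxtimes> \<Delta>) \<cdot> \<Delta> \<and>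
     \<lambda>\<^bold>l X \<cdot> (\<epsilon> \<boxtimes> \<I> X) \<cdot> \<Delta> = \<I> X \<and>
     \<rho> X \<cdot> (\<I> X \<boxtimes> \<epsilon>) \<cdot> \<Delta> = \<I> X \<and>
     \<sigma> X X \<cdot> \<Delta> = \<Delta>)"

definition comonoid_morphism ::
    "('o, 'm, 'y) comonoid_scheme \<Rightarrow> ('o, 'm, 'y) comonoid_scheme \<Rightarrow> 'm \<Rightarrow> bool" where
  "comonoid_morphism P Q f \<longleftrightarrow>
     f \<in> hom C (carr P) (carr Q) \<and>
     comult Q \<cdot> f = (f \<boxtimes> f) \<cdot> comult P \<and>
     counit Q \<cdot> f = counit P"

definition monoid_object :: "('o, 'm) hopf \<Rightarrow> bool" where
  "monoid_object A \<longleftrightarrow> (let X = carr A; m = mult A; u = munit A in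
     X \<in> Obj C \<and> m \<in> hom C (X \<otimes> X) X \<and> u \<in> hom C \<one> X \<and>
     m \<cdot> (m \<boxtimes> \<I> X) = m \<cdot> (\<I> X \<boxtimes> m) \<cdot> \<alpha> X X X \<and>
     m \<cdot> (u \<boxtimes> \<I> X) = \<lambda>\<^bold>l X \<and>
     m \<cdot> (\<I> X \<boxtimes> u) = \<rho> X)"

definition coc_hopf_monoid :: "('o, 'm) hopf \<Rightarrow> bool" where
  "coc_hopf_monoid A \<longleftrightarrow> monoid_object A \<and> coc_comonoid A \<and>
    (let X = carr A; m = mult A; u = munit A; \<Delta> = comult A; \<epsilon> = counit A; S = antipode A in
     \<Delta> \<cdot> m = (m \<boxtimes> m) \<cdot> middle X X X X \<cdot> (\<Delta> \<boxtimes> \<Delta>) \<and>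
     \<epsilon> \<cdot> m = \<lambda>\<^bold>l \<one> \<cdot> (\<epsilon> \<boxtimes> \<epsilon>) \<and>
     \<Delta> \<cdot> u = (u \<boxtimes> u) \<cdot> inv_arrow C (\<lambda>\<^bold>l \<one>) \<and>
     \<epsilon> \<cdot> u = \<I> \<one> \<and>
     S \<in> hom C X X \<and>
     m \<cdot> (S \<boxtimes> \<I> X) \<cdot> \<Delta> = u \<cdot> \<epsilon> \<and>
     m \<cdot> (\<I> X \<boxtimes> S) \<cdot> \<Delta> = u \<cdot> \<epsilon>)"

text \<open>Compatibility with the antipodes is automatic for bimonoid morphisms between Hopf monoids.\<close>

definition hopf_morphism :: "('o, 'm) hopf \<Rightarrow> ('o, 'm) hopf \<Rightarrow> 'm \<Rightarrow> bool" where
  "hopf_morphism A B f \<longleftrightarrow>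
     comonoid_morphism A B f \<and>
     f \<cdot> mult A = mult B \<cdot> (f \<boxtimes> f) \<and>
     f \<cdot> munit A = munit B"

definition Hopf_coc :: "(('o, 'm) hopf, ('o, 'm) hopf_arrow) cat" where
  "Hopf_coc = \<lparr>
     Obj = {A. coc_hopf_monoid A},
     Arr = {(A, f, B). coc_hopf_monoid A \<and> coc_hopf_monoid B \<and> hopf_morphism A B f},
     Dom = (\<lambda>(A, f, B). A),
     Cod = (\<lambda>(A, f, B). B),
     Ident = (\<lambda>A. (A, \<I> (carr A), A)),
     Comp = (\<lambda>(B', g, D) (A, f, B). (A, g \<cdot> f, D))\<rparr>"

definition tensor_act :: "('o, 'm) hopf \<Rightarrow> ('o, 'm) modcomon \<Rightarrow> 'm" where
  "tensor_act A Q =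
     (act Q \<boxtimes> act Q) \<cdot> middle (carr A) (carr A) (carr Q) (carr Q) \<cdot>
     (comult A \<boxtimes> \<I> (carr Q \<otimes> carr Q))"

definition trivial_act :: "('o, 'm) hopf \<Rightarrow> 'm" where
  "trivial_act A = counit A \<cdot> \<rho> (carr A)"

definition module_comonoid :: "('o, 'm) hopf \<Rightarrow> ('o, 'm) modcomon \<Rightarrow> bool" where
  "module_comonoid A Q \<longleftrightarrow> coc_comonoid Q \<and>
    (let X = carr A; Y = carr Q; \<mu> = act Q in
     \<mu> \<in> hom C (X \<otimes> Y) Y \<and>
     \<mu> \<cdot> (mult A \<boxtimes> \<I> Y) = \<mu> \<cdot> (\<I> X \<boxtimes> \<mu>) \<cdot> \<alpha> X X Y \<and>
     \<mu> \<cdot> (munit A \<boxtimes> \<I> Y) = \<lambda>\<^bold>l Y \<and>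
     comult Q \<cdot> \<mu> = tensor_act A Q \<cdot> (\<I> X \<boxtimes> comult Q) \<and>
     counit Q \<cdot> \<mu> = trivial_act A \<cdot> (\<I> X \<boxtimes> counit Q))"

definition modcomon_morphism ::
    "('o, 'm) hopf \<Rightarrow> ('o, 'm) modcomon \<Rightarrow> ('o, 'm) modcomon \<Rightarrow> 'm \<Rightarrow> bool" where
  "modcomon_morphism A P Q f \<longleftrightarrow>
     comonoid_morphism P Q f \<and>
     f \<cdot> act P = act Q \<cdot> (\<I> (carr A) \<boxtimes> f)"

definition Comon_coc ::
    "('o, 'm) hopf \<Rightarrow> (('o, 'm) modcomon, ('o, 'm) modcomon_arrow) cat" where
  "Comon_coc A = \<lparr>
     Obj = {Q. module_comonoid A Q},
     Arr = {(P, f, Q). module_comonoid A P \<and> module_comonoid A Q \<and> modcomon_morphism A P Q f},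
     Dom = (\<lambda>(P, f, Q). P),
     Cod = (\<lambda>(P, f, Q). Q),
     Ident = (\<lambda>Q. (Q, \<I> (carr Q), Q)),
     Comp = (\<lambda>(Q', g, R) (P, f, Q). (P, g \<cdot> f, R))\<rparr>"

section \<open>The Galois correspondence\<close>

text \<open>\<open>A \<otimes>\<^sub>K A\<close> and \<open>A \<box>\<^sub>Q A\<close> enter only through their universal properties, so the conditions
  below quantify existentially over the coequalizer \<open>q\<close> and the equalizer \<open>e\<close>; nothing depends
  on the choice.\<close>

definition is_tensor_over :: "('o, 'm) hopf \<Rightarrow> ('o, 'm) hopf \<Rightarrow> 'm \<Rightarrow> 'm \<Rightarrow> bool" where
  "is_tensor_over A K i q \<longleftrightarrow> (let X = carr A; m = mult A in
     is_coequalizer C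
       ((m \<cdot> (\<I> X \<boxtimes> i)) \<boxtimes> \<I> X)
       ((\<I> X \<boxtimes> (m \<cdot> (i \<boxtimes> \<I> X))) \<cdot> \<alpha> X (carr K) X)
       q)"

definition is_cotensor_over :: "('o, 'm) hopf \<Rightarrow> ('o, 'm) modcomon \<Rightarrow> 'm \<Rightarrow> 'm \<Rightarrow> bool" where
  "is_cotensor_over A Q p e \<longleftrightarrow> (let X = carr A; \<Delta> = comult A in
     is_equalizer C
       (((\<I> X \<boxtimes> p) \<cdot> \<Delta>) \<boxtimes> \<I> X)
       (inv_arrow C (\<alpha> X (carr Q) X) \<cdot> (\<I> X \<boxtimes> ((p \<boxtimes> \<I> X) \<cdot> \<Delta>)))
       e)"

definition sub_condition :: "('o, 'm) hopf \<Rightarrow> ('o, 'm) hopf \<Rightarrow> 'm \<Rightarrow> bool" where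
  "sub_condition A K i \<longleftrightarrow> (let X = carr A; u = munit A in
     \<exists>q. is_tensor_over A K i q \<and>
         is_equalizer C
           (q \<cdot> (u \<boxtimes> \<I> X) \<cdot> inv_arrow C (\<lambda>\<^bold>l X))
           (q \<cdot> (\<I> X \<boxtimes> u) \<cdot> inv_arrow C (\<rho> X))
           i)"

definition quot_condition :: "('o, 'm) hopf \<Rightarrow> ('o, 'm) modcomon \<Rightarrow> 'm \<Rightarrow> bool" where
  "quot_condition A Q p \<longleftrightarrow> (let X = carr A; \<epsilon> = counit A in
     \<exists>e. is_cotensor_over A Q p e \<and>
         is_coequalizer C
           (\<lambda>\<^bold>l X \<cdot> (\<epsilon> \<boxtimes> \<I> X) \<cdot> e)
           (\<rho> X \<cdot> (\<I> X \<boxtimes> \<epsilon>) \<cdot> e)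
           p)"

definition is_kernel :: "('o, 'm) hopf_arrow \<Rightarrow> ('o, 'm) hopf_arrow \<Rightarrow> bool" where
  "is_kernel f i \<longleftrightarrow>
     (let A = Dom Hopf_coc f; B = Cod Hopf_coc f in
      is_equalizer Hopf_coc f (A, munit B \<cdot> counit A, B) i)"

definition regular_epi_in_Hopf :: "('o, 'm) hopf \<Rightarrow> ('o, 'm) modcomon \<Rightarrow> 'm \<Rightarrow> bool" where
  "regular_epi_in_Hopf A Q p \<longleftrightarrow>
     (\<exists>H \<in> Obj Hopf_coc. carr H = carr Q \<and> comult H = comult Q \<and> counit H = counit Q \<and>
        regular_epi Hopf_coc (A, p, H))"

definition galois_subobjects :: "('o, 'm) hopf \<Rightarrow> ('o, 'm) hopf_arrow set set" where
  "galois_subobjects A =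
     {X \<in> subobjects Hopf_coc A. \<exists>K i. (K, i, A) \<in> X \<and> sub_condition A K i}"

definition galois_quotients :: "('o, 'm) hopf \<Rightarrow> ('o, 'm) modcomon_arrow set set" where
  "galois_quotients A =
     {Y \<in> quotients (Comon_coc A) (regular_module A).
        \<exists>p Q. (regular_module A, p, Q) \<in> Y \<and> quot_condition A Q p}"

definition kernel_subobjects :: "('o, 'm) hopf \<Rightarrow> ('o, 'm) hopf_arrow set set" where
  "kernel_subobjects A =
     {X \<in> subobjects Hopf_coc A. \<exists>i \<in> X. \<exists>f. is_kernel f i}"

definition regular_epi_quotients :: "('o, 'm) hopf \<Rightarrow> ('o, 'm) modcomon_arrow set set" where
  "regular_epi_quotients A =
     {Y \<in> quotients (Comon_coc A) (regular_module A).
        \<exists>p Q. (regular_module A, p, Q) \<in> Y \<and> regular_epi_in_Hopf A Q p}"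

text \<open>The two maps act on isomorphism classes. The value at a class collects all admissible
  representatives: every (co)equalizer in the base category of the pair attached to some
  representative of the class, with every structure for which it is a morphism.\<close>

definition phi :: "('o, 'm) hopf \<Rightarrow> ('o, 'm) hopf_arrow set \<Rightarrow> ('o, 'm) modcomon_arrow set" where
  "phi A X = {(P, p, Q).
     P = regular_module A \<and> (P, p, Q) \<in> Arr (Comon_coc A) \<and>
     (\<exists>K i. (K, i, A) \<in> X \<and>
        is_coequalizer C
          (mult A \<cdot> (\<I> (carr A) \<boxtimes> i))
          (\<rho> (carr A) \<cdot> (\<I> (carr A) \<boxtimes> counit K))
          p)}"

definition psi :: "('o, 'm) hopf \<Rightarrow> ('o, 'm) modcomon_arrow set \<Rightarrow> ('o, 'm) hopf_arrow set" where
  "psi A Y = {(K, i, B).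
     B = A \<and> (K, i, B) \<in> Arr Hopf_coc \<and>
     (\<exists>p Q. (regular_module A, p, Q) \<in> Y \<and>
        is_equalizer C
          ((p \<boxtimes> \<I> (carr A)) \<cdot> comult A)
          (((p \<cdot> munit A) \<boxtimes> \<I> (carr A)) \<cdot> inv_arrow C (\<lambda>\<^bold>l (carr A)))
          i)}"

end

end

(*
Cocommutative comonoids whose mutual braidings are involutive form a cartesian category in which
cocommutative Hopf monoids are group objects. The braiding of a cocommutative Hopf monoid A with
itself is involutive, because A is also a bimonoid for the inverse braiding and the braiding can be
recovered from the comultiplication of a product with the help of the antipode. Identities can
therefore be checked on generalized elements, as in a group.

The automorphism (a, b) |-> (a, ab) of A x A identifies the coequalizer A x A -> A (x)_K A with
p x A, where p is the quotient of A by the right translations of K; so the condition on i says that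
i is the equalizer defining psi of p. Dually, it identifies the equalizer A []_Q A -> A x A with
A x i, so the condition on p says that p is the coequalizer defining phi of i. This gives the
bijection. A kernel is a normal subobject, for which the quotient inherits a multiplication; and if
p coequalizes f, g : B -> A in Hopf monoids, then f g^-1 factors through the kernel K of p, so the
quotient of A by K also coequalizes f and g and hence agrees with p.
*)
theory Submission
  imports Defs
begin

section \<open>Categories\<close>

text \<open>M is only braided, so a tensor product of cocommutative comonoids can serve as a stage
  for elements only if the mutual braiding of its factors is involutive. The second obstacle is that
  limits are formed in M, where the test arrows need not be comonoid morphisms, so group arguments
  do not apply to them. The pair defining psi keeps a copy of its argument, (p(a), a) against (p(1),
  a); this makes its equalizer a subcomonoid, and on elements it reduces to p(a) = p(1), so that
  \<open>K\<close> is the stabilizer of the point p(1). Factorizations found in M are afterwards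
  upgraded to comonoid and Hopf morphisms, because tensor powers of regular monomorphisms and
  epimorphisms can still be cancelled. The same applies to kernels of Hopf monoids, which thereby
  become equalizers in M.\<close>

context category
begin

lemma hom_iff [simp]: "f \<in> hom C X Y \<longleftrightarrow> f \<in> Arr C \<and> Dom C f = X \<and> Cod C f = Y"
  by (auto simp: hom_def)

lemma Dom_Obj' [simp]: "f \<in> Arr C \<Longrightarrow> Dom C f \<in> Obj C"
  and Cod_Obj' [simp]: "f \<in> Arr C \<Longrightarrow> Cod C f \<in> Obj C"
  by (auto intro: Dom_Obj Cod_Obj)

lemma Ident_arr [simp]:
  assumes "X \<in> Obj C"
  shows "\<I> X \<in> Arr C" "Dom C (\<I> X) = X" "Cod C (\<I> X) = X"
  using Ident_hom[OF assms] by auto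

lemma comp_arr [simp]:
  assumes "f \<in> Arr C" "g \<in> Arr C" "Cod C f = Dom C g"
  shows "g \<cdot> f \<in> Arr C" "Dom C (g \<cdot> f) = Dom C f" "Cod C (g \<cdot> f) = Cod C g"
  using Comp_hom[of f "Dom C f" "Cod C f" g "Cod C g"] assms by auto

lemma comp_ident [simp]: "f \<in> Arr C \<Longrightarrow> Dom C f = X \<Longrightarrow> f \<cdot> \<I> X = f"
  using Comp_Ident[of f X "Cod C f"] by auto

lemma ident_comp [simp]: "f \<in> Arr C \<Longrightarrow> Cod C f = X \<Longrightarrow> \<I> X \<cdot> f = f"
  using Ident_Comp[of f "Dom C f" X] by auto

lemma comp_assoc [simp]:
  "f \<in> Arr C \<Longrightarrow> g \<in> Arr C \<Longrightarrow> h \<in> Arr C \<Longrightarrow> Cod C f = Dom C g \<Longrightarrow> Cod C g = Dom C h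
    \<Longrightarrow> (h \<cdot> g) \<cdot> f = h \<cdot> (g \<cdot> f)"
  using Comp_assoc[of f "Dom C f" "Cod C f" g "Cod C g" h "Cod C h"] by auto

text \<open>Composites are kept bracketed to the right by simp, so an equation for
  \<open>a \<cdot> b\<close> no longer matches inside a longer composite; this form and
  \<open>comp_swap\<close> restore it.\<close>

lemma comp_reduce:
  "a \<cdot> b = c \<Longrightarrow> a \<in> Arr C \<Longrightarrow> b \<in> Arr C \<Longrightarrow> x \<in> Arr C \<Longrightarrow> Cod C b = Dom C a \<Longrightarrow> Cod C x = Dom C b
    \<Longrightarrow> a \<cdot> (b \<cdot> x) = c \<cdot> x"
  using comp_assoc[of x b a] by simp

lemma comp_swap:
  assumes "a \<cdot> b = c \<cdot> d" "a \<in> Arr C" "b \<in> Arr C" "c \<in> Arr C" "d \<in> Arr C" "x \<in> Arr C"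
    "Cod C b = Dom C a" "Cod C d = Dom C c" "Cod C x = Dom C b" "Dom C d = Dom C b"
  shows "a \<cdot> (b \<cdot> x) = c \<cdot> (d \<cdot> x)"
  using assms comp_assoc[of x b a] comp_assoc[of x d c] by metis

lemma inverse_arrows_unique:
  assumes "inverse_arrows C f g" "inverse_arrows C f h" shows "g = h"
proof -
  have [simp]: "f \<in> Arr C" "g \<in> Arr C" "h \<in> Arr C" "Dom C g = Cod C f" "Cod C g = Dom C f"
      "Dom C h = Cod C f" "Cod C h = Dom C f"
    and e: "g \<cdot> f = \<I> (Dom C f)" "f \<cdot> h = \<I> (Cod C f)"
    using assms by (auto simp: inverse_arrows_def)
  have "(g \<cdot> f) \<cdot> h = g \<cdot> (f \<cdot> h)" by simp
  then show ?thesis unfolding e by simp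
qed

lemma inverse_inv_arrow: "iso_arrow C f \<Longrightarrow> inverse_arrows C f (inv_arrow C f)"
  unfolding inv_arrow_def iso_arrow_def
  by (erule exE) (rule theI, assumption, rule inverse_arrows_unique)

lemma iso_arr: "iso_arrow C f \<Longrightarrow> f \<in> Arr C"
  by (auto simp: iso_arrow_def inverse_arrows_def)

lemma inv_arrow [simp]:
  assumes "iso_arrow C f"
  shows "inv_arrow C f \<in> Arr C" "Dom C (inv_arrow C f) = Cod C f" "Cod C (inv_arrow C f) = Dom C f"
    "inv_arrow C f \<cdot> f = \<I> (Dom C f)" "f \<cdot> inv_arrow C f = \<I> (Cod C f)"
  using inverse_inv_arrow[OF assms] by (auto simp: inverse_arrows_def)

lemma inv_arrow_cancel [simp]:
  assumes "iso_arrow C f" "x \<in> Arr C"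
  shows "Cod C x = Dom C f \<Longrightarrow> inv_arrow C f \<cdot> (f \<cdot> x) = x"
    "Cod C x = Cod C f \<Longrightarrow> f \<cdot> (inv_arrow C f \<cdot> x) = x"
  using assms iso_arr[OF assms(1)]
    comp_reduce[of "inv_arrow C f" f "\<I> (Dom C f)" x] comp_reduce[of f "inv_arrow C f" "\<I> (Cod C f)" x]
  by auto

lemma iso_cancel_left:
  assumes "iso_arrow C f" "f \<cdot> x = f \<cdot> y" "x \<in> Arr C" "y \<in> Arr C" "Cod C x = Dom C f" "Cod C y = Dom C f"
  shows "x = y"
  using assms inv_arrow_cancel(1) by metis

lemma iso_cancel_right:
  assumes "iso_arrow C f" "x \<cdot> f = y \<cdot> f" "x \<in> Arr C" "y \<in> Arr C" "Dom C x = Cod C f" "Dom C y = Cod C f"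
  shows "x = y"
proof -
  note [simp] = iso_arr[OF assms(1)]
  have "(x \<cdot> f) \<cdot> inv_arrow C f = (y \<cdot> f) \<cdot> inv_arrow C f" using assms(2) by simp
  then show ?thesis using assms(1,3-) by simp
qed

text \<open>Conjugating a square by two isomorphisms turns naturality of a constraint into
  naturality of its inverse.\<close>

lemma inv_arrow_swap:
  assumes "iso_arrow C f" "iso_arrow C g" "g \<cdot> x = y \<cdot> f" "x \<in> Arr C" "y \<in> Arr C"
    "Dom C x = Dom C f" "Cod C x = Dom C g" "Dom C y = Cod C f" "Cod C y = Cod C g"
  shows "inv_arrow C g \<cdot> y = x \<cdot> inv_arrow C f"
proof -
  note [simp] = iso_arr[OF assms(1)] iso_arr[OF assms(2)] assms
  have "inv_arrow C g \<cdot> (g \<cdot> x) \<cdot> inv_arrow C f = inv_arrow C g \<cdot> (y \<cdot> f) \<cdot> inv_arrow C f"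
    using assms(3) by simp
  then show ?thesis by (simp del: assms(3))
qed

lemma iso_arrowI:
  "f \<in> Arr C \<Longrightarrow> g \<in> Arr C \<Longrightarrow> Dom C g = Cod C f \<Longrightarrow> Cod C g = Dom C f
   \<Longrightarrow> g \<cdot> f = \<I> (Dom C f) \<Longrightarrow> f \<cdot> g = \<I> (Cod C f) \<Longrightarrow> iso_arrow C f"
  unfolding iso_arrow_def inverse_arrows_def by (intro exI[of _ g]) auto

lemma iso_ident [simp]: "X \<in> Obj C \<Longrightarrow> iso_arrow C (\<I> X)"
  by (rule iso_arrowI[where g = "\<I> X"]) simp_all

lemma iso_inv [simp]: "iso_arrow C f \<Longrightarrow> iso_arrow C (inv_arrow C f)"
  using iso_arr[of f] by (intro iso_arrowI[where g = f]) auto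

lemma iso_comp [simp]:
  assumes "iso_arrow C f" "iso_arrow C g" "Cod C f = Dom C g" shows "iso_arrow C (g \<cdot> f)"
proof -
  note [simp] = iso_arr[OF assms(1)] iso_arr[OF assms(2)] assms
  show ?thesis by (rule iso_arrowI[where g = "inv_arrow C f \<cdot> inv_arrow C g"]) auto
qed

end

section \<open>Coherence in braided monoidal categories\<close>

context braided_monoidal_category
begin

lemma TenO_Obj' [simp]: "X \<in> Obj C \<Longrightarrow> Y \<in> Obj C \<Longrightarrow> X \<otimes> Y \<in> Obj C"
  by (rule TenO_Obj)

lemma TUnit_Obj' [simp]: "\<one> \<in> Obj C"
  by (rule TUnit_Obj)

lemma ten_arr [simp]:
  assumes "f \<in> Arr C" "g \<in> Arr C"
  shows "f \<boxtimes> g \<in> Arr C" "Dom C (f \<boxtimes> g) = Dom C f \<otimes> Dom C g" "Cod C (f \<boxtimes> g) = Cod C f \<otimes> Cod C g"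
  using TenA_hom[of f "Dom C f" "Cod C f" g "Dom C g" "Cod C g"] assms by auto

lemma ten_ident [simp]: "X \<in> Obj C \<Longrightarrow> Y \<in> Obj C \<Longrightarrow> \<I> X \<boxtimes> \<I> Y = \<I> (X \<otimes> Y)"
  by (rule TenA_Ident)

lemma ten_comp [simp]:
  "f \<in> Arr C \<Longrightarrow> g \<in> Arr C \<Longrightarrow> f' \<in> Arr C \<Longrightarrow> g' \<in> Arr C \<Longrightarrow> Cod C f = Dom C f' \<Longrightarrow> Cod C g = Dom C g'
    \<Longrightarrow> (f' \<boxtimes> g') \<cdot> (f \<boxtimes> g) = (f' \<cdot> f) \<boxtimes> (g' \<cdot> g)"
  using TenA_Comp[of f "Dom C f" "Cod C f" f' "Cod C f'" g "Dom C g" "Cod C g" g' "Cod C g'"] by auto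

lemma ten_comp' [simp]:
  "f \<in> Arr C \<Longrightarrow> g \<in> Arr C \<Longrightarrow> f' \<in> Arr C \<Longrightarrow> g' \<in> Arr C \<Longrightarrow> x \<in> Arr C
    \<Longrightarrow> Cod C f = Dom C f' \<Longrightarrow> Cod C g = Dom C g' \<Longrightarrow> Cod C x = Dom C f \<otimes> Dom C g
    \<Longrightarrow> (f' \<boxtimes> g') \<cdot> ((f \<boxtimes> g) \<cdot> x) = ((f' \<cdot> f) \<boxtimes> (g' \<cdot> g)) \<cdot> x"
  by (rule comp_reduce) auto

lemma Assoc_arr [simp]:
  assumes "X \<in> Obj C" "Y \<in> Obj C" "Z \<in> Obj C"
  shows "\<alpha> X Y Z \<in> Arr C" "Dom C (\<alpha> X Y Z) = (X \<otimes> Y) \<otimes> Z" "Cod C (\<alpha> X Y Z) = X \<otimes> (Y \<otimes> Z)"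
    "iso_arrow C (\<alpha> X Y Z)"
  using Assoc_hom[OF assms] Assoc_iso[OF assms] by auto

lemma LUnit_arr [simp]:
  assumes "X \<in> Obj C"
  shows "\<lambda>\<^bold>l X \<in> Arr C" "Dom C (\<lambda>\<^bold>l X) = \<one> \<otimes> X" "Cod C (\<lambda>\<^bold>l X) = X" "iso_arrow C (\<lambda>\<^bold>l X)"
  using LUnit_hom[OF assms] LUnit_iso[OF assms] by auto

lemma RUnit_arr [simp]:
  assumes "X \<in> Obj C"
  shows "\<rho> X \<in> Arr C" "Dom C (\<rho> X) = X \<otimes> \<one>" "Cod C (\<rho> X) = X" "iso_arrow C (\<rho> X)"
  using RUnit_hom[OF assms] RUnit_iso[OF assms] by auto

lemma Braid_arr [simp]:
  assumes "X \<in> Obj C" "Y \<in> Obj C"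
  shows "\<sigma> X Y \<in> Arr C" "Dom C (\<sigma> X Y) = X \<otimes> Y" "Cod C (\<sigma> X Y) = Y \<otimes> X" "iso_arrow C (\<sigma> X Y)"
  using Braid_hom[OF assms] Braid_iso[OF assms] by auto

lemma Assoc_natural:
  assumes "f \<in> Arr C" "g \<in> Arr C" "h \<in> Arr C"
    "Cod C f = X" "Cod C g = Y" "Cod C h = Z"
  shows "\<alpha> X Y Z \<cdot> ((f \<boxtimes> g) \<boxtimes> h) = (f \<boxtimes> (g \<boxtimes> h)) \<cdot> \<alpha> (Dom C f) (Dom C g) (Dom C h)"
  using Assoc_nat[of f "Dom C f" X g "Dom C g" Y h "Dom C h" Z] assms by auto

lemma Assoc_natural':
  assumes "f \<in> Arr C" "g \<in> Arr C" "h \<in> Arr C" "x \<in> Arr C"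
    "Cod C f = X" "Cod C g = Y" "Cod C h = Z" "Cod C x = (Dom C f \<otimes> Dom C g) \<otimes> Dom C h"
  shows "\<alpha> X Y Z \<cdot> (((f \<boxtimes> g) \<boxtimes> h) \<cdot> x) = (f \<boxtimes> (g \<boxtimes> h)) \<cdot> (\<alpha> (Dom C f) (Dom C g) (Dom C h) \<cdot> x)"
  using assms by (intro comp_swap Assoc_natural) auto

lemma inv_Assoc_natural:
  assumes "f \<in> Arr C" "g \<in> Arr C" "h \<in> Arr C"
    "Cod C f = X" "Cod C g = Y" "Cod C h = Z"
  shows "inv_arrow C (\<alpha> X Y Z) \<cdot> (f \<boxtimes> (g \<boxtimes> h))
    = ((f \<boxtimes> g) \<boxtimes> h) \<cdot> inv_arrow C (\<alpha> (Dom C f) (Dom C g) (Dom C h))"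
  using assms by (intro inv_arrow_swap Assoc_natural) auto

lemma inv_Assoc_natural':
  assumes "f \<in> Arr C" "g \<in> Arr C" "h \<in> Arr C" "x \<in> Arr C"
    "Cod C f = X" "Cod C g = Y" "Cod C h = Z" "Cod C x = Dom C f \<otimes> (Dom C g \<otimes> Dom C h)"
  shows "inv_arrow C (\<alpha> X Y Z) \<cdot> ((f \<boxtimes> (g \<boxtimes> h)) \<cdot> x)
    = ((f \<boxtimes> g) \<boxtimes> h) \<cdot> (inv_arrow C (\<alpha> (Dom C f) (Dom C g) (Dom C h)) \<cdot> x)"
  using assms by (intro comp_swap inv_Assoc_natural) auto

lemma Braid_natural:
  assumes "f \<in> Arr C" "g \<in> Arr C" "Cod C f = X" "Cod C g = Y"
  shows "\<sigma> X Y \<cdot> (f \<boxtimes> g) = (g \<boxtimes> f) \<cdot> \<sigma> (Dom C f) (Dom C g)"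
  using Braid_nat[of f "Dom C f" X g "Dom C g" Y] assms by auto

lemma Braid_natural':
  assumes "f \<in> Arr C" "g \<in> Arr C" "x \<in> Arr C" "Cod C f = X" "Cod C g = Y" "Cod C x = Dom C f \<otimes> Dom C g"
  shows "\<sigma> X Y \<cdot> ((f \<boxtimes> g) \<cdot> x) = (g \<boxtimes> f) \<cdot> (\<sigma> (Dom C f) (Dom C g) \<cdot> x)"
  using assms by (intro comp_swap Braid_natural) auto

lemma LUnit_natural: "f \<in> Arr C \<Longrightarrow> Cod C f = Y \<Longrightarrow> \<lambda>\<^bold>l Y \<cdot> (\<I> \<one> \<boxtimes> f) = f \<cdot> \<lambda>\<^bold>l (Dom C f)"
  using LUnit_nat[of f "Dom C f" Y] by auto

lemma RUnit_natural: "f \<in> Arr C \<Longrightarrow> Cod C f = Y \<Longrightarrow> \<rho> Y \<cdot> (f \<boxtimes> \<I> \<one>) = f \<cdot> \<rho> (Dom C f)"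
  using RUnit_nat[of f "Dom C f" Y] by auto

lemma inv_LUnit_natural:
  "f \<in> Arr C \<Longrightarrow> Dom C f = X \<Longrightarrow> inv_arrow C (\<lambda>\<^bold>l (Cod C f)) \<cdot> f = (\<I> \<one> \<boxtimes> f) \<cdot> inv_arrow C (\<lambda>\<^bold>l X)"
  by (intro inv_arrow_swap) (auto simp: LUnit_natural)

lemma iso_ten [simp]:
  assumes "iso_arrow C f" "iso_arrow C g" shows "iso_arrow C (f \<boxtimes> g)"
proof -
  note [simp] = iso_arr[OF assms(1)] iso_arr[OF assms(2)] assms
  show ?thesis by (rule iso_arrowI[where g = "inv_arrow C f \<boxtimes> inv_arrow C g"]) auto
qed

text \<open>Naturality of the unitor makes \<open>f\<close> a conjugate of its tensor with the unit
  object. Coherence laws between units are proved this way: they are first tensored with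
  \<one>.\<close>

lemma faithful_left_unit:
  assumes "\<I> \<one> \<boxtimes> f = \<I> \<one> \<boxtimes> g" "f \<in> Arr C" "g \<in> Arr C" "Dom C f = Dom C g" "Cod C f = Cod C g"
  shows "f = g"
  using LUnit_natural[of f "Cod C f"] LUnit_natural[of g "Cod C g"] assms
  by (intro iso_cancel_right[of "\<lambda>\<^bold>l (Dom C f)" f g]) auto

lemma faithful_right_unit:
  assumes "f \<boxtimes> \<I> \<one> = g \<boxtimes> \<I> \<one>" "f \<in> Arr C" "g \<in> Arr C" "Dom C f = Dom C g" "Cod C f = Cod C g"
  shows "f = g"
  using RUnit_natural[of f "Cod C f"] RUnit_natural[of g "Cod C g"] assms
  by (intro iso_cancel_right[of "\<rho> (Dom C f)" f g]) auto

lemma whisker_right: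
  "f \<in> Arr C \<Longrightarrow> g \<in> Arr C \<Longrightarrow> Z \<in> Obj C \<Longrightarrow> Cod C f = Dom C g \<Longrightarrow> (g \<cdot> f) \<boxtimes> \<I> Z = (g \<boxtimes> \<I> Z) \<cdot> (f \<boxtimes> \<I> Z)"
  by simp

lemma whisker_left:
  "f \<in> Arr C \<Longrightarrow> g \<in> Arr C \<Longrightarrow> Z \<in> Obj C \<Longrightarrow> Cod C f = Dom C g \<Longrightarrow> \<I> Z \<boxtimes> (g \<cdot> f) = (\<I> Z \<boxtimes> g) \<cdot> (\<I> Z \<boxtimes> f)"
  by simp

lemma Assoc_natural_right:
  assumes "h \<in> Arr C" "Cod C h = Z" "X \<in> Obj C" "Y \<in> Obj C"
  shows "\<alpha> X Y Z \<cdot> (\<I> (X \<otimes> Y) \<boxtimes> h) = (\<I> X \<boxtimes> (\<I> Y \<boxtimes> h)) \<cdot> \<alpha> X Y (Dom C h)"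
  using Assoc_natural[of "\<I> X" "\<I> Y" h X Y Z] assms by simp

lemma Assoc_natural_right':
  assumes "h \<in> Arr C" "Cod C h = Z" "X \<in> Obj C" "Y \<in> Obj C" "x \<in> Arr C" "Cod C x = (X \<otimes> Y) \<otimes> Dom C h"
  shows "\<alpha> X Y Z \<cdot> ((\<I> (X \<otimes> Y) \<boxtimes> h) \<cdot> x) = (\<I> X \<boxtimes> (\<I> Y \<boxtimes> h)) \<cdot> (\<alpha> X Y (Dom C h) \<cdot> x)"
  using assms by (intro comp_swap Assoc_natural_right) auto

lemma inv_Assoc_natural_left:
  assumes "f \<in> Arr C" "Cod C f = X" "Y \<in> Obj C" "Z \<in> Obj C"
  shows "inv_arrow C (\<alpha> X Y Z) \<cdot> (f \<boxtimes> \<I> (Y \<otimes> Z))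
    = ((f \<boxtimes> \<I> Y) \<boxtimes> \<I> Z) \<cdot> inv_arrow C (\<alpha> (Dom C f) Y Z)"
  using inv_Assoc_natural[of f "\<I> Y" "\<I> Z" X Y Z] assms by simp

lemma inv_Assoc_natural_left':
  assumes "f \<in> Arr C" "Cod C f = X" "Y \<in> Obj C" "Z \<in> Obj C" "x \<in> Arr C" "Cod C x = Dom C f \<otimes> (Y \<otimes> Z)"
  shows "inv_arrow C (\<alpha> X Y Z) \<cdot> ((f \<boxtimes> \<I> (Y \<otimes> Z)) \<cdot> x)
    = ((f \<boxtimes> \<I> Y) \<boxtimes> \<I> Z) \<cdot> (inv_arrow C (\<alpha> (Dom C f) Y Z) \<cdot> x)"
  using assms by (intro comp_swap inv_Assoc_natural_left) auto

lemma triangle':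
  assumes "X \<in> Obj C" "Y \<in> Obj C" "x \<in> Arr C" "Cod C x = (X \<otimes> \<one>) \<otimes> Y"
  shows "(\<I> X \<boxtimes> \<lambda>\<^bold>l Y) \<cdot> (\<alpha> X \<one> Y \<cdot> x) = (\<rho> X \<boxtimes> \<I> Y) \<cdot> x"
  using assms by (intro comp_reduce triangle) auto

lemma triangle_inv:
  assumes "X \<in> Obj C" "Y \<in> Obj C"
  shows "(\<rho> X \<boxtimes> \<I> Y) \<cdot> inv_arrow C (\<alpha> X \<one> Y) = \<I> X \<boxtimes> \<lambda>\<^bold>l Y"
  using assms by (subst triangle[symmetric]) auto

lemma pentagon':
  assumes "W \<in> Obj C" "X \<in> Obj C" "Y \<in> Obj C" "Z \<in> Obj C" "x \<in> Arr C" "Cod C x = ((W \<otimes> X) \<otimes> Y) \<otimes> Z"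
  shows "\<alpha> W X (Y \<otimes> Z) \<cdot> (\<alpha> (W \<otimes> X) Y Z \<cdot> x)
             = (\<I> W \<boxtimes> \<alpha> X Y Z) \<cdot> (\<alpha> W (X \<otimes> Y) Z \<cdot> ((\<alpha> W X Y \<boxtimes> \<I> Z) \<cdot> x))"
proof -
  have "\<alpha> W X (Y \<otimes> Z) \<cdot> (\<alpha> (W \<otimes> X) Y Z \<cdot> x) = ((\<I> W \<boxtimes> \<alpha> X Y Z) \<cdot> \<alpha> W (X \<otimes> Y) Z \<cdot> (\<alpha> W X Y \<boxtimes> \<I> Z)) \<cdot> x"
    using assms by (intro comp_reduce pentagon) auto
  then show ?thesis using assms by simp
qed

text \<open>Kelly's argument: after tensoring with \<one> on the left, the pentagon at \<one>,
  \<one>, X, Y and two instances of the triangle give the law; the extra unit and the associators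
  are then cancelled.\<close>

lemma LUnit_tensor:
  assumes [simp]: "X \<in> Obj C" "Y \<in> Obj C"
  shows "\<lambda>\<^bold>l (X \<otimes> Y) \<cdot> \<alpha> \<one> X Y = \<lambda>\<^bold>l X \<boxtimes> \<I> Y"
proof (rule faithful_left_unit)
  let ?i = "\<alpha> \<one> (\<one> \<otimes> X) Y \<cdot> (\<alpha> \<one> \<one> X \<boxtimes> \<I> Y)"
  have "(\<I> \<one> \<boxtimes> (\<lambda>\<^bold>l (X \<otimes> Y) \<cdot> \<alpha> \<one> X Y)) \<cdot> ?i
      = (\<I> \<one> \<boxtimes> \<lambda>\<^bold>l (X \<otimes> Y)) \<cdot> (\<alpha> \<one> \<one> (X \<otimes> Y) \<cdot> \<alpha> (\<one> \<otimes> \<one>) X Y)"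
    by (simp add: pentagon)
  also have "\<dots> = (\<rho> \<one> \<boxtimes> \<I> (X \<otimes> Y)) \<cdot> \<alpha> (\<one> \<otimes> \<one>) X Y"
    by (simp add: triangle')
  also have "\<dots> = \<alpha> \<one> X Y \<cdot> ((\<rho> \<one> \<boxtimes> \<I> X) \<boxtimes> \<I> Y)"
    by (simp add: Assoc_natural)
  also have "\<dots> = \<alpha> \<one> X Y \<cdot> (((\<I> \<one> \<boxtimes> \<lambda>\<^bold>l X) \<boxtimes> \<I> Y) \<cdot> (\<alpha> \<one> \<one> X \<boxtimes> \<I> Y))"
    by (simp add: triangle)
  also have "\<dots> = (\<I> \<one> \<boxtimes> (\<lambda>\<^bold>l X \<boxtimes> \<I> Y)) \<cdot> ?i"
    by (simp add: Assoc_natural' del: ten_comp)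
  finally have e: "(\<I> \<one> \<boxtimes> (\<lambda>\<^bold>l (X \<otimes> Y) \<cdot> \<alpha> \<one> X Y)) \<cdot> ?i = (\<I> \<one> \<boxtimes> (\<lambda>\<^bold>l X \<boxtimes> \<I> Y)) \<cdot> ?i" .
  have e2: "(\<I> \<one> \<boxtimes> (\<lambda>\<^bold>l (X \<otimes> Y) \<cdot> \<alpha> \<one> X Y)) \<cdot> \<alpha> \<one> (\<one> \<otimes> X) Y = (\<I> \<one> \<boxtimes> (\<lambda>\<^bold>l X \<boxtimes> \<I> Y)) \<cdot> \<alpha> \<one> (\<one> \<otimes> X) Y"
    by (rule iso_cancel_right[of "\<alpha> \<one> \<one> X \<boxtimes> \<I> Y"]) (use e in simp_all)
  show "\<I> \<one> \<boxtimes> (\<lambda>\<^bold>l (X \<otimes> Y) \<cdot> \<alpha> \<one> X Y) = \<I> \<one> \<boxtimes> (\<lambda>\<^bold>l X \<boxtimes> \<I> Y)"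
    by (rule iso_cancel_right[OF _ e2]) auto
qed auto

lemma RUnit_tensor:
  assumes [simp]: "X \<in> Obj C" "Y \<in> Obj C"
  shows "(\<I> X \<boxtimes> \<rho> Y) \<cdot> \<alpha> X Y \<one> = \<rho> (X \<otimes> Y)"
proof (rule faithful_right_unit)
  have "\<alpha> X Y \<one> \<cdot> (((\<I> X \<boxtimes> \<rho> Y) \<cdot> \<alpha> X Y \<one>) \<boxtimes> \<I> \<one>)
      = (\<I> X \<boxtimes> (\<rho> Y \<boxtimes> \<I> \<one>)) \<cdot> (\<alpha> X (Y \<otimes> \<one>) \<one> \<cdot> (\<alpha> X Y \<one> \<boxtimes> \<I> \<one>))"
    by (simp add: Assoc_natural' whisker_right del: ten_comp)
  also have "\<dots> = (\<I> X \<boxtimes> ((\<I> Y \<boxtimes> \<lambda>\<^bold>l \<one>) \<cdot> \<alpha> Y \<one> \<one>)) \<cdot> (\<alpha> X (Y \<otimes> \<one>) \<one> \<cdot> (\<alpha> X Y \<one> \<boxtimes> \<I> \<one>))"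
    by (simp add: triangle)
  also have "\<dots> = (\<I> X \<boxtimes> (\<I> Y \<boxtimes> \<lambda>\<^bold>l \<one>)) \<cdot> (\<alpha> X Y (\<one> \<otimes> \<one>) \<cdot> \<alpha> (X \<otimes> Y) \<one> \<one>)"
    by (simp add: pentagon)
  also have "\<dots> = \<alpha> X Y \<one> \<cdot> ((\<I> (X \<otimes> Y) \<boxtimes> \<lambda>\<^bold>l \<one>) \<cdot> \<alpha> (X \<otimes> Y) \<one> \<one>)"
    by (simp add: Assoc_natural_right')
  also have "\<dots> = \<alpha> X Y \<one> \<cdot> (\<rho> (X \<otimes> Y) \<boxtimes> \<I> \<one>)"
    by (simp add: triangle)
  finally show "((\<I> X \<boxtimes> \<rho> Y) \<cdot> \<alpha> X Y \<one>) \<boxtimes> \<I> \<one> = \<rho> (X \<otimes> Y) \<boxtimes> \<I> \<one>"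
    by (rule iso_cancel_left[rotated]) auto
qed auto

text \<open>Naturality of the left unitor along itself identifies the unitor of \<one> \<otimes>
  \<one> with \<one> tensored with the unitor of \<one>; the triangle and
  \<open>LUnit_tensor\<close> then compare both unitors after tensoring with \<one>.\<close>

lemma LUnit_eq_RUnit: "\<lambda>\<^bold>l \<one> = \<rho> \<one>"
proof (rule faithful_right_unit)
  have "\<lambda>\<^bold>l (\<one> \<otimes> \<one>) = \<I> \<one> \<boxtimes> \<lambda>\<^bold>l \<one>"
    by (rule iso_cancel_left[of "\<lambda>\<^bold>l \<one>"]) (auto simp: LUnit_natural)
  then show "\<lambda>\<^bold>l \<one> \<boxtimes> \<I> \<one> = \<rho> \<one> \<boxtimes> \<I> \<one>"
    using LUnit_tensor[of \<one> \<one>] triangle[of \<one> \<one>] by simp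
qed auto

text \<open>The pentagon solved for an edge carrying an inverse associator, in the direction needed
  to rewrite the unfolded \<open>swap\<close> laws.\<close>

lemma pentagon_inv1:
  assumes [simp]: "W \<in> Obj C" "X \<in> Obj C" "Y \<in> Obj C" "Z \<in> Obj C"
  shows "\<alpha> (W \<otimes> X) Y Z \<cdot> (inv_arrow C (\<alpha> W X Y) \<boxtimes> \<I> Z)
    = inv_arrow C (\<alpha> W X (Y \<otimes> Z)) \<cdot> ((\<I> W \<boxtimes> \<alpha> X Y Z) \<cdot> \<alpha> W (X \<otimes> Y) Z)"
  by (rule iso_cancel_left[of "\<alpha> W X (Y \<otimes> Z)"]) (auto simp: pentagon')

lemma pentagon_inv1':
  assumes [simp]: "W \<in> Obj C" "X \<in> Obj C" "Y \<in> Obj C" "Z \<in> Obj C" "x \<in> Arr C" "Cod C x = (W \<otimes> (X \<otimes> Y)) \<otimes> Z"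
  shows "\<alpha> (W \<otimes> X) Y Z \<cdot> ((inv_arrow C (\<alpha> W X Y) \<boxtimes> \<I> Z) \<cdot> x)
    = inv_arrow C (\<alpha> W X (Y \<otimes> Z)) \<cdot> ((\<I> W \<boxtimes> \<alpha> X Y Z) \<cdot> (\<alpha> W (X \<otimes> Y) Z \<cdot> x))"
  using comp_reduce[OF pentagon_inv1[of W X Y Z], of x] by simp

lemma pentagon_inv2:
  assumes [simp]: "W \<in> Obj C" "X \<in> Obj C" "Y \<in> Obj C" "Z \<in> Obj C"
  shows "\<alpha> W (X \<otimes> Y) Z \<cdot> (\<alpha> W X Y \<boxtimes> \<I> Z)
    = (\<I> W \<boxtimes> inv_arrow C (\<alpha> X Y Z)) \<cdot> (\<alpha> W X (Y \<otimes> Z) \<cdot> \<alpha> (W \<otimes> X) Y Z)"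
  by (simp add: pentagon)

lemma pentagon_inv2':
  assumes [simp]: "W \<in> Obj C" "X \<in> Obj C" "Y \<in> Obj C" "Z \<in> Obj C" "x \<in> Arr C" "Cod C x = ((W \<otimes> X) \<otimes> Y) \<otimes> Z"
  shows "\<alpha> W (X \<otimes> Y) Z \<cdot> ((\<alpha> W X Y \<boxtimes> \<I> Z) \<cdot> x)
    = (\<I> W \<boxtimes> inv_arrow C (\<alpha> X Y Z)) \<cdot> (\<alpha> W X (Y \<otimes> Z) \<cdot> (\<alpha> (W \<otimes> X) Y Z \<cdot> x))"
  using comp_reduce[OF pentagon_inv2[of W X Y Z], of x] by simp

lemma hexagon1_Braid:
  assumes [simp]: "X \<in> Obj C" "Y \<in> Obj C" "Z \<in> Obj C"
  shows "\<sigma> X (Y \<otimes> Z) = inv_arrow C (\<alpha> Y Z X) \<cdot> ((\<I> Y \<boxtimes> \<sigma> X Z) \<cdot> (\<alpha> Y X Z \<cdot> ((\<sigma> X Y \<boxtimes> \<I> Z) \<cdot> inv_arrow C (\<alpha> X Y Z))))"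
proof -
  have "inv_arrow C (\<alpha> Y Z X) \<cdot> (\<alpha> Y Z X \<cdot> \<sigma> X (Y \<otimes> Z) \<cdot> \<alpha> X Y Z) \<cdot> inv_arrow C (\<alpha> X Y Z)
     = inv_arrow C (\<alpha> Y Z X) \<cdot> ((\<I> Y \<boxtimes> \<sigma> X Z) \<cdot> \<alpha> Y X Z \<cdot> (\<sigma> X Y \<boxtimes> \<I> Z)) \<cdot> inv_arrow C (\<alpha> X Y Z)"
    by (simp only: hexagon1[OF assms])
  then show ?thesis by simp
qed

lemma hexagon2_Braid:
  assumes [simp]: "X \<in> Obj C" "Y \<in> Obj C" "Z \<in> Obj C"
  shows "\<sigma> (X \<otimes> Y) Z = \<alpha> Z X Y \<cdot> ((\<sigma> X Z \<boxtimes> \<I> Y) \<cdot> (inv_arrow C (\<alpha> X Z Y) \<cdot> ((\<I> X \<boxtimes> \<sigma> Y Z) \<cdot> \<alpha> X Y Z)))"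
proof -
  have "\<alpha> Z X Y \<cdot> (inv_arrow C (\<alpha> Z X Y) \<cdot> \<sigma> (X \<otimes> Y) Z \<cdot> inv_arrow C (\<alpha> X Y Z)) \<cdot> \<alpha> X Y Z
     = \<alpha> Z X Y \<cdot> ((\<sigma> X Z \<boxtimes> \<I> Y) \<cdot> inv_arrow C (\<alpha> X Z Y) \<cdot> (\<I> X \<boxtimes> \<sigma> Y Z)) \<cdot> \<alpha> X Y Z"
    by (simp only: hexagon2[OF assms])
  then show ?thesis by simp
qed

text \<open>The strict-looking braiding of two factors in front of a third one. With it, the hexagons
  involve no associators except those that unfold a tensor product into its factors.\<close>

definition swap :: "'o \<Rightarrow> 'o \<Rightarrow> 'o \<Rightarrow> 'm" where
  "swap X Y W = \<alpha> Y X W \<cdot> ((\<sigma> X Y \<boxtimes> \<I> W) \<cdot> inv_arrow C (\<alpha> X Y W))"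

lemma swap_arr [simp]:
  assumes [simp]: "X \<in> Obj C" "Y \<in> Obj C" "W \<in> Obj C"
  shows "swap X Y W \<in> Arr C" "Dom C (swap X Y W) = X \<otimes> (Y \<otimes> W)" "Cod C (swap X Y W) = Y \<otimes> (X \<otimes> W)"
  by (auto simp: swap_def)

lemma swap_natural:
  assumes [simp]: "f \<in> Arr C" "g \<in> Arr C" "h \<in> Arr C" "Cod C f = X" "Cod C g = Y" "Cod C h = W"
  shows "swap X Y W \<cdot> (f \<boxtimes> (g \<boxtimes> h)) = (g \<boxtimes> (f \<boxtimes> h)) \<cdot> swap (Dom C f) (Dom C g) (Dom C h)"
proof -
  have [simp]: "X \<in> Obj C" "Y \<in> Obj C" "W \<in> Obj C" using assms Cod_Obj' by metis+
  have "swap X Y W \<cdot> (f \<boxtimes> (g \<boxtimes> h)) = \<alpha> Y X W \<cdot> (((\<sigma> X Y \<cdot> (f \<boxtimes> g)) \<boxtimes> h) \<cdot> inv_arrow C (\<alpha> (Dom C f) (Dom C g) (Dom C h)))"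
    by (simp add: swap_def inv_Assoc_natural)
  also have "\<dots> = \<alpha> Y X W \<cdot> (((g \<boxtimes> f) \<boxtimes> h) \<cdot> ((\<sigma> (Dom C f) (Dom C g) \<boxtimes> \<I> (Dom C h)) \<cdot> inv_arrow C (\<alpha> (Dom C f) (Dom C g) (Dom C h))))"
    by (simp add: Braid_natural)
  also have "\<dots> = (g \<boxtimes> (f \<boxtimes> h)) \<cdot> swap (Dom C f) (Dom C g) (Dom C h)"
    by (simp add: swap_def Assoc_natural' del: ten_comp ten_comp')
  finally show ?thesis .
qed

text \<open>Moving one strand past a tensor product is moving it past each factor; the hexagon says
  so for the bare braiding, and pentagons absorb the spectator \<open>W\<close>.\<close>

lemma hexagon1_swap:
  assumes [simp]: "X \<in> Obj C" "Y \<in> Obj C" "Z \<in> Obj C" "W \<in> Obj C"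
  shows "\<alpha> Y Z (X \<otimes> W) \<cdot> swap X (Y \<otimes> Z) W
    = (\<I> Y \<boxtimes> swap X Z W) \<cdot> (swap X Y (Z \<otimes> W) \<cdot> (\<I> X \<boxtimes> \<alpha> Y Z W))"
proof -
  have 1: "(inv_arrow C (\<alpha> X Y Z) \<boxtimes> \<I> W) \<cdot> inv_arrow C (\<alpha> X (Y \<otimes> Z) W)
      = inv_arrow C (\<alpha> (X \<otimes> Y) Z W) \<cdot> (inv_arrow C (\<alpha> X Y (Z \<otimes> W)) \<cdot> (\<I> X \<boxtimes> \<alpha> Y Z W))"
    by (rule iso_cancel_left[of "\<alpha> (X \<otimes> Y) Z W"]) (auto simp: pentagon_inv1')
  show ?thesis
    by (simp add: swap_def hexagon1_Braid whisker_right whisker_left pentagon_inv1' pentagon_inv2' 1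
        Assoc_natural' Assoc_natural del: ten_comp ten_comp')
qed

lemma hexagon2_swap:
  assumes [simp]: "X \<in> Obj C" "Y \<in> Obj C" "Z \<in> Obj C" "W \<in> Obj C"
  shows "(\<I> Z \<boxtimes> \<alpha> X Y W) \<cdot> swap (X \<otimes> Y) Z W
    = swap X Z (Y \<otimes> W) \<cdot> ((\<I> X \<boxtimes> swap Y Z W) \<cdot> \<alpha> X Y (Z \<otimes> W))"
proof -
  have 1: "(\<I> Z \<boxtimes> \<alpha> X Y W) \<cdot> (\<alpha> Z (X \<otimes> Y) W \<cdot> ((\<alpha> Z X Y \<boxtimes> \<I> W) \<cdot> x)) = \<alpha> Z X (Y \<otimes> W) \<cdot> (\<alpha> (Z \<otimes> X) Y W \<cdot> x)"
    if [simp]: "x \<in> Arr C" "Cod C x = ((Z \<otimes> X) \<otimes> Y) \<otimes> W" for x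
    by (simp add: pentagon')
  have 2: "\<alpha> X (Y \<otimes> Z) W \<cdot> ((\<alpha> X Y Z \<boxtimes> \<I> W) \<cdot> inv_arrow C (\<alpha> (X \<otimes> Y) Z W)) = (\<I> X \<boxtimes> inv_arrow C (\<alpha> Y Z W)) \<cdot> \<alpha> X Y (Z \<otimes> W)"
    by (simp add: pentagon_inv2' del: ten_comp ten_comp')
  show ?thesis
    by (simp add: swap_def hexagon2_Braid whisker_right whisker_left pentagon_inv1' 1 2
        Assoc_natural' Assoc_natural del: ten_comp ten_comp')
qed

lemma hexagon1_swap_last:
  assumes [simp]: "X \<in> Obj C" "Y \<in> Obj C" "Z \<in> Obj C"
  shows "\<alpha> Y Z X \<cdot> \<sigma> X (Y \<otimes> Z) = (\<I> Y \<boxtimes> \<sigma> X Z) \<cdot> swap X Y Z"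
  by (simp add: hexagon1_Braid swap_def)

lemma hexagon2_swap_last:
  assumes [simp]: "X \<in> Obj C" "Y \<in> Obj C" "Z \<in> Obj C"
  shows "\<sigma> (X \<otimes> Y) Z = swap X Z Y \<cdot> ((\<I> X \<boxtimes> \<sigma> Y Z) \<cdot> \<alpha> X Y Z)"
  by (simp add: hexagon2_Braid swap_def)

text \<open>The last factor of \<open>swap\<close> is a spectator, so enlarging it is only a change
  of brackets.\<close>

lemma swap_ten:
  assumes [simp]: "X \<in> Obj C" "Y \<in> Obj C" "Z \<in> Obj C" "V \<in> Obj C"
  shows "(\<I> Y \<boxtimes> \<alpha> X Z V) \<cdot> (\<alpha> Y (X \<otimes> Z) V \<cdot> (swap X Y Z \<boxtimes> \<I> V))
    = swap X Y (Z \<otimes> V) \<cdot> ((\<I> X \<boxtimes> \<alpha> Y Z V) \<cdot> \<alpha> X (Y \<otimes> Z) V)"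
proof -
  have 1: "(\<I> Y \<boxtimes> \<alpha> X Z V) \<cdot> (\<alpha> Y (X \<otimes> Z) V \<cdot> ((\<alpha> Y X Z \<boxtimes> \<I> V) \<cdot> x)) = \<alpha> Y X (Z \<otimes> V) \<cdot> (\<alpha> (Y \<otimes> X) Z V \<cdot> x)"
    if [simp]: "x \<in> Arr C" "Cod C x = ((Y \<otimes> X) \<otimes> Z) \<otimes> V" for x
    by (simp add: pentagon')
  show ?thesis
    by (simp add: swap_def whisker_right pentagon_inv1 1 Assoc_natural' del: ten_comp ten_comp')
qed

lemma middle_swap:
  assumes [simp]: "X \<in> Obj C" "Y \<in> Obj C" "Z \<in> Obj C" "W \<in> Obj C"
  shows "middle C X Y Z W = inv_arrow C (\<alpha> X Z (Y \<otimes> W)) \<cdot> ((\<I> X \<boxtimes> swap Y Z W) \<cdot> \<alpha> X Y (Z \<otimes> W))"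
  by (simp add: middle_def swap_def)

lemma middle_arr [simp]:
  assumes [simp]: "X \<in> Obj C" "Y \<in> Obj C" "Z \<in> Obj C" "W \<in> Obj C"
  shows "middle C X Y Z W \<in> Arr C" "Dom C (middle C X Y Z W) = (X \<otimes> Y) \<otimes> (Z \<otimes> W)"
    "Cod C (middle C X Y Z W) = (X \<otimes> Z) \<otimes> (Y \<otimes> W)"
  by (auto simp: middle_swap)

lemma Assoc_middle:
  assumes [simp]: "X \<in> Obj C" "Y \<in> Obj C" "Z \<in> Obj C" "W \<in> Obj C"
  shows "\<alpha> X Z (Y \<otimes> W) \<cdot> middle C X Y Z W = (\<I> X \<boxtimes> swap Y Z W) \<cdot> \<alpha> X Y (Z \<otimes> W)"
  by (simp add: middle_swap)

lemma Assoc_middle':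
  assumes [simp]: "X \<in> Obj C" "Y \<in> Obj C" "Z \<in> Obj C" "W \<in> Obj C" "x \<in> Arr C" "Cod C x = (X \<otimes> Y) \<otimes> (Z \<otimes> W)"
  shows "\<alpha> X Z (Y \<otimes> W) \<cdot> (middle C X Y Z W \<cdot> x) = (\<I> X \<boxtimes> swap Y Z W) \<cdot> (\<alpha> X Y (Z \<otimes> W) \<cdot> x)"
  by (simp add: middle_swap)

lemma middle_natural:
  assumes [simp]: "f \<in> Arr C" "g \<in> Arr C" "h \<in> Arr C" "k \<in> Arr C" "Cod C f = X" "Cod C g = Y" "Cod C h = Z" "Cod C k = W"
  shows "middle C X Y Z W \<cdot> ((f \<boxtimes> g) \<boxtimes> (h \<boxtimes> k))
    = ((f \<boxtimes> h) \<boxtimes> (g \<boxtimes> k)) \<cdot> middle C (Dom C f) (Dom C g) (Dom C h) (Dom C k)"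
proof -
  have [simp]: "X \<in> Obj C" "Y \<in> Obj C" "Z \<in> Obj C" "W \<in> Obj C" using assms Cod_Obj' by metis+
  have "middle C X Y Z W \<cdot> ((f \<boxtimes> g) \<boxtimes> (h \<boxtimes> k))
     = inv_arrow C (\<alpha> X Z (Y \<otimes> W)) \<cdot> ((f \<boxtimes> (swap Y Z W \<cdot> (g \<boxtimes> (h \<boxtimes> k)))) \<cdot> \<alpha> (Dom C f) (Dom C g) (Dom C h \<otimes> Dom C k))"
    by (simp add: middle_swap Assoc_natural)
  also have "\<dots> = inv_arrow C (\<alpha> X Z (Y \<otimes> W)) \<cdot> ((f \<boxtimes> (h \<boxtimes> (g \<boxtimes> k))) \<cdot> ((\<I> (Dom C f) \<boxtimes> swap (Dom C g) (Dom C h) (Dom C k)) \<cdot> \<alpha> (Dom C f) (Dom C g) (Dom C h \<otimes> Dom C k)))"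
    by (simp add: swap_natural)
  also have "\<dots> = ((f \<boxtimes> h) \<boxtimes> (g \<boxtimes> k)) \<cdot> middle C (Dom C f) (Dom C g) (Dom C h) (Dom C k)"
    by (simp add: middle_swap inv_Assoc_natural' del: ten_comp ten_comp')
  finally show ?thesis .
qed

lemma middle_natural':
  assumes [simp]: "f \<in> Arr C" "g \<in> Arr C" "h \<in> Arr C" "k \<in> Arr C" "x \<in> Arr C"
    "Cod C f = X" "Cod C g = Y" "Cod C h = Z" "Cod C k = W"
    "Cod C x = (Dom C f \<otimes> Dom C g) \<otimes> (Dom C h \<otimes> Dom C k)"
  shows "middle C X Y Z W \<cdot> (((f \<boxtimes> g) \<boxtimes> (h \<boxtimes> k)) \<cdot> x)
    = ((f \<boxtimes> h) \<boxtimes> (g \<boxtimes> k)) \<cdot> (middle C (Dom C f) (Dom C g) (Dom C h) (Dom C k) \<cdot> x)"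
proof -
  have [simp]: "X \<in> Obj C" "Y \<in> Obj C" "Z \<in> Obj C" "W \<in> Obj C" using assms Cod_Obj' by metis+
  show ?thesis by (intro comp_swap middle_natural) auto
qed

text \<open>Two strands crossing two strands make four crossings: one inside each
  \<open>middle\<close> and two in between. This form serves both the cocommutativity of tensor
  products and the comparison with the inverse braiding.\<close>

lemma Braid_tensor:
  assumes [simp]: "X \<in> Obj C" "Y \<in> Obj C" "Z \<in> Obj C" "W \<in> Obj C"
  shows "\<sigma> (Y \<otimes> W) (X \<otimes> Z) = middle C X Y Z W \<cdot> ((\<sigma> Y X \<boxtimes> \<sigma> W Z) \<cdot> middle C Y W X Z)"
proof (rule iso_cancel_left[of "\<alpha> X Z (Y \<otimes> W)"])
  have 1: "(\<I> X \<boxtimes> (\<I> Y \<boxtimes> \<sigma> W Z)) \<cdot> (swap Y X (W \<otimes> Z) \<cdot> x) = \<alpha> X Y (Z \<otimes> W) \<cdot> ((\<sigma> Y X \<boxtimes> \<sigma> W Z) \<cdot> (inv_arrow C (\<alpha> Y X (W \<otimes> Z)) \<cdot> x))"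
    if [simp]: "x \<in> Arr C" "Cod C x = Y \<otimes> (X \<otimes> (W \<otimes> Z))" for x
  proof -
    have "\<sigma> Y X \<boxtimes> \<sigma> W Z = (\<I> (X \<otimes> Y) \<boxtimes> \<sigma> W Z) \<cdot> (\<sigma> Y X \<boxtimes> \<I> (W \<otimes> Z))" by simp
    then show ?thesis by (simp add: swap_def Assoc_natural_right' del: ten_comp ten_comp')
  qed
  have 2: "(\<I> X \<boxtimes> \<alpha> Y W Z) \<cdot> swap (Y \<otimes> W) X Z = swap Y X (W \<otimes> Z) \<cdot> ((\<I> Y \<boxtimes> swap W X Z) \<cdot> \<alpha> Y W (X \<otimes> Z))"
    by (rule hexagon2_swap) auto
  have "\<alpha> X Z (Y \<otimes> W) \<cdot> \<sigma> (Y \<otimes> W) (X \<otimes> Z) = (\<I> X \<boxtimes> swap Y Z W) \<cdot> ((\<I> X \<boxtimes> (\<I> Y \<boxtimes> \<sigma> W Z)) \<cdot> ((\<I> X \<boxtimes> \<alpha> Y W Z) \<cdot> swap (Y \<otimes> W) X Z))"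
    unfolding hexagon1_swap_last[OF TenO_Obj[OF assms(2,4)] assms(1,3)] by (simp add: hexagon2_swap_last)
  also have "\<dots> = \<alpha> X Z (Y \<otimes> W) \<cdot> (middle C X Y Z W \<cdot> ((\<sigma> Y X \<boxtimes> \<sigma> W Z) \<cdot> middle C Y W X Z))"
    by (simp add: Assoc_middle' 1 2 middle_swap[of Y W X Z] del: ten_comp ten_comp')
  finally show "\<alpha> X Z (Y \<otimes> W) \<cdot> \<sigma> (Y \<otimes> W) (X \<otimes> Z) = \<alpha> X Z (Y \<otimes> W) \<cdot> (middle C X Y Z W \<cdot> ((\<sigma> Y X \<boxtimes> \<sigma> W Z) \<cdot> middle C Y W X Z))" .
qed auto

text \<open>Coherence of the middle interchange with associativity, which is what makes the tensor
  product of comonoids coassociative. Both sides reduce to one word of strand swaps once the target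
  is bracketed to the right.\<close>

lemma middle_Assoc:
  assumes [simp]: "X \<in> Obj C" "X' \<in> Obj C" "X'' \<in> Obj C" "Y \<in> Obj C" "Y' \<in> Obj C" "Y'' \<in> Obj C"
  shows "\<alpha> (X \<otimes> Y) (X' \<otimes> Y') (X'' \<otimes> Y'') \<cdot> ((middle C X X' Y Y' \<boxtimes> \<I> (X'' \<otimes> Y'')) \<cdot> middle C (X \<otimes> X') X'' (Y \<otimes> Y') Y'')
    = (\<I> (X \<otimes> Y) \<boxtimes> middle C X' X'' Y' Y'') \<cdot> (middle C X (X' \<otimes> X'') Y (Y' \<otimes> Y'') \<cdot> (\<alpha> X X' X'' \<boxtimes> \<alpha> Y Y' Y''))"
    (is "?L = ?R")
proof -
  define V where "V = X'' \<otimes> Y''"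
  have [simp]: "V \<in> Obj C" by (simp add: V_def)
  \<comment> \<open>\<open>?J\<close> brackets the target to the right. \<open>?S\<close> swaps X'
    with Y, and \<open>?T\<close> moves X'' past Y and then past Y'; both sides become
    \<open>?S \<cdot> ?T\<close>.\<close>
  let ?J = "(\<I> X \<boxtimes> (\<I> Y \<boxtimes> \<alpha> X' Y' V)) \<cdot> \<alpha> X Y ((X' \<otimes> Y') \<otimes> V)"
  let ?S = "\<I> X \<boxtimes> swap X' Y (Y' \<otimes> V)"
  let ?T = "(\<I> X \<boxtimes> (\<I> X' \<boxtimes> ((\<I> Y \<boxtimes> swap X'' Y' Y'') \<cdot> swap X'' Y (Y' \<otimes> Y'')))) \<cdot> (\<alpha> X X' (X'' \<otimes> (Y \<otimes> (Y' \<otimes> Y''))) \<cdot> (\<alpha> (X \<otimes> X') X'' (Y \<otimes> (Y' \<otimes> Y''))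
     \<cdot> (\<I> ((X \<otimes> X') \<otimes> X'') \<boxtimes> \<alpha> Y Y' Y'')))"
  have 1: "(\<I> X \<boxtimes> ((\<I> Y \<boxtimes> \<alpha> X' Y' V) \<cdot> \<alpha> Y (X' \<otimes> Y') V)) \<cdot> (\<alpha> X (Y \<otimes> (X' \<otimes> Y')) V \<cdot> ((\<I> X \<boxtimes> swap X' Y Y') \<boxtimes> \<I> V))
     = ?S \<cdot> ((\<I> X \<boxtimes> ((\<I> X' \<boxtimes> \<alpha> Y Y' V) \<cdot> \<alpha> X' (Y \<otimes> Y') V)) \<cdot> \<alpha> X (X' \<otimes> (Y \<otimes> Y')) V)"
    by (simp add: Assoc_natural swap_ten)
  have "?J \<cdot> (\<alpha> (X \<otimes> Y) (X' \<otimes> Y') V \<cdot> (middle C X X' Y Y' \<boxtimes> \<I> V))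
      = ((\<I> X \<boxtimes> ((\<I> Y \<boxtimes> \<alpha> X' Y' V) \<cdot> \<alpha> Y (X' \<otimes> Y') V)) \<cdot> (\<alpha> X (Y \<otimes> (X' \<otimes> Y')) V \<cdot> ((\<I> X \<boxtimes> swap X' Y Y') \<boxtimes> \<I> V))) \<cdot> (\<alpha> X X' (Y \<otimes> Y') \<boxtimes> \<I> V)"
    by (simp add: pentagon' Assoc_middle)
  also have "\<dots> = ?S \<cdot> ((\<I> X \<boxtimes> (\<I> X' \<boxtimes> \<alpha> Y Y' V)) \<cdot> (\<alpha> X X' ((Y \<otimes> Y') \<otimes> V) \<cdot> \<alpha> (X \<otimes> X') (Y \<otimes> Y') V))"
    unfolding 1 by (simp add: pentagon)
  finally have 2: "?J \<cdot> (\<alpha> (X \<otimes> Y) (X' \<otimes> Y') V \<cdot> (middle C X X' Y Y' \<boxtimes> \<I> V))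
      = ?S \<cdot> ((\<I> X \<boxtimes> (\<I> X' \<boxtimes> \<alpha> Y Y' V)) \<cdot> (\<alpha> X X' ((Y \<otimes> Y') \<otimes> V) \<cdot> \<alpha> (X \<otimes> X') (Y \<otimes> Y') V))" .
  have "?J \<cdot> ?L = (?J \<cdot> (\<alpha> (X \<otimes> Y) (X' \<otimes> Y') V \<cdot> (middle C X X' Y Y' \<boxtimes> \<I> V))) \<cdot> middle C (X \<otimes> X') X'' (Y \<otimes> Y') Y''"
    by (simp add: V_def)
  also have "\<dots> = ?S \<cdot> ((\<I> X \<boxtimes> (\<I> X' \<boxtimes> (\<alpha> Y Y' V \<cdot> swap X'' (Y \<otimes> Y') Y''))) \<cdot> (\<alpha> X X' (X'' \<otimes> ((Y \<otimes> Y') \<otimes> Y'')) \<cdot> \<alpha> (X \<otimes> X') X'' ((Y \<otimes> Y') \<otimes> Y'')))"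
    unfolding 2 by (simp add: V_def Assoc_middle Assoc_natural_right')
  also have "\<dots> = ?S \<cdot> ?T"
    by (simp add: V_def hexagon1_swap Assoc_natural_right Assoc_natural_right')
  finally have L: "?J \<cdot> ?L = ?S \<cdot> ?T" .
  have 3: "(\<I> Y \<boxtimes> \<alpha> X' X'' (Y' \<otimes> Y'')) \<cdot> swap (X' \<otimes> X'') Y (Y' \<otimes> Y'')
     = swap X' Y (X'' \<otimes> (Y' \<otimes> Y'')) \<cdot> ((\<I> X' \<boxtimes> swap X'' Y (Y' \<otimes> Y'')) \<cdot> \<alpha> X' X'' (Y \<otimes> (Y' \<otimes> Y'')))"
    by (rule hexagon2_swap) auto
  have 4: "(\<I> Y \<boxtimes> (\<I> X' \<boxtimes> swap X'' Y' Y'')) \<cdot> swap X' Y (X'' \<otimes> (Y' \<otimes> Y''))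
     = swap X' Y (Y' \<otimes> V) \<cdot> (\<I> X' \<boxtimes> (\<I> Y \<boxtimes> swap X'' Y' Y''))"
    by (simp add: swap_natural V_def)
  have 5: "(\<I> Y \<boxtimes> ((\<I> X' \<boxtimes> swap X'' Y' Y'') \<cdot> \<alpha> X' X'' (Y' \<otimes> Y''))) \<cdot> swap (X' \<otimes> X'') Y (Y' \<otimes> Y'')
     = swap X' Y (Y' \<otimes> V) \<cdot> ((\<I> X' \<boxtimes> ((\<I> Y \<boxtimes> swap X'' Y' Y'') \<cdot> swap X'' Y (Y' \<otimes> Y''))) \<cdot> \<alpha> X' X'' (Y \<otimes> (Y' \<otimes> Y'')))"
  proof -
    have "(\<I> Y \<boxtimes> ((\<I> X' \<boxtimes> swap X'' Y' Y'') \<cdot> \<alpha> X' X'' (Y' \<otimes> Y''))) \<cdot> swap (X' \<otimes> X'') Y (Y' \<otimes> Y'')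
      = (\<I> Y \<boxtimes> (\<I> X' \<boxtimes> swap X'' Y' Y'')) \<cdot> ((\<I> Y \<boxtimes> \<alpha> X' X'' (Y' \<otimes> Y'')) \<cdot> swap (X' \<otimes> X'') Y (Y' \<otimes> Y''))"
      by simp
    also have "\<dots> = ((\<I> Y \<boxtimes> (\<I> X' \<boxtimes> swap X'' Y' Y'')) \<cdot> swap X' Y (X'' \<otimes> (Y' \<otimes> Y''))) \<cdot> ((\<I> X' \<boxtimes> swap X'' Y (Y' \<otimes> Y'')) \<cdot> \<alpha> X' X'' (Y \<otimes> (Y' \<otimes> Y'')))"
      unfolding 3 by simp
    also have "\<dots> = swap X' Y (Y' \<otimes> V) \<cdot> ((\<I> X' \<boxtimes> ((\<I> Y \<boxtimes> swap X'' Y' Y'') \<cdot> swap X'' Y (Y' \<otimes> Y''))) \<cdot> \<alpha> X' X'' (Y \<otimes> (Y' \<otimes> Y'')))"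
      unfolding 4 by (simp add: V_def)
    finally show ?thesis .
  qed
  have "?J \<cdot> ?R = (\<I> X \<boxtimes> ((\<I> Y \<boxtimes> ((\<I> X' \<boxtimes> swap X'' Y' Y'') \<cdot> \<alpha> X' X'' (Y' \<otimes> Y''))) \<cdot> swap (X' \<otimes> X'') Y (Y' \<otimes> Y'')))
      \<cdot> (\<alpha> X (X' \<otimes> X'') (Y \<otimes> (Y' \<otimes> Y'')) \<cdot> (\<alpha> X X' X'' \<boxtimes> \<alpha> Y Y' Y''))"
    by (simp add: V_def Assoc_natural_right' Assoc_middle' Assoc_middle)
  also have "\<dots> = ?S \<cdot> ((\<I> X \<boxtimes> (\<I> X' \<boxtimes> ((\<I> Y \<boxtimes> swap X'' Y' Y'') \<cdot> swap X'' Y (Y' \<otimes> Y''))))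
      \<cdot> ((\<I> X \<boxtimes> \<alpha> X' X'' (Y \<otimes> (Y' \<otimes> Y''))) \<cdot> (\<alpha> X (X' \<otimes> X'') (Y \<otimes> (Y' \<otimes> Y'')) \<cdot> ((\<alpha> X X' X'' \<boxtimes> \<I> (Y \<otimes> (Y' \<otimes> Y''))) \<cdot> (\<I> ((X \<otimes> X') \<otimes> X'') \<boxtimes> \<alpha> Y Y' Y'')))))"
    unfolding 5 by (simp add: V_def)
  also have "\<dots> = ?S \<cdot> ?T"
    by (simp add: pentagon' V_def del: ten_comp ten_comp')
  finally have R: "?J \<cdot> ?R = ?S \<cdot> ?T" .
  have e: "?J \<cdot> ?L = ?J \<cdot> ?R" unfolding L R ..
  show ?thesis
    by (rule iso_cancel_left[OF _ e]) (simp_all add: V_def)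
qed

text \<open>The hexagon at X, \<one>, \<one> contains the braiding with the unit twice. Naturality
  along the unitor and the triangle simplify it until one copy cancels and the claim remains,
  tensored with \<one>.\<close>

lemma LUnit_Braid: "X \<in> Obj C \<Longrightarrow> \<lambda>\<^bold>l X \<cdot> \<sigma> X \<one> = \<rho> X"
proof -
  assume [simp]: "X \<in> Obj C"
  have 1: "\<lambda>\<^bold>l (\<one> \<otimes> X) \<cdot> (\<alpha> \<one> \<one> X \<cdot> x) = (\<lambda>\<^bold>l \<one> \<boxtimes> \<I> X) \<cdot> x" if "x \<in> Arr C" "Cod C x = (\<one> \<otimes> \<one>) \<otimes> X" for x
    using that by (intro comp_reduce LUnit_tensor) auto
  have "\<sigma> X \<one> \<cdot> ((\<lambda>\<^bold>l X \<boxtimes> \<I> \<one>) \<cdot> (\<sigma> X \<one> \<boxtimes> \<I> \<one>)) = \<lambda>\<^bold>l (\<one> \<otimes> X) \<cdot> ((\<I> \<one> \<boxtimes> \<sigma> X \<one>) \<cdot> (\<alpha> \<one> X \<one> \<cdot> (\<sigma> X \<one> \<boxtimes> \<I> \<one>)))"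
    by (subst LUnit_tensor[symmetric]) (auto simp: comp_swap[OF LUnit_natural])
  also have "\<dots> = \<lambda>\<^bold>l (\<one> \<otimes> X) \<cdot> (\<alpha> \<one> \<one> X \<cdot> \<sigma> X (\<one> \<otimes> \<one>) \<cdot> \<alpha> X \<one> \<one>)"
    by (subst hexagon1) auto
  also have "\<dots> = \<sigma> X \<one> \<cdot> ((\<I> X \<boxtimes> \<lambda>\<^bold>l \<one>) \<cdot> \<alpha> X \<one> \<one>)"
    by (simp add: 1 Braid_natural')
  also have "\<dots> = \<sigma> X \<one> \<cdot> (\<rho> X \<boxtimes> \<I> \<one>)" by (simp add: triangle)
  finally have "(\<lambda>\<^bold>l X \<cdot> \<sigma> X \<one>) \<boxtimes> \<I> \<one> = \<rho> X \<boxtimes> \<I> \<one>"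
    by (intro iso_cancel_left[of "\<sigma> X \<one>" "(\<lambda>\<^bold>l X \<cdot> \<sigma> X \<one>) \<boxtimes> \<I> \<one>"]) auto
  then show ?thesis by (rule faithful_right_unit) auto
qed

lemma Braid_unit: "\<sigma> \<one> \<one> = \<I> (\<one> \<otimes> \<one>)"
  by (rule iso_cancel_left[of "\<lambda>\<^bold>l \<one>"]) (simp_all add: LUnit_Braid LUnit_eq_RUnit[symmetric])

text \<open>The mirror image goes through the second hexagon: in a braided category the two
  braidings with the unit are not given as inverse to each other.\<close>

lemma RUnit_Braid: "X \<in> Obj C \<Longrightarrow> \<rho> X \<cdot> \<sigma> \<one> X = \<lambda>\<^bold>l X"
proof -
  assume [simp]: "X \<in> Obj C"
  have "((\<rho> X \<cdot> \<sigma> \<one> X) \<boxtimes> \<I> \<one>) \<cdot> (inv_arrow C (\<alpha> \<one> X \<one>) \<cdot> (\<I> \<one> \<boxtimes> \<sigma> \<one> X)) 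
     = (\<rho> X \<boxtimes> \<I> \<one>) \<cdot> ((\<sigma> \<one> X \<boxtimes> \<I> \<one>) \<cdot> inv_arrow C (\<alpha> \<one> X \<one>) \<cdot> (\<I> \<one> \<boxtimes> \<sigma> \<one> X))" by simp
  also have "\<dots> = (\<rho> X \<boxtimes> \<I> \<one>) \<cdot> (inv_arrow C (\<alpha> X \<one> \<one>) \<cdot> \<sigma> (\<one> \<otimes> \<one>) X \<cdot> inv_arrow C (\<alpha> \<one> \<one> X))"
    by (subst hexagon2) auto
  also have "\<dots> = (\<I> X \<boxtimes> \<lambda>\<^bold>l \<one>) \<cdot> (\<sigma> (\<one> \<otimes> \<one>) X \<cdot> inv_arrow C (\<alpha> \<one> \<one> X))"
    by (simp add: comp_reduce[OF triangle_inv])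
  also have "\<dots> = \<sigma> \<one> X \<cdot> ((\<lambda>\<^bold>l \<one> \<boxtimes> \<I> X) \<cdot> inv_arrow C (\<alpha> \<one> \<one> X))"
    by (simp add: Braid_natural')
  also have "\<dots> = \<sigma> \<one> X \<cdot> \<lambda>\<^bold>l (\<one> \<otimes> X)"
    by (subst LUnit_tensor[symmetric]) auto
  also have "\<dots> = \<lambda>\<^bold>l (X \<otimes> \<one>) \<cdot> (\<I> \<one> \<boxtimes> \<sigma> \<one> X)" by (simp add: LUnit_natural)
  also have "\<dots> = (\<lambda>\<^bold>l X \<boxtimes> \<I> \<one>) \<cdot> (inv_arrow C (\<alpha> \<one> X \<one>) \<cdot> (\<I> \<one> \<boxtimes> \<sigma> \<one> X))"
    by (subst LUnit_tensor[symmetric]) (auto simp del: ten_comp)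
  finally have "(\<rho> X \<cdot> \<sigma> \<one> X) \<boxtimes> \<I> \<one> = \<lambda>\<^bold>l X \<boxtimes> \<I> \<one>"
    by (rule iso_cancel_right[rotated]) simp_all
  then show ?thesis by (rule faithful_right_unit) auto
qed

text \<open>Unit strands cross freely; this is the source of the counit laws of a tensor
  product.\<close>

lemma LUnit_swap:
  assumes [simp]: "X \<in> Obj C" "Y \<in> Obj C"
  shows "\<lambda>\<^bold>l (X \<otimes> Y) \<cdot> swap X \<one> Y = \<I> X \<boxtimes> \<lambda>\<^bold>l Y"
    "(\<I> X \<boxtimes> \<lambda>\<^bold>l Y) \<cdot> swap \<one> X Y = \<lambda>\<^bold>l (X \<otimes> Y)"
proof -
  have "\<lambda>\<^bold>l (X \<otimes> Y) \<cdot> swap X \<one> Y = (\<lambda>\<^bold>l X \<boxtimes> \<I> Y) \<cdot> ((\<sigma> X \<one> \<boxtimes> \<I> Y) \<cdot> inv_arrow C (\<alpha> X \<one> Y))"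
    unfolding swap_def by (rule comp_reduce[OF LUnit_tensor]) auto
  then show "\<lambda>\<^bold>l (X \<otimes> Y) \<cdot> swap X \<one> Y = \<I> X \<boxtimes> \<lambda>\<^bold>l Y"
    by (simp add: LUnit_Braid triangle_inv)
  have "(\<I> X \<boxtimes> \<lambda>\<^bold>l Y) \<cdot> swap \<one> X Y = (\<lambda>\<^bold>l X \<boxtimes> \<I> Y) \<cdot> inv_arrow C (\<alpha> \<one> X Y)"
    by (simp add: swap_def triangle' RUnit_Braid)
  then show "(\<I> X \<boxtimes> \<lambda>\<^bold>l Y) \<cdot> swap \<one> X Y = \<lambda>\<^bold>l (X \<otimes> Y)"
    unfolding LUnit_tensor[OF assms, symmetric] by simp
qed

lemma swap_unit: "X \<in> Obj C \<Longrightarrow> swap \<one> \<one> X = \<I> (\<one> \<otimes> (\<one> \<otimes> X))"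
  by (simp add: swap_def Braid_unit)

lemma middle_unit: "X \<in> Obj C \<Longrightarrow> Y \<in> Obj C \<Longrightarrow> middle C X \<one> \<one> Y = \<I> ((X \<otimes> \<one>) \<otimes> (\<one> \<otimes> Y))"
  by (simp add: middle_swap swap_unit)

end

section \<open>Tensor products of cocommutative comonoids\<close>

context braided_monoidal_category
begin

lemma coc_comonoidD:
  assumes "coc_comonoid C X"
  shows "carr X \<in> Obj C" "comult X \<in> Arr C" "Dom C (comult X) = carr X" "Cod C (comult X) = carr X \<otimes> carr X"
    "counit X \<in> Arr C" "Dom C (counit X) = carr X" "Cod C (counit X) = \<one>"
    "\<alpha> (carr X) (carr X) (carr X) \<cdot> ((comult X \<boxtimes> \<I> (carr X)) \<cdot> comult X) = (\<I> (carr X) \<boxtimes> comult X) \<cdot> comult X"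
    "\<lambda>\<^bold>l (carr X) \<cdot> ((counit X \<boxtimes> \<I> (carr X)) \<cdot> comult X) = \<I> (carr X)"
    "\<rho> (carr X) \<cdot> ((\<I> (carr X) \<boxtimes> counit X) \<cdot> comult X) = \<I> (carr X)"
    "\<sigma> (carr X) (carr X) \<cdot> comult X = comult X"
  using assms by (auto simp: coc_comonoid_def Let_def)

definition tens :: "('o, 'm, 'y) comonoid_scheme \<Rightarrow> ('o, 'm, 'z) comonoid_scheme \<Rightarrow> ('o, 'm) comonoid" where
  "tens X Y = \<lparr>carr = carr X \<otimes> carr Y,
     comult = middle C (carr X) (carr X) (carr Y) (carr Y) \<cdot> (comult X \<boxtimes> comult Y),
     counit = \<lambda>\<^bold>l \<one> \<cdot> (counit X \<boxtimes> counit Y)\<rparr>"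

text \<open>Substitute for a symmetry of M: it is the condition under which a tensor product of
  cocommutative comonoids is shown to be cocommutative again.\<close>

definition involutive :: "'o \<Rightarrow> 'o \<Rightarrow> bool" where
  "involutive X Y \<longleftrightarrow> \<sigma> Y X \<cdot> \<sigma> X Y = \<I> (X \<otimes> Y)"

lemma involutiveD:
  "involutive X Y \<Longrightarrow> \<sigma> Y X \<cdot> \<sigma> X Y = \<I> (X \<otimes> Y)"
  "involutive X Y \<Longrightarrow> X \<in> Obj C \<Longrightarrow> Y \<in> Obj C \<Longrightarrow> x \<in> Arr C \<Longrightarrow> Cod C x = X \<otimes> Y \<Longrightarrow> \<sigma> Y X \<cdot> (\<sigma> X Y \<cdot> x) = x"
  unfolding involutive_def using comp_reduce[of "\<sigma> Y X" "\<sigma> X Y" "\<I> (X \<otimes> Y)" x] by auto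

lemma involutive_sym:
  assumes [simp]: "X \<in> Obj C" "Y \<in> Obj C" and "involutive X Y"
  shows "involutive Y X"
  unfolding involutive_def
proof (rule iso_cancel_left[of "\<sigma> Y X"])
  show "\<sigma> Y X \<cdot> (\<sigma> X Y \<cdot> \<sigma> Y X) = \<sigma> Y X \<cdot> \<I> (Y \<otimes> X)"
    using involutiveD(2)[OF assms(3)] by simp
qed auto

lemma swap_involutive:
  assumes [simp]: "X \<in> Obj C" "Y \<in> Obj C" "W \<in> Obj C" and "involutive X Y"
  shows "swap Y X W \<cdot> swap X Y W = \<I> (X \<otimes> (Y \<otimes> W))"
  using involutiveD[OF assms(4)] by (simp add: swap_def)

lemma middle_involutive:
  assumes [simp]: "X \<in> Obj C" "Y \<in> Obj C" "Z \<in> Obj C" "W \<in> Obj C" and "involutive Y Z"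
  shows "middle C X Z Y W \<cdot> middle C X Y Z W = \<I> ((X \<otimes> Y) \<otimes> (Z \<otimes> W))"
  using swap_involutive[of Y Z W] assms(5) by (simp add: middle_swap)

text \<open>The hexagons express both braidings with X \<otimes> Y through those with X and with Y,
  which cancel from the inside out. This admits threefold products as stages.\<close>

lemma involutive_tensor_left:
  assumes [simp]: "X \<in> Obj C" "Y \<in> Obj C" "Z \<in> Obj C" and "involutive X Z" "involutive Y Z"
  shows "involutive (X \<otimes> Y) Z"
  using involutiveD[OF assms(4)] involutiveD[OF assms(5)]
  by (simp add: involutive_def hexagon1_Braid hexagon2_Braid whisker_left whisker_right)

lemma middle_LUnit:
  assumes [simp]: "X \<in> Obj C" "Y \<in> Obj C"
  shows "\<lambda>\<^bold>l (X \<otimes> Y) \<cdot> ((\<lambda>\<^bold>l \<one> \<boxtimes> \<I> (X \<otimes> Y)) \<cdot> middle C \<one> X \<one> Y) = \<lambda>\<^bold>l X \<boxtimes> \<lambda>\<^bold>l Y"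
proof -
  have "(\<lambda>\<^bold>l \<one> \<boxtimes> \<I> (X \<otimes> Y)) \<cdot> middle C \<one> X \<one> Y
     = (\<I> \<one> \<boxtimes> \<lambda>\<^bold>l (X \<otimes> Y)) \<cdot> ((\<I> \<one> \<boxtimes> swap X \<one> Y) \<cdot> \<alpha> \<one> X (\<one> \<otimes> Y))"
    unfolding middle_swap[OF TUnit_Obj assms(1) TUnit_Obj assms(2)] LUnit_eq_RUnit
    by (rule comp_reduce[OF triangle_inv]) auto
  also have "\<dots> = (\<I> \<one> \<boxtimes> (\<I> X \<boxtimes> \<lambda>\<^bold>l Y)) \<cdot> \<alpha> \<one> X (\<one> \<otimes> Y)"
    by (simp add: LUnit_swap)
  finally have "\<lambda>\<^bold>l (X \<otimes> Y) \<cdot> ((\<lambda>\<^bold>l \<one> \<boxtimes> \<I> (X \<otimes> Y)) \<cdot> middle C \<one> X \<one> Y) = (\<I> X \<boxtimes> \<lambda>\<^bold>l Y) \<cdot> (\<lambda>\<^bold>l (X \<otimes> (\<one> \<otimes> Y)) \<cdot> \<alpha> \<one> X (\<one> \<otimes> Y))"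
    by (simp add: comp_swap[OF LUnit_natural[of "\<I> X \<boxtimes> \<lambda>\<^bold>l Y"]])
  then show ?thesis by (simp add: LUnit_tensor)
qed

lemma middle_RUnit:
  assumes [simp]: "X \<in> Obj C" "Y \<in> Obj C"
  shows "(\<rho> X \<boxtimes> \<rho> Y) \<cdot> middle C X Y \<one> \<one> = \<rho> (X \<otimes> Y) \<cdot> (\<I> (X \<otimes> Y) \<boxtimes> \<lambda>\<^bold>l \<one>)"
proof -
  have "(\<rho> X \<boxtimes> \<rho> Y) \<cdot> middle C X Y \<one> \<one> = (\<I> X \<boxtimes> \<rho> Y) \<cdot> ((\<rho> X \<boxtimes> \<I> (Y \<otimes> \<one>)) \<cdot> (inv_arrow C (\<alpha> X \<one> (Y \<otimes> \<one>)) \<cdot> ((\<I> X \<boxtimes> swap Y \<one> \<one>) \<cdot> \<alpha> X Y (\<one> \<otimes> \<one>))))"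
    by (simp add: middle_swap)
  also have "\<dots> = (\<I> X \<boxtimes> \<rho> Y) \<cdot> ((\<I> X \<boxtimes> (\<I> Y \<boxtimes> \<lambda>\<^bold>l \<one>)) \<cdot> \<alpha> X Y (\<one> \<otimes> \<one>))"
    by (subst comp_reduce[OF triangle_inv]) (simp_all add: LUnit_swap)
  also have "\<dots> = ((\<I> X \<boxtimes> \<rho> Y) \<cdot> \<alpha> X Y \<one>) \<cdot> (\<I> (X \<otimes> Y) \<boxtimes> \<lambda>\<^bold>l \<one>)"
    by (simp add: Assoc_natural_right)
  finally show ?thesis unfolding RUnit_tensor[OF assms] .
qed

lemma middle_LUnit':
  assumes [simp]: "X \<in> Obj C" "Y \<in> Obj C"
  shows "(\<lambda>\<^bold>l X \<boxtimes> \<lambda>\<^bold>l Y) \<cdot> middle C \<one> \<one> X Y = \<lambda>\<^bold>l (X \<otimes> Y) \<cdot> (\<lambda>\<^bold>l \<one> \<boxtimes> \<I> (X \<otimes> Y))"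
proof -
  have "(\<lambda>\<^bold>l X \<boxtimes> \<lambda>\<^bold>l Y) \<cdot> middle C \<one> \<one> X Y = (\<I> X \<boxtimes> \<lambda>\<^bold>l Y) \<cdot> (((\<lambda>\<^bold>l X \<boxtimes> \<I> (\<one> \<otimes> Y)) \<cdot> inv_arrow C (\<alpha> \<one> X (\<one> \<otimes> Y))) \<cdot> ((\<I> \<one> \<boxtimes> swap \<one> X Y) \<cdot> \<alpha> \<one> \<one> (X \<otimes> Y)))"
    by (simp add: middle_swap)
  also have "(\<lambda>\<^bold>l X \<boxtimes> \<I> (\<one> \<otimes> Y)) \<cdot> inv_arrow C (\<alpha> \<one> X (\<one> \<otimes> Y)) = \<lambda>\<^bold>l (X \<otimes> (\<one> \<otimes> Y))"
    by (simp add: LUnit_tensor[symmetric])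
  also have "(\<I> X \<boxtimes> \<lambda>\<^bold>l Y) \<cdot> (\<lambda>\<^bold>l (X \<otimes> (\<one> \<otimes> Y)) \<cdot> ((\<I> \<one> \<boxtimes> swap \<one> X Y) \<cdot> \<alpha> \<one> \<one> (X \<otimes> Y)))
      = \<lambda>\<^bold>l (X \<otimes> Y) \<cdot> ((\<I> \<one> \<boxtimes> ((\<I> X \<boxtimes> \<lambda>\<^bold>l Y) \<cdot> swap \<one> X Y)) \<cdot> \<alpha> \<one> \<one> (X \<otimes> Y))"
    using comp_swap[OF LUnit_natural[of "\<I> X \<boxtimes> \<lambda>\<^bold>l Y" "X \<otimes> Y", symmetric], where x = "(\<I> \<one> \<boxtimes> swap \<one> X Y) \<cdot> \<alpha> \<one> \<one> (X \<otimes> Y)"] by simp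
  also have "\<dots> = \<lambda>\<^bold>l (X \<otimes> Y) \<cdot> (\<lambda>\<^bold>l \<one> \<boxtimes> \<I> (X \<otimes> Y))"
    unfolding LUnit_swap(2)[OF assms] LUnit_eq_RUnit by (simp add: triangle)
  finally show ?thesis .
qed

text \<open>Coassociativity and the left counit law are coherence of \<open>middle\<close>.
  Involutivity enters in cocommutativity, where two interchanges meet and must cancel.\<close>

lemma coc_comonoid_tens:
  fixes X :: "('o, 'm, 'y) comonoid_scheme" and Y :: "('o, 'm, 'z) comonoid_scheme"
  assumes X: "coc_comonoid C X" and Y: "coc_comonoid C Y" and s: "involutive (carr X) (carr Y)"
  shows "coc_comonoid C (tens X Y)"
proof -
  define P where "P = carr X"
  define Q where "Q = carr Y"
  define M where "M = middle C P P Q Q"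
  define D where "D = M \<cdot> (comult X \<boxtimes> comult Y)"
  have [simp]: "P \<in> Obj C" "Q \<in> Obj C" by (auto simp: P_def Q_def coc_comonoidD(1)[OF X] coc_comonoidD(1)[OF Y])
  have M [simp]: "M \<in> Arr C" "Dom C M = (P \<otimes> P) \<otimes> (Q \<otimes> Q)" "Cod C M = (P \<otimes> Q) \<otimes> (P \<otimes> Q)"
    by (auto simp: M_def)
  note c [simp] = coc_comonoidD(1-7)[OF X, folded P_def] coc_comonoidD(1-7)[OF Y, folded Q_def]
  note cX = coc_comonoidD(8-)[OF X, folded P_def] and cY = coc_comonoidD(8-)[OF Y, folded Q_def]
  have D [simp]: "D \<in> Arr C" "Dom C D = P \<otimes> Q" "Cod C D = (P \<otimes> Q) \<otimes> (P \<otimes> Q)"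
    by (auto simp: D_def)
  have "\<alpha> (P \<otimes> Q) (P \<otimes> Q) (P \<otimes> Q) \<cdot> ((D \<boxtimes> \<I> (P \<otimes> Q)) \<cdot> D)
    = \<alpha> (P \<otimes> Q) (P \<otimes> Q) (P \<otimes> Q) \<cdot> ((M \<boxtimes> \<I> (P \<otimes> Q)) \<cdot> (((comult X \<boxtimes> comult Y) \<boxtimes> (\<I> P \<boxtimes> \<I> Q)) \<cdot> (middle C P P Q Q \<cdot> (comult X \<boxtimes> comult Y))))"
    by (simp add: D_def M_def)
  also have "\<dots> = (\<alpha> (P \<otimes> Q) (P \<otimes> Q) (P \<otimes> Q) \<cdot> ((M \<boxtimes> \<I> (P \<otimes> Q)) \<cdot> middle C (P \<otimes> P) P (Q \<otimes> Q) Q))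
     \<cdot> (((comult X \<boxtimes> \<I> P) \<boxtimes> (comult Y \<boxtimes> \<I> Q)) \<cdot> (comult X \<boxtimes> comult Y))"
    using middle_natural'[of "comult X" "\<I> P" "comult Y" "\<I> Q" "comult X \<boxtimes> comult Y" "P \<otimes> P" P "Q \<otimes> Q" Q, symmetric] by (simp del: ten_ident ten_comp ten_comp')
  also have "\<dots> = (\<I> (P \<otimes> Q) \<boxtimes> M) \<cdot> (middle C P (P \<otimes> P) Q (Q \<otimes> Q) \<cdot> (((\<alpha> P P P \<cdot> ((comult X \<boxtimes> \<I> P) \<cdot> comult X)) \<boxtimes> (\<alpha> Q Q Q \<cdot> ((comult Y \<boxtimes> \<I> Q) \<cdot> comult Y)))))"
    unfolding M_def by (subst middle_Assoc) simp_all
  also have "\<dots> = (\<I> (P \<otimes> Q) \<boxtimes> M) \<cdot> (middle C P (P \<otimes> P) Q (Q \<otimes> Q) \<cdot> (((\<I> P \<boxtimes> comult X) \<boxtimes> (\<I> Q \<boxtimes> comult Y)) \<cdot> (comult X \<boxtimes> comult Y)))"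
    unfolding cX cY by simp
  also have "\<dots> = (\<I> (P \<otimes> Q) \<boxtimes> D) \<cdot> D"
    using middle_natural'[of "\<I> P" "comult X" "\<I> Q" "comult Y" "comult X \<boxtimes> comult Y" P "P \<otimes> P" Q "Q \<otimes> Q"] by (simp add: D_def M_def)
  finally have 1: "\<alpha> (P \<otimes> Q) (P \<otimes> Q) (P \<otimes> Q) \<cdot> ((D \<boxtimes> \<I> (P \<otimes> Q)) \<cdot> D) = (\<I> (P \<otimes> Q) \<boxtimes> D) \<cdot> D" .
  let ?e = "\<lambda>\<^bold>l \<one> \<cdot> (counit X \<boxtimes> counit Y)"
  have "(?e \<boxtimes> \<I> (P \<otimes> Q)) \<cdot> D = (\<lambda>\<^bold>l \<one> \<boxtimes> \<I> (P \<otimes> Q)) \<cdot> (((counit X \<boxtimes> counit Y) \<boxtimes> (\<I> P \<boxtimes> \<I> Q)) \<cdot> (middle C P P Q Q \<cdot> (comult X \<boxtimes> comult Y)))"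
    by (simp add: D_def M_def)
  also have "\<dots> = (\<lambda>\<^bold>l \<one> \<boxtimes> \<I> (P \<otimes> Q)) \<cdot> (middle C \<one> P \<one> Q \<cdot> (((counit X \<boxtimes> \<I> P) \<boxtimes> (counit Y \<boxtimes> \<I> Q)) \<cdot> (comult X \<boxtimes> comult Y)))"
    using middle_natural'[of "counit X" "\<I> P" "counit Y" "\<I> Q" "comult X \<boxtimes> comult Y" \<one> P \<one> Q, symmetric] by (simp del: ten_ident ten_comp ten_comp')
  finally have "\<lambda>\<^bold>l (P \<otimes> Q) \<cdot> ((?e \<boxtimes> \<I> (P \<otimes> Q)) \<cdot> D) = (\<lambda>\<^bold>l (P \<otimes> Q) \<cdot> ((\<lambda>\<^bold>l \<one> \<boxtimes> \<I> (P \<otimes> Q)) \<cdot> middle C \<one> P \<one> Q)) \<cdot> (((counit X \<boxtimes> \<I> P) \<boxtimes> (counit Y \<boxtimes> \<I> Q)) \<cdot> (comult X \<boxtimes> comult Y))"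
    by (simp del: ten_comp ten_comp')
  also have "\<dots> = (\<lambda>\<^bold>l P \<cdot> ((counit X \<boxtimes> \<I> P) \<cdot> comult X)) \<boxtimes> (\<lambda>\<^bold>l Q \<cdot> ((counit Y \<boxtimes> \<I> Q) \<cdot> comult Y))"
    by (subst middle_LUnit) simp_all
  finally have 2: "\<lambda>\<^bold>l (P \<otimes> Q) \<cdot> ((?e \<boxtimes> \<I> (P \<otimes> Q)) \<cdot> D) = \<I> (P \<otimes> Q)"
    unfolding cX cY by simp
  have "\<sigma> (P \<otimes> Q) (P \<otimes> Q) \<cdot> D = M \<cdot> ((\<sigma> P P \<boxtimes> \<sigma> Q Q) \<cdot> ((middle C P Q P Q \<cdot> middle C P P Q Q) \<cdot> (comult X \<boxtimes> comult Y)))"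
    by (simp add: Braid_tensor D_def M_def del: ten_comp ten_comp')
  also have "\<dots> = D"
    using s cX(4) cY(4) by (simp add: middle_involutive D_def flip: P_def Q_def)
  finally have 3: "\<sigma> (P \<otimes> Q) (P \<otimes> Q) \<cdot> D = D" .
  \<comment> \<open>The right counit law is transported from the left one along the cocommutativity
    just proved.\<close>
  have "\<rho> (P \<otimes> Q) \<cdot> ((\<I> (P \<otimes> Q) \<boxtimes> ?e) \<cdot> D) = \<rho> (P \<otimes> Q) \<cdot> ((\<I> (P \<otimes> Q) \<boxtimes> ?e) \<cdot> (\<sigma> (P \<otimes> Q) (P \<otimes> Q) \<cdot> D))"
    unfolding 3 ..
  also have "\<dots> = (\<rho> (P \<otimes> Q) \<cdot> \<sigma> \<one> (P \<otimes> Q)) \<cdot> ((?e \<boxtimes> \<I> (P \<otimes> Q)) \<cdot> D)"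
    using Braid_natural'[of ?e "\<I> (P \<otimes> Q)" D \<one> "P \<otimes> Q"] by simp
  also have "\<dots> = \<I> (P \<otimes> Q)"
    by (simp add: RUnit_Braid 2)
  finally have 4: "\<rho> (P \<otimes> Q) \<cdot> ((\<I> (P \<otimes> Q) \<boxtimes> ?e) \<cdot> D) = \<I> (P \<otimes> Q)" .
  show ?thesis
    using 1 2 3 4 by (simp add: coc_comonoid_def tens_def Let_def flip: P_def Q_def M_def D_def)
qed

end

section \<open>The braiding of a cocommutative Hopf monoid is involutive\<close>

locale coc_hopf = braided_monoidal_category C for C :: "('o, 'm) braided_cat" (structure) +
  fixes A :: "('o, 'm) hopf"
  assumes hopf: "coc_hopf_monoid C A"
begin

lemma coc: "coc_comonoid C A"
  using hopf by (simp add: coc_hopf_monoid_def)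

lemmas comonoid_simps = coc_comonoidD[OF coc]
declare comonoid_simps(1-7) [simp]

lemma monoid_arr [simp]:
  "mult A \<in> Arr C" "Dom C (mult A) = carr A \<otimes> carr A" "Cod C (mult A) = carr A"
  "munit A \<in> Arr C" "Dom C (munit A) = \<one>" "Cod C (munit A) = carr A"
  "antipode A \<in> Arr C" "Dom C (antipode A) = carr A" "Cod C (antipode A) = carr A"
  using hopf by (auto simp: coc_hopf_monoid_def monoid_object_def Let_def)

lemma mult_assoc: "mult A \<cdot> (mult A \<boxtimes> \<I> (carr A)) = mult A \<cdot> ((\<I> (carr A) \<boxtimes> mult A) \<cdot> \<alpha> (carr A) (carr A) (carr A))"
  and unit_left: "mult A \<cdot> (munit A \<boxtimes> \<I> (carr A)) = \<lambda>\<^bold>l (carr A)"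
  and unit_right: "mult A \<cdot> (\<I> (carr A) \<boxtimes> munit A) = \<rho> (carr A)"
  and comult_mult: "comult A \<cdot> mult A
    = (mult A \<boxtimes> mult A) \<cdot> (middle C (carr A) (carr A) (carr A) (carr A) \<cdot> (comult A \<boxtimes> comult A))"
  and counit_mult: "counit A \<cdot> mult A = \<lambda>\<^bold>l \<one> \<cdot> (counit A \<boxtimes> counit A)"
  and comult_unit: "comult A \<cdot> munit A = (munit A \<boxtimes> munit A) \<cdot> inv_arrow C (\<lambda>\<^bold>l \<one>)"
  and counit_unit: "counit A \<cdot> munit A = \<I> \<one>"
  and antipode_left: "mult A \<cdot> ((antipode A \<boxtimes> \<I> (carr A)) \<cdot> comult A) = munit A \<cdot> counit A"
  and antipode_right: "mult A \<cdot> ((\<I> (carr A) \<boxtimes> antipode A) \<cdot> comult A) = munit A \<cdot> counit A"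
  using hopf by (auto simp: coc_hopf_monoid_def monoid_object_def Let_def)

text \<open>Action of the free left module A \<otimes> V; \<open>comult_l\<close> is the coaction of
  the cofree left comodule, and the \<open>_r\<close> versions are right-handed. Their laws and the
  antipode carry the convolution argument below.\<close>

definition mult_l :: "'o \<Rightarrow> 'm" where
  "mult_l V = (mult A \<boxtimes> \<I> V) \<cdot> inv_arrow C (\<alpha> (carr A) (carr A) V)"

definition comult_l :: "'o \<Rightarrow> 'm" where
  "comult_l V = \<alpha> (carr A) (carr A) V \<cdot> (comult A \<boxtimes> \<I> V)"

definition mult_r :: "'o \<Rightarrow> 'm" where
  "mult_r V = (\<I> V \<boxtimes> mult A) \<cdot> \<alpha> V (carr A) (carr A)"

definition comult_r :: "'o \<Rightarrow> 'm" where
  "comult_r V = inv_arrow C (\<alpha> V (carr A) (carr A)) \<cdot> (\<I> V \<boxtimes> comult A)"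

lemma lr_arr [simp]:
  assumes "V \<in> Obj C"
  shows "mult_l V \<in> Arr C" "Dom C (mult_l V) = carr A \<otimes> (carr A \<otimes> V)" "Cod C (mult_l V) = carr A \<otimes> V"
    "comult_l V \<in> Arr C" "Dom C (comult_l V) = carr A \<otimes> V" "Cod C (comult_l V) = carr A \<otimes> (carr A \<otimes> V)"
    "mult_r V \<in> Arr C" "Dom C (mult_r V) = (V \<otimes> carr A) \<otimes> carr A" "Cod C (mult_r V) = V \<otimes> carr A"
    "comult_r V \<in> Arr C" "Dom C (comult_r V) = V \<otimes> carr A" "Cod C (comult_r V) = (V \<otimes> carr A) \<otimes> carr A"
  using assms by (auto simp: mult_l_def comult_l_def mult_r_def comult_r_def)

lemma comult_l_coassoc:
  assumes [simp]: "V \<in> Obj C"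
  shows "(\<I> (carr A) \<boxtimes> comult_l V) \<cdot> comult_l V = comult_l (carr A \<otimes> V) \<cdot> comult_l V"
proof -
  let ?X = "carr A"
  have "(\<I> ?X \<boxtimes> comult_l V) \<cdot> comult_l V = (\<I> ?X \<boxtimes> \<alpha> ?X ?X V) \<cdot> (\<alpha> ?X (?X \<otimes> ?X) V \<cdot> (((\<I> ?X \<boxtimes> comult A) \<cdot> comult A) \<boxtimes> \<I> V))"
    by (simp add: comult_l_def Assoc_natural' whisker_left whisker_right del: ten_comp ten_comp')
  also have "\<dots> = (\<I> ?X \<boxtimes> \<alpha> ?X ?X V) \<cdot> (\<alpha> ?X (?X \<otimes> ?X) V \<cdot> ((\<alpha> ?X ?X ?X \<boxtimes> \<I> V) \<cdot> (((comult A \<boxtimes> \<I> ?X) \<boxtimes> \<I> V) \<cdot> (comult A \<boxtimes> \<I> V))))"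
    unfolding comonoid_simps(8)[symmetric] by simp
  also have "\<dots> = comult_l (carr A \<otimes> V) \<cdot> comult_l V"
    by (simp add: comult_l_def pentagon'[symmetric] Assoc_natural' del: ten_comp ten_comp')
  finally show ?thesis .
qed

lemma mult_l_assoc:
  assumes [simp]: "V \<in> Obj C"
  shows "mult_l V \<cdot> (\<I> (carr A) \<boxtimes> mult_l V) = mult_l V \<cdot> mult_l (carr A \<otimes> V)"
proof (rule iso_cancel_right)
  let ?X = "carr A"
  let ?J = "(\<I> ?X \<boxtimes> \<alpha> ?X ?X V) \<cdot> (\<alpha> ?X (?X \<otimes> ?X) V \<cdot> (\<alpha> ?X ?X ?X \<boxtimes> \<I> V))"
  have "(mult_l V \<cdot> (\<I> ?X \<boxtimes> mult_l V)) \<cdot> ?J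
     = ((mult A \<cdot> ((\<I> ?X \<boxtimes> mult A) \<cdot> \<alpha> ?X ?X ?X)) \<boxtimes> \<I> V)"
    by (simp add: mult_l_def inv_Assoc_natural')
  moreover have "?J = \<alpha> ?X ?X (?X \<otimes> V) \<cdot> \<alpha> (?X \<otimes> ?X) ?X V"
    by (simp add: pentagon)
  moreover have "(mult_l V \<cdot> mult_l (?X \<otimes> V)) \<cdot> (\<alpha> ?X ?X (?X \<otimes> V) \<cdot> \<alpha> (?X \<otimes> ?X) ?X V) = (mult A \<cdot> (mult A \<boxtimes> \<I> ?X)) \<boxtimes> \<I> V"
    using Assoc_natural[of "mult A" "\<I> ?X" "\<I> V" ?X ?X V, symmetric] by (simp add: mult_l_def)
  ultimately show "(mult_l V \<cdot> (\<I> ?X \<boxtimes> mult_l V)) \<cdot> ?J = (mult_l V \<cdot> mult_l (?X \<otimes> V)) \<cdot> ?J"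
    using mult_assoc by simp
qed auto

lemma comult_l_natural:
  "f \<in> Arr C \<Longrightarrow> Dom C f = U \<Longrightarrow> Cod C f = V \<Longrightarrow> U \<in> Obj C \<Longrightarrow> V \<in> Obj C \<Longrightarrow>
    comult_l V \<cdot> (\<I> (carr A) \<boxtimes> f) = (\<I> (carr A) \<boxtimes> (\<I> (carr A) \<boxtimes> f)) \<cdot> comult_l U"
  using Assoc_natural_right'[of f V "carr A" "carr A" "comult A \<boxtimes> \<I> U"] by (simp add: comult_l_def)

lemma mult_l_antipode:
  assumes [simp]: "V \<in> Obj C"
  shows "mult_l V \<cdot> ((antipode A \<boxtimes> \<I> (carr A \<otimes> V)) \<cdot> comult_l V) = (munit A \<cdot> counit A) \<boxtimes> \<I> V"
  using Assoc_natural'[of "antipode A" "\<I> (carr A)" "\<I> V" "comult A \<boxtimes> \<I> V" "carr A" "carr A" V, symmetric] antipode_left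
  by (simp add: mult_l_def comult_l_def)

lemma mult_l_unit:
  assumes [simp]: "V \<in> Obj C"
  shows "mult_l V \<cdot> ((munit A \<cdot> counit A) \<boxtimes> \<I> (carr A \<otimes> V)) = \<lambda>\<^bold>l (carr A \<otimes> V) \<cdot> (counit A \<boxtimes> \<I> (carr A \<otimes> V))"
proof -
  let ?X = "carr A"
  have "mult_l V \<cdot> ((munit A \<cdot> counit A) \<boxtimes> \<I> (?X \<otimes> V)) = ((mult A \<cdot> (munit A \<boxtimes> \<I> ?X)) \<boxtimes> \<I> V) \<cdot> (inv_arrow C (\<alpha> \<one> ?X V) \<cdot> (counit A \<boxtimes> \<I> (?X \<otimes> V)))"
    by (simp add: mult_l_def whisker_right inv_Assoc_natural_left' inv_Assoc_natural_left del: ten_comp ten_comp')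
  also have "\<dots> = \<lambda>\<^bold>l (?X \<otimes> V) \<cdot> (counit A \<boxtimes> \<I> (?X \<otimes> V))"
    unfolding unit_left by (simp add: LUnit_tensor[symmetric] del: ten_comp ten_comp')
  finally show ?thesis .
qed

lemma comult_l_counit:
  assumes [simp]: "V \<in> Obj C"
  shows "\<lambda>\<^bold>l (carr A \<otimes> V) \<cdot> ((counit A \<boxtimes> \<I> (carr A \<otimes> V)) \<cdot> comult_l V) = \<I> (carr A \<otimes> V)"
proof -
  let ?X = "carr A"
  have "(counit A \<boxtimes> \<I> (?X \<otimes> V)) \<cdot> comult_l V = \<alpha> \<one> ?X V \<cdot> (((counit A \<boxtimes> \<I> ?X) \<cdot> comult A) \<boxtimes> \<I> V)"
    using Assoc_natural'[of "counit A" "\<I> ?X" "\<I> V" "comult A \<boxtimes> \<I> V" \<one> ?X V, symmetric]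
    by (simp add: comult_l_def)
  then have "\<lambda>\<^bold>l (?X \<otimes> V) \<cdot> ((counit A \<boxtimes> \<I> (?X \<otimes> V)) \<cdot> comult_l V) = (\<lambda>\<^bold>l (?X \<otimes> V) \<cdot> \<alpha> \<one> ?X V) \<cdot> (((counit A \<boxtimes> \<I> ?X) \<cdot> comult A) \<boxtimes> \<I> V)"
    by simp
  also have "\<dots> = \<I> (?X \<otimes> V)"
    unfolding LUnit_tensor[OF comonoid_simps(1) assms] using comonoid_simps(9) by simp
  finally show ?thesis .
qed

text \<open>Sending \<beta> to \<open>mult_l V \<cdot> ((\<I> (carr A) \<boxtimes> \<beta>) \<cdot>
  comult_l U)\<close> is convolution with the identity of \<open>A\<close>. Convolution with the
  antipode is a left inverse of it, so \<beta> can be recovered.\<close>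

lemma left_multiplier_inj:
  assumes [simp]: "\<beta> \<in> Arr C" "Dom C \<beta> = carr A \<otimes> U" "Cod C \<beta> = carr A \<otimes> V" "U \<in> Obj C" "V \<in> Obj C"
  shows "mult_l V \<cdot> ((antipode A \<boxtimes> (mult_l V \<cdot> ((\<I> (carr A) \<boxtimes> \<beta>) \<cdot> comult_l U))) \<cdot> comult_l U) = \<beta>"
proof -
  let ?X = "carr A"
  let ?S = "antipode A"
  have "mult_l V \<cdot> ((?S \<boxtimes> (mult_l V \<cdot> ((\<I> ?X \<boxtimes> \<beta>) \<cdot> comult_l U))) \<cdot> comult_l U)
     = (mult_l V \<cdot> (\<I> ?X \<boxtimes> mult_l V)) \<cdot> ((?S \<boxtimes> (\<I> ?X \<boxtimes> \<beta>)) \<cdot> ((\<I> ?X \<boxtimes> comult_l U) \<cdot> comult_l U))"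
    by simp
  also have "\<dots> = mult_l V \<cdot> (mult_l (?X \<otimes> V) \<cdot> ((?S \<boxtimes> \<I> (?X \<otimes> (?X \<otimes> V))) \<cdot> ((\<I> ?X \<boxtimes> (\<I> ?X \<boxtimes> \<beta>)) \<cdot> (comult_l (?X \<otimes> U) \<cdot> comult_l U))))"
    unfolding mult_l_assoc[OF assms(5)] comult_l_coassoc[OF assms(4)] by simp
  also have "(\<I> ?X \<boxtimes> (\<I> ?X \<boxtimes> \<beta>)) \<cdot> (comult_l (?X \<otimes> U) \<cdot> comult_l U) = comult_l (?X \<otimes> V) \<cdot> ((\<I> ?X \<boxtimes> \<beta>) \<cdot> comult_l U)"
    by (intro comp_swap comult_l_natural[symmetric]) auto
  also have "mult_l V \<cdot> (mult_l (?X \<otimes> V) \<cdot> ((?S \<boxtimes> \<I> (?X \<otimes> (?X \<otimes> V))) \<cdot> (comult_l (?X \<otimes> V) \<cdot> ((\<I> ?X \<boxtimes> \<beta>) \<cdot> comult_l U))))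
      = mult_l V \<cdot> ((mult_l (?X \<otimes> V) \<cdot> ((?S \<boxtimes> \<I> (?X \<otimes> (?X \<otimes> V))) \<cdot> comult_l (?X \<otimes> V))) \<cdot> ((\<I> ?X \<boxtimes> \<beta>) \<cdot> comult_l U))"
    by simp
  also have "\<dots> = (mult_l V \<cdot> ((munit A \<cdot> counit A) \<boxtimes> \<I> (?X \<otimes> V))) \<cdot> ((\<I> ?X \<boxtimes> \<beta>) \<cdot> comult_l U)"
    by (subst mult_l_antipode) simp_all
  also have "\<dots> = (\<lambda>\<^bold>l (?X \<otimes> V) \<cdot> (counit A \<boxtimes> \<I> (?X \<otimes> V))) \<cdot> ((\<I> ?X \<boxtimes> \<beta>) \<cdot> comult_l U)"
    by (subst mult_l_unit) simp_all
  also have "\<dots> = (\<lambda>\<^bold>l (?X \<otimes> V) \<cdot> (\<I> \<one> \<boxtimes> \<beta>)) \<cdot> ((counit A \<boxtimes> \<I> (?X \<otimes> U)) \<cdot> comult_l U)"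
    by simp
  also have "\<dots> = \<beta> \<cdot> (\<lambda>\<^bold>l (?X \<otimes> U) \<cdot> ((counit A \<boxtimes> \<I> (?X \<otimes> U)) \<cdot> comult_l U))"
    by (subst LUnit_natural) simp_all
  also have "\<dots> = \<beta>"
    by (subst comult_l_counit) simp_all
  finally show ?thesis .
qed

lemma comult_r_coassoc:
  assumes [simp]: "V \<in> Obj C"
  shows "(comult_r V \<boxtimes> \<I> (carr A)) \<cdot> comult_r V = comult_r (V \<otimes> carr A) \<cdot> comult_r V"
proof (rule iso_cancel_left)
  let ?X = "carr A"
  let ?J = "(\<I> V \<boxtimes> \<alpha> ?X ?X ?X) \<cdot> (\<alpha> V (?X \<otimes> ?X) ?X \<cdot> (\<alpha> V ?X ?X \<boxtimes> \<I> ?X))"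
  have "?J \<cdot> ((comult_r V \<boxtimes> \<I> ?X) \<cdot> comult_r V) = (\<I> V \<boxtimes> (\<alpha> ?X ?X ?X \<cdot> ((comult A \<boxtimes> \<I> ?X) \<cdot> comult A)))"
    by (simp add: comult_r_def Assoc_natural')
  moreover have "?J = \<alpha> V ?X (?X \<otimes> ?X) \<cdot> \<alpha> (V \<otimes> ?X) ?X ?X"
    by (simp add: pentagon)
  moreover have "(\<alpha> V ?X (?X \<otimes> ?X) \<cdot> \<alpha> (V \<otimes> ?X) ?X ?X) \<cdot> (comult_r (V \<otimes> ?X) \<cdot> comult_r V) = \<I> V \<boxtimes> ((\<I> ?X \<boxtimes> comult A) \<cdot> comult A)"
    using Assoc_natural_right'[of "comult A" "?X \<otimes> ?X" V ?X "inv_arrow C (\<alpha> V ?X ?X) \<cdot> (\<I> V \<boxtimes> comult A)"] by (simp add: comult_r_def)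
  ultimately show "?J \<cdot> ((comult_r V \<boxtimes> \<I> ?X) \<cdot> comult_r V) = ?J \<cdot> (comult_r (V \<otimes> ?X) \<cdot> comult_r V)"
    using comonoid_simps(8) by simp
qed auto

lemma mult_r_assoc:
  assumes [simp]: "V \<in> Obj C"
  shows "mult_r V \<cdot> (mult_r V \<boxtimes> \<I> (carr A)) = mult_r V \<cdot> mult_r (V \<otimes> carr A)"
proof -
  let ?X = "carr A"
  have "mult_r V \<cdot> (mult_r V \<boxtimes> \<I> ?X) = (\<I> V \<boxtimes> (mult A \<cdot> (mult A \<boxtimes> \<I> ?X))) \<cdot> (\<alpha> V (?X \<otimes> ?X) ?X \<cdot> (\<alpha> V ?X ?X \<boxtimes> \<I> ?X))"
    by (simp add: mult_r_def Assoc_natural' whisker_left whisker_right del: ten_comp ten_comp')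
  also have "\<dots> = (\<I> V \<boxtimes> (mult A \<cdot> (\<I> ?X \<boxtimes> mult A))) \<cdot> ((\<I> V \<boxtimes> \<alpha> ?X ?X ?X) \<cdot> (\<alpha> V (?X \<otimes> ?X) ?X \<cdot> (\<alpha> V ?X ?X \<boxtimes> \<I> ?X)))"
    unfolding mult_assoc by simp
  also have "\<dots> = (\<I> V \<boxtimes> (mult A \<cdot> (\<I> ?X \<boxtimes> mult A))) \<cdot> (\<alpha> V ?X (?X \<otimes> ?X) \<cdot> \<alpha> (V \<otimes> ?X) ?X ?X)"
    by (simp add: pentagon)
  also have "\<dots> = mult_r V \<cdot> mult_r (V \<otimes> ?X)"
    using Assoc_natural_right'[of "mult A" ?X V ?X "\<alpha> (V \<otimes> ?X) ?X ?X"] by (simp add: mult_r_def)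
  finally show ?thesis .
qed

lemma comult_r_natural:
  "f \<in> Arr C \<Longrightarrow> Dom C f = U \<Longrightarrow> Cod C f = V \<Longrightarrow> U \<in> Obj C \<Longrightarrow> V \<in> Obj C \<Longrightarrow>
    comult_r V \<cdot> (f \<boxtimes> \<I> (carr A)) = ((f \<boxtimes> \<I> (carr A)) \<boxtimes> \<I> (carr A)) \<cdot> comult_r U"
  using inv_Assoc_natural_left'[of f V "carr A" "carr A" "\<I> U \<boxtimes> comult A"] by (simp add: comult_r_def)

lemma mult_r_antipode:
  assumes [simp]: "V \<in> Obj C"
  shows "mult_r V \<cdot> ((\<I> (V \<otimes> carr A) \<boxtimes> antipode A) \<cdot> comult_r V) = \<I> V \<boxtimes> (munit A \<cdot> counit A)"
  using Assoc_natural_right'[of "antipode A" "carr A" V "carr A" "comult_r V"] antipode_right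
  by (simp add: mult_r_def comult_r_def)

lemma mult_r_unit:
  assumes [simp]: "V \<in> Obj C"
  shows "mult_r V \<cdot> (\<I> (V \<otimes> carr A) \<boxtimes> (munit A \<cdot> counit A)) = \<rho> (V \<otimes> carr A) \<cdot> (\<I> (V \<otimes> carr A) \<boxtimes> counit A)"
proof -
  let ?X = "carr A"
  have "mult_r V \<cdot> (\<I> (V \<otimes> ?X) \<boxtimes> (munit A \<cdot> counit A)) = (\<I> V \<boxtimes> (mult A \<cdot> (\<I> ?X \<boxtimes> munit A))) \<cdot> (\<alpha> V ?X \<one> \<cdot> (\<I> (V \<otimes> ?X) \<boxtimes> counit A))"
    by (simp add: mult_r_def whisker_left Assoc_natural_right' Assoc_natural_right del: ten_comp ten_comp')
  also have "\<dots> = \<rho> (V \<otimes> ?X) \<cdot> (\<I> (V \<otimes> ?X) \<boxtimes> counit A)"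
    unfolding unit_right by (simp add: RUnit_tensor[symmetric] del: ten_comp ten_comp')
  finally show ?thesis .
qed

lemma comult_r_counit:
  assumes [simp]: "V \<in> Obj C"
  shows "\<rho> (V \<otimes> carr A) \<cdot> ((\<I> (V \<otimes> carr A) \<boxtimes> counit A) \<cdot> comult_r V) = \<I> (V \<otimes> carr A)"
proof -
  let ?X = "carr A"
  have "\<rho> (V \<otimes> ?X) \<cdot> ((\<I> (V \<otimes> ?X) \<boxtimes> counit A) \<cdot> comult_r V) = (\<I> V \<boxtimes> \<rho> ?X) \<cdot> (\<alpha> V ?X \<one> \<cdot> ((\<I> (V \<otimes> ?X) \<boxtimes> counit A) \<cdot> comult_r V))"
    by (simp add: RUnit_tensor[symmetric])
  also have "\<dots> = \<I> V \<boxtimes> (\<rho> ?X \<cdot> ((\<I> ?X \<boxtimes> counit A) \<cdot> comult A))"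
    by (simp add: comult_r_def Assoc_natural_right')
  finally show ?thesis using comonoid_simps(10) by simp
qed

text \<open>The mirror image, with the convolution taken over the last tensor factor.\<close>

lemma right_multiplier_inj:
  assumes [simp]: "\<beta> \<in> Arr C" "Dom C \<beta> = U \<otimes> carr A" "Cod C \<beta> = V \<otimes> carr A" "U \<in> Obj C" "V \<in> Obj C"
  shows "mult_r V \<cdot> (((mult_r V \<cdot> ((\<beta> \<boxtimes> \<I> (carr A)) \<cdot> comult_r U)) \<boxtimes> antipode A) \<cdot> comult_r U) = \<beta>"
proof -
  let ?X = "carr A"
  let ?S = "antipode A"
  have "mult_r V \<cdot> (((mult_r V \<cdot> ((\<beta> \<boxtimes> \<I> ?X) \<cdot> comult_r U)) \<boxtimes> ?S) \<cdot> comult_r U)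
     = (mult_r V \<cdot> (mult_r V \<boxtimes> \<I> ?X)) \<cdot> (((\<beta> \<boxtimes> \<I> ?X) \<boxtimes> ?S) \<cdot> ((comult_r U \<boxtimes> \<I> ?X) \<cdot> comult_r U))"
    by simp
  also have "\<dots> = mult_r V \<cdot> (mult_r (V \<otimes> ?X) \<cdot> ((\<I> ((V \<otimes> ?X) \<otimes> ?X) \<boxtimes> ?S) \<cdot> (((\<beta> \<boxtimes> \<I> ?X) \<boxtimes> \<I> ?X) \<cdot> (comult_r (U \<otimes> ?X) \<cdot> comult_r U))))"
    unfolding mult_r_assoc[OF assms(5)] comult_r_coassoc[OF assms(4)] by simp
  also have "((\<beta> \<boxtimes> \<I> ?X) \<boxtimes> \<I> ?X) \<cdot> (comult_r (U \<otimes> ?X) \<cdot> comult_r U) = comult_r (V \<otimes> ?X) \<cdot> ((\<beta> \<boxtimes> \<I> ?X) \<cdot> comult_r U)"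
    by (intro comp_swap comult_r_natural[symmetric]) auto
  also have "mult_r V \<cdot> (mult_r (V \<otimes> ?X) \<cdot> ((\<I> ((V \<otimes> ?X) \<otimes> ?X) \<boxtimes> ?S) \<cdot> (comult_r (V \<otimes> ?X) \<cdot> ((\<beta> \<boxtimes> \<I> ?X) \<cdot> comult_r U))))
      = mult_r V \<cdot> ((mult_r (V \<otimes> ?X) \<cdot> ((\<I> ((V \<otimes> ?X) \<otimes> ?X) \<boxtimes> ?S) \<cdot> comult_r (V \<otimes> ?X))) \<cdot> ((\<beta> \<boxtimes> \<I> ?X) \<cdot> comult_r U))"
    by simp
  also have "\<dots> = (mult_r V \<cdot> (\<I> (V \<otimes> ?X) \<boxtimes> (munit A \<cdot> counit A))) \<cdot> ((\<beta> \<boxtimes> \<I> ?X) \<cdot> comult_r U)"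
    by (subst mult_r_antipode) simp_all
  also have "\<dots> = (\<rho> (V \<otimes> ?X) \<cdot> (\<I> (V \<otimes> ?X) \<boxtimes> counit A)) \<cdot> ((\<beta> \<boxtimes> \<I> ?X) \<cdot> comult_r U)"
    by (subst mult_r_unit) simp_all
  also have "\<dots> = (\<rho> (V \<otimes> ?X) \<cdot> (\<beta> \<boxtimes> \<I> \<one>)) \<cdot> ((\<I> (U \<otimes> ?X) \<boxtimes> counit A) \<cdot> comult_r U)"
    by simp
  also have "\<dots> = \<beta> \<cdot> (\<rho> (U \<otimes> ?X) \<cdot> ((\<I> (U \<otimes> ?X) \<boxtimes> counit A) \<cdot> comult_r U))"
    by (subst RUnit_natural) simp_all
  also have "\<dots> = \<beta>"
    by (subst comult_r_counit) simp_all
  finally show ?thesis .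
qed

text \<open>The formula for the comultiplication of a product, with the inner crossing replaced by
  an arbitrary \<beta>: the outer tensor factors merely convolve \<beta> with the identity of
  \<open>A\<close> from the right and then from the left, so they can be stripped off.\<close>

lemma conjugate_multiplier:
  assumes [simp]: "\<beta> \<in> Arr C" "Dom C \<beta> = carr A \<otimes> carr A" "Cod C \<beta> = carr A \<otimes> carr A"
  shows "(mult A \<boxtimes> mult A) \<cdot> (inv_arrow C (\<alpha> (carr A) (carr A) (carr A \<otimes> carr A))
       \<cdot> ((\<I> (carr A) \<boxtimes> (\<alpha> (carr A) (carr A) (carr A) \<cdot> ((\<beta> \<boxtimes> \<I> (carr A)) \<cdot> inv_arrow C (\<alpha> (carr A) (carr A) (carr A)))))
       \<cdot> (\<alpha> (carr A) (carr A) (carr A \<otimes> carr A) \<cdot> (comult A \<boxtimes> comult A))))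
    = mult_l (carr A) \<cdot> ((\<I> (carr A) \<boxtimes> (mult_r (carr A) \<cdot> ((\<beta> \<boxtimes> \<I> (carr A)) \<cdot> comult_r (carr A)))) \<cdot> comult_l (carr A))"
    (is "?L = ?R")
proof -
  let ?X = "carr A"
  let ?B = "\<alpha> ?X ?X ?X \<cdot> ((\<beta> \<boxtimes> \<I> ?X) \<cdot> inv_arrow C (\<alpha> ?X ?X ?X))"
  have 1: "\<alpha> ?X ?X (?X \<otimes> ?X) \<cdot> (comult A \<boxtimes> comult A) = (\<I> ?X \<boxtimes> (\<I> ?X \<boxtimes> comult A)) \<cdot> comult_l ?X"
    using Assoc_natural_right'[of "comult A" "?X \<otimes> ?X" ?X ?X "comult A \<boxtimes> \<I> ?X"] by (simp add: comult_l_def)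
  have 2: "(mult A \<boxtimes> mult A) \<cdot> inv_arrow C (\<alpha> ?X ?X (?X \<otimes> ?X)) = mult_l ?X \<cdot> (\<I> ?X \<boxtimes> (\<I> ?X \<boxtimes> mult A))"
    using inv_Assoc_natural[of "\<I> ?X" "\<I> ?X" "mult A" ?X ?X ?X] by (simp add: mult_l_def)
  have "?L = ((mult A \<boxtimes> mult A) \<cdot> inv_arrow C (\<alpha> ?X ?X (?X \<otimes> ?X))) \<cdot> ((\<I> ?X \<boxtimes> ?B) \<cdot> (\<alpha> ?X ?X (?X \<otimes> ?X) \<cdot> (comult A \<boxtimes> comult A)))"
    by simp
  also have "\<dots> = ?R"
    unfolding 1 2 by (simp add: mult_r_def comult_r_def)
  finally show ?thesis .
qed

text \<open>A cocommutative Hopf monoid is also a bimonoid for the inverse braiding, and the braiding can be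
  recovered from the comultiplication of a product by cancelling the outer factors with the antipode.\<close>

theorem involutive_self: "involutive (carr A) (carr A)"
proof -
  let ?X = "carr A"
  let ?M = "middle C ?X ?X ?X ?X"
  let ?t = "inv_arrow C (\<sigma> ?X ?X)"
  let ?f = "\<lambda>\<beta>. inv_arrow C (\<alpha> ?X ?X (?X \<otimes> ?X)) \<cdot> ((\<I> ?X \<boxtimes> (\<alpha> ?X ?X ?X \<cdot> ((\<beta> \<boxtimes> \<I> ?X) \<cdot> inv_arrow C (\<alpha> ?X ?X ?X)))) \<cdot> \<alpha> ?X ?X (?X \<otimes> ?X))"
  let ?r = "\<lambda>\<beta>. mult_r ?X \<cdot> ((\<beta> \<boxtimes> \<I> ?X) \<cdot> comult_r ?X)"
  let ?l = "\<lambda>\<beta>. mult_l ?X \<cdot> ((\<I> ?X \<boxtimes> \<beta>) \<cdot> comult_l ?X)"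
  have M: "?M = ?f (\<sigma> ?X ?X)" by (simp add: middle_swap swap_def)
  have D: "\<sigma> ?X ?X \<cdot> comult A = comult A" by (rule comonoid_simps(11))
  \<comment> \<open>With the inverse crossing inside, the first interchange cancels, and the two
    remaining braidings are absorbed by cocommutativity of both factors.\<close>
  have e1: "?M \<cdot> ((\<sigma> ?X ?X \<boxtimes> \<sigma> ?X ?X) \<cdot> (?M \<cdot> (?f ?t \<cdot> (comult A \<boxtimes> comult A)))) = ?M \<cdot> (comult A \<boxtimes> comult A)"
    unfolding M using D by simp
  \<comment> \<open>The product formula for the inverse braiding becomes the ordinary one after
    composing with the braiding: the braiding of pairs moves across
    \<open>mult A \<boxtimes> mult A\<close>, and \<open>comult A \<cdot> mult A\<close> is itself
    fixed by the braiding.\<close>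
  have "\<sigma> ?X ?X \<cdot> ((mult A \<boxtimes> mult A) \<cdot> (?f ?t \<cdot> (comult A \<boxtimes> comult A))) = (mult A \<boxtimes> mult A) \<cdot> (\<sigma> (?X \<otimes> ?X) (?X \<otimes> ?X) \<cdot> (?f ?t \<cdot> (comult A \<boxtimes> comult A)))"
    by (simp add: Braid_natural' del: ten_comp ten_comp')
  also have "\<dots> = (mult A \<boxtimes> mult A) \<cdot> (?M \<cdot> (comult A \<boxtimes> comult A))"
    unfolding e1[symmetric] by (simp add: Braid_tensor del: ten_comp ten_comp')
  also have "\<dots> = comult A \<cdot> mult A" by (rule comult_mult[symmetric])
  also have "\<dots> = \<sigma> ?X ?X \<cdot> (comult A \<cdot> mult A)"
    using D comp_reduce[of "\<sigma> ?X ?X" "comult A" "comult A" "mult A"] by simp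
  finally have e2: "\<sigma> ?X ?X \<cdot> ((mult A \<boxtimes> mult A) \<cdot> (?f ?t \<cdot> (comult A \<boxtimes> comult A))) = \<sigma> ?X ?X \<cdot> (comult A \<cdot> mult A)" .
  have "(mult A \<boxtimes> mult A) \<cdot> (?f ?t \<cdot> (comult A \<boxtimes> comult A)) = comult A \<cdot> mult A"
    by (rule iso_cancel_left[OF _ e2]) simp_all
  then have e3: "(mult A \<boxtimes> mult A) \<cdot> (?f ?t \<cdot> (comult A \<boxtimes> comult A)) = (mult A \<boxtimes> mult A) \<cdot> (?f (\<sigma> ?X ?X) \<cdot> (comult A \<boxtimes> comult A))"
    unfolding comult_mult M .
  have c: "(mult A \<boxtimes> mult A) \<cdot> (?f \<beta> \<cdot> (comult A \<boxtimes> comult A)) = ?l (?r \<beta>)"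
    if [simp]: "\<beta> \<in> Arr C" "Dom C \<beta> = ?X \<otimes> ?X" "Cod C \<beta> = ?X \<otimes> ?X" for \<beta>
    unfolding conjugate_multiplier[OF that, symmetric] by simp
  have "?l (?r ?t) = (mult A \<boxtimes> mult A) \<cdot> (?f ?t \<cdot> (comult A \<boxtimes> comult A))"
    by (rule c[symmetric]) simp_all
  also have "\<dots> = ?l (?r (\<sigma> ?X ?X))"
    unfolding e3 by (rule c) simp_all
  finally have e4: "?l (?r ?t) = ?l (?r (\<sigma> ?X ?X))" .
  \<comment> \<open>Both crossings now have the same double convolution; the antipode strips off
    first the left and then the right outer factor.\<close>
  have "?r ?t = mult_l ?X \<cdot> ((antipode A \<boxtimes> ?l (?r ?t)) \<cdot> comult_l ?X)"
    by (rule left_multiplier_inj[symmetric]) simp_all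
  also have "\<dots> = ?r (\<sigma> ?X ?X)"
    unfolding e4 by (rule left_multiplier_inj) simp_all
  finally have e5: "?r ?t = ?r (\<sigma> ?X ?X)" .
  have "?t = mult_r ?X \<cdot> ((?r ?t \<boxtimes> antipode A) \<cdot> comult_r ?X)"
    by (rule right_multiplier_inj[symmetric]) simp_all
  also have "\<dots> = \<sigma> ?X ?X"
    unfolding e5 by (rule right_multiplier_inj) simp_all
  finally have "?t = \<sigma> ?X ?X" .
  then have "\<sigma> ?X ?X \<cdot> \<sigma> ?X ?X = ?t \<cdot> \<sigma> ?X ?X" by simp
  then show ?thesis by (simp add: involutive_def)
qed

end

section \<open>Generalized elements of comonoids\<close>

context braided_monoidal_category
begin

text \<open>Defined for arbitrary arrows out of \<open>X\<close>, because some components, such as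
  an inverse or a value in a quotient, are paired before they are known to be comonoid
  morphisms.\<close>

definition pair :: "('o, 'm, 'x) comonoid_scheme \<Rightarrow> 'm \<Rightarrow> 'm \<Rightarrow> 'm" where
  "pair X a b = (a \<boxtimes> b) \<cdot> comult X"

text \<open>Unlike in \<open>comonoid_morphism\<close>, source and target may be records of
  different types, so that plain comonoids, Hopf monoids and module comonoids can be mixed.\<close>

definition cmor :: "('o, 'm, 'x) comonoid_scheme \<Rightarrow> ('o, 'm, 'y) comonoid_scheme \<Rightarrow> 'm \<Rightarrow> bool" where
  "cmor X Y a \<longleftrightarrow> a \<in> hom C (carr X) (carr Y) \<and> comult Y \<cdot> a = pair X a a \<and> counit Y \<cdot> a = counit X"

lemma comonoid_morphism_iff: "comonoid_morphism C P Q f \<longleftrightarrow> cmor P Q f"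
  by (simp add: comonoid_morphism_def cmor_def pair_def)

lemma cmorD:
  assumes "cmor X Y a"
  shows "a \<in> Arr C" "Dom C a = carr X" "Cod C a = carr Y" "comult Y \<cdot> a = pair X a a" "counit Y \<cdot> a = counit X"
  using assms by (auto simp: cmor_def)

lemma cmorI:
  "a \<in> Arr C \<Longrightarrow> Dom C a = carr X \<Longrightarrow> Cod C a = carr Y \<Longrightarrow> comult Y \<cdot> a = pair X a a \<Longrightarrow> counit Y \<cdot> a = counit X
    \<Longrightarrow> cmor X Y a"
  by (simp add: cmor_def)

lemma pair_comp:
  assumes X: "coc_comonoid C X" and a: "cmor X Y a" and [simp]: "f \<in> Arr C" "g \<in> Arr C" "Dom C f = carr Y" "Dom C g = carr Y"
    and Y: "coc_comonoid C Y"
  shows "pair Y f g \<cdot> a = pair X (f \<cdot> a) (g \<cdot> a)"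
  using cmorD[OF a] coc_comonoidD(1-7)[OF X] coc_comonoidD(1-7)[OF Y] by (simp add: pair_def)

lemma cmor_comp:
  assumes X: "coc_comonoid C X" and Y: "coc_comonoid C Y" and Z: "coc_comonoid C Z" and a: "cmor X Y a" and f: "cmor Y Z f"
  shows "cmor X Z (f \<cdot> a)"
proof -
  note [simp] = coc_comonoidD(1-7)[OF X] coc_comonoidD(1-7)[OF Y] coc_comonoidD(1-7)[OF Z] cmorD[OF a] cmorD[OF f]
  show ?thesis
    using comp_reduce[OF cmorD(4)[OF f], of a] comp_reduce[OF cmorD(5)[OF f], of a] pair_comp[OF X a, of f f]
    by (simp add: cmor_def Y)
qed

lemma cmor_ident: "coc_comonoid C X \<Longrightarrow> cmor X X (\<I> (carr X))"
  using coc_comonoidD(1-7)[of X] by (simp add: cmor_def pair_def)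

lemma cmor_inverse:
  assumes X: "coc_comonoid C X" and Y: "coc_comonoid C Y" and f: "cmor X Y f"
    and g [simp]: "g \<in> Arr C" "Dom C g = carr Y" "Cod C g = carr X" and fg: "f \<cdot> g = \<I> (carr Y)" and gf: "g \<cdot> f = \<I> (carr X)"
  shows "cmor Y X g"
proof -
  note [simp] = coc_comonoidD(1-7)[OF X] coc_comonoidD(1-7)[OF Y] cmorD(1-3)[OF f]
  have "comult X \<cdot> g = (g \<boxtimes> g) \<cdot> (((f \<boxtimes> f) \<cdot> comult X) \<cdot> g)"
    by (simp add: gf)
  also have "\<dots> = (g \<boxtimes> g) \<cdot> ((comult Y \<cdot> f) \<cdot> g)"
    using cmorD(4)[OF f] by (simp add: pair_def)
  also have "\<dots> = pair Y g g" by (simp add: fg pair_def)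
  finally have 1: "comult X \<cdot> g = pair Y g g" .
  have "counit X \<cdot> g = (counit Y \<cdot> f) \<cdot> g" using cmorD(5)[OF f] by simp
  also have "\<dots> = counit Y" by (simp add: fg)
  finally show ?thesis using 1 by (simp add: cmor_def)
qed

lemma tens_simps [simp]: "carr (tens X Y) = carr X \<otimes> carr Y"
  by (simp add: tens_def)

definition proj1 :: "('o, 'm, 'y) comonoid_scheme \<Rightarrow> ('o, 'm, 'z) comonoid_scheme \<Rightarrow> 'm" where
  "proj1 Y Z = \<rho> (carr Y) \<cdot> (\<I> (carr Y) \<boxtimes> counit Z)"

definition proj2 :: "('o, 'm, 'y) comonoid_scheme \<Rightarrow> ('o, 'm, 'z) comonoid_scheme \<Rightarrow> 'm" where
  "proj2 Y Z = \<lambda>\<^bold>l (carr Z) \<cdot> (counit Y \<boxtimes> \<I> (carr Z))"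

text \<open>What matters most is the last claim: since the identity of a tensor product is a pair of
  elements, the tensor product is itself the universal stage for pairs.\<close>

lemma proj_cmor:
  assumes Y: "coc_comonoid C Y" and Z: "coc_comonoid C Z"
  shows "cmor (tens Y Z) Y (proj1 Y Z)" "cmor (tens Y Z) Z (proj2 Y Z)"
    and pair_proj: "pair (tens Y Z) (proj1 Y Z) (proj2 Y Z) = \<I> (carr Y \<otimes> carr Z)"
proof -
  define P where "P = carr Y"
  define Q where "Q = carr Z"
  have [simp]: "P \<in> Obj C" "Q \<in> Obj C" by (auto simp: P_def Q_def coc_comonoidD(1)[OF Y] coc_comonoidD(1)[OF Z])
  note [simp] = coc_comonoidD(1-7)[OF Y, folded P_def] coc_comonoidD(1-7)[OF Z, folded Q_def]
  note cY = coc_comonoidD(8-)[OF Y, folded P_def] and cZ = coc_comonoidD(8-)[OF Z, folded Q_def]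
  let ?d = "comult Y" and ?d' = "comult Z" and ?e = "counit Y" and ?e' = "counit Z"
  \<comment> \<open>A counit is a comonoid morphism to the unit object: by naturality of the unitor
    one of the two counits is pulled out, and the counit law removes the rest.\<close>
  have eY: "(?e \<boxtimes> ?e) \<cdot> ?d = inv_arrow C (\<lambda>\<^bold>l \<one>) \<cdot> ?e" and eZ: "(?e' \<boxtimes> ?e') \<cdot> ?d' = inv_arrow C (\<lambda>\<^bold>l \<one>) \<cdot> ?e'"
  proof -
    have "\<lambda>\<^bold>l \<one> \<cdot> ((?e \<boxtimes> ?e) \<cdot> ?d) = (\<lambda>\<^bold>l \<one> \<cdot> (\<I> \<one> \<boxtimes> ?e)) \<cdot> ((?e \<boxtimes> \<I> P) \<cdot> ?d)" by simp
    also have "\<dots> = ?e \<cdot> (\<lambda>\<^bold>l P \<cdot> ((?e \<boxtimes> \<I> P) \<cdot> ?d))" by (subst LUnit_natural) simp_all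
    finally show "(?e \<boxtimes> ?e) \<cdot> ?d = inv_arrow C (\<lambda>\<^bold>l \<one>) \<cdot> ?e"
      unfolding cY by (intro iso_cancel_left[of "\<lambda>\<^bold>l \<one>" "(?e \<boxtimes> ?e) \<cdot> ?d" "inv_arrow C (\<lambda>\<^bold>l \<one>) \<cdot> ?e"]) simp_all
    have "\<lambda>\<^bold>l \<one> \<cdot> ((?e' \<boxtimes> ?e') \<cdot> ?d') = (\<lambda>\<^bold>l \<one> \<cdot> (\<I> \<one> \<boxtimes> ?e')) \<cdot> ((?e' \<boxtimes> \<I> Q) \<cdot> ?d')" by simp
    also have "\<dots> = ?e' \<cdot> (\<lambda>\<^bold>l Q \<cdot> ((?e' \<boxtimes> \<I> Q) \<cdot> ?d'))" by (subst LUnit_natural) simp_all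
    finally show "(?e' \<boxtimes> ?e') \<cdot> ?d' = inv_arrow C (\<lambda>\<^bold>l \<one>) \<cdot> ?e'"
      unfolding cZ by (intro iso_cancel_left[of "\<lambda>\<^bold>l \<one>" "(?e' \<boxtimes> ?e') \<cdot> ?d'" "inv_arrow C (\<lambda>\<^bold>l \<one>) \<cdot> ?e'"]) simp_all
  qed
  let ?M = "middle C P P Q Q"
  have c: "comult (tens Y Z) = ?M \<cdot> (?d \<boxtimes> ?d')" "counit (tens Y Z) = \<lambda>\<^bold>l \<one> \<cdot> (?e \<boxtimes> ?e')"
    by (simp_all add: tens_def P_def Q_def)
  have p: "proj1 Y Z = \<rho> P \<cdot> (\<I> P \<boxtimes> ?e')" "proj2 Y Z = \<lambda>\<^bold>l Q \<cdot> (?e \<boxtimes> \<I> Q)"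
    by (simp_all add: proj1_def proj2_def P_def Q_def)
  have "pair (tens Y Z) (proj1 Y Z) (proj1 Y Z) = (\<rho> P \<boxtimes> \<rho> P) \<cdot> (((\<I> P \<boxtimes> ?e') \<boxtimes> (\<I> P \<boxtimes> ?e')) \<cdot> (?M \<cdot> (?d \<boxtimes> ?d')))"
    by (simp add: pair_def c p)
  also have "\<dots> = ((\<rho> P \<boxtimes> \<rho> P) \<cdot> middle C P P \<one> \<one>) \<cdot> (((\<I> P \<boxtimes> \<I> P) \<boxtimes> (?e' \<boxtimes> ?e')) \<cdot> (?d \<boxtimes> ?d'))"
    using middle_natural'[of "\<I> P" "\<I> P" ?e' ?e' "?d \<boxtimes> ?d'" P P \<one> \<one>] by (simp del: ten_ident ten_comp ten_comp')
  also have "\<dots> = (\<rho> (P \<otimes> P) \<cdot> (\<I> (P \<otimes> P) \<boxtimes> \<lambda>\<^bold>l \<one>)) \<cdot> (?d \<boxtimes> ((?e' \<boxtimes> ?e') \<cdot> ?d'))"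
    by (subst middle_RUnit) simp_all
  also have "\<dots> = (\<rho> (P \<otimes> P) \<cdot> (?d \<boxtimes> \<I> \<one>)) \<cdot> (\<I> P \<boxtimes> ?e')"
    unfolding eZ by simp
  also have "\<dots> = ?d \<cdot> proj1 Y Z"
    by (subst RUnit_natural) (simp_all add: p)
  finally have 1: "?d \<cdot> proj1 Y Z = pair (tens Y Z) (proj1 Y Z) (proj1 Y Z)" by simp
  have "?e \<cdot> proj1 Y Z = (?e \<cdot> \<rho> P) \<cdot> (\<I> P \<boxtimes> ?e')" by (simp add: p)
  also have "?e \<cdot> \<rho> P = \<lambda>\<^bold>l \<one> \<cdot> (?e \<boxtimes> \<I> \<one>)"
    using RUnit_natural[of ?e \<one>] by (simp add: LUnit_eq_RUnit)
  finally have "?e \<cdot> proj1 Y Z = counit (tens Y Z)" by (simp add: c)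
  then show "cmor (tens Y Z) Y (proj1 Y Z)"
    using 1 by (simp add: cmor_def p flip: P_def Q_def)
  have "pair (tens Y Z) (proj2 Y Z) (proj2 Y Z) = (\<lambda>\<^bold>l Q \<boxtimes> \<lambda>\<^bold>l Q) \<cdot> (((?e \<boxtimes> \<I> Q) \<boxtimes> (?e \<boxtimes> \<I> Q)) \<cdot> (?M \<cdot> (?d \<boxtimes> ?d')))"
    by (simp add: pair_def c p)
  also have "\<dots> = ((\<lambda>\<^bold>l Q \<boxtimes> \<lambda>\<^bold>l Q) \<cdot> middle C \<one> \<one> Q Q) \<cdot> (((?e \<boxtimes> ?e) \<boxtimes> (\<I> Q \<boxtimes> \<I> Q)) \<cdot> (?d \<boxtimes> ?d'))"
    using middle_natural'[of ?e ?e "\<I> Q" "\<I> Q" "?d \<boxtimes> ?d'" \<one> \<one> Q Q] by (simp del: ten_ident ten_comp ten_comp')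
  also have "\<dots> = (\<lambda>\<^bold>l (Q \<otimes> Q) \<cdot> (\<lambda>\<^bold>l \<one> \<boxtimes> \<I> (Q \<otimes> Q))) \<cdot> (((?e \<boxtimes> ?e) \<cdot> ?d) \<boxtimes> ?d')"
    by (subst middle_LUnit') simp_all
  also have "\<dots> = (\<lambda>\<^bold>l (Q \<otimes> Q) \<cdot> (\<I> \<one> \<boxtimes> ?d')) \<cdot> (?e \<boxtimes> \<I> Q)"
    unfolding eY by simp
  also have "\<dots> = ?d' \<cdot> proj2 Y Z"
    by (subst LUnit_natural) (simp_all add: p)
  finally have 2: "?d' \<cdot> proj2 Y Z = pair (tens Y Z) (proj2 Y Z) (proj2 Y Z)" by simp
  have "?e' \<cdot> proj2 Y Z = (?e' \<cdot> \<lambda>\<^bold>l Q) \<cdot> (?e \<boxtimes> \<I> Q)" by (simp add: p)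
  also have "?e' \<cdot> \<lambda>\<^bold>l Q = \<lambda>\<^bold>l \<one> \<cdot> (\<I> \<one> \<boxtimes> ?e')"
    using LUnit_natural[of ?e' \<one>] by simp
  finally have "?e' \<cdot> proj2 Y Z = counit (tens Y Z)" by (simp add: c)
  then show "cmor (tens Y Z) Z (proj2 Y Z)"
    using 2 by (simp add: cmor_def p flip: P_def Q_def)
  have "pair (tens Y Z) (proj1 Y Z) (proj2 Y Z) = (\<rho> P \<boxtimes> \<lambda>\<^bold>l Q) \<cdot> (((\<I> P \<boxtimes> ?e') \<boxtimes> (?e \<boxtimes> \<I> Q)) \<cdot> (?M \<cdot> (?d \<boxtimes> ?d')))"
    by (simp add: pair_def c p)
  also have "\<dots> = (\<rho> P \<boxtimes> \<lambda>\<^bold>l Q) \<cdot> (middle C P \<one> \<one> Q \<cdot> (((\<I> P \<boxtimes> ?e) \<boxtimes> (?e' \<boxtimes> \<I> Q)) \<cdot> (?d \<boxtimes> ?d')))"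
    using middle_natural'[of "\<I> P" ?e ?e' "\<I> Q" "?d \<boxtimes> ?d'" P \<one> \<one> Q] by (simp del: ten_ident ten_comp ten_comp')
  also have "\<dots> = (\<rho> P \<cdot> ((\<I> P \<boxtimes> ?e) \<cdot> ?d)) \<boxtimes> (\<lambda>\<^bold>l Q \<cdot> ((?e' \<boxtimes> \<I> Q) \<cdot> ?d'))"
    by (simp add: middle_unit)
  finally show "pair (tens Y Z) (proj1 Y Z) (proj2 Y Z) = \<I> (carr Y \<otimes> carr Z)"
    unfolding cY cZ by (simp flip: P_def Q_def)
qed

end

section \<open>The calculus of generalized elements at a fixed stage\<close>

locale element_source = braided_monoidal_category C for C :: "('o, 'm) braided_cat" (structure) +
  fixes X :: "('o, 'm, 'x) comonoid_scheme"
  assumes source: "coc_comonoid C X"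
begin

lemmas source_simps [simp] = coc_comonoidD(1-7)[OF source]

lemma element_simps [simp]:
  "cmor X Y a \<Longrightarrow> comult Y \<cdot> a = pair X a a" "cmor X Y a \<Longrightarrow> counit Y \<cdot> a = counit X"
  by (auto simp: cmorD)

lemma pair_arr [simp]:
  assumes "a \<in> Arr C" "b \<in> Arr C" "Dom C a = carr X" "Dom C b = carr X"
  shows "pair X a b \<in> Arr C" "Dom C (pair X a b) = carr X" "Cod C (pair X a b) = Cod C a \<otimes> Cod C b"
  using assms by (auto simp: pair_def)

lemma ten_pair [simp]:
  "a \<in> Arr C \<Longrightarrow> b \<in> Arr C \<Longrightarrow> Dom C a = carr X \<Longrightarrow> Dom C b = carr X \<Longrightarrow> f \<in> Arr C \<Longrightarrow> g \<in> Arr C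
   \<Longrightarrow> Dom C f = Cod C a \<Longrightarrow> Dom C g = Cod C b \<Longrightarrow> (f \<boxtimes> g) \<cdot> pair X a b = pair X (f \<cdot> a) (g \<cdot> b)"
  by (simp add: pair_def)

text \<open>With the following lemmas this forms a simp set in which the constraint isomorphisms act
  on tuples by rebracketing or permuting; coassociativity of the stage makes tuples insensitive to
  brackets.\<close>

lemma Assoc_pair [simp]:
  assumes [simp]: "a \<in> Arr C" "b \<in> Arr C" "c \<in> Arr C" "Dom C a = carr X" "Dom C b = carr X" "Dom C c = carr X"
    and [simp]: "Cod C a = P" "Cod C b = Q" "Cod C c = R"
  shows "\<alpha> P Q R \<cdot> pair X (pair X a b) c = pair X a (pair X b c)"
proof -
  have [simp]: "P \<in> Obj C" "Q \<in> Obj C" "R \<in> Obj C" using assms Cod_Obj' by metis+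
  have "\<alpha> P Q R \<cdot> pair X (pair X a b) c = \<alpha> P Q R \<cdot> (((a \<boxtimes> b) \<boxtimes> c) \<cdot> ((comult X \<boxtimes> \<I> (carr X)) \<cdot> comult X))"
    by (simp add: pair_def)
  also have "\<dots> = (a \<boxtimes> (b \<boxtimes> c)) \<cdot> (\<alpha> (carr X) (carr X) (carr X) \<cdot> ((comult X \<boxtimes> \<I> (carr X)) \<cdot> comult X))"
    by (simp add: Assoc_natural' del: ten_comp ten_comp')
  also have "\<dots> = pair X a (pair X b c)"
    unfolding coc_comonoidD(8)[OF source] by (simp add: pair_def)
  finally show ?thesis .
qed

lemma inv_Assoc_pair [simp]:
  assumes [simp]: "a \<in> Arr C" "b \<in> Arr C" "c \<in> Arr C" "Dom C a = carr X" "Dom C b = carr X" "Dom C c = carr X"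
    and [simp]: "Cod C a = P" "Cod C b = Q" "Cod C c = R"
  shows "inv_arrow C (\<alpha> P Q R) \<cdot> pair X a (pair X b c) = pair X (pair X a b) c"
proof -
  have [simp]: "P \<in> Obj C" "Q \<in> Obj C" "R \<in> Obj C" using assms Cod_Obj' by metis+
  show ?thesis by (rule iso_cancel_left[of "\<alpha> P Q R"]) simp_all
qed

text \<open>Cocommutativity of the stage makes the braiding a plain exchange of components, even
  where braiding twice is not the identity of the whole tensor product.\<close>

lemma Braid_pair [simp]:
  assumes "a \<in> Arr C" "b \<in> Arr C" "Dom C a = carr X" "Dom C b = carr X" "Cod C a = P" "Cod C b = Q"
  shows "\<sigma> P Q \<cdot> pair X a b = pair X b a"
  using assms coc_comonoidD(11)[OF source] by (simp add: pair_def Braid_natural')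

lemma LUnit_pair [simp]:
  assumes [simp]: "b \<in> Arr C" "Dom C b = carr X" "Cod C b = P"
  shows "\<lambda>\<^bold>l P \<cdot> pair X (counit X) b = b"
proof -
  have "\<lambda>\<^bold>l P \<cdot> pair X (counit X) b = (\<lambda>\<^bold>l P \<cdot> (\<I> \<one> \<boxtimes> b)) \<cdot> ((counit X \<boxtimes> \<I> (carr X)) \<cdot> comult X)"
    using Cod_Obj'[OF assms(1)] by (simp add: pair_def)
  also have "\<dots> = b \<cdot> (\<lambda>\<^bold>l (carr X) \<cdot> ((counit X \<boxtimes> \<I> (carr X)) \<cdot> comult X))"
    by (subst LUnit_natural) simp_all
  finally show ?thesis unfolding coc_comonoidD(9)[OF source] by simp
qed

lemma RUnit_pair [simp]:
  assumes [simp]: "b \<in> Arr C" "Dom C b = carr X" "Cod C b = P"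
  shows "\<rho> P \<cdot> pair X b (counit X) = b"
proof -
  have "\<rho> P \<cdot> pair X b (counit X) = (\<rho> P \<cdot> (b \<boxtimes> \<I> \<one>)) \<cdot> ((\<I> (carr X) \<boxtimes> counit X) \<cdot> comult X)"
    using Cod_Obj'[OF assms(1)] by (simp add: pair_def)
  also have "\<dots> = b \<cdot> (\<rho> (carr X) \<cdot> ((\<I> (carr X) \<boxtimes> counit X) \<cdot> comult X))"
    by (subst RUnit_natural) simp_all
  finally show ?thesis unfolding coc_comonoidD(10)[OF source] by simp
qed

lemma inv_unit_pair [simp]:
  assumes [simp]: "b \<in> Arr C" "Dom C b = carr X" "Cod C b = P"
  shows "inv_arrow C (\<lambda>\<^bold>l P) \<cdot> b = pair X (counit X) b" "inv_arrow C (\<rho> P) \<cdot> b = pair X b (counit X)"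
proof -
  have [simp]: "P \<in> Obj C" using Cod_Obj'[OF assms(1)] by simp
  show "inv_arrow C (\<lambda>\<^bold>l P) \<cdot> b = pair X (counit X) b"
    by (rule iso_cancel_left[of "\<lambda>\<^bold>l P"]) simp_all
  show "inv_arrow C (\<rho> P) \<cdot> b = pair X b (counit X)"
    by (rule iso_cancel_left[of "\<rho> P"]) simp_all
qed

lemma middle_pair [simp]:
  assumes [simp]: "a \<in> Arr C" "b \<in> Arr C" "c \<in> Arr C" "d \<in> Arr C"
    "Dom C a = carr X" "Dom C b = carr X" "Dom C c = carr X" "Dom C d = carr X"
    and [simp]: "Cod C a = P" "Cod C b = Q" "Cod C c = R" "Cod C d = W"
  shows "middle C P Q R W \<cdot> pair X (pair X a b) (pair X c d) = pair X (pair X a c) (pair X b d)"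
proof -
  have [simp]: "P \<in> Obj C" "Q \<in> Obj C" "R \<in> Obj C" "W \<in> Obj C" using assms Cod_Obj' by metis+
  show ?thesis by (simp add: middle_swap swap_def)
qed

lemma pair_cmor:
  assumes Y: "coc_comonoid C Y" and Z: "coc_comonoid C Z" and a: "cmor X Y a" and b: "cmor X Z b"
  shows "cmor X (tens Y Z) (pair X a b)"
proof -
  note [simp] = coc_comonoidD(1-7)[OF Y] coc_comonoidD(1-7)[OF Z] cmorD[OF a] cmorD[OF b]
  show ?thesis by (simp add: cmor_def tens_def)
qed

end

section \<open>Separation of arrows by elements of tensor products\<close>

context braided_monoidal_category
begin

text \<open>The test is made on the universal pair: the stage is the tensor product itself and the
  elements are the projections. Involutivity is what admits this tensor product as a stage.\<close>

lemma element_ext2: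
  assumes Y: "coc_comonoid C Y" and Z: "coc_comonoid C Z" and s: "involutive (carr Y) (carr Z)"
    and [simp]: "F \<in> Arr C" "G \<in> Arr C" "Dom C F = carr Y \<otimes> carr Z" "Dom C G = carr Y \<otimes> carr Z"
    and eq: "\<And>(X :: ('o, 'm) comonoid) a b. coc_comonoid C X \<Longrightarrow> cmor X Y a \<Longrightarrow> cmor X Z b \<Longrightarrow> F \<cdot> pair X a b = G \<cdot> pair X a b"
  shows "F = G"
  using eq[OF coc_comonoid_tens[OF Y Z s] proj_cmor(1,2)[OF Y Z]] unfolding pair_proj[OF Y Z] by simp

text \<open>An element of a tensor product, being a comonoid morphism, is the pair of its
  projections; so the test on triples reduces to the binary one.\<close>

lemma element_ext3:
  assumes Y: "coc_comonoid C Y" and Z: "coc_comonoid C Z" and W: "coc_comonoid C W"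
    and s: "involutive (carr Y) (carr Z)" "involutive (carr Y) (carr W)" "involutive (carr Z) (carr W)"
    and F: "F \<in> Arr C" "G \<in> Arr C" "Dom C F = (carr Y \<otimes> carr Z) \<otimes> carr W" "Dom C G = (carr Y \<otimes> carr Z) \<otimes> carr W"
    and eq: "\<And>(X :: ('o, 'm) comonoid) a b c. coc_comonoid C X \<Longrightarrow> cmor X Y a \<Longrightarrow> cmor X Z b \<Longrightarrow> cmor X W c
        \<Longrightarrow> F \<cdot> pair X (pair X a b) c = G \<cdot> pair X (pair X a b) c"
  shows "F = G"
proof (rule element_ext2[OF coc_comonoid_tens[OF Y Z s(1)] W])
  note [simp] = coc_comonoidD(1)[OF Y] coc_comonoidD(1)[OF Z] coc_comonoidD(1)[OF W]
  show "involutive (carr (tens Y Z)) (carr W)" using s by (simp add: involutive_tensor_left)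
  fix X :: "('o, 'm) comonoid" and x c
  assume X: "coc_comonoid C X" and x: "cmor X (tens Y Z) x" and c: "cmor X W c"
  have T: "coc_comonoid C (tens Y Z)" by (rule coc_comonoid_tens[OF Y Z s(1)])
  note p = proj_cmor[OF Y Z]
  have "x = pair (tens Y Z) (proj1 Y Z) (proj2 Y Z) \<cdot> x"
    unfolding pair_proj[OF Y Z] using cmorD(1-3)[OF x] by simp
  also have "\<dots> = pair X (proj1 Y Z \<cdot> x) (proj2 Y Z \<cdot> x)"
    by (rule pair_comp[OF X x]) (use cmorD(1-3)[OF p(1)] cmorD(1-3)[OF p(2)] T in auto)
  finally have e: "x = pair X (proj1 Y Z \<cdot> x) (proj2 Y Z \<cdot> x)" .
  show "F \<cdot> pair X x c = G \<cdot> pair X x c"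
    by (subst (1 2) e) (rule eq[OF X cmor_comp[OF X T Y x p(1)] cmor_comp[OF X T Z x p(2)] c])
qed (use F in auto)

lemma element_ext3':
  assumes Y: "coc_comonoid C Y" and Z: "coc_comonoid C Z" and W: "coc_comonoid C W"
    and s: "involutive (carr Y) (carr Z)" "involutive (carr Y) (carr W)" "involutive (carr Z) (carr W)"
    and F: "F \<in> Arr C" "G \<in> Arr C" "Dom C F = carr Y \<otimes> (carr Z \<otimes> carr W)" "Dom C G = carr Y \<otimes> (carr Z \<otimes> carr W)"
    and eq: "\<And>(X :: ('o, 'm) comonoid) a b c. coc_comonoid C X \<Longrightarrow> cmor X Y a \<Longrightarrow> cmor X Z b \<Longrightarrow> cmor X W c
        \<Longrightarrow> F \<cdot> pair X a (pair X b c) = G \<cdot> pair X a (pair X b c)"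
  shows "F = G"
proof -
  note [simp] = coc_comonoidD(1)[OF Y] coc_comonoidD(1)[OF Z] coc_comonoidD(1)[OF W] F
  have "F \<cdot> \<alpha> (carr Y) (carr Z) (carr W) = G \<cdot> \<alpha> (carr Y) (carr Z) (carr W)"
  proof (rule element_ext3[OF Y Z W s])
    fix X :: "('o, 'm) comonoid" and a b c
    assume X: "coc_comonoid C X" and a: "cmor X Y a" and b: "cmor X Z b" and c: "cmor X W c"
    interpret X: element_source C X by unfold_locales (rule X)
    show "(F \<cdot> \<alpha> (carr Y) (carr Z) (carr W)) \<cdot> pair X (pair X a b) c = (G \<cdot> \<alpha> (carr Y) (carr Z) (carr W)) \<cdot> pair X (pair X a b) c"
      using cmorD(1-3)[OF a] cmorD(1-3)[OF b] cmorD(1-3)[OF c] eq[OF X a b c] by simp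
  qed auto
  then show ?thesis by (intro iso_cancel_right[of "\<alpha> (carr Y) (carr Z) (carr W)" F G]) auto
qed

end

section \<open>Generalized elements of cocommutative Hopf monoids\<close>

text \<open>The elements of \<open>A\<close> at stage \<open>X\<close> form a group. The simp rules
  bracket products to the right, which is why inverses come with cancellation rules for nested
  products.\<close>

locale hopf_source = element_source C X + coc_hopf C A
  for C :: "('o, 'm) braided_cat" (structure) and X :: "('o, 'm, 'x) comonoid_scheme" and A :: "('o, 'm) hopf"
begin

lemma mul_assoc [simp]:
  assumes [simp]: "a \<in> Arr C" "b \<in> Arr C" "c \<in> Arr C" "Dom C a = carr X" "Dom C b = carr X" "Dom C c = carr X"
    "Cod C a = carr A" "Cod C b = carr A" "Cod C c = carr A"
  shows "mult A \<cdot> pair X (mult A \<cdot> pair X a b) c = mult A \<cdot> pair X a (mult A \<cdot> pair X b c)"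
proof -
  have "(mult A \<cdot> (mult A \<boxtimes> \<I> (carr A))) \<cdot> pair X (pair X a b) c
     = (mult A \<cdot> ((\<I> (carr A) \<boxtimes> mult A) \<cdot> \<alpha> (carr A) (carr A) (carr A))) \<cdot> pair X (pair X a b) c"
    unfolding mult_assoc ..
  then show ?thesis by simp
qed

lemma mul_unit [simp]:
  assumes [simp]: "a \<in> Arr C" "Dom C a = carr X" "Cod C a = carr A"
  shows "mult A \<cdot> pair X (munit A \<cdot> counit X) a = a" "mult A \<cdot> pair X a (munit A \<cdot> counit X) = a"
proof -
  have "(mult A \<cdot> (munit A \<boxtimes> \<I> (carr A))) \<cdot> pair X (counit X) a = \<lambda>\<^bold>l (carr A) \<cdot> pair X (counit X) a"
    unfolding unit_left ..
  then show "mult A \<cdot> pair X (munit A \<cdot> counit X) a = a" by simp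
  have "(mult A \<cdot> (\<I> (carr A) \<boxtimes> munit A)) \<cdot> pair X a (counit X) = \<rho> (carr A) \<cdot> pair X a (counit X)"
    unfolding unit_right ..
  then show "mult A \<cdot> pair X a (munit A \<cdot> counit X) = a" by simp
qed

lemma mul_antipode [simp]:
  assumes [simp]: "cmor X A a"
  shows "mult A \<cdot> pair X (antipode A \<cdot> a) a = munit A \<cdot> counit X"
    "mult A \<cdot> pair X a (antipode A \<cdot> a) = munit A \<cdot> counit X"
proof -
  note [simp] = cmorD(1-3)[OF assms]
  have "(mult A \<cdot> ((antipode A \<boxtimes> \<I> (carr A)) \<cdot> comult A)) \<cdot> a = (munit A \<cdot> counit A) \<cdot> a"
    unfolding antipode_left ..
  then show "mult A \<cdot> pair X (antipode A \<cdot> a) a = munit A \<cdot> counit X" by simp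
  have "(mult A \<cdot> ((\<I> (carr A) \<boxtimes> antipode A) \<cdot> comult A)) \<cdot> a = (munit A \<cdot> counit A) \<cdot> a"
    unfolding antipode_right ..
  then show "mult A \<cdot> pair X a (antipode A \<cdot> a) = munit A \<cdot> counit X" by simp
qed

lemma mul_antipode_cancel [simp]:
  assumes a [simp]: "cmor X A a" and [simp]: "b \<in> Arr C" "Dom C b = carr X" "Cod C b = carr A"
  shows "mult A \<cdot> pair X (antipode A \<cdot> a) (mult A \<cdot> pair X a b) = b"
    "mult A \<cdot> pair X a (mult A \<cdot> pair X (antipode A \<cdot> a) b) = b"
proof -
  note [simp] = cmorD(1-3)[OF a]
  have "mult A \<cdot> pair X (antipode A \<cdot> a) (mult A \<cdot> pair X a b) = mult A \<cdot> pair X (mult A \<cdot> pair X (antipode A \<cdot> a) a) b"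
    by (simp del: mul_antipode)
  also have "\<dots> = b"
    unfolding mul_antipode[OF a] by simp
  finally show "mult A \<cdot> pair X (antipode A \<cdot> a) (mult A \<cdot> pair X a b) = b" .
  have "mult A \<cdot> pair X a (mult A \<cdot> pair X (antipode A \<cdot> a) b) = mult A \<cdot> pair X (mult A \<cdot> pair X a (antipode A \<cdot> a)) b"
    by (simp del: mul_antipode)
  also have "\<dots> = b"
    unfolding mul_antipode[OF a] by simp
  finally show "mult A \<cdot> pair X a (mult A \<cdot> pair X (antipode A \<cdot> a) b) = b" .
qed

text \<open>This is the bimonoid axiom evaluated on a pair.\<close>

lemma mul_cmor [simp]:
  assumes a [simp]: "cmor X A a" and b [simp]: "cmor X A b"
  shows "cmor X A (mult A \<cdot> pair X a b)"
proof -
  note [simp] = cmorD(1-3)[OF a] cmorD(1-3)[OF b]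
  have "(comult A \<cdot> mult A) \<cdot> pair X a b = pair X (mult A \<cdot> pair X a b) (mult A \<cdot> pair X a b)"
    unfolding comult_mult by simp
  moreover have "(counit A \<cdot> mult A) \<cdot> pair X a b = counit X"
    unfolding counit_mult by simp
  ultimately show ?thesis by (intro cmorI) simp_all
qed

lemma unit_cmor [simp]: "cmor X A (munit A \<cdot> counit X)"
proof -
  have "(comult A \<cdot> munit A) \<cdot> counit X = pair X (munit A \<cdot> counit X) (munit A \<cdot> counit X)"
    unfolding comult_unit by simp
  moreover have "(counit A \<cdot> munit A) \<cdot> counit X = counit X"
    unfolding counit_unit by simp
  ultimately show ?thesis by (intro cmorI) simp_all
qed

text \<open>Multiply the hypothesis by the inverse of \<open>a\<close> on the left. This identifies
  the inverse of a product and the image of an inverse under a Hopf morphism.\<close>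

lemma inverse_unique:
  assumes a [simp]: "cmor X A a" and b [simp]: "b \<in> Arr C" "Dom C b = carr X" "Cod C b = carr A"
    and ab: "mult A \<cdot> pair X a b = munit A \<cdot> counit X"
  shows "b = antipode A \<cdot> a"
proof -
  note [simp] = cmorD(1-3)[OF a]
  have "b = mult A \<cdot> pair X (antipode A \<cdot> a) (mult A \<cdot> pair X a b)" by simp
  also have "\<dots> = antipode A \<cdot> a" unfolding ab by simp
  finally show ?thesis .
qed

end

section \<open>The shear map and the antipode\<close>

context coc_hopf
begin

definition shear :: 'm where
  "shear = (\<I> (carr A) \<boxtimes> mult A) \<cdot> (\<alpha> (carr A) (carr A) (carr A) \<cdot> (comult A \<boxtimes> \<I> (carr A)))"

definition unshear :: 'm where
  "unshear = (\<I> (carr A) \<boxtimes> mult A) \<cdot> (\<alpha> (carr A) (carr A) (carr A) \<cdot> (((\<I> (carr A) \<boxtimes> antipode A) \<cdot> comult A) \<boxtimes> \<I> (carr A)))"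

lemma shear_arr [simp]:
  "shear \<in> Arr C" "Dom C shear = carr A \<otimes> carr A" "Cod C shear = carr A \<otimes> carr A"
  "unshear \<in> Arr C" "Dom C unshear = carr A \<otimes> carr A" "Cod C unshear = carr A \<otimes> carr A"
  by (simp_all add: shear_def unshear_def)

text \<open>The second component is allowed to be any arrow, since at this point
  \<open>antipode A \<cdot> a\<close> is not yet known to be an element.\<close>

lemma shear_pair:
  assumes X: "coc_comonoid C X" and a: "cmor X A a" and b [simp]: "b \<in> Arr C" "Dom C b = carr X" "Cod C b = carr A"
  shows "shear \<cdot> pair X a b = pair X a (mult A \<cdot> pair X a b)"
    "unshear \<cdot> pair X a b = pair X a (mult A \<cdot> pair X (antipode A \<cdot> a) b)"
proof -
  interpret X: hopf_source C X A by unfold_locales (rule X)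
  note [simp] = a cmorD(1-3)[OF a]
  show "shear \<cdot> pair X a b = pair X a (mult A \<cdot> pair X a b)"
    "unshear \<cdot> pair X a b = pair X a (mult A \<cdot> pair X (antipode A \<cdot> a) b)"
    by (simp_all add: shear_def unshear_def)
qed

lemma shear_inverse: "unshear \<cdot> shear = \<I> (carr A \<otimes> carr A)" "shear \<cdot> unshear = \<I> (carr A \<otimes> carr A)"
proof -
  have *: "(unshear \<cdot> shear) \<cdot> pair X a b = \<I> (carr A \<otimes> carr A) \<cdot> pair X a b \<and> (shear \<cdot> unshear) \<cdot> pair X a b = \<I> (carr A \<otimes> carr A) \<cdot> pair X a b"
    if X: "coc_comonoid C X" and a [simp]: "cmor X A a" and b [simp]: "cmor X A b" for X :: "('o, 'm) comonoid" and a b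
  proof -
    interpret X: hopf_source C X A by unfold_locales (rule X)
    note [simp] = cmorD(1-3)[OF a] cmorD(1-3)[OF b]
    show ?thesis by (simp add: shear_pair[OF X])
  qed
  show "unshear \<cdot> shear = \<I> (carr A \<otimes> carr A)"
    by (rule element_ext2[OF coc coc involutive_self]) (use * in auto)
  show "shear \<cdot> unshear = \<I> (carr A \<otimes> carr A)"
    by (rule element_ext2[OF coc coc involutive_self]) (use * in auto)
qed

text \<open>The shear map is an invertible comonoid morphism, so its inverse is one as well; the antipode is
  read off from the inverse.\<close>

lemma antipode_cmor: "cmor A A (antipode A)"
proof -
  let ?T = "tens A A"
  have T: "coc_comonoid C ?T" by (rule coc_comonoid_tens[OF coc coc involutive_self])
  interpret T: hopf_source C ?T A by unfold_locales (rule T)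
  interpret A: hopf_source C A A by unfold_locales (rule coc)
  note p [simp] = proj_cmor(1,2)[OF coc coc]
  note [simp] = cmorD(1-3)[OF p(1)] cmorD(1-3)[OF p(2)]
  have "shear = shear \<cdot> pair ?T (proj1 A A) (proj2 A A)"
    unfolding pair_proj[OF coc coc] by simp
  also have "\<dots> = pair ?T (proj1 A A) (mult A \<cdot> pair ?T (proj1 A A) (proj2 A A))"
    by (simp add: shear_pair[OF T])
  finally have "cmor ?T ?T shear"
    using T.pair_cmor[OF coc coc p(1) T.mul_cmor[OF p]] by simp
  then have u: "cmor ?T ?T unshear"
    by (rule cmor_inverse[OF T T]) (simp_all add: shear_inverse)
  \<comment> \<open>The element (x, 1): the inverse shear sends it to (x, x^-1), whose second
    projection is the antipode.\<close>
  let ?a = "pair A (\<I> (carr A)) (munit A \<cdot> counit A)"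
  have a: "cmor A ?T ?a"
    by (rule A.pair_cmor[OF coc coc cmor_ident[OF coc] A.unit_cmor])
  have "cmor A A (proj2 A A \<cdot> (unshear \<cdot> ?a))"
    by (rule cmor_comp[OF coc T coc cmor_comp[OF coc T T a u] p(2)])
  moreover have "unshear \<cdot> ?a = pair A (\<I> (carr A)) (antipode A)"
    using shear_pair(2)[OF coc cmor_ident[OF coc], of "munit A \<cdot> counit A"] by simp
  moreover have "proj2 A A \<cdot> pair A (\<I> (carr A)) (antipode A) = antipode A"
    by (simp add: proj2_def)
  ultimately show ?thesis by simp
qed

end

context hopf_source
begin

lemma inv_cmor [simp]: "cmor X A a \<Longrightarrow> cmor X A (antipode A \<cdot> a)"
  by (rule cmor_comp[OF source coc coc _ antipode_cmor])

lemma inv_mul [simp]: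
  assumes a [simp]: "cmor X A a" and b [simp]: "cmor X A b"
  shows "antipode A \<cdot> (mult A \<cdot> pair X a b) = mult A \<cdot> pair X (antipode A \<cdot> b) (antipode A \<cdot> a)"
proof -
  note [simp] = cmorD(1-3)[OF a] cmorD(1-3)[OF b]
  show ?thesis by (rule inverse_unique[symmetric]) simp_all
qed

end

section \<open>Sub-Hopf monoids and quotient module comonoids\<close>

context category
begin

lemma parallel_iff:
  "parallel C f g \<longleftrightarrow> f \<in> Arr C \<and> g \<in> Arr C \<and> Dom C f = Dom C g \<and> Cod C f = Cod C g"
  by (simp add: parallel_def)

lemma equalizerD:
  assumes "is_equalizer C f g e"
  shows "f \<in> Arr C" "g \<in> Arr C" "Dom C g = Dom C f" "Cod C g = Cod C f" "e \<in> Arr C" "Cod C e = Dom C f" "f \<cdot> e = g \<cdot> e"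
  using assms by (auto simp: is_equalizer_def parallel_def)

lemma equalizer_factor:
  assumes "is_equalizer C f g e" "h \<in> Arr C" "Cod C h = Dom C f" "f \<cdot> h = g \<cdot> h"
  obtains k where "k \<in> Arr C" "Dom C k = Dom C h" "Cod C k = Dom C e" "e \<cdot> k = h"
proof -
  have "\<exists>!k. k \<in> hom C (Dom C h) (Dom C e) \<and> e \<cdot> k = h"
    using assms unfolding is_equalizer_def by blast
  then show thesis using that by auto
qed

lemma equalizer_mono:
  assumes e: "is_equalizer C f g e" and [simp]: "x \<in> Arr C" "y \<in> Arr C" "Cod C x = Dom C e" "Cod C y = Dom C e" "Dom C x = Dom C y"
    and xy: "e \<cdot> x = e \<cdot> y"
  shows "x = y"
proof -
  note [simp] = equalizerD(1-6)[OF e]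
  have "f \<cdot> (e \<cdot> y) = g \<cdot> (e \<cdot> y)"
    using comp_swap[OF equalizerD(7)[OF e], of y] by simp
  then have "\<exists>!k. k \<in> hom C (Dom C (e \<cdot> y)) (Dom C e) \<and> e \<cdot> k = e \<cdot> y"
    using e unfolding is_equalizer_def by (elim conjE, drule_tac bspec[of _ _ "e \<cdot> y"]) auto
  moreover have "x \<in> hom C (Dom C (e \<cdot> y)) (Dom C e)" "y \<in> hom C (Dom C (e \<cdot> y)) (Dom C e)" by auto
  ultimately show ?thesis using xy by blast
qed

lemma coequalizerD:
  assumes "is_coequalizer C f g q"
  shows "f \<in> Arr C" "g \<in> Arr C" "Dom C g = Dom C f" "Cod C g = Cod C f" "q \<in> Arr C" "Dom C q = Cod C f" "q \<cdot> f = q \<cdot> g"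
  using assms by (auto simp: is_coequalizer_def parallel_def)

lemma coequalizer_factor:
  assumes "is_coequalizer C f g q" "h \<in> Arr C" "Dom C h = Cod C f" "h \<cdot> f = h \<cdot> g"
  obtains k where "k \<in> Arr C" "Dom C k = Cod C q" "Cod C k = Cod C h" "k \<cdot> q = h"
proof -
  have "\<exists>!k. k \<in> hom C (Cod C q) (Cod C h) \<and> k \<cdot> q = h"
    using assms unfolding is_coequalizer_def by blast
  then show thesis using that by auto
qed

lemma coequalizer_epi:
  assumes q: "is_coequalizer C f g q" and [simp]: "x \<in> Arr C" "y \<in> Arr C" "Dom C x = Cod C q" "Dom C y = Cod C q" "Cod C x = Cod C y"
    and xy: "x \<cdot> q = y \<cdot> q"
  shows "x = y"
proof -
  note [simp] = coequalizerD(1-6)[OF q]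
  have "(y \<cdot> q) \<cdot> f = (y \<cdot> q) \<cdot> g"
    using coequalizerD(7)[OF q] by simp
  then have "\<exists>!k. k \<in> hom C (Cod C q) (Cod C (y \<cdot> q)) \<and> k \<cdot> q = y \<cdot> q"
    using q unfolding is_coequalizer_def by (elim conjE, drule_tac bspec[of _ _ "y \<cdot> q"]) auto
  moreover have "x \<in> hom C (Cod C q) (Cod C (y \<cdot> q))" "y \<in> hom C (Cod C q) (Cod C (y \<cdot> q))" by auto
  ultimately show ?thesis using xy by blast
qed

definition regular_mono :: "'m \<Rightarrow> bool" where
  "regular_mono i \<longleftrightarrow> (\<exists>f g. is_equalizer C f g i)"

lemma regular_mono_cancel:
  assumes "regular_mono e" "e \<cdot> x = e \<cdot> y" "x \<in> Arr C" "y \<in> Arr C" "Cod C x = Dom C e" "Cod C y = Dom C e" "Dom C x = Dom C y"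
  shows "x = y"
  using assms equalizer_mono unfolding regular_mono_def by blast

lemma regular_epi_cancel:
  assumes "regular_epi C q" "x \<cdot> q = y \<cdot> q" "x \<in> Arr C" "y \<in> Arr C" "Dom C x = Cod C q" "Dom C y = Cod C q" "Cod C x = Cod C y"
  shows "x = y"
  using assms coequalizer_epi unfolding regular_epi_def by blast

lemma regular_mono_arr: "regular_mono i \<Longrightarrow> i \<in> Arr C"
  by (auto simp: regular_mono_def dest: equalizerD(5))

lemma regular_epi_arr: "regular_epi C p \<Longrightarrow> p \<in> Arr C"
  by (auto simp: regular_epi_def dest: coequalizerD(5))

text \<open>The universal property refers to a parallel pair only through the arrows that equalize
  it. Each side condition of the correspondence is replaced in this way by an equalizer or
  coequalizer that is easier to handle.\<close>

lemma equalizer_cong: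
  assumes "parallel C f g" "parallel C f' g'" "Dom C f = Dom C f'"
    and "\<And>y. y \<in> Arr C \<Longrightarrow> Cod C y = Dom C f' \<Longrightarrow> f \<cdot> y = g \<cdot> y \<longleftrightarrow> f' \<cdot> y = g' \<cdot> y"
  shows "is_equalizer C f g e \<longleftrightarrow> is_equalizer C f' g' e"
proof -
  have 1: "(f \<cdot> e = g \<cdot> e) = (f' \<cdot> e = g' \<cdot> e)" if "e \<in> Arr C" "Cod C e = Dom C f'"
    using assms(4) that by simp
  show ?thesis
    unfolding is_equalizer_def assms(3) using assms(1,2,4) 1 by (smt (verit))
qed

lemma coequalizer_cong:
  assumes "parallel C f g" "parallel C f' g'" "Cod C f = Cod C f'"
    and "\<And>y. y \<in> Arr C \<Longrightarrow> Dom C y = Cod C f' \<Longrightarrow> y \<cdot> f = y \<cdot> g \<longleftrightarrow> y \<cdot> f' = y \<cdot> g'"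
  shows "is_coequalizer C f g e \<longleftrightarrow> is_coequalizer C f' g' e"
proof -
  have 1: "(e \<cdot> f = e \<cdot> g) = (e \<cdot> f' = e \<cdot> g')" if "e \<in> Arr C" "Dom C e = Cod C f'"
    using assms(4) that by simp
  show ?thesis
    unfolding is_coequalizer_def assms(3) using assms(1,2,4) 1 by (smt (verit))
qed

end

section \<open>Regular monomorphisms and epimorphisms under the tensor product\<close>

locale exact_braided = braided_monoidal_category C for C :: "('o, 'm) braided_cat" (structure) +
  assumes eqs: "has_equalizers C" and coeqs: "has_coequalizers C"
    and ten_eqs: "tensor_preserves_equalizers C" and ten_coeqs: "tensor_preserves_coequalizers C"
begin

lemma ten_equalizer:
  assumes "is_equalizer C f g e" "Z \<in> Obj C"
  shows "is_equalizer C (\<I> Z \<boxtimes> f) (\<I> Z \<boxtimes> g) (\<I> Z \<boxtimes> e)" "is_equalizer C (f \<boxtimes> \<I> Z) (g \<boxtimes> \<I> Z) (e \<boxtimes> \<I> Z)"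
  using ten_eqs assms by (auto simp: tensor_preserves_equalizers_def)

lemma ten_coequalizer:
  assumes "is_coequalizer C f g e" "Z \<in> Obj C"
  shows "is_coequalizer C (\<I> Z \<boxtimes> f) (\<I> Z \<boxtimes> g) (\<I> Z \<boxtimes> e)" "is_coequalizer C (f \<boxtimes> \<I> Z) (g \<boxtimes> \<I> Z) (e \<boxtimes> \<I> Z)"
  using ten_coeqs assms by (auto simp: tensor_preserves_coequalizers_def)

lemma ten_regular_mono:
  assumes "regular_mono i" "Z \<in> Obj C"
  shows "regular_mono (\<I> Z \<boxtimes> i)" "regular_mono (i \<boxtimes> \<I> Z)"
  using ten_equalizer assms unfolding regular_mono_def by blast+

lemma ten_regular_epi:
  assumes "regular_epi C p" "Z \<in> Obj C"
  shows "regular_epi C (\<I> Z \<boxtimes> p)" "regular_epi C (p \<boxtimes> \<I> Z)"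
  using ten_coequalizer assms unfolding regular_epi_def by blast+

text \<open>Preservation by the tensor product speaks about one arrow tensored with an identity, so
  the two factors are cancelled one after the other.\<close>

lemma ten_mono_cancel:
  assumes i: "regular_mono i" and j: "regular_mono j" and e: "(i \<boxtimes> j) \<cdot> x = (i \<boxtimes> j) \<cdot> y"
    and [simp]: "x \<in> Arr C" "y \<in> Arr C" "Cod C x = Dom C i \<otimes> Dom C j" "Cod C y = Dom C i \<otimes> Dom C j" "Dom C x = Dom C y"
  shows "x = y"
proof -
  note [simp] = regular_mono_arr[OF i] regular_mono_arr[OF j]
  have "(i \<boxtimes> \<I> (Cod C j)) \<cdot> ((\<I> (Dom C i) \<boxtimes> j) \<cdot> x) = (i \<boxtimes> \<I> (Cod C j)) \<cdot> ((\<I> (Dom C i) \<boxtimes> j) \<cdot> y)"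
    using e by simp
  then have "(\<I> (Dom C i) \<boxtimes> j) \<cdot> x = (\<I> (Dom C i) \<boxtimes> j) \<cdot> y"
    by (rule regular_mono_cancel[OF ten_regular_mono(2)[OF i Cod_Obj[OF regular_mono_arr[OF j]]]]) simp_all
  then show ?thesis
    by (rule regular_mono_cancel[OF ten_regular_mono(1)[OF j Dom_Obj[OF regular_mono_arr[OF i]]]]) simp_all
qed

lemma ten_epi_cancel:
  assumes i: "regular_epi C i" and j: "regular_epi C j" and e: "x \<cdot> (i \<boxtimes> j) = y \<cdot> (i \<boxtimes> j)"
    and [simp]: "x \<in> Arr C" "y \<in> Arr C" "Dom C x = Cod C i \<otimes> Cod C j" "Dom C y = Cod C i \<otimes> Cod C j" "Cod C x = Cod C y"
  shows "x = y"
proof -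
  note [simp] = regular_epi_arr[OF i] regular_epi_arr[OF j]
  have "(x \<cdot> (\<I> (Cod C i) \<boxtimes> j)) \<cdot> (i \<boxtimes> \<I> (Dom C j)) = (y \<cdot> (\<I> (Cod C i) \<boxtimes> j)) \<cdot> (i \<boxtimes> \<I> (Dom C j))"
    using e by simp
  then have "x \<cdot> (\<I> (Cod C i) \<boxtimes> j) = y \<cdot> (\<I> (Cod C i) \<boxtimes> j)"
    by (rule regular_epi_cancel[OF ten_regular_epi(2)[OF i Dom_Obj[OF regular_epi_arr[OF j]]]]) simp_all
  then show ?thesis
    by (rule regular_epi_cancel[OF ten_regular_epi(1)[OF j Cod_Obj[OF regular_epi_arr[OF i]]]]) simp_all
qed

text \<open>The universal property of an equalizer in M yields a bare arrow; its compatibility with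
  the comultiplication is checked after \<open>i \<boxtimes> i\<close>, which can be
  cancelled.\<close>

lemma cmor_factor_mono:
  assumes X: "coc_comonoid C X" and K: "coc_comonoid C K" and i: "cmor K A i" "regular_mono i"
    and A: "coc_comonoid C A" and ik: "cmor X A (i \<cdot> k)" and [simp]: "k \<in> Arr C" "Dom C k = carr X" "Cod C k = carr K"
  shows "cmor X K k"
proof (rule cmorI)
  interpret element_source C X by unfold_locales (rule X)
  note [simp] = coc_comonoidD(1-7)[OF K] coc_comonoidD(1-7)[OF A] cmorD(1-3)[OF i(1)]
  have "(i \<boxtimes> i) \<cdot> (comult K \<cdot> k) = (comult A \<cdot> i) \<cdot> k"
    using cmorD(4)[OF i(1)] by (simp add: pair_def)
  also have "\<dots> = (i \<boxtimes> i) \<cdot> pair X k k" using ik by simp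
  finally show "comult K \<cdot> k = pair X k k"
    by (rule ten_mono_cancel[OF i(2) i(2)]) simp_all
  have "counit K \<cdot> k = (counit A \<cdot> i) \<cdot> k" using cmorD(5)[OF i(1)] by simp
  also have "\<dots> = counit X" using ik by simp
  finally show "counit K \<cdot> k = counit X" .
qed simp_all

text \<open>Both sides of each equation have source \<open>Q\<close>, so here it is \<open>p\<close>
  itself that is cancelled and not a tensor power.\<close>

lemma cmor_factor_epi:
  assumes A: "coc_comonoid C A" and Q: "coc_comonoid C Q" and R: "coc_comonoid C R" and p: "cmor A Q p" "regular_epi C p"
    and kp: "cmor A R (k \<cdot> p)" and [simp]: "k \<in> Arr C" "Dom C k = carr Q" "Cod C k = carr R"
  shows "cmor Q R k"
proof (rule cmorI)
  interpret element_source C A by unfold_locales (rule A)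
  note [simp] = coc_comonoidD(1-7)[OF Q] coc_comonoidD(1-7)[OF R] cmorD[OF p(1)] cmorD(1-3)[OF kp]
  have "(comult R \<cdot> k) \<cdot> p = comult R \<cdot> (k \<cdot> p)" by simp
  also have "\<dots> = pair A (k \<cdot> p) (k \<cdot> p)" by (rule cmorD(4)[OF kp])
  also have "\<dots> = pair Q k k \<cdot> p" by (subst pair_comp[OF A p(1) _ _ _ _ Q]) simp_all
  finally show "comult R \<cdot> k = pair Q k k"
    by (rule regular_epi_cancel[OF p(2)]) (simp_all add: pair_def)
  have "(counit R \<cdot> k) \<cdot> p = counit R \<cdot> (k \<cdot> p)" by simp
  also have "\<dots> = counit Q \<cdot> p" unfolding cmorD(5)[OF kp] by simp
  finally show "counit R \<cdot> k = counit Q"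
    by (rule regular_epi_cancel[OF p(2)]) simp_all
qed simp_all

lemma ten3_mono_cancel:
  assumes i: "regular_mono i" and e: "(i \<boxtimes> (i \<boxtimes> i)) \<cdot> x = (i \<boxtimes> (i \<boxtimes> i)) \<cdot> y"
    and [simp]: "x \<in> Arr C" "y \<in> Arr C" "Cod C x = Dom C i \<otimes> (Dom C i \<otimes> Dom C i)"
      "Cod C y = Dom C i \<otimes> (Dom C i \<otimes> Dom C i)" "Dom C x = Dom C y"
  shows "x = y"
proof -
  note [simp] = regular_mono_arr[OF i]
  let ?P = "Dom C i" and ?X = "Cod C i"
  have 1: "regular_mono (\<I> ?P \<boxtimes> (\<I> ?P \<boxtimes> i))" "regular_mono (\<I> ?P \<boxtimes> (i \<boxtimes> \<I> ?X))" "regular_mono (i \<boxtimes> \<I> (?X \<otimes> ?X))"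
    by (intro ten_regular_mono i; simp)+
  have "(i \<boxtimes> \<I> (?X \<otimes> ?X)) \<cdot> ((\<I> ?P \<boxtimes> (i \<boxtimes> i)) \<cdot> x) = (i \<boxtimes> \<I> (?X \<otimes> ?X)) \<cdot> ((\<I> ?P \<boxtimes> (i \<boxtimes> i)) \<cdot> y)"
    using e by simp
  then have "(\<I> ?P \<boxtimes> (i \<boxtimes> i)) \<cdot> x = (\<I> ?P \<boxtimes> (i \<boxtimes> i)) \<cdot> y"
    by (rule regular_mono_cancel[OF 1(3)]) simp_all
  then have "(\<I> ?P \<boxtimes> (i \<boxtimes> \<I> ?X)) \<cdot> ((\<I> ?P \<boxtimes> (\<I> ?P \<boxtimes> i)) \<cdot> x) = (\<I> ?P \<boxtimes> (i \<boxtimes> \<I> ?X)) \<cdot> ((\<I> ?P \<boxtimes> (\<I> ?P \<boxtimes> i)) \<cdot> y)"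
    by simp
  then have "(\<I> ?P \<boxtimes> (\<I> ?P \<boxtimes> i)) \<cdot> x = (\<I> ?P \<boxtimes> (\<I> ?P \<boxtimes> i)) \<cdot> y"
    by (rule regular_mono_cancel[OF 1(2)]) simp_all
  then show ?thesis
    by (rule regular_mono_cancel[OF 1(1)]) simp_all
qed

text \<open>Once the comultiplication restricts, every axiom is inherited by composing with one, two
  or three copies of \<open>i\<close> and cancelling them.\<close>

lemma subcomonoid:
  assumes A: "coc_comonoid C A" and i: "regular_mono i" "Cod C i = carr A"
    and w [simp]: "w \<in> Arr C" "Dom C w = Dom C i" "Cod C w = Dom C i \<otimes> Dom C i" and iw: "(i \<boxtimes> i) \<cdot> w = comult A \<cdot> i"
  shows "coc_comonoid C \<lparr>carr = Dom C i, comult = w, counit = counit A \<cdot> i\<rparr>"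
proof -
  note [simp] = coc_comonoidD(1-7)[OF A] regular_mono_arr[OF i(1)] i(2)
  let ?P = "Dom C i" and ?X = "carr A"
  have 1: "\<alpha> ?P ?P ?P \<cdot> ((w \<boxtimes> \<I> ?P) \<cdot> w) = (\<I> ?P \<boxtimes> w) \<cdot> w"
  proof (rule ten3_mono_cancel[OF i(1)])
    have "(i \<boxtimes> (i \<boxtimes> i)) \<cdot> (\<alpha> ?P ?P ?P \<cdot> ((w \<boxtimes> \<I> ?P) \<cdot> w)) = \<alpha> ?X ?X ?X \<cdot> ((((i \<boxtimes> i) \<cdot> w) \<boxtimes> i) \<cdot> w)"
      using Assoc_natural'[of i i i "(w \<boxtimes> \<I> ?P) \<cdot> w" ?X ?X ?X, symmetric] by simp
    also have "((i \<boxtimes> i) \<cdot> w) \<boxtimes> i = (comult A \<boxtimes> \<I> ?X) \<cdot> (i \<boxtimes> i)"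
      unfolding iw by simp
    also have "\<alpha> ?X ?X ?X \<cdot> (((comult A \<boxtimes> \<I> ?X) \<cdot> (i \<boxtimes> i)) \<cdot> w) = \<alpha> ?X ?X ?X \<cdot> ((comult A \<boxtimes> \<I> ?X) \<cdot> ((i \<boxtimes> i) \<cdot> w))"
      by (simp del: ten_comp ten_comp')
    also have "\<dots> = (\<alpha> ?X ?X ?X \<cdot> ((comult A \<boxtimes> \<I> ?X) \<cdot> comult A)) \<cdot> i"
      unfolding iw by simp
    also have "\<dots> = (\<I> ?X \<boxtimes> comult A) \<cdot> ((i \<boxtimes> i) \<cdot> w)"
      unfolding iw coc_comonoidD(8)[OF A] by simp
    also have "\<dots> = ((\<I> ?X \<boxtimes> comult A) \<cdot> (i \<boxtimes> i)) \<cdot> w"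
      by (simp del: ten_comp ten_comp')
    also have "(\<I> ?X \<boxtimes> comult A) \<cdot> (i \<boxtimes> i) = i \<boxtimes> ((i \<boxtimes> i) \<cdot> w)"
      unfolding iw by simp
    also have "(i \<boxtimes> ((i \<boxtimes> i) \<cdot> w)) \<cdot> w = (i \<boxtimes> (i \<boxtimes> i)) \<cdot> ((\<I> ?P \<boxtimes> w) \<cdot> w)"
      by simp
    finally show "(i \<boxtimes> (i \<boxtimes> i)) \<cdot> (\<alpha> ?P ?P ?P \<cdot> ((w \<boxtimes> \<I> ?P) \<cdot> w)) = (i \<boxtimes> (i \<boxtimes> i)) \<cdot> ((\<I> ?P \<boxtimes> w) \<cdot> w)" .
  qed simp_all
  have 2: "\<lambda>\<^bold>l ?P \<cdot> (((counit A \<cdot> i) \<boxtimes> \<I> ?P) \<cdot> w) = \<I> ?P"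
  proof (rule regular_mono_cancel[OF i(1)])
    have "i \<cdot> (\<lambda>\<^bold>l ?P \<cdot> (((counit A \<cdot> i) \<boxtimes> \<I> ?P) \<cdot> w)) = (\<lambda>\<^bold>l ?X \<cdot> (\<I> \<one> \<boxtimes> i)) \<cdot> (((counit A \<cdot> i) \<boxtimes> \<I> ?P) \<cdot> w)"
      by (subst LUnit_natural) simp_all
    also have "\<dots> = \<lambda>\<^bold>l ?X \<cdot> ((counit A \<boxtimes> \<I> ?X) \<cdot> ((i \<boxtimes> i) \<cdot> w))"
      by simp
    also have "\<dots> = (\<lambda>\<^bold>l ?X \<cdot> ((counit A \<boxtimes> \<I> ?X) \<cdot> comult A)) \<cdot> i"
      unfolding iw by simp
    finally show "i \<cdot> (\<lambda>\<^bold>l ?P \<cdot> (((counit A \<cdot> i) \<boxtimes> \<I> ?P) \<cdot> w)) = i \<cdot> \<I> ?P"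
      unfolding coc_comonoidD(9)[OF A] by simp
  qed simp_all
  have 3: "\<rho> ?P \<cdot> ((\<I> ?P \<boxtimes> (counit A \<cdot> i)) \<cdot> w) = \<I> ?P"
  proof (rule regular_mono_cancel[OF i(1)])
    have "i \<cdot> (\<rho> ?P \<cdot> ((\<I> ?P \<boxtimes> (counit A \<cdot> i)) \<cdot> w)) = (\<rho> ?X \<cdot> (i \<boxtimes> \<I> \<one>)) \<cdot> ((\<I> ?P \<boxtimes> (counit A \<cdot> i)) \<cdot> w)"
      by (subst RUnit_natural) simp_all
    also have "\<dots> = \<rho> ?X \<cdot> ((\<I> ?X \<boxtimes> counit A) \<cdot> ((i \<boxtimes> i) \<cdot> w))"
      by simp
    also have "\<dots> = (\<rho> ?X \<cdot> ((\<I> ?X \<boxtimes> counit A) \<cdot> comult A)) \<cdot> i"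
      unfolding iw by simp
    finally show "i \<cdot> (\<rho> ?P \<cdot> ((\<I> ?P \<boxtimes> (counit A \<cdot> i)) \<cdot> w)) = i \<cdot> \<I> ?P"
      unfolding coc_comonoidD(10)[OF A] by simp
  qed simp_all
  have 4: "\<sigma> ?P ?P \<cdot> w = w"
  proof (rule ten_mono_cancel[OF i(1) i(1)])
    have "(i \<boxtimes> i) \<cdot> (\<sigma> ?P ?P \<cdot> w) = \<sigma> ?X ?X \<cdot> ((i \<boxtimes> i) \<cdot> w)"
      by (simp add: Braid_natural')
    also have "\<dots> = (\<sigma> ?X ?X \<cdot> comult A) \<cdot> i" unfolding iw by simp
    finally show "(i \<boxtimes> i) \<cdot> (\<sigma> ?P ?P \<cdot> w) = (i \<boxtimes> i) \<cdot> w"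
      unfolding coc_comonoidD(11)[OF A] iw .
  qed simp_all
  show ?thesis
    using 1 2 3 4 by (simp add: coc_comonoid_def)
qed

text \<open>Naturality carries the double braiding along \<open>i\<close>, and
  \<open>i \<boxtimes> \<I> Y\<close> can still be cancelled. Sub-Hopf monoids thereby become
  admissible factors of a stage.\<close>

lemma involutive_mono:
  assumes i: "regular_mono i" and [simp]: "Cod C i = X" "Y \<in> Obj C" and s: "involutive X Y"
  shows "involutive (Dom C i) Y"
  unfolding involutive_def
proof (rule regular_mono_cancel[OF ten_regular_mono(2)[OF i assms(3)]])
  note [simp] = regular_mono_arr[OF i]
  have [simp]: "X \<in> Obj C" using Cod_Obj[OF regular_mono_arr[OF i]] by simp
  have "(i \<boxtimes> \<I> Y) \<cdot> (\<sigma> Y (Dom C i) \<cdot> \<sigma> (Dom C i) Y) = \<sigma> Y X \<cdot> (\<sigma> X Y \<cdot> (i \<boxtimes> \<I> Y))"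
    by (simp add: Braid_natural Braid_natural')
  also have "\<dots> = i \<boxtimes> \<I> Y" using involutiveD(2)[OF s] by simp
  finally show "(i \<boxtimes> \<I> Y) \<cdot> (\<sigma> Y (Dom C i) \<cdot> \<sigma> (Dom C i) Y) = (i \<boxtimes> \<I> Y) \<cdot> \<I> (Dom C i \<otimes> Y)" by simp
qed (use assms regular_mono_arr[OF i] in auto)

end

section \<open>Hopf monoid morphisms on elements\<close>

context braided_monoidal_category
begin

lemma hopf_morphism_iff:
  "hopf_morphism C A B f \<longleftrightarrow> cmor A B f \<and> f \<cdot> mult A = mult B \<cdot> (f \<boxtimes> f) \<and> f \<cdot> munit A = munit B"
  by (simp add: hopf_morphism_def comonoid_morphism_iff)

lemma coc_hopfI: "coc_hopf_monoid C A \<Longrightarrow> coc_hopf C A"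
  by unfold_locales

lemma hopf_morphism_mul:
  assumes X: "coc_comonoid C X" and A: "coc_hopf_monoid C A" and B: "coc_hopf_monoid C B" and f: "hopf_morphism C A B f"
    and [simp]: "a \<in> Arr C" "b \<in> Arr C" "Dom C a = carr X" "Dom C b = carr X" "Cod C a = carr A" "Cod C b = carr A"
  shows "f \<cdot> (mult A \<cdot> pair X a b) = mult B \<cdot> pair X (f \<cdot> a) (f \<cdot> b)"
proof -
  interpret A: coc_hopf C A by (rule coc_hopfI[OF A])
  interpret B: coc_hopf C B by (rule coc_hopfI[OF B])
  interpret element_source C X by unfold_locales (rule X)
  note [simp] = cmorD(1-3)[OF conjunct1[OF f[unfolded hopf_morphism_iff]]]
  have "f \<cdot> (mult A \<cdot> pair X a b) = mult B \<cdot> ((f \<boxtimes> f) \<cdot> pair X a b)"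
    using f by (intro comp_swap) (simp_all add: hopf_morphism_iff)
  then show ?thesis by simp
qed

lemma hopf_morphism_unit:
  assumes A: "coc_hopf_monoid C A" and f: "hopf_morphism C A B f" and x: "x \<in> Arr C" "Cod C x = \<one>"
  shows "f \<cdot> (munit A \<cdot> x) = munit B \<cdot> x"
proof -
  interpret A: coc_hopf C A by (rule coc_hopfI[OF A])
  show ?thesis
    using f x by (intro comp_reduce) (simp_all add: hopf_morphism_iff cmor_def)
qed

text \<open>A multiplicative map sends an inverse to an inverse, and inverses are unique.\<close>

lemma hopf_morphism_antipode:
  assumes X: "coc_comonoid C X" and A: "coc_hopf_monoid C A" and B: "coc_hopf_monoid C B" and f: "hopf_morphism C A B f"
    and a: "cmor X A a"
  shows "f \<cdot> (antipode A \<cdot> a) = antipode B \<cdot> (f \<cdot> a)"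
proof -
  interpret A: hopf_source C X A using X A by unfold_locales
  interpret B: hopf_source C X B using X B by unfold_locales
  have f': "cmor A B f" using f by (simp add: hopf_morphism_iff)
  note [simp] = a cmorD(1-3)[OF a] cmorD(1-3)[OF f']
  have fa: "cmor X B (f \<cdot> a)" by (rule cmor_comp[OF X A.coc B.coc a f'])
  have "mult B \<cdot> pair X (f \<cdot> a) (f \<cdot> (antipode A \<cdot> a)) = f \<cdot> (mult A \<cdot> pair X a (antipode A \<cdot> a))"
    by (rule hopf_morphism_mul[OF X A B f, symmetric]) simp_all
  also have "\<dots> = munit B \<cdot> counit X"
    by (simp add: hopf_morphism_unit[OF A f])
  finally show ?thesis by (intro B.inverse_unique fa) simp_all
qed

end

locale exact_hopf = exact_braided C + coc_hopf C A for C :: "('o, 'm) braided_cat" (structure) and A :: "('o, 'm) hopf"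
begin

text \<open>\<open>i\<close> carries each operation of the candidate to the operation of
  \<open>A\<close>, so each axiom is the one of \<open>A\<close> after composing with
  \<open>i\<close> or its tensor square.\<close>

lemma sub_hopf:
  assumes K: "coc_comonoid C K" and i: "cmor K A i" and rm: "regular_mono i"
    and m [simp]: "mK \<in> Arr C" "Dom C mK = carr K \<otimes> carr K" "Cod C mK = carr K"
    and u [simp]: "uK \<in> Arr C" "Dom C uK = \<one>" "Cod C uK = carr K"
    and S [simp]: "SK \<in> Arr C" "Dom C SK = carr K" "Cod C SK = carr K"
    and im: "i \<cdot> mK = mult A \<cdot> (i \<boxtimes> i)" and iu: "i \<cdot> uK = munit A" and iS: "i \<cdot> SK = antipode A \<cdot> i"
  defines "H \<equiv> \<lparr>carr = carr K, comult = comult K, counit = counit K, mult = mK, munit = uK, antipode = SK\<rparr>"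
  shows "coc_hopf_monoid C H" "hopf_morphism C H A i"
proof -
  let ?P = "carr K" and ?X = "carr A"
  note [simp] = coc_comonoidD(1-7)[OF K] cmorD(1-3)[OF i]
  have iD: "comult A \<cdot> i = (i \<boxtimes> i) \<cdot> comult K" and ie: "counit A \<cdot> i = counit K"
    using cmorD(4,5)[OF i] by (simp_all add: pair_def)
  have HK: "coc_comonoid C H" using K by (simp add: coc_comonoid_def H_def)
  have imx: "i \<cdot> (mK \<cdot> x) = mult A \<cdot> ((i \<boxtimes> i) \<cdot> x)" if "x \<in> Arr C" "Cod C x = ?P \<otimes> ?P" for x
    using that by (intro comp_swap im) simp_all
  have 1: "mK \<cdot> (mK \<boxtimes> \<I> ?P) = mK \<cdot> ((\<I> ?P \<boxtimes> mK) \<cdot> \<alpha> ?P ?P ?P)"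
  proof (rule regular_mono_cancel[OF rm])
    have "i \<cdot> (mK \<cdot> (mK \<boxtimes> \<I> ?P)) = mult A \<cdot> ((i \<cdot> mK) \<boxtimes> i)" by (simp add: imx)
    also have "\<dots> = (mult A \<cdot> (mult A \<boxtimes> \<I> ?X)) \<cdot> ((i \<boxtimes> i) \<boxtimes> i)" unfolding im by simp
    also have "\<dots> = mult A \<cdot> ((\<I> ?X \<boxtimes> mult A) \<cdot> ((i \<boxtimes> (i \<boxtimes> i)) \<cdot> \<alpha> ?P ?P ?P))"
      unfolding mult_assoc by (simp add: Assoc_natural)
    also have "\<dots> = mult A \<cdot> ((i \<boxtimes> (i \<cdot> mK)) \<cdot> \<alpha> ?P ?P ?P)" unfolding im by simp
    also have "\<dots> = i \<cdot> (mK \<cdot> ((\<I> ?P \<boxtimes> mK) \<cdot> \<alpha> ?P ?P ?P))" by (simp add: imx)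
    finally show "i \<cdot> (mK \<cdot> (mK \<boxtimes> \<I> ?P)) = i \<cdot> (mK \<cdot> ((\<I> ?P \<boxtimes> mK) \<cdot> \<alpha> ?P ?P ?P))" .
  qed simp_all
  have 2: "mK \<cdot> (uK \<boxtimes> \<I> ?P) = \<lambda>\<^bold>l ?P"
  proof (rule regular_mono_cancel[OF rm])
    have "i \<cdot> (mK \<cdot> (uK \<boxtimes> \<I> ?P)) = mult A \<cdot> ((i \<cdot> uK) \<boxtimes> i)" by (simp add: imx)
    also have "\<dots> = (mult A \<cdot> (munit A \<boxtimes> \<I> ?X)) \<cdot> (\<I> \<one> \<boxtimes> i)" unfolding iu by simp
    also have "\<dots> = i \<cdot> \<lambda>\<^bold>l ?P" unfolding unit_left by (simp add: LUnit_natural)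
    finally show "i \<cdot> (mK \<cdot> (uK \<boxtimes> \<I> ?P)) = i \<cdot> \<lambda>\<^bold>l ?P" .
  qed simp_all
  have 3: "mK \<cdot> (\<I> ?P \<boxtimes> uK) = \<rho> ?P"
  proof (rule regular_mono_cancel[OF rm])
    have "i \<cdot> (mK \<cdot> (\<I> ?P \<boxtimes> uK)) = mult A \<cdot> (i \<boxtimes> (i \<cdot> uK))" by (simp add: imx)
    also have "\<dots> = (mult A \<cdot> (\<I> ?X \<boxtimes> munit A)) \<cdot> (i \<boxtimes> \<I> \<one>)" unfolding iu by simp
    also have "\<dots> = i \<cdot> \<rho> ?P" unfolding unit_right by (simp add: RUnit_natural)
    finally show "i \<cdot> (mK \<cdot> (\<I> ?P \<boxtimes> uK)) = i \<cdot> \<rho> ?P" .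
  qed simp_all
  have 4: "comult K \<cdot> mK = (mK \<boxtimes> mK) \<cdot> (middle C ?P ?P ?P ?P \<cdot> (comult K \<boxtimes> comult K))"
  proof (rule ten_mono_cancel[OF rm rm])
    have "(i \<boxtimes> i) \<cdot> (comult K \<cdot> mK) = comult A \<cdot> (i \<cdot> mK)"
      using comp_swap[OF iD, of mK] by simp
    also have "\<dots> = (comult A \<cdot> mult A) \<cdot> (i \<boxtimes> i)" unfolding im by simp
    also have "\<dots> = (mult A \<boxtimes> mult A) \<cdot> (middle C ?X ?X ?X ?X \<cdot> ((comult A \<cdot> i) \<boxtimes> (comult A \<cdot> i)))"
      unfolding comult_mult by simp
    also have "\<dots> = (mult A \<boxtimes> mult A) \<cdot> (middle C ?X ?X ?X ?X \<cdot> (((i \<boxtimes> i) \<boxtimes> (i \<boxtimes> i)) \<cdot> (comult K \<boxtimes> comult K)))"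
      unfolding iD by simp
    also have "\<dots> = ((mult A \<cdot> (i \<boxtimes> i)) \<boxtimes> (mult A \<cdot> (i \<boxtimes> i))) \<cdot> (middle C ?P ?P ?P ?P \<cdot> (comult K \<boxtimes> comult K))"
      by (subst middle_natural') simp_all
    finally show "(i \<boxtimes> i) \<cdot> (comult K \<cdot> mK) = (i \<boxtimes> i) \<cdot> ((mK \<boxtimes> mK) \<cdot> (middle C ?P ?P ?P ?P \<cdot> (comult K \<boxtimes> comult K)))"
      unfolding im[symmetric] by simp
  qed simp_all
  have 5: "counit K \<cdot> mK = \<lambda>\<^bold>l \<one> \<cdot> (counit K \<boxtimes> counit K)"
  proof -
    have "counit K \<cdot> mK = counit A \<cdot> (i \<cdot> mK)" unfolding ie[symmetric] by simp
    also have "\<dots> = (counit A \<cdot> mult A) \<cdot> (i \<boxtimes> i)" unfolding im by simp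
    also have "\<dots> = \<lambda>\<^bold>l \<one> \<cdot> ((counit A \<cdot> i) \<boxtimes> (counit A \<cdot> i))" unfolding counit_mult by simp
    finally show ?thesis unfolding ie .
  qed
  have 6: "comult K \<cdot> uK = (uK \<boxtimes> uK) \<cdot> inv_arrow C (\<lambda>\<^bold>l \<one>)"
  proof (rule ten_mono_cancel[OF rm rm])
    have "(i \<boxtimes> i) \<cdot> (comult K \<cdot> uK) = comult A \<cdot> (i \<cdot> uK)"
      using comp_swap[OF iD, of uK] by simp
    also have "\<dots> = ((i \<cdot> uK) \<boxtimes> (i \<cdot> uK)) \<cdot> inv_arrow C (\<lambda>\<^bold>l \<one>)" unfolding iu by (rule comult_unit)
    finally show "(i \<boxtimes> i) \<cdot> (comult K \<cdot> uK) = (i \<boxtimes> i) \<cdot> ((uK \<boxtimes> uK) \<cdot> inv_arrow C (\<lambda>\<^bold>l \<one>))" by simp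
  qed simp_all
  have 7: "counit K \<cdot> uK = \<I> \<one>"
    unfolding ie[symmetric] using counit_unit by (simp add: iu)
  have 8: "mK \<cdot> ((SK \<boxtimes> \<I> ?P) \<cdot> comult K) = uK \<cdot> counit K"
  proof (rule regular_mono_cancel[OF rm])
    have "i \<cdot> (mK \<cdot> ((SK \<boxtimes> \<I> ?P) \<cdot> comult K)) = mult A \<cdot> (((i \<cdot> SK) \<boxtimes> i) \<cdot> comult K)" by (simp add: imx)
    also have "\<dots> = mult A \<cdot> ((antipode A \<boxtimes> \<I> ?X) \<cdot> ((i \<boxtimes> i) \<cdot> comult K))" unfolding iS by simp
    also have "\<dots> = (mult A \<cdot> ((antipode A \<boxtimes> \<I> ?X) \<cdot> comult A)) \<cdot> i" unfolding iD[symmetric] by simp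
    also have "\<dots> = (i \<cdot> uK) \<cdot> (counit A \<cdot> i)" unfolding antipode_left iu by simp
    finally show "i \<cdot> (mK \<cdot> ((SK \<boxtimes> \<I> ?P) \<cdot> comult K)) = i \<cdot> (uK \<cdot> counit K)" unfolding ie by simp
  qed simp_all
  have 9: "mK \<cdot> ((\<I> ?P \<boxtimes> SK) \<cdot> comult K) = uK \<cdot> counit K"
  proof (rule regular_mono_cancel[OF rm])
    have "i \<cdot> (mK \<cdot> ((\<I> ?P \<boxtimes> SK) \<cdot> comult K)) = mult A \<cdot> ((i \<boxtimes> (i \<cdot> SK)) \<cdot> comult K)" by (simp add: imx)
    also have "\<dots> = mult A \<cdot> ((\<I> ?X \<boxtimes> antipode A) \<cdot> ((i \<boxtimes> i) \<cdot> comult K))" unfolding iS by simp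
    also have "\<dots> = (mult A \<cdot> ((\<I> ?X \<boxtimes> antipode A) \<cdot> comult A)) \<cdot> i" unfolding iD[symmetric] by simp
    also have "\<dots> = (i \<cdot> uK) \<cdot> (counit A \<cdot> i)" unfolding antipode_right iu by simp
    finally show "i \<cdot> (mK \<cdot> ((\<I> ?P \<boxtimes> SK) \<cdot> comult K)) = i \<cdot> (uK \<cdot> counit K)" unfolding ie by simp
  qed simp_all
  show "coc_hopf_monoid C H"
    using HK 1 2 3 4 5 6 7 8 9 by (simp add: coc_hopf_monoid_def monoid_object_def H_def)
  show "hopf_morphism C H A i"
    using i im iu by (simp add: hopf_morphism_iff H_def cmor_def pair_def)
qed

end

text \<open>One setting for two situations: a quotient module comonoid, and a Hopf morphism whose
  target is acted on through it. The locale asks of \<mu> only that \<open>p\<close> be linear, so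
  it is available while the action laws of a quotient are still being proved.\<close>

locale module_map = exact_hopf C A for C :: "('o, 'm) braided_cat" (structure) and A :: "('o, 'm) hopf" +
  fixes Q :: "('o, 'm, 'y) comonoid_scheme" and p \<mu> :: 'm
  assumes Q: "coc_comonoid C Q" and p: "cmor A Q p"
    and mu_arr [simp]: "\<mu> \<in> Arr C" "Dom C \<mu> = carr A \<otimes> carr Q" "Cod C \<mu> = carr Q"
    and linear: "p \<cdot> mult A = \<mu> \<cdot> (\<I> (carr A) \<boxtimes> p)"
begin

lemmas module_map_simps [simp] = coc_comonoidD(1-7)[OF Q] cmorD(1-3)[OF p]

lemma mu_pair:
  assumes X: "coc_comonoid C X" and [simp]: "a \<in> Arr C" "b \<in> Arr C" "Dom C a = carr X" "Dom C b = carr X" "Cod C a = carr A" "Cod C b = carr A"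
  shows "\<mu> \<cdot> pair X a (p \<cdot> b) = p \<cdot> (mult A \<cdot> pair X a b)"
proof -
  interpret element_source C X by unfold_locales (rule X)
  have "p \<cdot> (mult A \<cdot> pair X a b) = \<mu> \<cdot> ((\<I> (carr A) \<boxtimes> p) \<cdot> pair X a b)"
    by (intro comp_swap linear) simp_all
  then show ?thesis by simp
qed

lemma p_cmor: "coc_comonoid C X \<Longrightarrow> cmor X A a \<Longrightarrow> cmor X Q (p \<cdot> a)"
  by (rule cmor_comp[OF _ coc Q _ p])

text \<open>Together with \<open>coact0\<close> the pair defining psi: on elements, a goes to (p(a),
  a) and to (p(1), a).\<close>

definition coact :: 'm where
  "coact = (p \<boxtimes> \<I> (carr A)) \<cdot> comult A"

definition coact0 :: 'm where
  "coact0 = ((p \<cdot> munit A) \<boxtimes> \<I> (carr A)) \<cdot> inv_arrow C (\<lambda>\<^bold>l (carr A))"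

lemma coact_arr [simp]:
  "coact \<in> Arr C" "Dom C coact = carr A" "Cod C coact = carr Q \<otimes> carr A"
  "coact0 \<in> Arr C" "Dom C coact0 = carr A" "Cod C coact0 = carr Q \<otimes> carr A"
  by (simp_all add: coact_def coact0_def)

lemma coact_element:
  assumes X: "coc_comonoid C X" and a: "cmor X A a"
  shows "coact \<cdot> a = pair X (p \<cdot> a) a" "coact0 \<cdot> a = pair X (p \<cdot> (munit A \<cdot> counit X)) a"
proof -
  interpret hopf_source C X A by unfold_locales (rule X)
  note [simp] = a cmorD(1-3)[OF a]
  show "coact \<cdot> a = pair X (p \<cdot> a) a" "coact0 \<cdot> a = pair X (p \<cdot> (munit A \<cdot> counit X)) a"
    by (simp_all add: coact_def coact0_def)
qed

text \<open>Applying the counit to the copy of a leaves the pointwise condition. The equivalence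
  concerns comonoid morphisms, whereas arbitrary test arrows in M have to satisfy the equation with
  the copy.\<close>

lemma coact_eq_iff:
  assumes X: "coc_comonoid C X" and a: "cmor X A a"
  shows "coact \<cdot> a = coact0 \<cdot> a \<longleftrightarrow> p \<cdot> a = p \<cdot> (munit A \<cdot> counit X)"
proof
  interpret hopf_source C X A by unfold_locales (rule X)
  note [simp] = a cmorD(1-3)[OF a]
  assume "coact \<cdot> a = coact0 \<cdot> a"
  then have "\<rho> (carr Q) \<cdot> ((\<I> (carr Q) \<boxtimes> counit A) \<cdot> pair X (p \<cdot> a) a)
      = \<rho> (carr Q) \<cdot> ((\<I> (carr Q) \<boxtimes> counit A) \<cdot> pair X (p \<cdot> (munit A \<cdot> counit X)) a)"
    by (simp only: coact_element[OF X a])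
  then show "p \<cdot> a = p \<cdot> (munit A \<cdot> counit X)" by simp
qed (simp add: coact_element[OF X a])

lemma coact_A: "coact = pair A p (\<I> (carr A))" "coact0 = pair A (p \<cdot> (munit A \<cdot> counit A)) (\<I> (carr A))"
  using coact_element[OF coc cmor_ident[OF coc]] by simp_all

text \<open>Coassociativity lets the legs of the comultiplication be tested separately: the
  restriction to \<open>i\<close> equalizes the pair in the right leg and then in the left leg, and
  tensoring preserves the equalizer.\<close>

lemma kernel_comult:
  assumes i: "is_equalizer C coact coact0 i"
  obtains w where "w \<in> Arr C" "Dom C w = Dom C i" "Cod C w = Dom C i \<otimes> Dom C i" "(i \<boxtimes> i) \<cdot> w = comult A \<cdot> i"
proof -
  let ?X = "carr A" and ?Q = "carr Q" and ?P = "Dom C i"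
  interpret A: element_source C A by unfold_locales (rule coc)
  note iD = equalizerD[OF i]
  note [simp] = iD(5) iD(6)[simplified]
  \<comment> \<open>On elements, \<open>?H\<close> sends (q, x) to (x, (q, x)) and
    \<open>?H'\<close> sends it to ((q, x), x); they carry the equation for \<open>i\<close> to the
    right and to the left leg of \<open>comult A\<close>.\<close>
  let ?H = "\<alpha> ?X ?Q ?X \<cdot> ((\<sigma> ?Q ?X \<boxtimes> \<I> ?X) \<cdot> (inv_arrow C (\<alpha> ?Q ?X ?X) \<cdot> (\<I> ?Q \<boxtimes> comult A)))"
  let ?H' = "inv_arrow C (\<alpha> ?Q ?X ?X) \<cdot> (\<I> ?Q \<boxtimes> comult A)"
  have D: "comult A = pair A (\<I> ?X) (\<I> ?X)" by (simp add: pair_def)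
  have H: "?H \<cdot> coact = (\<I> ?X \<boxtimes> coact) \<cdot> comult A" "?H \<cdot> coact0 = (\<I> ?X \<boxtimes> coact0) \<cdot> comult A"
    unfolding coact_A D by simp_all
  have H': "?H' \<cdot> coact = (coact \<boxtimes> \<I> ?X) \<cdot> comult A" "?H' \<cdot> coact0 = (coact0 \<boxtimes> \<I> ?X) \<cdot> comult A"
    unfolding coact_A D by simp_all
  have "(\<I> ?X \<boxtimes> coact) \<cdot> (comult A \<cdot> i) = (?H \<cdot> coact) \<cdot> i" unfolding H by simp
  also have "\<dots> = ?H \<cdot> (coact0 \<cdot> i)" unfolding iD(7)[symmetric] by simp
  also have "\<dots> = (?H \<cdot> coact0) \<cdot> i" by simp
  also have "\<dots> = (\<I> ?X \<boxtimes> coact0) \<cdot> (comult A \<cdot> i)" unfolding H by simp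
  finally obtain z where z [simp]: "z \<in> Arr C" "Dom C z = ?P" "Cod C z = ?X \<otimes> ?P" and iz: "(\<I> ?X \<boxtimes> i) \<cdot> z = comult A \<cdot> i"
    by (rule equalizer_factor[OF ten_equalizer(1)[OF i comonoid_simps(1)], rotated 2]) simp_all
  \<comment> \<open>The left leg is tested after
    \<open>\<I> (?Q \<otimes> ?X) \<boxtimes> i\<close>, which can be cancelled and turns
    \<open>z\<close> back into the comultiplication.\<close>
  have "(coact \<boxtimes> \<I> ?P) \<cdot> z = (coact0 \<boxtimes> \<I> ?P) \<cdot> z"
  proof (rule equalizer_mono[OF ten_equalizer(1)[OF i]])
    show "?Q \<otimes> ?X \<in> Obj C" by simp
    have "(\<I> (?Q \<otimes> ?X) \<boxtimes> i) \<cdot> ((coact \<boxtimes> \<I> ?P) \<cdot> z) = (coact \<boxtimes> \<I> ?X) \<cdot> ((\<I> ?X \<boxtimes> i) \<cdot> z)" by simp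
    also have "\<dots> = ((coact \<boxtimes> \<I> ?X) \<cdot> comult A) \<cdot> i" unfolding iz by simp
    also have "\<dots> = ?H' \<cdot> (coact0 \<cdot> i)" unfolding H'[symmetric] iD(7)[symmetric] by simp
    also have "\<dots> = (?H' \<cdot> coact0) \<cdot> i" by simp
    also have "\<dots> = (coact0 \<boxtimes> \<I> ?X) \<cdot> ((\<I> ?X \<boxtimes> i) \<cdot> z)" unfolding H' iz by simp
    finally show "(\<I> (?Q \<otimes> ?X) \<boxtimes> i) \<cdot> ((coact \<boxtimes> \<I> ?P) \<cdot> z) = (\<I> (?Q \<otimes> ?X) \<boxtimes> i) \<cdot> ((coact0 \<boxtimes> \<I> ?P) \<cdot> z)" by simp
  qed simp_all
  then obtain w where w [simp]: "w \<in> Arr C" "Dom C w = ?P" "Cod C w = ?P \<otimes> ?P" and iw: "(i \<boxtimes> \<I> ?P) \<cdot> w = z"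
    by (rule equalizer_factor[OF ten_equalizer(2)[OF i Dom_Obj[OF iD(5)]], rotated 2]) simp_all
  have "(i \<boxtimes> i) \<cdot> w = (\<I> ?X \<boxtimes> i) \<cdot> ((i \<boxtimes> \<I> ?P) \<cdot> w)" by simp
  also have "\<dots> = comult A \<cdot> i" unfolding iw iz ..
  finally show thesis using that[of w] by simp
qed

text \<open>The form in which membership in the equalizer is used: a pointwise condition goes in, an
  element of \<open>K\<close> comes out.\<close>

lemma kernel_element:
  assumes i: "is_equalizer C coact coact0 i" and K: "coc_comonoid C K" and iK: "cmor K A i"
    and X: "coc_comonoid C X" and a: "cmor X A a" and pa: "p \<cdot> a = p \<cdot> (munit A \<cdot> counit X)"
  obtains k where "cmor X K k" "i \<cdot> k = a"
proof -
  obtain k where k: "k \<in> Arr C" "Dom C k = Dom C a" "Cod C k = Dom C i" "i \<cdot> k = a"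
    by (rule equalizer_factor[OF i, of a]) (use cmorD[OF a] coact_eq_iff[OF X a] pa in auto)
  have "cmor X K k"
    by (rule cmor_factor_mono[OF X K iK _ coc]) (use k a i cmorD[OF a] cmorD[OF iK] in \<open>auto simp: regular_mono_def\<close>)
  then show thesis using that k by auto
qed

lemma kernel_trivial:
  assumes i: "is_equalizer C coact coact0 i" and K: "coc_comonoid C K" and iK: "cmor K A i"
  shows "p \<cdot> i = p \<cdot> (munit A \<cdot> counit K)"
  using coact_eq_iff[OF K iK] equalizerD(7)[OF i] by simp

text \<open>The equalizer is the stabilizer of the point p(1), hence closed under the group
  operations: p(k l) = k p(l) = k p(1) = p(k) = p(1), and p(k^-1) = k^-1 p(1) = k^-1 p(k) =
  p(1).\<close>

lemma kernel_hopf: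
  assumes i: "is_equalizer C coact coact0 i"
  obtains K where "coc_hopf_monoid C K" "hopf_morphism C K A i"
proof -
  let ?P = "Dom C i" and ?X = "carr A"
  have rm: "regular_mono i" using i by (auto simp: regular_mono_def)
  note [simp] = equalizerD(5)[OF i] equalizerD(6)[OF i, simplified]
  obtain w where w [simp]: "w \<in> Arr C" "Dom C w = ?P" "Cod C w = ?P \<otimes> ?P" and iw: "(i \<boxtimes> i) \<cdot> w = comult A \<cdot> i"
    by (rule kernel_comult[OF i])
  define K where "K = \<lparr>carr = ?P, comult = w, counit = counit A \<cdot> i\<rparr>"
  have cK [simp]: "carr K = ?P" by (simp add: K_def)
  have K: "coc_comonoid C K" unfolding K_def by (rule subcomonoid[OF coc rm _ w iw]) simp
  have iK: "cmor K A i"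
    by (rule cmorI) (simp_all add: K_def pair_def iw)
  have pi: "p \<cdot> i = p \<cdot> (munit A \<cdot> counit K)" by (rule kernel_trivial[OF i K iK])
  \<comment> \<open>Involutivity passes from \<open>A\<close> to \<open>K\<close> in one variable
    and then, by symmetry, in the other.\<close>
  have inv: "involutive (carr K) (carr K)"
    by (metis cK comonoid_simps(1) equalizerD(5,6)[OF i] Dom_Obj coact_arr(2) involutive_mono[OF rm] involutive_self involutive_sym)
  have pik: "p \<cdot> (i \<cdot> k) = p \<cdot> (munit A \<cdot> counit X)" if X: "coc_comonoid C X" and k: "cmor X K k" for X :: "('o, 'm) comonoid" and k
  proof -
    interpret element_source C X by unfold_locales (rule X)
    note [simp] = cmorD[OF k] coc_comonoidD(1-7)[OF K]
    have "p \<cdot> (i \<cdot> k) = (p \<cdot> (munit A \<cdot> counit K)) \<cdot> k"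
      using comp_reduce[OF pi, of k] by simp
    then show ?thesis by simp
  qed
  have "coact \<cdot> (mult A \<cdot> (i \<boxtimes> i)) = coact0 \<cdot> (mult A \<cdot> (i \<boxtimes> i))"
  proof (rule element_ext2[OF K K inv])
    fix X :: "('o, 'm) comonoid" and a b
    assume X: "coc_comonoid C X" and a: "cmor X K a" and b: "cmor X K b"
    interpret hopf_source C X A by unfold_locales (rule X)
    note [simp] = cmorD(1-3)[OF a] cmorD(1-3)[OF b] cmor_comp[OF X K coc a iK] cmor_comp[OF X K coc b iK]
    have "p \<cdot> (mult A \<cdot> pair X (i \<cdot> a) (i \<cdot> b)) = \<mu> \<cdot> pair X (i \<cdot> a) (p \<cdot> (i \<cdot> b))"
      by (simp add: mu_pair[OF X])
    also have "\<dots> = p \<cdot> (i \<cdot> a)"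
      unfolding pik[OF X b] by (simp add: mu_pair[OF X])
    finally have "coact \<cdot> (mult A \<cdot> pair X (i \<cdot> a) (i \<cdot> b)) = coact0 \<cdot> (mult A \<cdot> pair X (i \<cdot> a) (i \<cdot> b))"
      by (subst coact_eq_iff[OF X]) (simp_all add: pik[OF X a])
    then show "(coact \<cdot> (mult A \<cdot> (i \<boxtimes> i))) \<cdot> pair X a b = (coact0 \<cdot> (mult A \<cdot> (i \<boxtimes> i))) \<cdot> pair X a b"
      by simp
  qed simp_all
  then obtain mK where mK: "mK \<in> Arr C" "Dom C mK = ?P \<otimes> ?P" "Cod C mK = ?P" "i \<cdot> mK = mult A \<cdot> (i \<boxtimes> i)"
    by (rule equalizer_factor[OF i, rotated 2]) simp_all
  \<comment> \<open>The source of the unit is \<one>, which is not set up as a stage, so this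
    equation is computed directly.\<close>
  have "coact \<cdot> munit A = coact0 \<cdot> munit A"
  proof -
    have "coact \<cdot> munit A = (p \<boxtimes> \<I> ?X) \<cdot> (comult A \<cdot> munit A)" by (simp add: coact_def)
    also have "\<dots> = ((p \<cdot> munit A) \<boxtimes> \<I> ?X) \<cdot> ((\<I> \<one> \<boxtimes> munit A) \<cdot> inv_arrow C (\<lambda>\<^bold>l \<one>))"
      unfolding comult_unit by simp
    also have "(\<I> \<one> \<boxtimes> munit A) \<cdot> inv_arrow C (\<lambda>\<^bold>l \<one>) = inv_arrow C (\<lambda>\<^bold>l ?X) \<cdot> munit A"
      using inv_LUnit_natural[of "munit A" \<one>] by simp
    finally show ?thesis by (simp add: coact0_def)
  qed
  then obtain uK where uK: "uK \<in> Arr C" "Dom C uK = \<one>" "Cod C uK = ?P" "i \<cdot> uK = munit A"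
    by (rule equalizer_factor[OF i, rotated 2]) simp_all
  interpret KA: hopf_source C K A by unfold_locales (rule K)
  have Si: "cmor K A (antipode A \<cdot> i)" by (rule KA.inv_cmor[OF iK])
  have "p \<cdot> (antipode A \<cdot> i) = p \<cdot> (mult A \<cdot> pair K (antipode A \<cdot> i) (munit A \<cdot> counit K))" by simp
  also have "\<dots> = \<mu> \<cdot> pair K (antipode A \<cdot> i) (p \<cdot> i)"
    unfolding pi by (simp add: mu_pair[OF K])
  also have "\<dots> = p \<cdot> (munit A \<cdot> counit K)"
    using iK by (simp add: mu_pair[OF K])
  finally have "coact \<cdot> (antipode A \<cdot> i) = coact0 \<cdot> (antipode A \<cdot> i)"
    by (subst coact_eq_iff[OF K Si])
  then obtain SK where SK: "SK \<in> Arr C" "Dom C SK = ?P" "Cod C SK = ?P" "i \<cdot> SK = antipode A \<cdot> i"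
    by (rule equalizer_factor[OF i, rotated 2]) simp_all
  show thesis
    using sub_hopf[OF K iK rm, of mK uK SK] mK uK SK that by simp
qed

end

section \<open>The regular module comonoid\<close>

context coc_hopf
begin

lemma regular_module_simps [simp]:
  "carr (regular_module A) = carr A" "comult (regular_module A) = comult A"
  "counit (regular_module A) = counit A" "act (regular_module A) = mult A"
  by (simp_all add: regular_module_def)

lemma coc_regular_module: "coc_comonoid C (regular_module A)"
  using coc by (simp add: coc_comonoid_def)

lemma regular_module_cmor: "cmor (regular_module A) Q f \<longleftrightarrow> cmor A Q f"
  by (simp add: cmor_def pair_def)

lemma counit_mult_trivial: "counit A \<cdot> mult A = trivial_act C A \<cdot> (\<I> (carr A) \<boxtimes> counit A)"
proof -
  have "trivial_act C A \<cdot> (\<I> (carr A) \<boxtimes> counit A) = (counit A \<cdot> \<rho> (carr A)) \<cdot> (\<I> (carr A) \<boxtimes> counit A)"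
    by (simp add: trivial_act_def)
  also have "counit A \<cdot> \<rho> (carr A) = \<rho> \<one> \<cdot> (counit A \<boxtimes> \<I> \<one>)"
    by (simp add: RUnit_natural)
  finally show ?thesis
    by (simp add: counit_mult LUnit_eq_RUnit)
qed

lemma module_comonoid_regular: "module_comonoid C A (regular_module A)"
  using mult_assoc unit_left coc_regular_module comult_mult counit_mult_trivial
  by (simp add: module_comonoid_def Let_def tensor_act_def)

lemma module_comonoidD:
  fixes Q :: "('o, 'm) modcomon"
  assumes "module_comonoid C A Q"
  shows "coc_comonoid C Q" "act Q \<in> Arr C" "Dom C (act Q) = carr A \<otimes> carr Q" "Cod C (act Q) = carr Q"
  using assms by (auto simp: module_comonoid_def Let_def)

lemma modcomon_morphism_iff: "modcomon_morphism C A P Q f \<longleftrightarrow> cmor P Q f \<and> f \<cdot> act P = act Q \<cdot> (\<I> (carr A) \<boxtimes> f)"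
  by (simp add: modcomon_morphism_def comonoid_morphism_iff)

end

text \<open>Being an equalizer in M, and not just a monomorphism of Hopf monoids, is the part of the
  Galois or kernel condition that survives tensoring; all cancellations of \<open>i\<close> rest on
  it.\<close>

locale sub_hopf_map = exact_hopf C A for C :: "('o, 'm) braided_cat" (structure) and A :: "('o, 'm) hopf" +
  fixes K :: "('o, 'm) hopf" and i :: 'm
  assumes K: "coc_hopf_monoid C K" and i: "hopf_morphism C K A i" and rm: "regular_mono i"
begin

sublocale K: coc_hopf C K by (rule coc_hopfI[OF K])

lemma i_cmor: "cmor K A i"
  using i by (simp add: hopf_morphism_iff)

lemmas i_simps [simp] = cmorD(1-3)[OF i_cmor]

lemma involutive_K: "involutive (carr K) (carr A)" "involutive (carr A) (carr K)"
proof -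
  show 1: "involutive (carr K) (carr A)"
    using involutive_mono[OF rm, of "carr A" "carr A"] involutive_self by simp
  show "involutive (carr A) (carr K)"
    by (rule involutive_sym[OF _ _ 1]) simp_all
qed

definition translate :: 'm where
  "translate = mult A \<cdot> (\<I> (carr A) \<boxtimes> i)"

definition translate0 :: 'm where
  "translate0 = \<rho> (carr A) \<cdot> (\<I> (carr A) \<boxtimes> counit K)"

lemma translate_arr [simp]:
  "translate \<in> Arr C" "Dom C translate = carr A \<otimes> carr K" "Cod C translate = carr A"
  "translate0 \<in> Arr C" "Dom C translate0 = carr A \<otimes> carr K" "Cod C translate0 = carr A"
  by (simp_all add: translate_def translate0_def)

lemma i_element: "coc_comonoid C X \<Longrightarrow> cmor X K k \<Longrightarrow> cmor X A (i \<cdot> k)"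
  by (rule cmor_comp[OF _ K.coc coc _ i_cmor])

lemma translate_pair:
  assumes X: "coc_comonoid C X" and k: "cmor X K k" and [simp]: "a \<in> Arr C" "Dom C a = carr X" "Cod C a = carr A"
  shows "translate \<cdot> pair X a k = mult A \<cdot> pair X a (i \<cdot> k)" "translate0 \<cdot> pair X a k = a"
proof -
  interpret element_source C X by unfold_locales (rule X)
  note [simp] = k cmorD(1-3)[OF k]
  show "translate \<cdot> pair X a k = mult A \<cdot> pair X a (i \<cdot> k)" "translate0 \<cdot> pair X a k = a"
    by (simp_all add: translate_def translate0_def)
qed

definition invariant :: "'m \<Rightarrow> bool" where
  "invariant h \<longleftrightarrow> h \<in> Arr C \<and> Dom C h = carr A \<and> h \<cdot> translate = h \<cdot> translate0"

lemma invariant_pair: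
  assumes h: "invariant h" and X: "coc_comonoid C X" and k: "cmor X K k" and a [simp]: "a \<in> Arr C" "Dom C a = carr X" "Cod C a = carr A"
  shows "h \<cdot> (mult A \<cdot> pair X a (i \<cdot> k)) = h \<cdot> a"
proof -
  interpret element_source C X by unfold_locales (rule X)
  note [simp] = cmorD(1-3)[OF k]
  have "h \<cdot> (translate \<cdot> pair X a k) = h \<cdot> (translate0 \<cdot> pair X a k)"
    using h by (intro comp_swap) (simp_all add: invariant_def)
  then show ?thesis by (simp add: translate_pair[OF X k])
qed

lemma invariantI:
  assumes [simp]: "h \<in> Arr C" "Dom C h = carr A"
    and eq: "\<And>(X :: ('o, 'm) comonoid) a k. coc_comonoid C X \<Longrightarrow> cmor X A a \<Longrightarrow> cmor X K k \<Longrightarrow> h \<cdot> (mult A \<cdot> pair X a (i \<cdot> k)) = h \<cdot> a"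
  shows "invariant h"
proof -
  have "h \<cdot> translate = h \<cdot> translate0"
  proof (rule element_ext2[OF coc K.coc involutive_K(2)])
    fix X :: "('o, 'm) comonoid" and a k
    assume X: "coc_comonoid C X" and a: "cmor X A a" and k: "cmor X K k"
    interpret element_source C X by unfold_locales (rule X)
    note [simp] = cmorD(1-3)[OF a] cmorD(1-3)[OF k]
    show "(h \<cdot> translate) \<cdot> pair X a k = (h \<cdot> translate0) \<cdot> pair X a k"
      using eq[OF X a k] by (simp add: translate_pair[OF X k])
  qed simp_all
  then show ?thesis by (simp add: invariant_def)
qed

text \<open>It suffices that \<open>q\<close> and
  \<open>(p \<boxtimes> \<I> (carr A)) \<cdot> shear\<close> factor through each other: then they
  identify the same arrows into A \<otimes> A, and the two pairs have the same equalizers.\<close>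

lemma sub_condition_iff:
  assumes p: "is_coequalizer C translate translate0 p"
  shows "sub_condition C A K i \<longleftrightarrow> is_equalizer C ((p \<boxtimes> \<I> (carr A)) \<cdot> comult A) (((p \<cdot> munit A) \<boxtimes> \<I> (carr A)) \<cdot> inv_arrow C (\<lambda>\<^bold>l (carr A))) i"
proof -
  let ?X = "carr A"
  let ?j = "(p \<boxtimes> \<I> ?X) \<cdot> comult A" and ?jz = "((p \<cdot> munit A) \<boxtimes> \<I> ?X) \<cdot> inv_arrow C (\<lambda>\<^bold>l ?X)"
  note pD = coequalizerD[OF p]
  note [simp] = pD(5) pD(6)[simplified]
  have inv: "invariant p" using pD(7) by (simp add: invariant_def)
  let ?f = "(mult A \<cdot> (\<I> ?X \<boxtimes> i)) \<boxtimes> \<I> ?X" and ?g = "(\<I> ?X \<boxtimes> (mult A \<cdot> (i \<boxtimes> \<I> ?X))) \<cdot> \<alpha> ?X (carr K) ?X"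
  let ?P = "(p \<boxtimes> \<I> ?X) \<cdot> shear"
  have iff: "is_equalizer C (q \<cdot> (munit A \<boxtimes> \<I> ?X) \<cdot> inv_arrow C (\<lambda>\<^bold>l ?X)) (q \<cdot> (\<I> ?X \<boxtimes> munit A) \<cdot> inv_arrow C (\<rho> ?X)) i
      \<longleftrightarrow> is_equalizer C ?j ?jz i" if q: "is_coequalizer C ?f ?g q" for q
  proof -
    note qD = coequalizerD[OF q]
    have q0 [simp]: "q \<in> Arr C" "Dom C q = ?X \<otimes> ?X" using qD(5,6) by simp_all
    \<comment> \<open>On (a, k, b): the shear sends (a k, b) to (a k, a k b) and (a, k b) to (a, a k
      b), and p(a k) = p(a).\<close>
    have "?P \<cdot> ?f = ?P \<cdot> ?g"
    proof (rule element_ext3[OF coc K.coc coc involutive_K(2) involutive_self involutive_K(1)])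
      fix X :: "('o, 'm) comonoid" and a k b
      assume X: "coc_comonoid C X" and a: "cmor X A a" and k: "cmor X K k" and b: "cmor X A b"
      interpret hopf_source C X A by unfold_locales (rule X)
      note [simp] = a k b cmorD(1-3)[OF a] cmorD(1-3)[OF k] cmorD(1-3)[OF b] i_element[OF X k]
      show "(?P \<cdot> ?f) \<cdot> pair X (pair X a k) b = (?P \<cdot> ?g) \<cdot> pair X (pair X a k) b"
        by (simp add: shear_pair[OF X] invariant_pair[OF inv X k])
    qed simp_all
    then obtain r where r [simp]: "r \<in> Arr C" "Dom C r = Cod C q" "Cod C r = Cod C p \<otimes> ?X" and rq: "r \<cdot> q = ?P"
      by (rule coequalizer_factor[OF q, rotated 2]) simp_all
    \<comment> \<open>On (a, k, b): q(a k, (a k)^-1 b) = q(a, k (a k)^-1 b) = q(a, a^-1 b). The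
      balancing of \<open>q\<close> is applied with \<open>?c\<close> = (a k)^-1 b as last
      entry.\<close>
    have "(q \<cdot> unshear) \<cdot> (translate \<boxtimes> \<I> ?X) = (q \<cdot> unshear) \<cdot> (translate0 \<boxtimes> \<I> ?X)"
    proof (rule element_ext3[OF coc K.coc coc involutive_K(2) involutive_self involutive_K(1)])
      fix X :: "('o, 'm) comonoid" and a k b
      assume X: "coc_comonoid C X" and a: "cmor X A a" and k: "cmor X K k" and b: "cmor X A b"
      interpret hopf_source C X A by unfold_locales (rule X)
      note [simp] = a k b cmorD(1-3)[OF a] cmorD(1-3)[OF k] cmorD(1-3)[OF b] i_element[OF X k]
      let ?c = "mult A \<cdot> pair X (antipode A \<cdot> (mult A \<cdot> pair X a (i \<cdot> k))) b"
      have "q \<cdot> (?f \<cdot> pair X (pair X a k) ?c) = q \<cdot> (?g \<cdot> pair X (pair X a k) ?c)"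
        using qD(7) by (intro comp_swap) simp_all
      then show "((q \<cdot> unshear) \<cdot> (translate \<boxtimes> \<I> ?X)) \<cdot> pair X (pair X a k) b = ((q \<cdot> unshear) \<cdot> (translate0 \<boxtimes> \<I> ?X)) \<cdot> pair X (pair X a k) b"
        by (simp add: shear_pair[OF X] translate_pair[OF X k])
    qed simp_all
    then obtain r' where r' [simp]: "r' \<in> Arr C" "Dom C r' = Cod C p \<otimes> ?X" "Cod C r' = Cod C q" and rp: "r' \<cdot> (p \<boxtimes> \<I> ?X) = q \<cdot> unshear"
      by (rule coequalizer_factor[OF ten_coequalizer(2)[OF p], rotated 3]) simp_all
    have "r' \<cdot> ?P = (r' \<cdot> (p \<boxtimes> \<I> ?X)) \<cdot> shear" by simp
    also have "\<dots> = q" unfolding rp by (simp add: shear_inverse)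
    finally have rP: "r' \<cdot> ?P = q" .
    interpret A: hopf_source C A A by unfold_locales (rule coc)
    have idA [simp]: "cmor A A (\<I> ?X)" by (rule cmor_ident[OF coc])
    have u: "inv_arrow C (\<lambda>\<^bold>l ?X) = pair A (counit A) (\<I> ?X)" "inv_arrow C (\<rho> ?X) = pair A (\<I> ?X) (counit A)"
      using A.inv_unit_pair[of "\<I> ?X" ?X] by simp_all
    have D: "comult A = pair A (\<I> ?X) (\<I> ?X)" by (simp add: pair_def)
    \<comment> \<open>The elements (1, x) and (x, 1) become (p(1), x) and (p(x), x), which is the
      pair defining psi.\<close>
    have j0: "?P \<cdot> ((munit A \<boxtimes> \<I> ?X) \<cdot> inv_arrow C (\<lambda>\<^bold>l ?X)) = ?jz"
      unfolding u by (simp add: shear_pair[OF coc])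
    have j: "?P \<cdot> ((\<I> ?X \<boxtimes> munit A) \<cdot> inv_arrow C (\<rho> ?X)) = ?j"
      unfolding u D by (simp add: shear_pair[OF coc])
    let ?a0 = "(munit A \<boxtimes> \<I> ?X) \<cdot> inv_arrow C (\<lambda>\<^bold>l ?X)" and ?a1 = "(\<I> ?X \<boxtimes> munit A) \<cdot> inv_arrow C (\<rho> ?X)"
    have e: "(q \<cdot> ?a0) \<cdot> y = (q \<cdot> ?a1) \<cdot> y \<longleftrightarrow> ?j \<cdot> y = ?jz \<cdot> y" if [simp]: "y \<in> Arr C" "Cod C y = ?X" for y
    proof
      assume h: "(q \<cdot> ?a0) \<cdot> y = (q \<cdot> ?a1) \<cdot> y"
      have "?j \<cdot> y = r \<cdot> ((q \<cdot> ?a1) \<cdot> y)" unfolding j[symmetric] rq[symmetric] by simp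
      also have "\<dots> = (r \<cdot> q) \<cdot> (?a0 \<cdot> y)" unfolding h[symmetric] by simp
      also have "\<dots> = (?P \<cdot> ?a0) \<cdot> y" unfolding rq by simp
      finally show "?j \<cdot> y = ?jz \<cdot> y" unfolding j0 .
    next
      assume h: "?j \<cdot> y = ?jz \<cdot> y"
      have "(q \<cdot> ?a0) \<cdot> y = (r' \<cdot> ?P) \<cdot> (?a0 \<cdot> y)" unfolding rP by simp
      also have "\<dots> = r' \<cdot> ((?P \<cdot> ?a0) \<cdot> y)" by simp
      also have "\<dots> = r' \<cdot> ((?P \<cdot> ?a1) \<cdot> y)" unfolding j0 h[symmetric] j ..
      also have "\<dots> = (r' \<cdot> ?P) \<cdot> (?a1 \<cdot> y)" by simp
      finally show "(q \<cdot> ?a0) \<cdot> y = (q \<cdot> ?a1) \<cdot> y" unfolding rP by simp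
    qed
    show ?thesis
      by (rule equalizer_cong) (use e in \<open>auto simp: parallel_iff\<close>)
  qed
  have "parallel C ?f ?g" by (simp add: parallel_iff)
  then obtain q where "is_coequalizer C ?f ?g q"
    using coeqs unfolding has_coequalizers_def by blast
  then show ?thesis
    using iff unfolding sub_condition_def is_tensor_over_def Let_def by blast
qed

text \<open>Whatever is compatible with right translation by \<open>K\<close> descends along
  \<open>p\<close>, and the axioms are checked after \<open>p\<close>. For the action it is
  \<open>\<I> (carr A) \<boxtimes> p\<close> that has to be a coequalizer.\<close>

lemma quotient_structure:
  assumes p: "is_coequalizer C translate translate0 p"
  obtains Q :: "('o, 'm) modcomon" where "carr Q = Cod C p" "module_comonoid C A Q" "modcomon_morphism C A (regular_module A) Q p"
proof -
  let ?X = "carr A"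
  define Y where "Y = Cod C p"
  have [simp]: "Cod C p = Y" by (simp add: Y_def)
  note pD = coequalizerD[OF p]
  note [simp] = pD(5) pD(6)[simplified]
  have [simp]: "Y \<in> Obj C" using Cod_Obj[OF pD(5)] by simp
  have re: "regular_epi C p" using p by (auto simp: regular_epi_def)
  have inv: "invariant p" using pD(7) by (simp add: invariant_def)
  interpret A: hopf_source C A A by unfold_locales (rule coc)
  have "invariant ((p \<boxtimes> p) \<cdot> comult A)"
  proof (rule invariantI)
    fix X :: "('o, 'm) comonoid" and a k
    assume X: "coc_comonoid C X" and a: "cmor X A a" and k: "cmor X K k"
    interpret hopf_source C X A by unfold_locales (rule X)
    note [simp] = a cmorD(1-3)[OF a] cmorD(1-3)[OF k] i_element[OF X k]
    show "((p \<boxtimes> p) \<cdot> comult A) \<cdot> (mult A \<cdot> pair X a (i \<cdot> k)) = ((p \<boxtimes> p) \<cdot> comult A) \<cdot> a"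
      by (simp add: invariant_pair[OF inv X k])
  qed simp_all
  then obtain D where D [simp]: "D \<in> Arr C" "Dom C D = Y" "Cod C D = Y \<otimes> Y" and Dp: "D \<cdot> p = (p \<boxtimes> p) \<cdot> comult A"
    using coequalizer_factor[OF p, of "(p \<boxtimes> p) \<cdot> comult A"] by (auto simp: invariant_def)
  have "invariant (counit A)"
  proof (rule invariantI)
    fix X :: "('o, 'm) comonoid" and a k
    assume X: "coc_comonoid C X" and a: "cmor X A a" and k: "cmor X K k"
    interpret hopf_source C X A by unfold_locales (rule X)
    note [simp] = a cmorD(1-3)[OF a] cmorD(1-3)[OF k] i_element[OF X k]
    show "counit A \<cdot> (mult A \<cdot> pair X a (i \<cdot> k)) = counit A \<cdot> a" by simp
  qed simp_all
  then obtain E where E [simp]: "E \<in> Arr C" "Dom C E = Y" "Cod C E = \<one>" and Ep: "E \<cdot> p = counit A"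
    using coequalizer_factor[OF p, of "counit A"] by (auto simp: invariant_def)
  have "(p \<cdot> mult A) \<cdot> (\<I> ?X \<boxtimes> translate) = (p \<cdot> mult A) \<cdot> (\<I> ?X \<boxtimes> translate0)"
  proof (rule element_ext3'[OF coc coc K.coc involutive_self involutive_K(2) involutive_K(2)])
    fix X :: "('o, 'm) comonoid" and a b k
    assume X: "coc_comonoid C X" and a: "cmor X A a" and b: "cmor X A b" and k: "cmor X K k"
    interpret hopf_source C X A by unfold_locales (rule X)
    note [simp] = a b cmorD(1-3)[OF a] cmorD(1-3)[OF b] cmorD(1-3)[OF k] i_element[OF X k]
    have "p \<cdot> (mult A \<cdot> pair X (mult A \<cdot> pair X a b) (i \<cdot> k)) = p \<cdot> (mult A \<cdot> pair X a b)"
      by (rule invariant_pair[OF inv X k]) simp_all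
    then show "((p \<cdot> mult A) \<cdot> (\<I> ?X \<boxtimes> translate)) \<cdot> pair X a (pair X b k) = ((p \<cdot> mult A) \<cdot> (\<I> ?X \<boxtimes> translate0)) \<cdot> pair X a (pair X b k)"
      by (simp add: translate_pair[OF X k])
  qed simp_all
  then obtain \<mu> where \<mu> [simp]: "\<mu> \<in> Arr C" "Dom C \<mu> = ?X \<otimes> Y" "Cod C \<mu> = Y" and \<mu>p: "\<mu> \<cdot> (\<I> ?X \<boxtimes> p) = p \<cdot> mult A"
    by (rule coequalizer_factor[OF ten_coequalizer(1)[OF p comonoid_simps(1)], rotated 2]) simp_all
  define Q where "Q = \<lparr>carr = Y, comult = D, counit = E, act = \<mu>\<rparr>"
  have Q_simps [simp]: "carr Q = Y" "comult Q = D" "counit Q = E" "act Q = \<mu>" by (simp_all add: Q_def)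
  have Dp': "D \<cdot> p = pair A p p" by (simp add: Dp pair_def)
  \<comment> \<open>\<open>p\<close> is treated as an arrow out of the stage \<open>A\<close>, so
    that the comonoid axioms of the quotient become identities between tuples of copies of
    \<open>p\<close>.\<close>
  have 1: "\<alpha> Y Y Y \<cdot> ((D \<boxtimes> \<I> Y) \<cdot> D) = (\<I> Y \<boxtimes> D) \<cdot> D"
    by (rule regular_epi_cancel[OF re]) (simp_all add: Dp')
  have 2: "\<lambda>\<^bold>l Y \<cdot> ((E \<boxtimes> \<I> Y) \<cdot> D) = \<I> Y"
    by (rule regular_epi_cancel[OF re]) (simp_all add: Dp' Ep)
  have 3: "\<rho> Y \<cdot> ((\<I> Y \<boxtimes> E) \<cdot> D) = \<I> Y"
    by (rule regular_epi_cancel[OF re]) (simp_all add: Dp' Ep)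
  have 4: "\<sigma> Y Y \<cdot> D = D"
    by (rule regular_epi_cancel[OF re]) (simp_all add: Dp')
  have Q: "coc_comonoid C Q"
    using 1 2 3 4 by (simp add: coc_comonoid_def)
  have pQ: "cmor A Q p"
    by (rule cmorI) (simp_all add: Dp' Ep)
  interpret M: module_map C A Q p \<mu>
    by unfold_locales (use Q pQ \<mu>p in simp_all)
  have 5: "\<mu> \<cdot> (mult A \<boxtimes> \<I> Y) = \<mu> \<cdot> ((\<I> ?X \<boxtimes> \<mu>) \<cdot> \<alpha> ?X ?X Y)"
  proof (rule regular_epi_cancel[OF ten_regular_epi(1)[OF re]])
    show "?X \<otimes> ?X \<in> Obj C" by simp
    show "(\<mu> \<cdot> (mult A \<boxtimes> \<I> Y)) \<cdot> (\<I> (?X \<otimes> ?X) \<boxtimes> p) = (\<mu> \<cdot> ((\<I> ?X \<boxtimes> \<mu>) \<cdot> \<alpha> ?X ?X Y)) \<cdot> (\<I> (?X \<otimes> ?X) \<boxtimes> p)"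
    proof (rule element_ext3[OF coc coc coc involutive_self involutive_self involutive_self])
      fix X :: "('o, 'm) comonoid" and a b c
      assume X: "coc_comonoid C X" and a: "cmor X A a" and b: "cmor X A b" and c: "cmor X A c"
      interpret hopf_source C X A by unfold_locales (rule X)
      note [simp] = cmorD(1-3)[OF a] cmorD(1-3)[OF b] cmorD(1-3)[OF c]
      show "((\<mu> \<cdot> (mult A \<boxtimes> \<I> Y)) \<cdot> (\<I> (?X \<otimes> ?X) \<boxtimes> p)) \<cdot> pair X (pair X a b) c
         = ((\<mu> \<cdot> ((\<I> ?X \<boxtimes> \<mu>) \<cdot> \<alpha> ?X ?X Y)) \<cdot> (\<I> (?X \<otimes> ?X) \<boxtimes> p)) \<cdot> pair X (pair X a b) c"
        by (simp add: M.mu_pair[OF X])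
    qed simp_all
  qed simp_all
  \<comment> \<open>The source \<one> \<otimes> A is reached through the inverse unitor, which is
    the pair of the counit and the identity at stage \<open>A\<close>.\<close>
  have 6: "\<mu> \<cdot> (munit A \<boxtimes> \<I> Y) = \<lambda>\<^bold>l Y"
  proof (rule regular_epi_cancel[OF ten_regular_epi(1)[OF re]])
    have "((\<mu> \<cdot> (munit A \<boxtimes> \<I> Y)) \<cdot> (\<I> \<one> \<boxtimes> p)) \<cdot> pair A (counit A) (\<I> ?X) = (\<lambda>\<^bold>l Y \<cdot> (\<I> \<one> \<boxtimes> p)) \<cdot> pair A (counit A) (\<I> ?X)"
      using M.mu_pair[OF coc, of "munit A \<cdot> counit A" "\<I> ?X"] by simp
    moreover have "pair A (counit A) (\<I> ?X) = inv_arrow C (\<lambda>\<^bold>l ?X)"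
      using A.inv_unit_pair[of "\<I> ?X" ?X] by simp
    ultimately have "((\<mu> \<cdot> (munit A \<boxtimes> \<I> Y)) \<cdot> (\<I> \<one> \<boxtimes> p)) \<cdot> inv_arrow C (\<lambda>\<^bold>l ?X) = (\<lambda>\<^bold>l Y \<cdot> (\<I> \<one> \<boxtimes> p)) \<cdot> inv_arrow C (\<lambda>\<^bold>l ?X)"
      by simp
    then show "(\<mu> \<cdot> (munit A \<boxtimes> \<I> Y)) \<cdot> (\<I> \<one> \<boxtimes> p) = \<lambda>\<^bold>l Y \<cdot> (\<I> \<one> \<boxtimes> p)"
      by (rule iso_cancel_right[rotated]) simp_all
  qed simp_all
  have 7: "D \<cdot> \<mu> = tensor_act C A Q \<cdot> (\<I> ?X \<boxtimes> D)"
  proof (rule regular_epi_cancel[OF ten_regular_epi(1)[OF re comonoid_simps(1)]])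
    show "(D \<cdot> \<mu>) \<cdot> (\<I> ?X \<boxtimes> p) = (tensor_act C A Q \<cdot> (\<I> ?X \<boxtimes> D)) \<cdot> (\<I> ?X \<boxtimes> p)"
    proof (rule element_ext2[OF coc coc involutive_self])
      fix X :: "('o, 'm) comonoid" and a b
      assume X: "coc_comonoid C X" and a: "cmor X A a" and b: "cmor X A b"
      interpret hopf_source C X A by unfold_locales (rule X)
      note [simp] = a b cmorD(1-3)[OF a] cmorD(1-3)[OF b]
      have D_el: "D \<cdot> (p \<cdot> c) = pair X (p \<cdot> c) (p \<cdot> c)" if "cmor X A c" for c
        using cmorD(4)[OF M.p_cmor[OF X that]] by simp
      show "((D \<cdot> \<mu>) \<cdot> (\<I> ?X \<boxtimes> p)) \<cdot> pair X a b = ((tensor_act C A Q \<cdot> (\<I> ?X \<boxtimes> D)) \<cdot> (\<I> ?X \<boxtimes> p)) \<cdot> pair X a b"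
        by (simp add: M.mu_pair[OF X] D_el tensor_act_def)
    qed (simp_all add: tensor_act_def)
  qed (simp_all add: tensor_act_def)
  have 8: "E \<cdot> \<mu> = trivial_act C A \<cdot> (\<I> ?X \<boxtimes> E)"
  proof (rule regular_epi_cancel[OF ten_regular_epi(1)[OF re comonoid_simps(1)]])
    show "(E \<cdot> \<mu>) \<cdot> (\<I> ?X \<boxtimes> p) = (trivial_act C A \<cdot> (\<I> ?X \<boxtimes> E)) \<cdot> (\<I> ?X \<boxtimes> p)"
    proof (rule element_ext2[OF coc coc involutive_self])
      fix X :: "('o, 'm) comonoid" and a b
      assume X: "coc_comonoid C X" and a: "cmor X A a" and b: "cmor X A b"
      interpret hopf_source C X A by unfold_locales (rule X)
      note [simp] = a b cmorD(1-3)[OF a] cmorD(1-3)[OF b]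
      have E_el: "E \<cdot> (p \<cdot> c) = counit X" if "cmor X A c" for c
        using cmorD(5)[OF M.p_cmor[OF X that]] by simp
      show "((E \<cdot> \<mu>) \<cdot> (\<I> ?X \<boxtimes> p)) \<cdot> pair X a b = ((trivial_act C A \<cdot> (\<I> ?X \<boxtimes> E)) \<cdot> (\<I> ?X \<boxtimes> p)) \<cdot> pair X a b"
        by (simp add: M.mu_pair[OF X] E_el trivial_act_def)
    qed (simp_all add: trivial_act_def)
  qed (simp_all add: trivial_act_def)
  have "module_comonoid C A Q"
    using Q 5 6 7 8 by (simp add: module_comonoid_def Let_def)
  moreover have "modcomon_morphism C A (regular_module A) Q p"
    using pQ \<mu>p by (simp add: modcomon_morphism_iff regular_module_cmor)
  ultimately show thesis using that[of Q] by simp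
qed

end

section \<open>The cotensor condition on a quotient\<close>

locale galois_pair = module_map C A Q p \<mu> + sub_hopf_map C A K i
  for C :: "('o, 'm) braided_cat" (structure) and A :: "('o, 'm) hopf" and Q :: "('o, 'm) modcomon" and p \<mu> :: 'm
    and K :: "('o, 'm) hopf" and i :: 'm
begin

text \<open>On elements, the twist is \<open>(a, x, b) \<mapsto> (a, a x, a b)\<close>; it is undone by the action of the inverse of \<open>a\<close>.\<close>

definition twist :: 'm where
  "twist = ((\<I> (carr A) \<boxtimes> \<mu>) \<boxtimes> mult A) \<cdot> ((\<alpha> (carr A) (carr A) (carr Q) \<boxtimes> \<I> (carr A \<otimes> carr A)) \<cdot>
     (((comult A \<boxtimes> \<I> (carr Q)) \<boxtimes> \<I> (carr A \<otimes> carr A)) \<cdot> (middle C (carr A) (carr A) (carr Q) (carr A) \<cdot> (comult A \<boxtimes> \<I> (carr Q \<otimes> carr A)))))"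

definition untwist :: 'm where
  "untwist = (\<I> (carr A) \<boxtimes> ((\<mu> \<cdot> (antipode A \<boxtimes> \<I> (carr Q))) \<boxtimes> (mult A \<cdot> (antipode A \<boxtimes> \<I> (carr A))))) \<cdot>
     (\<alpha> (carr A) (carr A \<otimes> carr Q) (carr A \<otimes> carr A) \<cdot> ((\<alpha> (carr A) (carr A) (carr Q) \<boxtimes> \<I> (carr A \<otimes> carr A)) \<cdot>
     (((comult A \<boxtimes> \<I> (carr Q)) \<boxtimes> \<I> (carr A \<otimes> carr A)) \<cdot> (middle C (carr A) (carr A) (carr Q) (carr A) \<cdot>
     ((comult A \<boxtimes> \<I> (carr Q \<otimes> carr A)) \<cdot> \<alpha> (carr A) (carr Q) (carr A))))))"

lemma twist_arr [simp]:
  "twist \<in> Arr C" "Dom C twist = carr A \<otimes> (carr Q \<otimes> carr A)" "Cod C twist = (carr A \<otimes> carr Q) \<otimes> carr A"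
  "untwist \<in> Arr C" "Dom C untwist = (carr A \<otimes> carr Q) \<otimes> carr A" "Cod C untwist = carr A \<otimes> (carr Q \<otimes> carr A)"
  by (simp_all add: twist_def untwist_def)

lemma twist_pair:
  assumes X: "coc_comonoid C X" and a: "cmor X A a"
    and [simp]: "x \<in> Arr C" "Dom C x = carr X" "Cod C x = carr Q" "b \<in> Arr C" "Dom C b = carr X" "Cod C b = carr A"
  shows "twist \<cdot> pair X a (pair X x b) = pair X (pair X a (\<mu> \<cdot> pair X a x)) (mult A \<cdot> pair X a b)"
    "untwist \<cdot> pair X (pair X a x) b = pair X a (pair X (\<mu> \<cdot> pair X (antipode A \<cdot> a) x) (mult A \<cdot> pair X (antipode A \<cdot> a) b))"
proof -
  interpret hopf_source C X A by unfold_locales (rule X)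
  note [simp] = a cmorD(1-3)[OF a]
  show "twist \<cdot> pair X a (pair X x b) = pair X (pair X a (\<mu> \<cdot> pair X a x)) (mult A \<cdot> pair X a b)"
    "untwist \<cdot> pair X (pair X a x) b = pair X a (pair X (\<mu> \<cdot> pair X (antipode A \<cdot> a) x) (mult A \<cdot> pair X (antipode A \<cdot> a) b))"
    by (simp_all add: twist_def untwist_def)
qed

abbreviation "cot1 \<equiv> ((\<I> (carr A) \<boxtimes> p) \<cdot> comult A) \<boxtimes> \<I> (carr A)"
abbreviation "cot2 \<equiv> inv_arrow C (\<alpha> (carr A) (carr Q) (carr A)) \<cdot> (\<I> (carr A) \<boxtimes> coact)"

text \<open>Under the shear the two cotensor maps become ((a, p(a)), a b) and ((a, p(a b)), a b),
  which by linearity are the twists of (a, (p(1), b)) and (a, (p(b), b)). All four identities have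
  source A \<otimes> A; inverse laws for \<open>twist\<close> itself would have to be tested on
  \<open>Q\<close>.\<close>

lemma cotensor_shear:
  "cot1 \<cdot> shear = twist \<cdot> (\<I> (carr A) \<boxtimes> coact0)" "cot2 \<cdot> shear = twist \<cdot> (\<I> (carr A) \<boxtimes> coact)"
  "untwist \<cdot> (cot1 \<cdot> shear) = \<I> (carr A) \<boxtimes> coact0" "untwist \<cdot> (cot2 \<cdot> shear) = \<I> (carr A) \<boxtimes> coact"
proof -
  have *: "(cot1 \<cdot> shear) \<cdot> pair X a b = (twist \<cdot> (\<I> (carr A) \<boxtimes> coact0)) \<cdot> pair X a b \<and>
     (cot2 \<cdot> shear) \<cdot> pair X a b = (twist \<cdot> (\<I> (carr A) \<boxtimes> coact)) \<cdot> pair X a b \<and>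
     (untwist \<cdot> (cot1 \<cdot> shear)) \<cdot> pair X a b = (\<I> (carr A) \<boxtimes> coact0) \<cdot> pair X a b \<and>
     (untwist \<cdot> (cot2 \<cdot> shear)) \<cdot> pair X a b = (\<I> (carr A) \<boxtimes> coact) \<cdot> pair X a b"
    if X: "coc_comonoid C X" and a: "cmor X A a" and b: "cmor X A b" for X :: "('o, 'm) comonoid" and a b
  proof -
    interpret hopf_source C X A by unfold_locales (rule X)
    note [simp] = a b cmorD(1-3)[OF a] cmorD(1-3)[OF b]
    show ?thesis
      by (simp add: shear_pair[OF X] twist_pair[OF X] coact_element[OF X] mu_pair[OF X])
  qed
  show "cot1 \<cdot> shear = twist \<cdot> (\<I> (carr A) \<boxtimes> coact0)"
    by (rule element_ext2[OF coc coc involutive_self]) (use * in simp_all)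
  show "cot2 \<cdot> shear = twist \<cdot> (\<I> (carr A) \<boxtimes> coact)"
    by (rule element_ext2[OF coc coc involutive_self]) (use * in simp_all)
  show "untwist \<cdot> (cot1 \<cdot> shear) = \<I> (carr A) \<boxtimes> coact0"
    by (rule element_ext2[OF coc coc involutive_self]) (use * in simp_all)
  show "untwist \<cdot> (cot2 \<cdot> shear) = \<I> (carr A) \<boxtimes> coact"
    by (rule element_ext2[OF coc coc involutive_self]) (use * in simp_all)
qed

text \<open>The shear sends (a, k) to (a, a k), whose projections are the translated and the
  original point.\<close>

lemma counit_shear:
  "\<lambda>\<^bold>l (carr A) \<cdot> ((counit A \<boxtimes> \<I> (carr A)) \<cdot> (shear \<cdot> (\<I> (carr A) \<boxtimes> i))) = translate"
  "\<rho> (carr A) \<cdot> ((\<I> (carr A) \<boxtimes> counit A) \<cdot> (shear \<cdot> (\<I> (carr A) \<boxtimes> i))) = translate0"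
proof -
  let ?l = "\<lambda>\<^bold>l (carr A) \<cdot> ((counit A \<boxtimes> \<I> (carr A)) \<cdot> (shear \<cdot> (\<I> (carr A) \<boxtimes> i)))"
  let ?r = "\<rho> (carr A) \<cdot> ((\<I> (carr A) \<boxtimes> counit A) \<cdot> (shear \<cdot> (\<I> (carr A) \<boxtimes> i)))"
  have *: "?l \<cdot> pair X a k = translate \<cdot> pair X a k \<and> ?r \<cdot> pair X a k = translate0 \<cdot> pair X a k"
    if X: "coc_comonoid C X" and a: "cmor X A a" and k: "cmor X K k" for X :: "('o, 'm) comonoid" and a k
  proof -
    interpret hopf_source C X A by unfold_locales (rule X)
    note [simp] = a cmorD(1-3)[OF a] cmorD(1-3)[OF k] i_element[OF X k]
    show ?thesis by (simp add: shear_pair[OF X] translate_pair[OF X k])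
  qed
  show "?l = translate" by (rule element_ext2[OF coc K.coc involutive_K(2)]) (use * in simp_all)
  show "?r = translate0" by (rule element_ext2[OF coc K.coc involutive_K(2)]) (use * in simp_all)
qed

text \<open>\<open>e\<close> and the sheared \<open>\<I> (carr A) \<boxtimes> i\<close> factor
  through each other, so composing them with the two projections gives pairs coequalized by the same
  arrows.\<close>

lemma quot_condition_iff:
  assumes eq: "is_equalizer C coact coact0 i"
  shows "quot_condition C A Q p \<longleftrightarrow> is_coequalizer C translate translate0 p"
proof -
  let ?X = "carr A"
  let ?x = "\<lambda>\<^bold>l ?X \<cdot> (counit A \<boxtimes> \<I> ?X)" and ?y = "\<rho> ?X \<cdot> (\<I> ?X \<boxtimes> counit A)"
  let ?s = "shear \<cdot> (\<I> ?X \<boxtimes> i)"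
  have iff: "is_coequalizer C (\<lambda>\<^bold>l ?X \<cdot> (counit A \<boxtimes> \<I> ?X) \<cdot> e) (\<rho> ?X \<cdot> (\<I> ?X \<boxtimes> counit A) \<cdot> e) p
      \<longleftrightarrow> is_coequalizer C translate translate0 p" if e: "is_equalizer C cot1 cot2 e" for e
  proof -
    note eD = equalizerD[OF e]
    have [simp]: "e \<in> Arr C" "Cod C e = ?X \<otimes> ?X" using eD(5,6) by simp_all
    have ie: "coact \<cdot> i = coact0 \<cdot> i" by (rule equalizerD(7)[OF eq])
    have "cot1 \<cdot> ?s = (cot1 \<cdot> shear) \<cdot> (\<I> ?X \<boxtimes> i)" by simp
    also have "\<dots> = twist \<cdot> (\<I> ?X \<boxtimes> (coact \<cdot> i))" unfolding cotensor_shear ie by simp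
    also have "\<dots> = (cot2 \<cdot> shear) \<cdot> (\<I> ?X \<boxtimes> i)" unfolding cotensor_shear by simp
    finally have "cot1 \<cdot> ?s = cot2 \<cdot> ?s" by simp
    then obtain s where s [simp]: "s \<in> Arr C" "Dom C s = ?X \<otimes> carr K" "Cod C s = Dom C e" and es: "e \<cdot> s = ?s"
      by (rule equalizer_factor[OF e, rotated 2]) simp_all
    \<comment> \<open>Unshearing reduces the cotensor equation to
      \<open>\<I> ?X \<boxtimes> coact\<close> against \<open>\<I> ?X \<boxtimes> coact0\<close>,
      and the equalizer of these is \<open>\<I> ?X \<boxtimes> i\<close> because tensoring preserves
      it.\<close>
    have "(\<I> ?X \<boxtimes> coact) \<cdot> (unshear \<cdot> e) = (untwist \<cdot> (cot2 \<cdot> shear)) \<cdot> (unshear \<cdot> e)" unfolding cotensor_shear(4) ..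
    also have "\<dots> = untwist \<cdot> ((cot2 \<cdot> (shear \<cdot> unshear)) \<cdot> e)" by simp
    also have "\<dots> = untwist \<cdot> (cot2 \<cdot> e)" unfolding shear_inverse by simp
    also have "\<dots> = untwist \<cdot> ((cot1 \<cdot> (shear \<cdot> unshear)) \<cdot> e)" unfolding eD(7)[symmetric] shear_inverse by simp
    also have "\<dots> = (untwist \<cdot> (cot1 \<cdot> shear)) \<cdot> (unshear \<cdot> e)" by simp
    finally have "(\<I> ?X \<boxtimes> coact) \<cdot> (unshear \<cdot> e) = (\<I> ?X \<boxtimes> coact0) \<cdot> (unshear \<cdot> e)" unfolding cotensor_shear(3) .
    then obtain s' where s' [simp]: "s' \<in> Arr C" "Dom C s' = Dom C e" "Cod C s' = ?X \<otimes> carr K" and is': "(\<I> ?X \<boxtimes> i) \<cdot> s' = unshear \<cdot> e"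
      by (rule equalizer_factor[OF ten_equalizer(1)[OF eq comonoid_simps(1)], rotated 2]) simp_all
    have "?s \<cdot> s' = shear \<cdot> ((\<I> ?X \<boxtimes> i) \<cdot> s')" by simp
    also have "\<dots> = (shear \<cdot> unshear) \<cdot> e" unfolding is' by simp
    finally have ss': "?s \<cdot> s' = e" unfolding shear_inverse by simp
    have t: "translate = ?x \<cdot> ?s" "translate0 = ?y \<cdot> ?s"
      using counit_shear by simp_all
    have h: "h \<cdot> (?x \<cdot> e) = h \<cdot> (?y \<cdot> e) \<longleftrightarrow> h \<cdot> translate = h \<cdot> translate0" if [simp]: "h \<in> Arr C" "Dom C h = ?X" for h
    proof
      assume *: "h \<cdot> (?x \<cdot> e) = h \<cdot> (?y \<cdot> e)"
      have "h \<cdot> translate = (h \<cdot> (?x \<cdot> e)) \<cdot> s" unfolding t es[symmetric] by simp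
      also have "\<dots> = h \<cdot> translate0" unfolding * unfolding t es[symmetric] by simp
      finally show "h \<cdot> translate = h \<cdot> translate0" .
    next
      assume *: "h \<cdot> translate = h \<cdot> translate0"
      have "h \<cdot> (?x \<cdot> e) = h \<cdot> (?x \<cdot> (?s \<cdot> s'))" unfolding ss' ..
      also have "\<dots> = (h \<cdot> translate) \<cdot> s'" unfolding t by simp
      also have "\<dots> = h \<cdot> (?y \<cdot> (?s \<cdot> s'))" unfolding * unfolding t by simp
      also have "\<dots> = h \<cdot> (?y \<cdot> e)" unfolding ss' ..
      finally show "h \<cdot> (?x \<cdot> e) = h \<cdot> (?y \<cdot> e)" .
    qed
    show ?thesis
      by (rule coequalizer_cong) (use h in \<open>auto simp: parallel_iff\<close>)
  qed
  have "parallel C cot1 cot2" by (simp add: parallel_iff)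
  then obtain e where "is_equalizer C cot1 cot2 e"
    using eqs unfolding has_equalizers_def by blast
  then show ?thesis
    using iff unfolding quot_condition_def is_cotensor_over_def Let_def coact_def by blast
qed

end

section \<open>Hopf monoid structures on quotients\<close>

context exact_hopf
begin

lemma ten3_epi_cancel:
  assumes p: "regular_epi C p" and e: "x \<cdot> ((p \<boxtimes> p) \<boxtimes> p) = y \<cdot> ((p \<boxtimes> p) \<boxtimes> p)"
    and [simp]: "x \<in> Arr C" "y \<in> Arr C" "Dom C x = (Cod C p \<otimes> Cod C p) \<otimes> Cod C p"
      "Dom C y = (Cod C p \<otimes> Cod C p) \<otimes> Cod C p" "Cod C x = Cod C y"
  shows "x = y"
proof -
  note [simp] = regular_epi_arr[OF p]
  let ?P = "Dom C p" and ?Y = "Cod C p"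
  have 1: "regular_epi C ((p \<boxtimes> \<I> ?P) \<boxtimes> \<I> ?P)" "regular_epi C ((\<I> ?Y \<boxtimes> p) \<boxtimes> \<I> ?P)" "regular_epi C (\<I> (?Y \<otimes> ?Y) \<boxtimes> p)"
    by (intro ten_regular_epi p; simp)+
  have "((x \<cdot> (\<I> (?Y \<otimes> ?Y) \<boxtimes> p)) \<cdot> ((\<I> ?Y \<boxtimes> p) \<boxtimes> \<I> ?P)) \<cdot> ((p \<boxtimes> \<I> ?P) \<boxtimes> \<I> ?P) = ((y \<cdot> (\<I> (?Y \<otimes> ?Y) \<boxtimes> p)) \<cdot> ((\<I> ?Y \<boxtimes> p) \<boxtimes> \<I> ?P)) \<cdot> ((p \<boxtimes> \<I> ?P) \<boxtimes> \<I> ?P)"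
    using e by simp
  then have "(x \<cdot> (\<I> (?Y \<otimes> ?Y) \<boxtimes> p)) \<cdot> ((\<I> ?Y \<boxtimes> p) \<boxtimes> \<I> ?P) = (y \<cdot> (\<I> (?Y \<otimes> ?Y) \<boxtimes> p)) \<cdot> ((\<I> ?Y \<boxtimes> p) \<boxtimes> \<I> ?P)"
    by (rule regular_epi_cancel[OF 1(1)]) simp_all
  then have "x \<cdot> (\<I> (?Y \<otimes> ?Y) \<boxtimes> p) = y \<cdot> (\<I> (?Y \<otimes> ?Y) \<boxtimes> p)"
    by (rule regular_epi_cancel[OF 1(2)]) simp_all
  then show ?thesis by (rule regular_epi_cancel[OF 1(3)]) simp_all
qed

text \<open>Each remaining axiom is that of \<open>A\<close> after precomposing with
  \<open>p\<close> or a tensor power of it. The comonoid structure is given beforehand and kept, so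
  that only multiplication, unit and antipode are added to \<open>Q\<close>.\<close>

lemma quotient_hopf:
  fixes Q :: "('o, 'm, 'y) comonoid_scheme"
  assumes Q: "coc_comonoid C Q" and p: "cmor A Q p" and re: "regular_epi C p"
    and m [simp]: "mQ \<in> Arr C" "Dom C mQ = carr Q \<otimes> carr Q" "Cod C mQ = carr Q"
    and S [simp]: "SQ \<in> Arr C" "Dom C SQ = carr Q" "Cod C SQ = carr Q"
    and mp: "mQ \<cdot> (p \<boxtimes> p) = p \<cdot> mult A" and Sp: "SQ \<cdot> p = p \<cdot> antipode A"
  defines "H \<equiv> \<lparr>carr = carr Q, comult = comult Q, counit = counit Q, mult = mQ, munit = p \<cdot> munit A, antipode = SQ\<rparr>"
  shows "coc_hopf_monoid C H" "hopf_morphism C A H p"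
proof -
  let ?Y = "carr Q" and ?X = "carr A"
  note [simp] = coc_comonoidD(1-7)[OF Q] cmorD(1-3)[OF p]
  have Dp: "comult Q \<cdot> p = (p \<boxtimes> p) \<cdot> comult A" and ep: "counit Q \<cdot> p = counit A"
    using cmorD(4,5)[OF p] by (simp_all add: pair_def)
  have HQ: "coc_comonoid C H" using Q by (simp add: coc_comonoid_def H_def)
  have 1: "mQ \<cdot> (mQ \<boxtimes> \<I> ?Y) = mQ \<cdot> ((\<I> ?Y \<boxtimes> mQ) \<cdot> \<alpha> ?Y ?Y ?Y)"
  proof (rule ten3_epi_cancel[OF re])
    have "(mQ \<cdot> (mQ \<boxtimes> \<I> ?Y)) \<cdot> ((p \<boxtimes> p) \<boxtimes> p) = mQ \<cdot> ((mQ \<cdot> (p \<boxtimes> p)) \<boxtimes> p)" by simp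
    also have "\<dots> = mQ \<cdot> ((p \<cdot> mult A) \<boxtimes> p)" unfolding mp ..
    also have "\<dots> = (mQ \<cdot> (p \<boxtimes> p)) \<cdot> (mult A \<boxtimes> \<I> ?X)" by simp
    also have "\<dots> = p \<cdot> (mult A \<cdot> (mult A \<boxtimes> \<I> ?X))" unfolding mp by simp
    also have "\<dots> = (p \<cdot> mult A) \<cdot> ((\<I> ?X \<boxtimes> mult A) \<cdot> \<alpha> ?X ?X ?X)" unfolding mult_assoc by simp
    also have "\<dots> = (mQ \<cdot> (p \<boxtimes> p)) \<cdot> ((\<I> ?X \<boxtimes> mult A) \<cdot> \<alpha> ?X ?X ?X)" unfolding mp ..
    also have "\<dots> = mQ \<cdot> ((p \<boxtimes> (p \<cdot> mult A)) \<cdot> \<alpha> ?X ?X ?X)" by simp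
    also have "\<dots> = mQ \<cdot> ((p \<boxtimes> (mQ \<cdot> (p \<boxtimes> p))) \<cdot> \<alpha> ?X ?X ?X)" unfolding mp ..
    also have "\<dots> = (mQ \<cdot> (\<I> ?Y \<boxtimes> mQ)) \<cdot> ((p \<boxtimes> (p \<boxtimes> p)) \<cdot> \<alpha> ?X ?X ?X)" by simp
    also have "\<dots> = (mQ \<cdot> ((\<I> ?Y \<boxtimes> mQ) \<cdot> \<alpha> ?Y ?Y ?Y)) \<cdot> ((p \<boxtimes> p) \<boxtimes> p)" by (simp add: Assoc_natural)
    finally show "(mQ \<cdot> (mQ \<boxtimes> \<I> ?Y)) \<cdot> ((p \<boxtimes> p) \<boxtimes> p) = (mQ \<cdot> ((\<I> ?Y \<boxtimes> mQ) \<cdot> \<alpha> ?Y ?Y ?Y)) \<cdot> ((p \<boxtimes> p) \<boxtimes> p)" .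
  qed simp_all
  have 2: "mQ \<cdot> ((p \<cdot> munit A) \<boxtimes> \<I> ?Y) = \<lambda>\<^bold>l ?Y"
  proof (rule regular_epi_cancel[OF ten_regular_epi(1)[OF re TUnit_Obj]])
    have "(mQ \<cdot> ((p \<cdot> munit A) \<boxtimes> \<I> ?Y)) \<cdot> (\<I> \<one> \<boxtimes> p) = (mQ \<cdot> (p \<boxtimes> p)) \<cdot> (munit A \<boxtimes> \<I> ?X)" by simp
    also have "\<dots> = p \<cdot> (mult A \<cdot> (munit A \<boxtimes> \<I> ?X))" unfolding mp by simp
    finally show "(mQ \<cdot> ((p \<cdot> munit A) \<boxtimes> \<I> ?Y)) \<cdot> (\<I> \<one> \<boxtimes> p) = \<lambda>\<^bold>l ?Y \<cdot> (\<I> \<one> \<boxtimes> p)"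
      unfolding unit_left by (simp add: LUnit_natural)
  qed simp_all
  have 3: "mQ \<cdot> (\<I> ?Y \<boxtimes> (p \<cdot> munit A)) = \<rho> ?Y"
  proof (rule regular_epi_cancel[OF ten_regular_epi(2)[OF re TUnit_Obj]])
    have "(mQ \<cdot> (\<I> ?Y \<boxtimes> (p \<cdot> munit A))) \<cdot> (p \<boxtimes> \<I> \<one>) = (mQ \<cdot> (p \<boxtimes> p)) \<cdot> (\<I> ?X \<boxtimes> munit A)" by simp
    also have "\<dots> = p \<cdot> (mult A \<cdot> (\<I> ?X \<boxtimes> munit A))" unfolding mp by simp
    finally show "(mQ \<cdot> (\<I> ?Y \<boxtimes> (p \<cdot> munit A))) \<cdot> (p \<boxtimes> \<I> \<one>) = \<rho> ?Y \<cdot> (p \<boxtimes> \<I> \<one>)"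
      unfolding unit_right by (simp add: RUnit_natural)
  qed simp_all
  have 4: "comult Q \<cdot> mQ = (mQ \<boxtimes> mQ) \<cdot> (middle C ?Y ?Y ?Y ?Y \<cdot> (comult Q \<boxtimes> comult Q))"
  proof (rule ten_epi_cancel[OF re re])
    have "(comult Q \<cdot> mQ) \<cdot> (p \<boxtimes> p) = (comult Q \<cdot> p) \<cdot> mult A" by (simp add: mp)
    also have "\<dots> = (p \<boxtimes> p) \<cdot> (comult A \<cdot> mult A)" unfolding Dp by simp
    also have "\<dots> = ((p \<cdot> mult A) \<boxtimes> (p \<cdot> mult A)) \<cdot> (middle C ?X ?X ?X ?X \<cdot> (comult A \<boxtimes> comult A))"
      unfolding comult_mult by simp
    also have "\<dots> = (mQ \<boxtimes> mQ) \<cdot> (((p \<boxtimes> p) \<boxtimes> (p \<boxtimes> p)) \<cdot> (middle C ?X ?X ?X ?X \<cdot> (comult A \<boxtimes> comult A)))"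
      unfolding mp[symmetric] by simp
    also have "\<dots> = (mQ \<boxtimes> mQ) \<cdot> (middle C ?Y ?Y ?Y ?Y \<cdot> (((p \<boxtimes> p) \<cdot> comult A) \<boxtimes> ((p \<boxtimes> p) \<cdot> comult A)))"
      using middle_natural'[of p p p p "comult A \<boxtimes> comult A" ?Y ?Y ?Y ?Y] by simp
    finally show "(comult Q \<cdot> mQ) \<cdot> (p \<boxtimes> p) = ((mQ \<boxtimes> mQ) \<cdot> (middle C ?Y ?Y ?Y ?Y \<cdot> (comult Q \<boxtimes> comult Q))) \<cdot> (p \<boxtimes> p)"
      unfolding Dp[symmetric] by simp
  qed simp_all
  have 5: "counit Q \<cdot> mQ = \<lambda>\<^bold>l \<one> \<cdot> (counit Q \<boxtimes> counit Q)"
  proof (rule ten_epi_cancel[OF re re])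
    have "(counit Q \<cdot> mQ) \<cdot> (p \<boxtimes> p) = (counit Q \<cdot> p) \<cdot> mult A" by (simp add: mp)
    also have "\<dots> = \<lambda>\<^bold>l \<one> \<cdot> ((counit Q \<cdot> p) \<boxtimes> (counit Q \<cdot> p))" unfolding ep by (rule counit_mult)
    finally show "(counit Q \<cdot> mQ) \<cdot> (p \<boxtimes> p) = (\<lambda>\<^bold>l \<one> \<cdot> (counit Q \<boxtimes> counit Q)) \<cdot> (p \<boxtimes> p)" by simp
  qed simp_all
  have "comult Q \<cdot> (p \<cdot> munit A) = (p \<boxtimes> p) \<cdot> (comult A \<cdot> munit A)"
    by (rule comp_swap[OF Dp]) simp_all
  then have 6: "comult Q \<cdot> (p \<cdot> munit A) = ((p \<cdot> munit A) \<boxtimes> (p \<cdot> munit A)) \<cdot> inv_arrow C (\<lambda>\<^bold>l \<one>)"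
    unfolding comult_unit by simp
  have 7: "counit Q \<cdot> (p \<cdot> munit A) = \<I> \<one>"
    using comp_reduce[OF ep, of "munit A"] counit_unit by simp
  have 8: "mQ \<cdot> ((SQ \<boxtimes> \<I> ?Y) \<cdot> comult Q) = (p \<cdot> munit A) \<cdot> counit Q"
  proof (rule regular_epi_cancel[OF re])
    have "(mQ \<cdot> ((SQ \<boxtimes> \<I> ?Y) \<cdot> comult Q)) \<cdot> p = mQ \<cdot> ((SQ \<boxtimes> \<I> ?Y) \<cdot> (comult Q \<cdot> p))" by simp
    also have "\<dots> = mQ \<cdot> (((SQ \<cdot> p) \<boxtimes> p) \<cdot> comult A)" unfolding Dp by simp
    also have "\<dots> = (mQ \<cdot> (p \<boxtimes> p)) \<cdot> ((antipode A \<boxtimes> \<I> ?X) \<cdot> comult A)" unfolding Sp by simp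
    also have "\<dots> = p \<cdot> (mult A \<cdot> ((antipode A \<boxtimes> \<I> ?X) \<cdot> comult A))" unfolding mp by simp
    also have "\<dots> = ((p \<cdot> munit A) \<cdot> counit Q) \<cdot> p" unfolding antipode_left by (simp add: ep)
    finally show "(mQ \<cdot> ((SQ \<boxtimes> \<I> ?Y) \<cdot> comult Q)) \<cdot> p = ((p \<cdot> munit A) \<cdot> counit Q) \<cdot> p" .
  qed simp_all
  have 9: "mQ \<cdot> ((\<I> ?Y \<boxtimes> SQ) \<cdot> comult Q) = (p \<cdot> munit A) \<cdot> counit Q"
  proof (rule regular_epi_cancel[OF re])
    have "(mQ \<cdot> ((\<I> ?Y \<boxtimes> SQ) \<cdot> comult Q)) \<cdot> p = mQ \<cdot> ((\<I> ?Y \<boxtimes> SQ) \<cdot> (comult Q \<cdot> p))" by simp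
    also have "\<dots> = mQ \<cdot> ((p \<boxtimes> (SQ \<cdot> p)) \<cdot> comult A)" unfolding Dp by simp
    also have "\<dots> = (mQ \<cdot> (p \<boxtimes> p)) \<cdot> ((\<I> ?X \<boxtimes> antipode A) \<cdot> comult A)" unfolding Sp by simp
    also have "\<dots> = p \<cdot> (mult A \<cdot> ((\<I> ?X \<boxtimes> antipode A) \<cdot> comult A))" unfolding mp by simp
    also have "\<dots> = ((p \<cdot> munit A) \<cdot> counit Q) \<cdot> p" unfolding antipode_right by (simp add: ep)
    finally show "(mQ \<cdot> ((\<I> ?Y \<boxtimes> SQ) \<cdot> comult Q)) \<cdot> p = ((p \<cdot> munit A) \<cdot> counit Q) \<cdot> p" .
  qed simp_all
  show "coc_hopf_monoid C H"
    using HQ 1 2 3 4 5 6 7 8 9 by (simp add: coc_hopf_monoid_def monoid_object_def H_def)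
  show "hopf_morphism C A H p"
    using p mp by (simp add: hopf_morphism_iff H_def cmor_def pair_def)
qed

end

context sub_hopf_map
begin

text \<open>Normality is expressed on elements, by a conjugate lying in \<open>K\<close> at every
  stage. The stage has the plain record type because a definition cannot quantify over record
  extensions.\<close>

definition normal :: bool where
  "normal \<longleftrightarrow> (\<forall>(X :: ('o, 'm) comonoid) b k. coc_comonoid C X \<longrightarrow> cmor X A b \<longrightarrow> cmor X K k \<longrightarrow>
     (\<exists>k'. cmor X K k' \<and> i \<cdot> k' = mult A \<cdot> pair X (antipode A \<cdot> b) (mult A \<cdot> pair X (i \<cdot> k) b)))"

text \<open>a k b = (a b) (b^-1 k b), and an invariant arrow absorbs the last factor.\<close>

lemma normal_invariant:
  assumes n: "normal" and h: "invariant h" and X: "coc_comonoid C X" and a: "cmor X A a" and b: "cmor X A b" and k: "cmor X K k"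
  shows "h \<cdot> (mult A \<cdot> pair X a (mult A \<cdot> pair X (i \<cdot> k) b)) = h \<cdot> (mult A \<cdot> pair X a b)"
proof -
  \<comment> \<open>\<open>normal\<close> speaks of plain comonoid records, so the extra fields of
    \<open>X\<close> are dropped; elements and pairs do not change.\<close>
  let ?X = "comonoid.truncate X"
  have X': "coc_comonoid C ?X" using X by (simp add: coc_comonoid_def comonoid.truncate_def)
  have c: "cmor ?X A' x \<longleftrightarrow> cmor X A' x" for A' :: "('o, 'm) hopf" and x
    by (simp add: cmor_def pair_def comonoid.truncate_def)
  have pr: "pair ?X x y = pair X x y" for x y
    by (simp add: pair_def comonoid.truncate_def)
  obtain k' where k': "cmor X K k'" and ik': "i \<cdot> k' = mult A \<cdot> pair X (antipode A \<cdot> b) (mult A \<cdot> pair X (i \<cdot> k) b)"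
    using n X' b k unfolding normal_def by (metis c pr)
  interpret hopf_source C X A by unfold_locales (rule X)
  note [simp] = a b cmorD(1-3)[OF a] cmorD(1-3)[OF b] cmorD(1-3)[OF k] i_element[OF X k]
  have "h \<cdot> (mult A \<cdot> pair X (mult A \<cdot> pair X a b) (i \<cdot> k')) = h \<cdot> (mult A \<cdot> pair X a b)"
    by (rule invariant_pair[OF h X k']) simp_all
  then show ?thesis unfolding ik' by simp
qed

text \<open>The multiplication of the quotient is its action with the acting argument passed to the
  quotient, which is possible since a k b and a b have the same image. Inverses descend because (a
  k)^-1 = k^-1 a^-1, and normality lets the leading factor be dropped.\<close>

lemma hopf_quotient:
  assumes p: "is_coequalizer C translate translate0 p" and n: "normal"
  obtains H where "coc_hopf_monoid C H" "hopf_morphism C A H p"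
proof -
  let ?X = "carr A"
  obtain Q :: "('o, 'm) modcomon" where cQ: "carr Q = Cod C p" and Q: "module_comonoid C A Q" and pQ: "modcomon_morphism C A (regular_module A) Q p"
    by (rule quotient_structure[OF p])
  have re: "regular_epi C p" using p by (auto simp: regular_epi_def)
  have inv: "invariant p" using coequalizerD[OF p] by (simp add: invariant_def)
  note QD = module_comonoidD[OF Q]
  have p': "cmor A Q p" using pQ by (simp add: modcomon_morphism_iff regular_module_cmor)
  interpret M: module_map C A Q p "act Q"
    by unfold_locales (use QD p' pQ in \<open>simp_all add: modcomon_morphism_iff\<close>)
  have "act Q \<cdot> (translate \<boxtimes> \<I> (carr Q)) = act Q \<cdot> (translate0 \<boxtimes> \<I> (carr Q))"
  proof (rule regular_epi_cancel[OF ten_regular_epi(1)[OF re]])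
    show "?X \<otimes> carr K \<in> Obj C" by simp
    show "(act Q \<cdot> (translate \<boxtimes> \<I> (carr Q))) \<cdot> (\<I> (?X \<otimes> carr K) \<boxtimes> p) = (act Q \<cdot> (translate0 \<boxtimes> \<I> (carr Q))) \<cdot> (\<I> (?X \<otimes> carr K) \<boxtimes> p)"
    proof (rule element_ext3[OF coc K.coc coc involutive_K(2) involutive_self involutive_K(1)])
      fix X :: "('o, 'm) comonoid" and a k b
      assume X: "coc_comonoid C X" and a: "cmor X A a" and k: "cmor X K k" and b: "cmor X A b"
      interpret hopf_source C X A by unfold_locales (rule X)
      note [simp] = a b cmorD(1-3)[OF a] cmorD(1-3)[OF b] cmorD(1-3)[OF k] i_element[OF X k]
      show "((act Q \<cdot> (translate \<boxtimes> \<I> (carr Q))) \<cdot> (\<I> (?X \<otimes> carr K) \<boxtimes> p)) \<cdot> pair X (pair X a k) b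
          = ((act Q \<cdot> (translate0 \<boxtimes> \<I> (carr Q))) \<cdot> (\<I> (?X \<otimes> carr K) \<boxtimes> p)) \<cdot> pair X (pair X a k) b"
        by (simp add: translate_pair[OF X k] M.mu_pair[OF X] normal_invariant[OF n inv X a b k])
    qed simp_all
  qed simp_all
  then obtain mQ where mQ [simp]: "mQ \<in> Arr C" "Dom C mQ = carr Q \<otimes> carr Q" "Cod C mQ = carr Q" and mp: "mQ \<cdot> (p \<boxtimes> \<I> (carr Q)) = act Q"
    by (rule coequalizer_factor[OF ten_coequalizer(2)[OF p QD(1)[THEN coc_comonoidD(1)]], rotated 2]) simp_all
  have "mQ \<cdot> (p \<boxtimes> p) = (mQ \<cdot> (p \<boxtimes> \<I> (carr Q))) \<cdot> (\<I> ?X \<boxtimes> p)" by simp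
  also have "\<dots> = p \<cdot> mult A" unfolding mp by (rule M.linear[symmetric])
  finally have mpp: "mQ \<cdot> (p \<boxtimes> p) = p \<cdot> mult A" .
  have "invariant (p \<cdot> antipode A)"
  proof (rule invariantI)
    fix X :: "('o, 'm) comonoid" and a k
    assume X: "coc_comonoid C X" and a: "cmor X A a" and k: "cmor X K k"
    interpret hopf_source C X A by unfold_locales (rule X)
    interpret XK: hopf_source C X K by unfold_locales
    note [simp] = a k cmorD(1-3)[OF a] cmorD(1-3)[OF k] i_element[OF X k]
    have S: "antipode A \<cdot> (i \<cdot> k) = i \<cdot> (antipode K \<cdot> k)"
      by (rule hopf_morphism_antipode[OF X K hopf i k, symmetric])
    \<comment> \<open>\<open>normal_invariant\<close> removes an inner factor from \<open>K\<close>;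
      a leading one is handled by putting 1 in front.\<close>
    have "p \<cdot> (mult A \<cdot> pair X (munit A \<cdot> counit X) (mult A \<cdot> pair X (i \<cdot> (antipode K \<cdot> k)) (antipode A \<cdot> a))) = p \<cdot> (mult A \<cdot> pair X (munit A \<cdot> counit X) (antipode A \<cdot> a))"
      by (rule normal_invariant[OF n inv X]) simp_all
    then have "p \<cdot> (mult A \<cdot> pair X (i \<cdot> (antipode K \<cdot> k)) (antipode A \<cdot> a)) = p \<cdot> (antipode A \<cdot> a)"
      by simp
    then show "(p \<cdot> antipode A) \<cdot> (mult A \<cdot> pair X a (i \<cdot> k)) = (p \<cdot> antipode A) \<cdot> a"
      by (simp add: S)
  qed simp_all
  then have "(p \<cdot> antipode A) \<cdot> translate = (p \<cdot> antipode A) \<cdot> translate0"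
    by (simp add: invariant_def)
  then obtain SQ where "SQ \<in> Arr C" "Dom C SQ = carr Q" "Cod C SQ = carr Q" "SQ \<cdot> p = p \<cdot> antipode A"
    by (rule coequalizer_factor[OF p, rotated 2]) simp_all
  then show thesis
    using quotient_hopf[OF QD(1) p' re mQ _ _ _ mpp] that by blast
qed

end

section \<open>Kernels and regular epimorphisms of cocommutative Hopf monoids\<close>

context category
begin

lemma equalizer_unique:
  assumes e: "is_equalizer C f g e" and e': "is_equalizer C f g e'"
  obtains h h' where "h \<in> Arr C" "Dom C h = Dom C e'" "Cod C h = Dom C e" "e \<cdot> h = e'"
    "h' \<in> Arr C" "Dom C h' = Dom C e" "Cod C h' = Dom C e'" "e' \<cdot> h' = e"
    "h \<cdot> h' = \<I> (Dom C e)" "h' \<cdot> h = \<I> (Dom C e')"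
proof -
  note eD = equalizerD[OF e] and eD' = equalizerD[OF e']
  note [simp] = eD(1-6) eD'(5,6)
  obtain h where h [simp]: "h \<in> Arr C" "Dom C h = Dom C e'" "Cod C h = Dom C e" and eh: "e \<cdot> h = e'"
    by (rule equalizer_factor[OF e, of e']) (use eD'(7) in auto)
  obtain h' where h' [simp]: "h' \<in> Arr C" "Dom C h' = Dom C e" "Cod C h' = Dom C e'" and eh': "e' \<cdot> h' = e"
    by (rule equalizer_factor[OF e', of e]) (use eD(7) in auto)
  have e1: "e \<cdot> (h \<cdot> h') = e"
    using comp_reduce[OF eh, of h'] eh' by simp
  have 1: "h \<cdot> h' = \<I> (Dom C e)" by (rule equalizer_mono[OF e]) (simp_all add: e1)
  have e2: "e' \<cdot> (h' \<cdot> h) = e'"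
    using comp_reduce[OF eh', of h] eh by simp
  have 2: "h' \<cdot> h = \<I> (Dom C e')" by (rule equalizer_mono[OF e']) (simp_all add: e2)
  show thesis using that[of h h'] eh eh' 1 2 by simp
qed

lemma coequalizer_unique:
  assumes q: "is_coequalizer C f g q" and q': "is_coequalizer C f g q'"
  obtains h h' where "h \<in> Arr C" "Dom C h = Cod C q" "Cod C h = Cod C q'" "h \<cdot> q = q'"
    "h' \<in> Arr C" "Dom C h' = Cod C q'" "Cod C h' = Cod C q" "h' \<cdot> q' = q"
    "h' \<cdot> h = \<I> (Cod C q)" "h \<cdot> h' = \<I> (Cod C q')"
proof -
  note qD = coequalizerD[OF q] and qD' = coequalizerD[OF q']
  note [simp] = qD(1-6) qD'(5,6)
  obtain h where h [simp]: "h \<in> Arr C" "Dom C h = Cod C q" "Cod C h = Cod C q'" and hq: "h \<cdot> q = q'"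
    by (rule coequalizer_factor[OF q, of q']) (use qD'(7) in auto)
  obtain h' where h' [simp]: "h' \<in> Arr C" "Dom C h' = Cod C q'" "Cod C h' = Cod C q" and hq': "h' \<cdot> q' = q"
    by (rule coequalizer_factor[OF q', of q]) (use qD(7) in auto)
  have 1: "h' \<cdot> h = \<I> (Cod C q)" by (rule coequalizer_epi[OF q]) (simp_all add: hq hq')
  have 2: "h \<cdot> h' = \<I> (Cod C q')" by (rule coequalizer_epi[OF q']) (simp_all add: hq hq')
  show thesis using that[of h h'] hq hq' 1 2 by simp
qed

lemma equalizer_iso:
  assumes e: "is_equalizer C f g e" and h: "iso_arrow C h" "Cod C h = Dom C e"
  shows "is_equalizer C f g (e \<cdot> h)"
proof -
  note eD = equalizerD[OF e]
  note [simp] = eD(1-6) iso_arr[OF h(1)] h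
  have 1: "f \<cdot> (e \<cdot> h) = g \<cdot> (e \<cdot> h)" by (rule comp_swap[OF eD(7)]) simp_all
  have 2: "\<exists>!k. k \<in> hom C (Dom C y) (Dom C (e \<cdot> h)) \<and> (e \<cdot> h) \<cdot> k = y"
    if y [simp]: "y \<in> Arr C" and y': "Cod C y = Dom C f" "f \<cdot> y = g \<cdot> y" for y
  proof -
    obtain k where k [simp]: "k \<in> Arr C" "Dom C k = Dom C y" "Cod C k = Dom C e" and ek: "e \<cdot> k = y"
      by (rule equalizer_factor[OF e y y'])
    show ?thesis
    proof (intro ex1I[of _ "inv_arrow C h \<cdot> k"] conjI)
      show "(e \<cdot> h) \<cdot> (inv_arrow C h \<cdot> k) = y" using ek by simp
      fix x assume x: "x \<in> hom C (Dom C y) (Dom C (e \<cdot> h)) \<and> (e \<cdot> h) \<cdot> x = y"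
      then have [simp]: "x \<in> Arr C" "Dom C x = Dom C y" "Cod C x = Dom C h" by auto
      have "h \<cdot> x = k" by (rule equalizer_mono[OF e]) (use x ek in simp_all)
      then show "x = inv_arrow C h \<cdot> k" by auto
    qed simp
  qed
  show ?thesis unfolding is_equalizer_def using 1 2 by (simp add: parallel_iff del: comp_assoc)
qed

lemma coequalizer_iso:
  assumes q: "is_coequalizer C f g q" and h: "iso_arrow C h" "Dom C h = Cod C q"
  shows "is_coequalizer C f g (h \<cdot> q)"
proof -
  note qD = coequalizerD[OF q]
  note [simp] = qD(1-6) iso_arr[OF h(1)] h
  have 1: "(h \<cdot> q) \<cdot> f = (h \<cdot> q) \<cdot> g" using qD(7) by simp
  have 2: "\<exists>!k. k \<in> hom C (Cod C (h \<cdot> q)) (Cod C y) \<and> k \<cdot> (h \<cdot> q) = y"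
    if y [simp]: "y \<in> Arr C" and y': "Dom C y = Cod C f" "y \<cdot> f = y \<cdot> g" for y
  proof -
    obtain k where k [simp]: "k \<in> Arr C" "Dom C k = Cod C q" "Cod C k = Cod C y" and kq: "k \<cdot> q = y"
      by (rule coequalizer_factor[OF q y y'])
    show ?thesis
    proof (intro ex1I[of _ "k \<cdot> inv_arrow C h"] conjI)
      show "(k \<cdot> inv_arrow C h) \<cdot> (h \<cdot> q) = y" using kq by simp
      fix x assume x: "x \<in> hom C (Cod C (h \<cdot> q)) (Cod C y) \<and> x \<cdot> (h \<cdot> q) = y"
      then have [simp]: "x \<in> Arr C" "Dom C x = Cod C h" "Cod C x = Cod C y" by auto
      have "x \<cdot> h = k" by (rule coequalizer_epi[OF q]) (use x kq in simp_all)
      then show "x = k \<cdot> inv_arrow C h" by auto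
    qed simp
  qed
  show ?thesis unfolding is_coequalizer_def using 1 2 by (simp add: parallel_iff del: comp_assoc)
qed

end

section \<open>The category of cocommutative Hopf monoids\<close>

context braided_monoidal_category
begin

lemma Hopf_coc_simps [simp]:
  "A \<in> Obj (Hopf_coc C) \<longleftrightarrow> coc_hopf_monoid C A"
  "(A, f, B) \<in> Arr (Hopf_coc C) \<longleftrightarrow> coc_hopf_monoid C A \<and> coc_hopf_monoid C B \<and> hopf_morphism C A B f"
  "Dom (Hopf_coc C) (A, f, B) = A" "Cod (Hopf_coc C) (A, f, B) = B"
  "Ident (Hopf_coc C) A = (A, \<I> (carr A), A)"
  "Comp (Hopf_coc C) (B', g, D) (A, f, B) = (A, g \<cdot> f, D)"
  by (simp_all add: Hopf_coc_def)

lemma hopf_morphism_ident: "coc_hopf_monoid C A \<Longrightarrow> hopf_morphism C A A (\<I> (carr A))"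
proof -
  assume A: "coc_hopf_monoid C A"
  interpret coc_hopf C A by (rule coc_hopfI[OF A])
  show ?thesis by (simp add: hopf_morphism_iff cmor_ident[OF coc])
qed

lemma hopf_morphism_comp:
  assumes A: "coc_hopf_monoid C A" and B: "coc_hopf_monoid C B" and D: "coc_hopf_monoid C D"
    and f: "hopf_morphism C A B f" and g: "hopf_morphism C B D g"
  shows "hopf_morphism C A D (g \<cdot> f)"
proof -
  interpret A: coc_hopf C A by (rule coc_hopfI[OF A])
  interpret B: coc_hopf C B by (rule coc_hopfI[OF B])
  interpret D: coc_hopf C D by (rule coc_hopfI[OF D])
  have f': "cmor A B f" "f \<cdot> mult A = mult B \<cdot> (f \<boxtimes> f)" "f \<cdot> munit A = munit B"
    and g': "cmor B D g" "g \<cdot> mult B = mult D \<cdot> (g \<boxtimes> g)" "g \<cdot> munit B = munit D"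
    using f g by (auto simp: hopf_morphism_iff)
  note [simp] = cmorD(1-3)[OF f'(1)] cmorD(1-3)[OF g'(1)]
  have "(g \<cdot> f) \<cdot> mult A = (g \<cdot> mult B) \<cdot> (f \<boxtimes> f)" using f'(2) by simp
  then have "(g \<cdot> f) \<cdot> mult A = mult D \<cdot> ((g \<cdot> f) \<boxtimes> (g \<cdot> f))" unfolding g'(2) by simp
  moreover have "(g \<cdot> f) \<cdot> munit A = munit D" using f'(3) g'(3) by simp
  ultimately show ?thesis
    unfolding hopf_morphism_iff using cmor_comp[OF A.coc B.coc D.coc f'(1) g'(1)] by blast
qed

lemma hopf_zero:
  assumes A: "coc_hopf_monoid C A" and B: "coc_hopf_monoid C B"
  shows "hopf_morphism C A B (munit B \<cdot> counit A)"
proof -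
  interpret A: coc_hopf C A by (rule coc_hopfI[OF A])
  interpret B: hopf_source C A B using A.coc B by unfold_locales
  have "(munit B \<cdot> counit A) \<cdot> mult A = munit B \<cdot> (\<lambda>\<^bold>l \<one> \<cdot> (counit A \<boxtimes> counit A))"
    using A.counit_mult by simp
  also have "\<dots> = (\<lambda>\<^bold>l (carr B) \<cdot> (\<I> \<one> \<boxtimes> munit B)) \<cdot> (counit A \<boxtimes> counit A)"
    by (subst LUnit_natural) simp_all
  also have "\<dots> = mult B \<cdot> ((munit B \<cdot> counit A) \<boxtimes> (munit B \<cdot> counit A))"
    unfolding B.unit_left[symmetric] by simp
  finally show ?thesis
    using A.counit_unit by (simp add: hopf_morphism_iff)
qed

lemma category_Hopf_coc: "category (Hopf_coc C)"
proof
  fix f assume "f \<in> Arr (Hopf_coc C)"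
  then show "Dom (Hopf_coc C) f \<in> Obj (Hopf_coc C)" "Cod (Hopf_coc C) f \<in> Obj (Hopf_coc C)" by (cases f; simp)+
next
  fix X assume "X \<in> Obj (Hopf_coc C)"
  then show "Ident (Hopf_coc C) X \<in> hom (Hopf_coc C) X X" by (simp add: hom_def hopf_morphism_ident)
next
  fix f g X Y Z assume "f \<in> hom (Hopf_coc C) X Y" "g \<in> hom (Hopf_coc C) Y Z"
  then show "Comp (Hopf_coc C) g f \<in> hom (Hopf_coc C) X Z"
    by (cases f; cases g) (auto simp: hom_def intro: hopf_morphism_comp)
next
  fix f X Y assume "f \<in> hom (Hopf_coc C) X Y"
  then show "Comp (Hopf_coc C) f (Ident (Hopf_coc C) X) = f" "Comp (Hopf_coc C) (Ident (Hopf_coc C) Y) f = f"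
    by (cases f; auto simp: hom_def hopf_morphism_iff cmor_def)+
next
  fix f g h W X Y Z assume "f \<in> hom (Hopf_coc C) W X" "g \<in> hom (Hopf_coc C) X Y" "h \<in> hom (Hopf_coc C) Y Z"
  then show "Comp (Hopf_coc C) h (Comp (Hopf_coc C) g f) = Comp (Hopf_coc C) (Comp (Hopf_coc C) h g) f"
    by (cases f; cases g; cases h) (auto simp: hom_def hopf_morphism_iff cmor_def)
qed

lemma hopf_isoD:
  assumes "iso_arrow (Hopf_coc C) (A, f, B)"
  shows "coc_hopf_monoid C A" "coc_hopf_monoid C B" "hopf_morphism C A B f" "iso_arrow C f"
proof -
  obtain g where g: "inverse_arrows (Hopf_coc C) (A, f, B) g" using assms by (auto simp: iso_arrow_def)
  then obtain g' where g': "g = (B, g', A)" by (cases g) (auto simp: inverse_arrows_def hom_def)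
  show "coc_hopf_monoid C A" "coc_hopf_monoid C B" "hopf_morphism C A B f"
    using g by (auto simp: inverse_arrows_def)
  show "iso_arrow C f"
    using g unfolding g' by (intro iso_arrowI[where g = g']) (auto simp: inverse_arrows_def hom_def hopf_morphism_iff cmor_def)
qed

lemma hopf_isoI:
  assumes "coc_hopf_monoid C A" "coc_hopf_monoid C B" "hopf_morphism C A B f" "hopf_morphism C B A g"
    "g \<cdot> f = \<I> (carr A)" "f \<cdot> g = \<I> (carr B)"
  shows "iso_arrow (Hopf_coc C) (A, f, B)"
  unfolding iso_arrow_def using assms by (intro exI[of _ "(B, g, A)"]) (simp add: inverse_arrows_def hom_def)

end

context exact_braided
begin

text \<open>Upgrades factorizations found in M: the multiplication and the unit are compared after
  the regular monomorphism \<open>i\<close>.\<close>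

lemma hopf_factor_mono:
  assumes L: "coc_hopf_monoid C L" and K: "coc_hopf_monoid C K" and A: "coc_hopf_monoid C A"
    and i: "hopf_morphism C K A i" "regular_mono i" and h: "hopf_morphism C L A (i \<cdot> k)" and k: "k \<in> Arr C" "Dom C k = carr L" "Cod C k = carr K"
  shows "hopf_morphism C L K k"
proof -
  interpret L: coc_hopf C L by (rule coc_hopfI[OF L])
  interpret K: coc_hopf C K by (rule coc_hopfI[OF K])
  interpret A: coc_hopf C A by (rule coc_hopfI[OF A])
  have i': "cmor K A i" "i \<cdot> mult K = mult A \<cdot> (i \<boxtimes> i)" "i \<cdot> munit K = munit A"
    and h': "cmor L A (i \<cdot> k)" "(i \<cdot> k) \<cdot> mult L = mult A \<cdot> ((i \<cdot> k) \<boxtimes> (i \<cdot> k))" "(i \<cdot> k) \<cdot> munit L = munit A"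
    using i h by (auto simp: hopf_morphism_iff)
  note [simp] = cmorD(1-3)[OF i'(1)] k
  have 1: "cmor L K k" by (rule cmor_factor_mono[OF L.coc K.coc i'(1) i(2) A.coc h'(1) k])
  have 2: "k \<cdot> mult L = mult K \<cdot> (k \<boxtimes> k)"
  proof (rule regular_mono_cancel[OF i(2)])
    have "i \<cdot> (k \<cdot> mult L) = mult A \<cdot> ((i \<boxtimes> i) \<cdot> (k \<boxtimes> k))" using h'(2) by simp
    also have "\<dots> = i \<cdot> (mult K \<cdot> (k \<boxtimes> k))" by (rule comp_swap[OF i'(2), symmetric]) simp_all
    finally show "i \<cdot> (k \<cdot> mult L) = i \<cdot> (mult K \<cdot> (k \<boxtimes> k))" .
  qed simp_all
  have 3: "k \<cdot> munit L = munit K"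
    by (rule regular_mono_cancel[OF i(2)]) (use h'(3) i'(3) in simp_all)
  show ?thesis using 1 2 3 by (simp add: hopf_morphism_iff)
qed

text \<open>Compatibility with multiplication is tested on \<open>p \<boxtimes> p\<close>, which can
  be cancelled since tensoring preserves coequalizers.\<close>

lemma hopf_factor_epi:
  assumes L: "coc_hopf_monoid C L" and Q: "coc_hopf_monoid C Q" and A: "coc_hopf_monoid C A"
    and p: "hopf_morphism C A Q p" "regular_epi C p" and h: "hopf_morphism C A L (k \<cdot> p)" and k: "k \<in> Arr C" "Dom C k = carr Q" "Cod C k = carr L"
  shows "hopf_morphism C Q L k"
proof -
  interpret L: coc_hopf C L by (rule coc_hopfI[OF L])
  interpret Q: coc_hopf C Q by (rule coc_hopfI[OF Q])
  interpret A: coc_hopf C A by (rule coc_hopfI[OF A])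
  have p': "cmor A Q p" "p \<cdot> mult A = mult Q \<cdot> (p \<boxtimes> p)" "p \<cdot> munit A = munit Q"
    and h': "cmor A L (k \<cdot> p)" "(k \<cdot> p) \<cdot> mult A = mult L \<cdot> ((k \<cdot> p) \<boxtimes> (k \<cdot> p))" "(k \<cdot> p) \<cdot> munit A = munit L"
    using p h by (auto simp: hopf_morphism_iff)
  note [simp] = cmorD(1-3)[OF p'(1)] k
  have 1: "cmor Q L k" by (rule cmor_factor_epi[OF A.coc Q.coc L.coc p'(1) p(2) h'(1) k])
  have 2: "k \<cdot> mult Q = mult L \<cdot> (k \<boxtimes> k)"
  proof (rule ten_epi_cancel[OF p(2) p(2)])
    have "(k \<cdot> mult Q) \<cdot> (p \<boxtimes> p) = k \<cdot> (p \<cdot> mult A)" unfolding p'(2) by simp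
    then show "(k \<cdot> mult Q) \<cdot> (p \<boxtimes> p) = (mult L \<cdot> (k \<boxtimes> k)) \<cdot> (p \<boxtimes> p)" using h'(2) by simp
  qed simp_all
  have 3: "k \<cdot> munit Q = munit L"
    unfolding p'(3)[symmetric] using h'(3) by simp
  show ?thesis using 1 2 3 by (simp add: hopf_morphism_iff)
qed

end

section \<open>Kernels of Hopf monoid morphisms\<close>

locale hopf_map = exact_hopf C A for C :: "('o, 'm) braided_cat" (structure) and A :: "('o, 'm) hopf" +
  fixes B :: "('o, 'm) hopf" and f :: 'm
  assumes B: "coc_hopf_monoid C B" and f: "hopf_morphism C A B f"
begin

sublocale B: coc_hopf C B by (rule coc_hopfI[OF B])

lemma f_cmor: "cmor A B f"
  using f by (simp add: hopf_morphism_iff)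

text \<open>\<open>A\<close> acts on \<open>B\<close> through \<open>f\<close> and left
  multiplication, so that kernels of Hopf morphisms fall under the equalizers already studied for
  linear maps.\<close>

sublocale module_map C A B f "mult B \<cdot> (f \<boxtimes> \<I> (carr B))"
  using f cmorD(1-3)[OF f_cmor] by unfold_locales (simp_all add: hopf_morphism_iff B.coc)

lemma f_unit: "x \<in> Arr C \<Longrightarrow> Cod C x = \<one> \<Longrightarrow> f \<cdot> (munit A \<cdot> x) = munit B \<cdot> x"
  by (rule hopf_morphism_unit[OF hopf f])

text \<open>For a Hopf morphism into \<open>A\<close>, being killed by \<open>f\<close> is the
  pointwise condition of \<open>kernel_element\<close>, and the factorization obtained in M is
  automatically a Hopf morphism.\<close>

lemma kernelI:
  assumes K: "coc_hopf_monoid C K" and i: "hopf_morphism C K A i" and eq: "is_equalizer C coact coact0 i"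
  shows "is_kernel C (A, f, B) (K, i, A)"
proof -
  interpret K: coc_hopf C K by (rule coc_hopfI[OF K])
  have i': "cmor K A i" using i by (simp add: hopf_morphism_iff)
  note [simp] = cmorD[OF i']
  have rm: "regular_mono i" using eq by (auto simp: regular_mono_def)
  have fi: "f \<cdot> i = (munit B \<cdot> counit A) \<cdot> i"
    using kernel_trivial[OF eq K.coc i'] by (simp add: f_unit)
  have "\<exists>!k. k \<in> hom (Hopf_coc C) (Dom (Hopf_coc C) h) K \<and> Comp (Hopf_coc C) (K, i, A) k = h"
    if h: "h \<in> Arr (Hopf_coc C)" "Cod (Hopf_coc C) h = A" "Comp (Hopf_coc C) (A, f, B) h = Comp (Hopf_coc C) (A, munit B \<cdot> counit A, B) h" for h
  proof -
    obtain L h' where h': "h = (L, h', A)" "coc_hopf_monoid C L" "hopf_morphism C L A h'"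
      using h by (cases h) auto
    interpret L: coc_hopf C L by (rule coc_hopfI[OF h'(2)])
    have hc: "cmor L A h'" using h'(3) by (simp add: hopf_morphism_iff)
    note [simp] = cmorD[OF hc]
    have "f \<cdot> h' = f \<cdot> (munit A \<cdot> counit L)"
      using h(3) by (simp add: h' f_unit)
    then obtain k where k: "cmor L K k" "i \<cdot> k = h'"
      by (rule kernel_element[OF eq K.coc i' L.coc hc])
    have kh: "hopf_morphism C L K k"
      by (rule hopf_factor_mono[OF h'(2) K hopf i rm]) (use k h' cmorD(1-3)[OF k(1)] in simp_all)
    show ?thesis
    proof (intro ex1I[of _ "(L, k, K)"] conjI)
      fix y assume y: "y \<in> hom (Hopf_coc C) (Dom (Hopf_coc C) h) K \<and> Comp (Hopf_coc C) (K, i, A) y = h"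
      then obtain y' where y': "y = (L, y', K)" "hopf_morphism C L K y'" "i \<cdot> y' = h'"
        by (cases y) (auto simp: hom_def h')
      have yc: "cmor L K y'" using y'(2) by (simp add: hopf_morphism_iff)
      have "y' = k"
        by (rule regular_mono_cancel[OF rm]) (use y'(3) k cmorD(1-3)[OF yc] cmorD(1-3)[OF k(1)] in simp_all)
      then show "y = (L, k, K)" using y' by simp
    qed (use kh K h' k in \<open>simp_all add: hom_def\<close>)
  qed
  then show ?thesis
    using fi hopf B K f i hopf_zero[OF hopf B]
    by (simp add: is_kernel_def Let_def is_equalizer_def parallel_def)
qed

text \<open>The equalizer formed in M is also a kernel, so a given kernel differs from it by an
  isomorphism of Hopf monoids, which is one in M.\<close>

lemma kernelD:
  assumes k: "is_kernel C (A, f, B) (K, i, A)"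
  shows "coc_hopf_monoid C K" "hopf_morphism C K A i" "is_equalizer C coact coact0 i"
proof -
  interpret H: category "Hopf_coc C" by (rule category_Hopf_coc)
  have e: "is_equalizer (Hopf_coc C) (A, f, B) (A, munit B \<cdot> counit A, B) (K, i, A)"
    using k by (simp add: is_kernel_def Let_def)
  show K: "coc_hopf_monoid C K" and i: "hopf_morphism C K A i"
    using H.equalizerD(5)[OF e] by simp_all
  have "parallel C coact coact0" by (simp add: parallel_iff)
  then obtain j where j: "is_equalizer C coact coact0 j"
    using eqs unfolding has_equalizers_def by blast
  obtain L where L: "coc_hopf_monoid C L" "hopf_morphism C L A j" by (rule kernel_hopf[OF j])
  have "is_kernel C (A, f, B) (L, j, A)" by (rule kernelI[OF L j])
  then have e': "is_equalizer (Hopf_coc C) (A, f, B) (A, munit B \<cdot> counit A, B) (L, j, A)"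
    by (simp add: is_kernel_def Let_def)
  obtain h h' where h: "h \<in> Arr (Hopf_coc C)" "Dom (Hopf_coc C) h = K" "Cod (Hopf_coc C) h = L"
      "Comp (Hopf_coc C) (L, j, A) h = (K, i, A)"
    and h': "h' \<in> Arr (Hopf_coc C)" "Dom (Hopf_coc C) h' = L" "Cod (Hopf_coc C) h' = K"
    and hh': "Comp (Hopf_coc C) h h' = Ident (Hopf_coc C) L" "Comp (Hopf_coc C) h' h = Ident (Hopf_coc C) K"
    by (rule H.equalizer_unique[OF e' e]) (simp only: Hopf_coc_simps; blast)
  obtain x where x: "h = (K, x, L)" "j \<cdot> x = i" using h by (cases h) auto
  obtain y where y: "h' = (L, y, K)" using h' by (cases h') auto
  have "iso_arrow (Hopf_coc C) (K, x, L)"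
    by (rule hopf_isoI[where g = y]) (use h h' hh' x y in simp_all)
  then have "iso_arrow C x" by (rule hopf_isoD)
  moreover have "Cod C x = Dom C j" using h L(2) by (simp add: x hopf_morphism_iff cmor_def)
  ultimately show "is_equalizer C coact coact0 i"
    using equalizer_iso[OF j] x by auto
qed

lemma kernel_sub_hopf_map:
  "coc_hopf_monoid C K \<Longrightarrow> hopf_morphism C K A i \<Longrightarrow> is_equalizer C coact coact0 i \<Longrightarrow> sub_hopf_map C A K i"
  by unfold_locales (auto simp: regular_mono_def)

text \<open>f(b^-1 k b) = f(b)^-1 f(b) = 1, so the conjugate lies in the kernel at every
  stage.\<close>

lemma kernel_normal:
  assumes K: "coc_hopf_monoid C K" and i: "hopf_morphism C K A i" and eq: "is_equalizer C coact coact0 i"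
  shows "sub_hopf_map.normal C A K i"
proof -
  interpret S: sub_hopf_map C A K i by (rule kernel_sub_hopf_map[OF assms])
  have "\<exists>k'. cmor X K k' \<and> i \<cdot> k' = mult A \<cdot> pair X (antipode A \<cdot> b) (mult A \<cdot> pair X (i \<cdot> k) b)"
    if X: "coc_comonoid C X" and b: "cmor X A b" and k: "cmor X K k" for X :: "('o, 'm) comonoid" and b k
  proof -
    interpret hopf_source C X A by unfold_locales (rule X)
    interpret XB: hopf_source C X B by unfold_locales
    let ?c = "mult A \<cdot> pair X (antipode A \<cdot> b) (mult A \<cdot> pair X (i \<cdot> k) b)"
    note [simp] = b k cmorD(1-3)[OF b] cmorD(1-3)[OF k] S.i_element[OF X k]
    have fb [simp]: "cmor X B (f \<cdot> b)" by (rule cmor_comp[OF X coc B.coc b f_cmor])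
    have "f \<cdot> (i \<cdot> k) = (f \<cdot> (munit A \<cdot> counit K)) \<cdot> k"
      unfolding kernel_trivial[OF eq S.K.coc S.i_cmor, symmetric] by simp
    then have fik [simp]: "f \<cdot> (i \<cdot> k) = munit B \<cdot> counit X" by (simp add: f_unit)
    have "f \<cdot> ?c = f \<cdot> (munit A \<cdot> counit X)"
      by (simp add: hopf_morphism_mul[OF X hopf B f] hopf_morphism_antipode[OF X hopf B f] f_unit)
    then obtain k' where "cmor X K k'" "i \<cdot> k' = ?c"
      by (rule kernel_element[OF eq S.K.coc S.i_cmor X, rotated]) simp_all
    then show ?thesis by auto
  qed
  then show ?thesis unfolding S.normal_def by blast
qed

text \<open>\<open>f\<close> factors through \<open>p\<close>, so an arrow equalizing the pair of
  \<open>p\<close> also equalizes the pair of \<open>f\<close> and hence factors through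
  \<open>i\<close>; and \<open>i\<close> itself equalizes the pair of \<open>p\<close>. Thus psi
  returns the kernel from its quotient.\<close>

lemma kernel_equalizer_quotient:
  assumes K: "coc_hopf_monoid C K" and i: "hopf_morphism C K A i" and eq: "is_equalizer C coact coact0 i"
    and p: "is_coequalizer C (sub_hopf_map.translate C A i) (sub_hopf_map.translate0 C A K) p"
  shows "is_equalizer C ((p \<boxtimes> \<I> (carr A)) \<cdot> comult A) (((p \<cdot> munit A) \<boxtimes> \<I> (carr A)) \<cdot> inv_arrow C (\<lambda>\<^bold>l (carr A))) i"
proof -
  interpret S: sub_hopf_map C A K i by (rule kernel_sub_hopf_map[OF K i eq])
  let ?X = "carr A"
  let ?j = "(p \<boxtimes> \<I> ?X) \<cdot> comult A" and ?z = "((p \<cdot> munit A) \<boxtimes> \<I> ?X) \<cdot> inv_arrow C (\<lambda>\<^bold>l ?X)"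
  note pD = coequalizerD[OF p]
  have [simp]: "p \<in> Arr C" "Dom C p = ?X" using pD(5,6) by simp_all
  have inv: "S.invariant p" using pD(7) by (simp add: S.invariant_def)
  have "S.invariant f"
  proof (rule S.invariantI)
    fix X :: "('o, 'm) comonoid" and a k
    assume X: "coc_comonoid C X" and a: "cmor X A a" and k: "cmor X K k"
    interpret XB: hopf_source C X B by unfold_locales (rule X)
    note [simp] = a k cmorD(1-3)[OF a] cmorD(1-3)[OF k] S.i_element[OF X k]
    have "f \<cdot> (i \<cdot> k) = (f \<cdot> (munit A \<cdot> counit K)) \<cdot> k"
      unfolding kernel_trivial[OF eq S.K.coc S.i_cmor, symmetric] by simp
    then have fik [simp]: "f \<cdot> (i \<cdot> k) = munit B \<cdot> counit X" by (simp add: f_unit)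
    show "f \<cdot> (mult A \<cdot> pair X a (i \<cdot> k)) = f \<cdot> a"
      by (simp add: hopf_morphism_mul[OF X hopf B f])
  qed simp_all
  then have "f \<cdot> S.translate = f \<cdot> S.translate0" by (simp add: S.invariant_def)
  then obtain r where r [simp]: "r \<in> Arr C" "Dom C r = Cod C p" "Cod C r = carr B" and rp: "r \<cdot> p = f"
    by (rule coequalizer_factor[OF p, rotated 2]) simp_all
  have rj: "(r \<boxtimes> \<I> ?X) \<cdot> ?j = coact" "(r \<boxtimes> \<I> ?X) \<cdot> ?z = coact0"
    using comp_reduce[OF rp, of "munit A"] by (simp_all add: coact_def coact0_def rp)
  have ji: "?j \<cdot> i = ?z \<cdot> i"
  proof -
    interpret KA: hopf_source C K A by unfold_locales (rule S.K.coc)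
    have idK [simp]: "cmor K K (\<I> (carr K))" by (rule cmor_ident[OF S.K.coc])
    note [simp] = S.i_cmor
    have "p \<cdot> (mult A \<cdot> pair K (munit A \<cdot> counit K) (i \<cdot> \<I> (carr K))) = p \<cdot> (munit A \<cdot> counit K)"
      by (rule S.invariant_pair[OF inv S.K.coc]) simp_all
    then have "p \<cdot> i = p \<cdot> (munit A \<cdot> counit K)" by simp
    then show ?thesis by simp
  qed
  have "?j \<cdot> y = ?z \<cdot> y \<longleftrightarrow> coact \<cdot> y = coact0 \<cdot> y" if [simp]: "y \<in> Arr C" "Cod C y = ?X" for y
  proof
    assume "?j \<cdot> y = ?z \<cdot> y"
    then have "(r \<boxtimes> \<I> ?X) \<cdot> (?j \<cdot> y) = (r \<boxtimes> \<I> ?X) \<cdot> (?z \<cdot> y)" by (rule arg_cong)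
    then have "((r \<boxtimes> \<I> ?X) \<cdot> ?j) \<cdot> y = ((r \<boxtimes> \<I> ?X) \<cdot> ?z) \<cdot> y" by simp
    then show "coact \<cdot> y = coact0 \<cdot> y" unfolding rj .
  next
    assume "coact \<cdot> y = coact0 \<cdot> y"
    then obtain k where k [simp]: "k \<in> Arr C" "Dom C k = Dom C y" "Cod C k = carr K" and ik: "i \<cdot> k = y"
      by (rule equalizer_factor[OF eq, rotated 2]) simp_all
    have "?j \<cdot> y = (?j \<cdot> i) \<cdot> k" unfolding ik[symmetric] by simp
    also have "\<dots> = ?z \<cdot> y" unfolding ji unfolding ik[symmetric] by simp
    finally show "?j \<cdot> y = ?z \<cdot> y" .
  qed
  then have "is_equalizer C ?j ?z i \<longleftrightarrow> is_equalizer C coact coact0 i"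
    by (intro equalizer_cong) (simp_all add: parallel_iff)
  then show ?thesis using eq by blast
qed

end

section \<open>Quotients by kernels and regular epimorphisms\<close>

context exact_hopf
begin

text \<open>g(a k) = g(a) g(k) = g(a), so \<open>g\<close> factors through \<open>p\<close> in M,
  and cancelling \<open>p\<close> makes the factor a Hopf morphism.\<close>

lemma hopf_coequalizer:
  assumes S: "sub_hopf_map C A K i" and p: "is_coequalizer C (sub_hopf_map.translate C A i) (sub_hopf_map.translate0 C A K) p"
    and H: "coc_hopf_monoid C H" "hopf_morphism C A H p"
    and D: "coc_hopf_monoid C D" "hopf_morphism C A D g" "g \<cdot> i = g \<cdot> (munit A \<cdot> counit K)"
  obtains k where "hopf_morphism C H D k" "k \<cdot> p = g"
proof -
  interpret S: sub_hopf_map C A K i by (rule S)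
  interpret G: hopf_map C A D g by unfold_locales (use D in simp_all)
  have re: "regular_epi C p" using p by (auto simp: regular_epi_def)
  note [simp] = coequalizerD(5,6)[OF p]
  have "S.invariant g"
  proof (rule S.invariantI)
    fix X :: "('o, 'm) comonoid" and a k
    assume X: "coc_comonoid C X" and a: "cmor X A a" and k: "cmor X K k"
    interpret XD: hopf_source C X D by unfold_locales (rule X)
    note [simp] = a k cmorD(1-3)[OF a] cmorD(1-3)[OF k] S.i_element[OF X k]
    have "g \<cdot> (i \<cdot> k) = (g \<cdot> (munit A \<cdot> counit K)) \<cdot> k" unfolding D(3)[symmetric] by simp
    then have [simp]: "g \<cdot> (i \<cdot> k) = munit D \<cdot> counit X" by (simp add: G.f_unit)
    show "g \<cdot> (mult A \<cdot> pair X a (i \<cdot> k)) = g \<cdot> a"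
      by (simp add: hopf_morphism_mul[OF X hopf D(1) D(2)])
  qed simp_all
  then have "g \<cdot> S.translate = g \<cdot> S.translate0" by (simp add: S.invariant_def)
  then obtain k where k: "k \<in> Arr C" "Dom C k = Cod C p" "Cod C k = carr D" "k \<cdot> p = g"
    by (rule coequalizer_factor[OF p, rotated 2]) simp_all
  have "Cod C p = carr H" using H(2) by (simp add: hopf_morphism_iff cmor_def)
  then have "hopf_morphism C H D k"
    by (intro hopf_factor_epi[OF D(1) H(1) hopf H(2) re]) (use k D in simp_all)
  then show thesis using that k(4) by blast
qed

text \<open>The quotient is a cokernel: it coequalizes \<open>i\<close> and the zero morphism, and
  Hopf morphisms trivial on \<open>K\<close> factor through it.\<close>

lemma hopf_quotient_regular_epi:
  assumes S: "sub_hopf_map C A K i" and p: "is_coequalizer C (sub_hopf_map.translate C A i) (sub_hopf_map.translate0 C A K) p"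
    and H: "coc_hopf_monoid C H" "hopf_morphism C A H p"
  shows "is_coequalizer (Hopf_coc C) (K, i, A) (K, munit A \<cdot> counit K, A) (A, p, H)"
proof -
  interpret S: sub_hopf_map C A K i by (rule S)
  interpret P: hopf_map C A H p by unfold_locales (use H in simp_all)
  interpret KA: hopf_source C K A by unfold_locales (rule S.K.coc)
  have re: "regular_epi C p" using p by (auto simp: regular_epi_def)
  have inv: "S.invariant p" using coequalizerD[OF p] by (simp add: S.invariant_def)
  have idK [simp]: "cmor K K (\<I> (carr K))" by (rule cmor_ident[OF S.K.coc])
  have "p \<cdot> (mult A \<cdot> pair K (munit A \<cdot> counit K) (i \<cdot> \<I> (carr K))) = p \<cdot> (munit A \<cdot> counit K)"
    by (rule S.invariant_pair[OF inv S.K.coc]) simp_all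
  then have pi: "p \<cdot> i = p \<cdot> (munit A \<cdot> counit K)" by simp
  have "\<exists>!k. k \<in> hom (Hopf_coc C) H (Cod (Hopf_coc C) h) \<and> Comp (Hopf_coc C) k (A, p, H) = h"
    if h: "h \<in> Arr (Hopf_coc C)" "Dom (Hopf_coc C) h = A" "Comp (Hopf_coc C) h (K, i, A) = Comp (Hopf_coc C) h (K, munit A \<cdot> counit K, A)" for h
  proof -
    obtain g D where g: "h = (A, g, D)" "coc_hopf_monoid C D" "hopf_morphism C A D g" "g \<cdot> i = g \<cdot> (munit A \<cdot> counit K)"
      using h by (cases h) auto
    obtain k where k: "hopf_morphism C H D k" "k \<cdot> p = g"
      by (rule hopf_coequalizer[OF S p H g(2-4)])
    show ?thesis
    proof (intro ex1I[of _ "(H, k, D)"] conjI)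
      fix y assume y: "y \<in> hom (Hopf_coc C) H (Cod (Hopf_coc C) h) \<and> Comp (Hopf_coc C) y (A, p, H) = h"
      then obtain y' where y': "y = (H, y', D)" "hopf_morphism C H D y'" "y' \<cdot> p = g"
        by (cases y) (auto simp: hom_def g)
      have yk: "cmor H D y'" "cmor H D k" using y'(2) k(1) by (simp_all add: hopf_morphism_iff)
      have "y' = k"
        by (rule regular_epi_cancel[OF re]) (use y'(3) k(2) cmorD(1-3)[OF yk(1)] cmorD(1-3)[OF yk(2)] in simp_all)
      then show "y = (H, k, D)" using y' by simp
    qed (use g H k in \<open>simp_all add: hom_def\<close>)
  qed
  then show ?thesis
    using pi S.K hopf H S.i hopf_zero[OF S.K hopf]
    by (simp add: is_coequalizer_def parallel_def)
qed

text \<open>A coequalizer of Hopf monoids is not visibly a coequalizer in M. The property is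
  transferred to \<open>p\<close> from the quotient \<open>q\<close> by its kernel, which has it by
  construction.\<close>

lemma regular_epi_is_kernel_quotient:
  assumes H: "coc_hopf_monoid C H" and re: "regular_epi (Hopf_coc C) (A, p, H)"
  obtains K i where "sub_hopf_map C A K i" "is_kernel C (A, p, H) (K, i, A)"
    "is_equalizer C ((p \<boxtimes> \<I> (carr A)) \<cdot> comult A) (((p \<cdot> munit A) \<boxtimes> \<I> (carr A)) \<cdot> inv_arrow C (\<lambda>\<^bold>l (carr A))) i"
    "is_coequalizer C (sub_hopf_map.translate C A i) (sub_hopf_map.translate0 C A K) p"
proof -
  interpret HC: category "Hopf_coc C" by (rule category_Hopf_coc)
  obtain F G where FG: "is_coequalizer (Hopf_coc C) F G (A, p, H)" using re by (auto simp: regular_epi_def)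
  note FGD = HC.coequalizerD[OF FG]
  obtain Z f where F: "F = (Z, f, A)" using FGD(6) by (cases F) auto
  obtain g where G: "G = (Z, g, A)" using FGD(3,4) F by (cases G) auto
  have Z: "coc_hopf_monoid C Z" and f: "hopf_morphism C Z A f" and g: "hopf_morphism C Z A g" and p: "hopf_morphism C A H p"
    using FGD(1,2,5) by (auto simp: F G)
  have pfg: "p \<cdot> f = p \<cdot> g" using FGD(7) by (simp add: F G)
  interpret P: hopf_map C A H p by unfold_locales (use H p in simp_all)
  have "parallel C P.coact P.coact0" by (simp add: parallel_iff)
  then obtain i where i: "is_equalizer C P.coact P.coact0 i"
    using eqs unfolding has_equalizers_def by blast
  obtain K where K: "coc_hopf_monoid C K" "hopf_morphism C K A i" by (rule P.kernel_hopf[OF i])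
  interpret S: sub_hopf_map C A K i by (rule P.kernel_sub_hopf_map[OF K i])
  have "parallel C S.translate S.translate0" by (simp add: parallel_iff)
  then obtain q where q: "is_coequalizer C S.translate S.translate0 q"
    using coeqs unfolding has_coequalizers_def by blast
  have n: "S.normal" by (rule P.kernel_normal[OF K i])
  obtain L where L: "coc_hopf_monoid C L" "hopf_morphism C A L q" by (rule S.hopf_quotient[OF q n])
  interpret L: coc_hopf C L by (rule coc_hopfI[OF L(1)])
  have inv: "S.invariant q" using coequalizerD[OF q] by (simp add: S.invariant_def)
  have q': "cmor A L q" using L(2) by (simp add: hopf_morphism_iff)
  note [simp] = cmorD(1-3)[OF q']
  obtain r where r: "hopf_morphism C L H r" "r \<cdot> q = p"
    by (rule hopf_coequalizer[OF S.sub_hopf_map_axioms q L H p P.kernel_trivial[OF i S.K.coc S.i_cmor]])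
  have qfg: "q \<cdot> f = q \<cdot> g"
  proof -
    interpret Z: coc_hopf C Z by (rule coc_hopfI[OF Z])
    interpret ZA: hopf_source C Z A by unfold_locales (rule Z.coc)
    interpret ZH: hopf_source C Z H by unfold_locales
    have f' [simp]: "cmor Z A f" and g' [simp]: "cmor Z A g" using f g by (simp_all add: hopf_morphism_iff)
    note [simp] = cmorD(1-3)[OF f'] cmorD(1-3)[OF g']
    have pg [simp]: "cmor Z H (p \<cdot> g)" by (rule cmor_comp[OF Z.coc coc P.B.coc g' P.f_cmor])
    let ?d = "mult A \<cdot> pair Z f (antipode A \<cdot> g)"
    have "p \<cdot> ?d = p \<cdot> (munit A \<cdot> counit Z)"
      by (simp add: hopf_morphism_mul[OF Z.coc hopf H p] hopf_morphism_antipode[OF Z.coc hopf H p] pfg P.f_unit)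
    then obtain k where k: "cmor Z K k" and ik: "i \<cdot> k = ?d"
      by (rule P.kernel_element[OF i S.K.coc S.i_cmor Z.coc, rotated]) simp_all
    have fg: "f = mult A \<cdot> pair Z ?d g" by simp
    note [simp] = cmorD(1-3)[OF k] S.i_element[OF Z.coc k]
    \<comment> \<open>f = (f g^-1) g with f g^-1 in \<open>K\<close>; a unit is put in front so that
      \<open>normal_invariant\<close> can drop this factor.\<close>
    have "q \<cdot> f = q \<cdot> (mult A \<cdot> pair Z (munit A \<cdot> counit Z) (mult A \<cdot> pair Z (i \<cdot> k) g))"
      unfolding ik by simp
    also have "\<dots> = q \<cdot> (mult A \<cdot> pair Z (munit A \<cdot> counit Z) g)"
      by (rule S.normal_invariant[OF n inv Z.coc _ g' k]) simp
    finally show ?thesis by simp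
  qed
  have "Comp (Hopf_coc C) (A, q, L) F = Comp (Hopf_coc C) (A, q, L) G"
    using qfg by (simp add: F G)
  then obtain s' where s': "s' \<in> Arr (Hopf_coc C)" "Dom (Hopf_coc C) s' = H" "Cod (Hopf_coc C) s' = L" "Comp (Hopf_coc C) s' (A, p, H) = (A, q, L)"
    by (rule HC.coequalizer_factor[OF FG, rotated 2]) (use L hopf in \<open>simp_all add: F\<close>)
  then obtain s where s: "s' = (H, s, L)" "hopf_morphism C H L s" "s \<cdot> p = q"
    by (cases s') auto
  have s_arr: "s \<in> Arr C" "Dom C s = carr H" "Cod C s = carr L" and r_arr: "r \<in> Arr C" "Dom C r = carr L" "Cod C r = carr H"
    using s(2) r(1) by (auto simp: hopf_morphism_iff cmor_def)
  note [simp] = s_arr r_arr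
  \<comment> \<open>The two composites need different uniqueness principles: \<open>p\<close> is so
    far a coequalizer only among Hopf monoids, while \<open>q\<close> is one in M.\<close>
  have rs: "r \<cdot> s = \<I> (carr H)"
  proof -
    have "Comp (Hopf_coc C) (H, r \<cdot> s, H) (A, p, H) = Comp (Hopf_coc C) (H, \<I> (carr H), H) (A, p, H)"
      using r(2) s(3) by simp
    then have "(H, r \<cdot> s, H) = (H, \<I> (carr H), H)"
      by (rule HC.coequalizer_epi[OF FG, rotated 5])
        (use H hopf_morphism_ident[OF H] hopf_morphism_comp[OF H L(1) H s(2) r(1)] in simp_all)
    then show ?thesis by simp
  qed
  have sr: "s \<cdot> r = \<I> (carr L)"
    by (rule coequalizer_epi[OF q]) (simp_all add: r(2) s(3))
  have "iso_arrow C r"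
    by (rule iso_arrowI[where g = s]) (simp_all add: rs sr)
  then have "is_coequalizer C S.translate S.translate0 (r \<cdot> q)"
    by (intro coequalizer_iso[OF q]) simp_all
  then show thesis
    using that[OF S.sub_hopf_map_axioms P.kernelI[OF K i] i[unfolded P.coact_def P.coact0_def]] r(2) by simp
qed

end

section \<open>Classes of subobjects and quotients\<close>

context category
begin

lemma iso_inverse:
  assumes "iso_arrow C h" "h \<in> hom C X Y"
  obtains g where "iso_arrow C g" "g \<in> hom C Y X" "g \<cdot> h = \<I> X" "h \<cdot> g = \<I> Y"
  using that[of "inv_arrow C h"] assms by simp

text \<open>Classes are sets of arrows, so independence of the representative has to be an equality
  of sets; isomorphisms are composed with the given one or with its inverse.\<close>

lemma subobject_class_cong:
  assumes i: "i \<in> Arr C" and j: "j \<in> subobject_class C i"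
  shows "subobject_class C j = subobject_class C i"
proof -
  obtain h where h: "iso_arrow C h" "h \<in> hom C (Dom C i) (Dom C j)" "j \<cdot> h = i" and m: "monic C j"
    using j by (auto simp: subobject_class_def)
  have [simp]: "j \<in> Arr C" using m by (simp add: monic_def)
  obtain g where g: "iso_arrow C g" "g \<in> hom C (Dom C j) (Dom C i)" "h \<cdot> g = \<I> (Dom C j)"
    by (rule iso_inverse[OF h(1,2)])
  note [simp] = h(1) g(1) i
  have ig: "i \<cdot> g = j" unfolding h(3)[symmetric] using h(2) g(2,3) by simp
  have "(\<exists>k. iso_arrow C k \<and> k \<in> hom C (Dom C j) (Dom C x) \<and> x \<cdot> k = j) \<longleftrightarrow> (\<exists>k. iso_arrow C k \<and> k \<in> hom C (Dom C i) (Dom C x) \<and> x \<cdot> k = i)"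
    if x: "monic C x" for x
  proof -
    have [simp]: "x \<in> Arr C" using x by (simp add: monic_def)
    show ?thesis
    proof
      assume "\<exists>k. iso_arrow C k \<and> k \<in> hom C (Dom C j) (Dom C x) \<and> x \<cdot> k = j"
      then obtain k where k: "iso_arrow C k" "k \<in> hom C (Dom C j) (Dom C x)" "x \<cdot> k = j" by blast
      then have "x \<cdot> (k \<cdot> h) = i" using comp_reduce[OF k(3), of h] h by simp
      then show "\<exists>k. iso_arrow C k \<and> k \<in> hom C (Dom C i) (Dom C x) \<and> x \<cdot> k = i"
        using k h by (intro exI[of _ "k \<cdot> h"]) simp
    next
      assume "\<exists>k. iso_arrow C k \<and> k \<in> hom C (Dom C i) (Dom C x) \<and> x \<cdot> k = i"
      then obtain k where k: "iso_arrow C k" "k \<in> hom C (Dom C i) (Dom C x)" "x \<cdot> k = i" by blast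
      then have "x \<cdot> (k \<cdot> g) = j" using comp_reduce[OF k(3), of g] g ig by simp
      then show "\<exists>k. iso_arrow C k \<and> k \<in> hom C (Dom C j) (Dom C x) \<and> x \<cdot> k = j"
        using k g by (intro exI[of _ "k \<cdot> g"]) simp
    qed
  qed
  then show ?thesis unfolding subobject_class_def by (intro Collect_cong conj_cong) simp_all
qed

lemma quotient_class_cong:
  assumes p: "p \<in> Arr C" and q: "q \<in> quotient_class C p"
  shows "quotient_class C q = quotient_class C p"
proof -
  obtain h where h: "iso_arrow C h" "h \<in> hom C (Cod C p) (Cod C q)" "h \<cdot> p = q" and m: "epic C q"
    using q by (auto simp: quotient_class_def)
  have [simp]: "q \<in> Arr C" using m by (simp add: epic_def)
  obtain g where g: "iso_arrow C g" "g \<in> hom C (Cod C q) (Cod C p)" "g \<cdot> h = \<I> (Cod C p)"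
    by (rule iso_inverse[OF h(1,2)])
  note [simp] = h(1) g(1) p
  have gq: "g \<cdot> q = p" unfolding h(3)[symmetric] using h(2) g(2) comp_reduce[OF g(3), of p] by simp
  have "(\<exists>k. iso_arrow C k \<and> k \<in> hom C (Cod C q) (Cod C x) \<and> k \<cdot> q = x) \<longleftrightarrow> (\<exists>k. iso_arrow C k \<and> k \<in> hom C (Cod C p) (Cod C x) \<and> k \<cdot> p = x)"
    if x: "epic C x" for x
  proof -
    have [simp]: "x \<in> Arr C" using x by (simp add: epic_def)
    show ?thesis
    proof
      assume "\<exists>k. iso_arrow C k \<and> k \<in> hom C (Cod C q) (Cod C x) \<and> k \<cdot> q = x"
      then obtain k where k: "iso_arrow C k" "k \<in> hom C (Cod C q) (Cod C x)" "k \<cdot> q = x" by blast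
      then show "\<exists>k. iso_arrow C k \<and> k \<in> hom C (Cod C p) (Cod C x) \<and> k \<cdot> p = x"
        using h by (intro exI[of _ "k \<cdot> h"]) simp
    next
      assume "\<exists>k. iso_arrow C k \<and> k \<in> hom C (Cod C p) (Cod C x) \<and> k \<cdot> p = x"
      then obtain k where k: "iso_arrow C k" "k \<in> hom C (Cod C p) (Cod C x)" "k \<cdot> p = x" by blast
      then show "\<exists>k. iso_arrow C k \<and> k \<in> hom C (Cod C q) (Cod C x) \<and> k \<cdot> q = x"
        using g gq by (intro exI[of _ "k \<cdot> g"]) simp
    qed
  qed
  then show ?thesis unfolding quotient_class_def by (intro Collect_cong conj_cong) simp_all
qed

lemma subobject_class_self:
  assumes "monic C i" shows "i \<in> subobject_class C i"
proof -
  have "i \<in> Arr C" using assms by (simp add: monic_def)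
  then have "iso_arrow C (\<I> (Dom C i)) \<and> \<I> (Dom C i) \<in> hom C (Dom C i) (Dom C i) \<and> i \<cdot> \<I> (Dom C i) = i"
    by simp
  then show ?thesis unfolding subobject_class_def using assms by blast
qed

lemma quotient_class_self:
  assumes "epic C p" shows "p \<in> quotient_class C p"
proof -
  have "p \<in> Arr C" using assms by (simp add: epic_def)
  then have "iso_arrow C (\<I> (Cod C p)) \<and> \<I> (Cod C p) \<in> hom C (Cod C p) (Cod C p) \<and> \<I> (Cod C p) \<cdot> p = p"
    by simp
  then show ?thesis unfolding quotient_class_def using assms by blast
qed

lemma subobjectsD:
  assumes X: "X \<in> subobjects C A" and j: "j \<in> X"
  shows "X = subobject_class C j" "monic C j" "j \<in> Arr C" "Cod C j = A"
proof -
  obtain i where i: "X = subobject_class C i" "monic C i" "Cod C i = A" using X by (auto simp: subobjects_def)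
  show "X = subobject_class C j" using subobject_class_cong[of i j] i j by (simp add: monic_def)
  show "monic C j" using i j by (simp add: subobject_class_def)
  then show jA: "j \<in> Arr C" by (simp add: monic_def)
  obtain h where "iso_arrow C h" "h \<in> hom C (Dom C i) (Dom C j)" "j \<cdot> h = i"
    using i j by (auto simp: subobject_class_def)
  then show "Cod C j = A" using i(3) jA by auto
qed

lemma quotientsD:
  assumes Y: "Y \<in> quotients C A" and q: "q \<in> Y"
  shows "Y = quotient_class C q" "epic C q" "q \<in> Arr C" "Dom C q = A"
proof -
  obtain p where p: "Y = quotient_class C p" "epic C p" "Dom C p = A" using Y by (auto simp: quotients_def)
  show "Y = quotient_class C q" using quotient_class_cong[of p q] p q by (simp add: epic_def)
  show "epic C q" using p q by (simp add: quotient_class_def)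
  then show "q \<in> Arr C" by (simp add: epic_def)
  have pA: "p \<in> Arr C" using p(2) by (simp add: epic_def)
  obtain h where "iso_arrow C h" "h \<in> hom C (Cod C p) (Cod C q)" "h \<cdot> p = q"
    using p q by (auto simp: quotient_class_def)
  then show "Dom C q = A" using p(3) pA by auto
qed

end

section \<open>Module comonoids and the two maps on classes\<close>

context exact_hopf
begin

lemma Comon_coc_simps [simp]:
  "Q \<in> Obj (Comon_coc C A) \<longleftrightarrow> module_comonoid C A Q"
  "(P, f, Q) \<in> Arr (Comon_coc C A) \<longleftrightarrow> module_comonoid C A P \<and> module_comonoid C A Q \<and> modcomon_morphism C A P Q f"
  "Dom (Comon_coc C A) (P, f, Q) = P" "Cod (Comon_coc C A) (P, f, Q) = Q"
  "Ident (Comon_coc C A) Q = (Q, \<I> (carr Q), Q)"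
  "Comp (Comon_coc C A) (Q', g, R) (P, f, Q) = (P, g \<cdot> f, R)"
  by (simp_all add: Comon_coc_def)

lemma modcomon_comp:
  assumes P: "module_comonoid C A P" and Q: "module_comonoid C A Q" and R: "module_comonoid C A R"
    and f: "modcomon_morphism C A P Q f" and g: "modcomon_morphism C A Q R g"
  shows "modcomon_morphism C A P R (g \<cdot> f)"
proof -
  note PD = module_comonoidD[OF P] and QD = module_comonoidD[OF Q] and RD = module_comonoidD[OF R]
  have f': "cmor P Q f" "f \<cdot> act P = act Q \<cdot> (\<I> (carr A) \<boxtimes> f)" and g': "cmor Q R g" "g \<cdot> act Q = act R \<cdot> (\<I> (carr A) \<boxtimes> g)"
    using f g by (auto simp: modcomon_morphism_iff)
  note [simp] = cmorD(1-3)[OF f'(1)] cmorD(1-3)[OF g'(1)] PD(2-4) QD(2-4) RD(2-4)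
    coc_comonoidD(1)[OF PD(1)] coc_comonoidD(1)[OF QD(1)] coc_comonoidD(1)[OF RD(1)]
  have "(g \<cdot> f) \<cdot> act P = (g \<cdot> act Q) \<cdot> (\<I> (carr A) \<boxtimes> f)" using f'(2) by simp
  also have "\<dots> = act R \<cdot> (\<I> (carr A) \<boxtimes> (g \<cdot> f))" unfolding g'(2) by simp
  finally show ?thesis
    using cmor_comp[OF PD(1) QD(1) RD(1) f'(1) g'(1)] by (simp add: modcomon_morphism_iff)
qed

lemma category_Comon_coc: "category (Comon_coc C A)"
proof
  fix f assume "f \<in> Arr (Comon_coc C A)"
  then show "Dom (Comon_coc C A) f \<in> Obj (Comon_coc C A)" "Cod (Comon_coc C A) f \<in> Obj (Comon_coc C A)" by (cases f; simp)+
next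
  fix X assume X: "X \<in> Obj (Comon_coc C A)"
  then have "modcomon_morphism C A X X (\<I> (carr X))"
    using module_comonoidD[of X] cmor_ident[of X] by (simp add: modcomon_morphism_iff coc_comonoidD(1))
  then show "Ident (Comon_coc C A) X \<in> hom (Comon_coc C A) X X" using X by (simp add: hom_def)
next
  fix f g X Y Z assume "f \<in> hom (Comon_coc C A) X Y" "g \<in> hom (Comon_coc C A) Y Z"
  then show "Comp (Comon_coc C A) g f \<in> hom (Comon_coc C A) X Z"
    by (cases f; cases g) (auto simp: hom_def intro: modcomon_comp)
next
  fix f X Y assume "f \<in> hom (Comon_coc C A) X Y"
  then show "Comp (Comon_coc C A) f (Ident (Comon_coc C A) X) = f" "Comp (Comon_coc C A) (Ident (Comon_coc C A) Y) f = f"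
    by (cases f; auto simp: hom_def modcomon_morphism_iff cmor_def)+
next
  fix f g h W X Y Z assume "f \<in> hom (Comon_coc C A) W X" "g \<in> hom (Comon_coc C A) X Y" "h \<in> hom (Comon_coc C A) Y Z"
  then show "Comp (Comon_coc C A) h (Comp (Comon_coc C A) g f) = Comp (Comon_coc C A) (Comp (Comon_coc C A) h g) f"
    by (cases f; cases g; cases h) (auto simp: hom_def modcomon_morphism_iff cmor_def)
qed

lemma modcomon_isoD:
  assumes "iso_arrow (Comon_coc C A) (P, f, Q)"
  shows "iso_arrow C f" "f \<in> Arr C" "Dom C f = carr P" "Cod C f = carr Q"
proof -
  obtain g where g: "inverse_arrows (Comon_coc C A) (P, f, Q) g" using assms by (auto simp: iso_arrow_def)
  then obtain g' where g': "g = (Q, g', P)" by (cases g) (auto simp: inverse_arrows_def hom_def)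
  have f: "cmor P Q f" and gc: "cmor Q P g'"
    using g unfolding g' by (auto simp: inverse_arrows_def hom_def modcomon_morphism_iff)
  show "f \<in> Arr C" "Dom C f = carr P" "Cod C f = carr Q" by (rule cmorD[OF f])+
  show "iso_arrow C f"
    using g cmorD(1-3)[OF f] cmorD(1-3)[OF gc] unfolding g'
    by (intro iso_arrowI[where g = g']) (auto simp: inverse_arrows_def)
qed

lemma modcomon_factor_epi:
  assumes P: "module_comonoid C A P" and Q: "module_comonoid C A Q" and R: "module_comonoid C A R"
    and p: "modcomon_morphism C A P Q p" "regular_epi C p" and h: "modcomon_morphism C A P R (k \<cdot> p)"
    and k: "k \<in> Arr C" "Dom C k = carr Q" "Cod C k = carr R"
  shows "modcomon_morphism C A Q R k"
proof -
  note PD = module_comonoidD[OF P] and QD = module_comonoidD[OF Q] and RD = module_comonoidD[OF R]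
  have p': "cmor P Q p" "p \<cdot> act P = act Q \<cdot> (\<I> (carr A) \<boxtimes> p)" and h': "cmor P R (k \<cdot> p)" "(k \<cdot> p) \<cdot> act P = act R \<cdot> (\<I> (carr A) \<boxtimes> (k \<cdot> p))"
    using p h by (auto simp: modcomon_morphism_iff)
  note [simp] = cmorD(1-3)[OF p'(1)] PD(2-4) QD(2-4) RD(2-4) k
    coc_comonoidD(1)[OF PD(1)] coc_comonoidD(1)[OF QD(1)] coc_comonoidD(1)[OF RD(1)]
  have 1: "cmor Q R k" by (rule cmor_factor_epi[OF PD(1) QD(1) RD(1) p'(1) p(2) h'(1) k])
  have "k \<cdot> act Q = act R \<cdot> (\<I> (carr A) \<boxtimes> k)"
  proof (rule regular_epi_cancel[OF ten_regular_epi(1)[OF p(2) comonoid_simps(1)]])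
    have "(k \<cdot> act Q) \<cdot> (\<I> (carr A) \<boxtimes> p) = k \<cdot> (p \<cdot> act P)" unfolding p'(2) by simp
    then show "(k \<cdot> act Q) \<cdot> (\<I> (carr A) \<boxtimes> p) = (act R \<cdot> (\<I> (carr A) \<boxtimes> k)) \<cdot> (\<I> (carr A) \<boxtimes> p)"
      using h'(2) by simp
  qed simp_all
  then show ?thesis using 1 by (simp add: modcomon_morphism_iff)
qed

lemma modcomon_epic:
  assumes "module_comonoid C A P" "module_comonoid C A Q" "modcomon_morphism C A P Q p" "regular_epi C p"
  shows "epic (Comon_coc C A) (P, p, Q)"
  unfolding epic_def
proof (intro conjI allI impI)
  fix Y g h
  assume gh: "g \<in> hom (Comon_coc C A) (Cod (Comon_coc C A) (P, p, Q)) Y \<and> h \<in> hom (Comon_coc C A) (Cod (Comon_coc C A) (P, p, Q)) Y \<and>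
     Comp (Comon_coc C A) g (P, p, Q) = Comp (Comon_coc C A) h (P, p, Q)"
  then obtain g' h' where g': "g = (Q, g', Y)" "h = (Q, h', Y)" "modcomon_morphism C A Q Y g'" "modcomon_morphism C A Q Y h'" "g' \<cdot> p = h' \<cdot> p"
    by (cases g; cases h) (auto simp: hom_def)
  have c: "cmor Q Y g'" "cmor Q Y h'" "cmor P Q p" using g'(3,4) assms(3) by (simp_all add: modcomon_morphism_iff)
  have "g' = h'"
    by (rule regular_epi_cancel[OF assms(4) g'(5)]) (use cmorD(1-3)[OF c(1)] cmorD(1-3)[OF c(2)] cmorD(1-3)[OF c(3)] in simp_all)
  then show "g = h" by (simp add: g')
qed (use assms in simp)

lemma hopf_monic:
  assumes K: "coc_hopf_monoid C K" and i: "hopf_morphism C K A i" "regular_mono i"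
  shows "monic (Hopf_coc C) (K, i, A)"
  unfolding monic_def
proof (intro conjI allI impI)
  fix X g h
  assume gh: "g \<in> hom (Hopf_coc C) X (Dom (Hopf_coc C) (K, i, A)) \<and> h \<in> hom (Hopf_coc C) X (Dom (Hopf_coc C) (K, i, A)) \<and>
     Comp (Hopf_coc C) (K, i, A) g = Comp (Hopf_coc C) (K, i, A) h"
  then obtain g' h' where g': "g = (X, g', K)" "h = (X, h', K)" "hopf_morphism C X K g'" "hopf_morphism C X K h'" "i \<cdot> g' = i \<cdot> h'"
    by (cases g; cases h) (auto simp: hom_def)
  have c: "cmor X K g'" "cmor X K h'" "cmor K A i" using g'(3,4) i(1) by (simp_all add: hopf_morphism_iff)
  have "g' = h'"
    by (rule regular_mono_cancel[OF i(2) g'(5)]) (use cmorD(1-3)[OF c(1)] cmorD(1-3)[OF c(2)] cmorD(1-3)[OF c(3)] in simp_all)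
  then show "g = h" by (simp add: g')
qed (use K i hopf in simp)

text \<open>Representatives of a subobject differ by isomorphisms, which do not change the arrows
  coequalizing the pair; and two coequalizers in M of one pair differ by an isomorphism that is
  automatically one of module comonoids. So the admissible values fill exactly one class.\<close>

lemma phi_subobject_class:
  assumes S: "sub_hopf_map C A K i" and p: "is_coequalizer C (sub_hopf_map.translate C A i) (sub_hopf_map.translate0 C A K) p"
    and Q: "module_comonoid C A Q" "modcomon_morphism C A (regular_module A) Q p"
  shows "phi C A (subobject_class (Hopf_coc C) (K, i, A)) = quotient_class (Comon_coc C A) (regular_module A, p, Q)"
proof -
  interpret S: sub_hopf_map C A K i by (rule S)
  let ?R = "regular_module A"
  have re: "regular_epi C p" using p by (auto simp: regular_epi_def)
  have cpQ: "Cod C p = carr Q" using Q(2) cmorD(3)[of "regular_module A" Q p] by (simp add: modcomon_morphism_iff)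
  note [simp] = module_comonoid_regular
  show ?thesis
  proof (intro subset_antisym subsetI)
    fix x assume x: "x \<in> phi C A (subobject_class (Hopf_coc C) (K, i, A))"
    then obtain p' Q' L j where x': "x = (?R, p', Q')" and Q': "module_comonoid C A Q'" "modcomon_morphism C A ?R Q' p'"
      and L: "(L, j, A) \<in> subobject_class (Hopf_coc C) (K, i, A)"
      and p': "is_coequalizer C (mult A \<cdot> (\<I> (carr A) \<boxtimes> j)) (\<rho> (carr A) \<cdot> (\<I> (carr A) \<boxtimes> counit L)) p'"
      by (auto simp: phi_def)
    obtain h where h: "iso_arrow (Hopf_coc C) (K, h, L)" "j \<cdot> h = i"
      using L by (auto simp: subobject_class_def hom_def)
    note hD = hopf_isoD[OF h(1)]
    have hc: "cmor K L h" using hD(3) by (simp add: hopf_morphism_iff)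
    have jc: "cmor L A j" using L by (auto simp: subobject_class_def monic_def hopf_morphism_iff)
    note [simp] = cmorD(1-3)[OF hc] cmorD(1-3)[OF jc] coc_comonoidD(1-7)[OF coc_hopf.coc[OF coc_hopfI[OF hD(2)]]] hD(4)
    \<comment> \<open>The pair of one representative is the pair of the other precomposed with an
      isomorphism, so the same arrows coequalize both.\<close>
    have t: "S.translate = (mult A \<cdot> (\<I> (carr A) \<boxtimes> j)) \<cdot> (\<I> (carr A) \<boxtimes> h)"
      "S.translate0 = (\<rho> (carr A) \<cdot> (\<I> (carr A) \<boxtimes> counit L)) \<cdot> (\<I> (carr A) \<boxtimes> h)"
      by (simp_all add: S.translate_def S.translate0_def h(2) cmorD(5)[OF hc])
    have "is_coequalizer C (mult A \<cdot> (\<I> (carr A) \<boxtimes> j)) (\<rho> (carr A) \<cdot> (\<I> (carr A) \<boxtimes> counit L)) p' \<longleftrightarrow> is_coequalizer C S.translate S.translate0 p'"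
    proof (rule coequalizer_cong)
      fix y assume [simp]: "y \<in> Arr C" "Dom C y = Cod C S.translate"
      show "y \<cdot> (mult A \<cdot> (\<I> (carr A) \<boxtimes> j)) = y \<cdot> (\<rho> (carr A) \<cdot> (\<I> (carr A) \<boxtimes> counit L)) \<longleftrightarrow> y \<cdot> S.translate = y \<cdot> S.translate0"
      proof
        assume *: "y \<cdot> (mult A \<cdot> (\<I> (carr A) \<boxtimes> j)) = y \<cdot> (\<rho> (carr A) \<cdot> (\<I> (carr A) \<boxtimes> counit L))"
        have "y \<cdot> S.translate = (y \<cdot> (mult A \<cdot> (\<I> (carr A) \<boxtimes> j))) \<cdot> (\<I> (carr A) \<boxtimes> h)" unfolding t by simp
        also have "\<dots> = y \<cdot> S.translate0" unfolding * unfolding t by simp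
        finally show "y \<cdot> S.translate = y \<cdot> S.translate0" .
      next
        assume *: "y \<cdot> S.translate = y \<cdot> S.translate0"
        have e: "(y \<cdot> (mult A \<cdot> (\<I> (carr A) \<boxtimes> j))) \<cdot> (\<I> (carr A) \<boxtimes> h) = (y \<cdot> (\<rho> (carr A) \<cdot> (\<I> (carr A) \<boxtimes> counit L))) \<cdot> (\<I> (carr A) \<boxtimes> h)"
          using * unfolding t by simp
        show "y \<cdot> (mult A \<cdot> (\<I> (carr A) \<boxtimes> j)) = y \<cdot> (\<rho> (carr A) \<cdot> (\<I> (carr A) \<boxtimes> counit L))"
          by (rule iso_cancel_right[OF _ e]) simp_all
      qed
    qed (simp_all add: parallel_iff)
    then have p'': "is_coequalizer C S.translate S.translate0 p'" using p' by blast
    then have re': "regular_epi C p'" by (auto simp: regular_epi_def)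
    obtain k k' where k: "k \<in> Arr C" "Dom C k = Cod C p" "Cod C k = Cod C p'" "k \<cdot> p = p'"
      and k': "k' \<in> Arr C" "Dom C k' = Cod C p'" "Cod C k' = Cod C p" "k' \<cdot> p' = p"
      and kk': "k' \<cdot> k = \<I> (Cod C p)" "k \<cdot> k' = \<I> (Cod C p')"
      by (rule coequalizer_unique[OF p p''])
    have cpQ': "Cod C p' = carr Q'" using Q'(2) cmorD(3)[of "regular_module A" Q' p'] by (simp add: modcomon_morphism_iff)
    have km: "modcomon_morphism C A Q Q' k"
      by (rule modcomon_factor_epi[OF module_comonoid_regular Q(1) Q'(1) Q(2) re]) (use k Q' cpQ cpQ' in simp_all)
    have km': "modcomon_morphism C A Q' Q k'"
      by (rule modcomon_factor_epi[OF module_comonoid_regular Q'(1) Q(1) Q'(2) re']) (use k' Q cpQ cpQ' in simp_all)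
    have "iso_arrow (Comon_coc C A) (Q, k, Q')"
      unfolding iso_arrow_def using km km' kk' Q(1) Q'(1) cpQ cpQ'
      by (intro exI[of _ "(Q', k', Q)"]) (simp add: inverse_arrows_def hom_def)
    then show "x \<in> quotient_class (Comon_coc C A) (?R, p, Q)"
      unfolding quotient_class_def x'
      using modcomon_epic[OF module_comonoid_regular Q' re'] k(4) km Q(1) Q'(1)
      by (intro CollectI conjI exI[of _ "(Q, k, Q')"]) (simp_all add: hom_def)
  next
    fix x assume x: "x \<in> quotient_class (Comon_coc C A) (?R, p, Q)"
    then obtain h where h: "iso_arrow (Comon_coc C A) h" "h \<in> hom (Comon_coc C A) Q (Cod (Comon_coc C A) x)"
       "Comp (Comon_coc C A) h (?R, p, Q) = x" and xe: "epic (Comon_coc C A) x"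
      by (auto simp: quotient_class_def)
    obtain h' Q' where h': "h = (Q, h', Q')" using h(2) by (cases h) (auto simp: hom_def)
    have x': "x = (?R, h' \<cdot> p, Q')" using h(3) by (simp add: h')
    note hi = modcomon_isoD[OF h(1)[unfolded h']]
    have "is_coequalizer C S.translate S.translate0 (h' \<cdot> p)"
      by (rule coequalizer_iso[OF p hi(1)]) (simp add: hi cpQ)
    moreover have "x \<in> Arr (Comon_coc C A)" using xe by (simp add: epic_def)
    moreover have "(K, i, A) \<in> subobject_class (Hopf_coc C) (K, i, A)"
      by (rule category.subobject_class_self[OF category_Hopf_coc hopf_monic[OF S.K S.i S.rm]])
    ultimately show "x \<in> phi C A (subobject_class (Hopf_coc C) (K, i, A))"
      unfolding phi_def x' S.translate_def S.translate0_def by blast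
  qed
qed

text \<open>Dual to the computation of \<open>phi\<close>: another representative of the quotient
  composes the pair with an isomorphism on the left, and two equalizers of one pair differ by an
  isomorphism of Hopf monoids.\<close>

lemma psi_quotient_class:
  assumes Q: "module_comonoid C A Q" "modcomon_morphism C A (regular_module A) Q p" and re: "regular_epi C p"
    and K: "coc_hopf_monoid C K" and i: "hopf_morphism C K A i"
    and eq: "is_equalizer C ((p \<boxtimes> \<I> (carr A)) \<cdot> comult A) (((p \<cdot> munit A) \<boxtimes> \<I> (carr A)) \<cdot> inv_arrow C (\<lambda>\<^bold>l (carr A))) i"
  shows "psi C A (quotient_class (Comon_coc C A) (regular_module A, p, Q)) = subobject_class (Hopf_coc C) (K, i, A)"
proof -
  let ?R = "regular_module A" and ?X = "carr A"
  let ?j = "\<lambda>p. (p \<boxtimes> \<I> ?X) \<cdot> comult A" and ?z = "\<lambda>p. ((p \<cdot> munit A) \<boxtimes> \<I> ?X) \<cdot> inv_arrow C (\<lambda>\<^bold>l ?X)"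
  have pc: "cmor A Q p" using Q(2) by (simp add: modcomon_morphism_iff regular_module_cmor)
  have ic: "cmor K A i" using i by (simp add: hopf_morphism_iff)
  note [simp] = cmorD(1-3)[OF pc] cmorD(1-3)[OF ic] coc_comonoidD(1)[OF module_comonoidD(1)[OF Q(1)]]
  have rm: "regular_mono i" using eq by (auto simp: regular_mono_def)
  show ?thesis
  proof (intro subset_antisym subsetI)
    fix x assume x: "x \<in> psi C A (quotient_class (Comon_coc C A) (?R, p, Q))"
    then obtain L j p' Q' where x': "x = (L, j, A)" and L: "coc_hopf_monoid C L" "hopf_morphism C L A j"
      and p': "(?R, p', Q') \<in> quotient_class (Comon_coc C A) (?R, p, Q)" and j: "is_equalizer C (?j p') (?z p') j"
      by (auto simp: psi_def)
    obtain h where h: "iso_arrow (Comon_coc C A) (Q, h, Q')" "h \<cdot> p = p'"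
      using p' by (auto simp: quotient_class_def hom_def)
    note hi = modcomon_isoD[OF h(1)]
    note [simp] = hi
    have [simp]: "carr Q' \<in> Obj C" using Cod_Obj[OF hi(2)] by simp
    have t: "?j p' = (h \<boxtimes> \<I> ?X) \<cdot> ?j p" "?z p' = (h \<boxtimes> \<I> ?X) \<cdot> ?z p"
      unfolding h(2)[symmetric] by simp_all
    have "is_equalizer C (?j p') (?z p') j \<longleftrightarrow> is_equalizer C (?j p) (?z p) j"
    proof (rule equalizer_cong)
      fix y assume [simp]: "y \<in> Arr C" "Cod C y = Dom C (?j p)"
      show "?j p' \<cdot> y = ?z p' \<cdot> y \<longleftrightarrow> ?j p \<cdot> y = ?z p \<cdot> y"
      proof
        assume *: "?j p' \<cdot> y = ?z p' \<cdot> y"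
        have e: "(h \<boxtimes> \<I> ?X) \<cdot> (?j p \<cdot> y) = (h \<boxtimes> \<I> ?X) \<cdot> (?z p \<cdot> y)"
          using * unfolding t by simp
        show "?j p \<cdot> y = ?z p \<cdot> y"
          by (rule iso_cancel_left[OF _ e]) simp_all
      next
        assume *: "?j p \<cdot> y = ?z p \<cdot> y"
        have "?j p' \<cdot> y = (h \<boxtimes> \<I> ?X) \<cdot> (?j p \<cdot> y)" unfolding t by simp
        also have "\<dots> = ?z p' \<cdot> y" unfolding * unfolding t by simp
        finally show "?j p' \<cdot> y = ?z p' \<cdot> y" .
      qed
    qed (simp_all add: parallel_iff t)
    then have j': "is_equalizer C (?j p) (?z p) j" using j by blast
    then have rm': "regular_mono j" by (auto simp: regular_mono_def)
    have jc: "cmor L A j" using L by (simp add: hopf_morphism_iff)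
    note [simp] = cmorD(1-3)[OF jc]
    obtain k k' where k: "k \<in> Arr C" "Dom C k = Dom C i" "Cod C k = Dom C j" "j \<cdot> k = i"
      and k': "k' \<in> Arr C" "Dom C k' = Dom C j" "Cod C k' = Dom C i" "i \<cdot> k' = j"
      and kk': "k \<cdot> k' = \<I> (Dom C j)" "k' \<cdot> k = \<I> (Dom C i)"
      by (rule equalizer_unique[OF j' eq])
    have km: "hopf_morphism C K L k"
      by (rule hopf_factor_mono[OF K L(1) hopf L(2) rm']) (use k i in simp_all)
    have km': "hopf_morphism C L K k'"
      by (rule hopf_factor_mono[OF L(1) K hopf i rm]) (use k' L in simp_all)
    have "iso_arrow (Hopf_coc C) (K, k, L)"
      by (rule hopf_isoI[OF K L(1) km km']) (use kk' in simp_all)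
    then show "x \<in> subobject_class (Hopf_coc C) (K, i, A)"
      unfolding subobject_class_def x' using hopf_monic[OF L rm'] k(4) km K L(1)
      by (intro CollectI conjI exI[of _ "(K, k, L)"]) (simp_all add: hom_def)
  next
    fix x assume x: "x \<in> subobject_class (Hopf_coc C) (K, i, A)"
    then obtain h where h: "iso_arrow (Hopf_coc C) h" "h \<in> hom (Hopf_coc C) K (Dom (Hopf_coc C) x)"
       "Comp (Hopf_coc C) x h = (K, i, A)" and xm: "monic (Hopf_coc C) x"
      by (auto simp: subobject_class_def)
    obtain L j where x': "x = (L, j, A)" using h(3) by (cases x; cases h) (auto simp: Hopf_coc_def)
    obtain h' where h': "h = (K, h', L)" using h(2) by (cases h) (auto simp: hom_def x')
    have jh: "j \<cdot> h' = i" using h(3) by (simp add: h' x')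
    note hD = hopf_isoD[OF h(1)[unfolded h']]
    have hc: "cmor K L h'" using hD(3) by (simp add: hopf_morphism_iff)
    have xa: "x \<in> Arr (Hopf_coc C)" using xm by (simp add: monic_def)
    then have jc: "cmor L A j" by (simp add: x' hopf_morphism_iff)
    note [simp] = cmorD(1-3)[OF hc] cmorD(1-3)[OF jc] hD(4)
    have "i \<cdot> inv_arrow C h' = j" unfolding jh[symmetric] by simp
    moreover have "is_equalizer C (?j p) (?z p) (i \<cdot> inv_arrow C h')"
      by (rule equalizer_iso[OF eq]) simp_all
    ultimately have "is_equalizer C (?j p) (?z p) j" by simp
    moreover have "(?R, p, Q) \<in> quotient_class (Comon_coc C A) (?R, p, Q)"
      by (rule category.quotient_class_self[OF category_Comon_coc modcomon_epic[OF module_comonoid_regular Q re]])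
    ultimately show "x \<in> psi C A (quotient_class (Comon_coc C A) (?R, p, Q))"
      using xa unfolding psi_def x' by blast
  qed
qed

section \<open>The correspondence\<close>

text \<open>Symmetric form of the correspondence: \<open>p\<close> is a value of \<open>phi\<close>
  at \<open>i\<close> and \<open>i\<close> a value of \<open>psi\<close> at \<open>p\<close>. Each
  class in any of the four families is represented by one side of such a pair, so all claims reduce
  to this relation.\<close>

definition galois_related :: "('o, 'm) hopf \<Rightarrow> 'm \<Rightarrow> ('o, 'm) modcomon \<Rightarrow> 'm \<Rightarrow> bool" where
  "galois_related K i Q p \<longleftrightarrow> sub_hopf_map C A K i \<and>
     module_comonoid C A Q \<and> modcomon_morphism C A (regular_module A) Q p \<and>
     is_coequalizer C (mult A \<cdot> (\<I> (carr A) \<boxtimes> i)) (\<rho> (carr A) \<cdot> (\<I> (carr A) \<boxtimes> counit K)) p \<and>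
     is_equalizer C ((p \<boxtimes> \<I> (carr A)) \<cdot> comult A) (((p \<cdot> munit A) \<boxtimes> \<I> (carr A)) \<cdot> inv_arrow C (\<lambda>\<^bold>l (carr A))) i"

text \<open>The Galois conditions on \<open>i\<close> and on \<open>p\<close> come back from the two
  equivalences, both applied to the same pair.\<close>

lemma galois_relatedD:
  assumes g: "galois_related K i Q p"
  defines "X \<equiv> subobject_class (Hopf_coc C) (K, i, A)" and "Y \<equiv> quotient_class (Comon_coc C A) (regular_module A, p, Q)"
  shows "phi C A X = Y" "psi C A Y = X" "X \<in> galois_subobjects C A" "Y \<in> galois_quotients C A"
    "(K, i, A) \<in> X" "(regular_module A, p, Q) \<in> Y"
proof -
  have S: "sub_hopf_map C A K i" and Q: "module_comonoid C A Q" "modcomon_morphism C A (regular_module A) Q p"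
    and eq: "is_equalizer C ((p \<boxtimes> \<I> (carr A)) \<cdot> comult A) (((p \<cdot> munit A) \<boxtimes> \<I> (carr A)) \<cdot> inv_arrow C (\<lambda>\<^bold>l (carr A))) i"
    using g by (auto simp: galois_related_def)
  interpret S: sub_hopf_map C A K i by (rule S)
  have p: "is_coequalizer C S.translate S.translate0 p"
    using g by (simp add: galois_related_def S.translate_def S.translate0_def)
  have re: "regular_epi C p" using p by (auto simp: regular_epi_def)
  note QD = module_comonoidD[OF Q(1)]
  interpret G: galois_pair C A Q p "act Q" K i
    by unfold_locales (use QD Q in \<open>simp_all add: modcomon_morphism_iff regular_module_cmor\<close>)
  show "phi C A X = Y" unfolding X_def Y_def by (rule phi_subobject_class[OF S p Q])
  show "psi C A Y = X" unfolding X_def Y_def by (rule psi_quotient_class[OF Q re S.K S.i eq])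
  have m: "monic (Hopf_coc C) (K, i, A)" by (rule hopf_monic[OF S.K S.i S.rm])
  show K: "(K, i, A) \<in> X"
    unfolding X_def by (rule category.subobject_class_self[OF category_Hopf_coc m])
  have e: "epic (Comon_coc C A) (regular_module A, p, Q)"
    by (rule modcomon_epic[OF module_comonoid_regular Q re])
  show P: "(regular_module A, p, Q) \<in> Y"
    unfolding Y_def by (rule category.quotient_class_self[OF category_Comon_coc e])
  have "X \<in> subobjects (Hopf_coc C) A"
    unfolding X_def subobjects_def using m by (intro CollectI exI[of _ "(K, i, A)"]) simp
  moreover have "sub_condition C A K i" using S.sub_condition_iff[OF p] eq by blast
  ultimately show "X \<in> galois_subobjects C A"
    using K unfolding galois_subobjects_def by blast
  have "Y \<in> quotients (Comon_coc C A) (regular_module A)"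
    unfolding Y_def quotients_def using e by (intro CollectI exI[of _ "(regular_module A, p, Q)"]) simp
  moreover have "quot_condition C A Q p"
    using G.quot_condition_iff[unfolded G.coact_def G.coact0_def, OF eq] p by blast
  ultimately show "Y \<in> galois_quotients C A"
    using P unfolding galois_quotients_def by blast
qed

text \<open>With \<open>p\<close> formed as the quotient by \<open>K\<close>, the Galois condition
  on \<open>i\<close> says precisely that \<open>i\<close> is recovered from
  \<open>p\<close>.\<close>

lemma galois_subobject_related:
  assumes X: "X \<in> galois_subobjects C A"
  obtains K i Q p where "galois_related K i Q p" "X = subobject_class (Hopf_coc C) (K, i, A)"
proof -
  interpret H: category "Hopf_coc C" by (rule category_Hopf_coc)
  obtain K i where Xs: "X \<in> subobjects (Hopf_coc C) A" and iX: "(K, i, A) \<in> X" and sc: "sub_condition C A K i"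
    using X by (auto simp: galois_subobjects_def)
  note XD = H.subobjectsD[OF Xs iX]
  have S: "sub_hopf_map C A K i"
    using XD(3) sc by unfold_locales (auto simp: sub_condition_def Let_def regular_mono_def)
  interpret S: sub_hopf_map C A K i by (rule S)
  have "parallel C S.translate S.translate0" by (simp add: parallel_iff)
  then obtain p where p: "is_coequalizer C S.translate S.translate0 p"
    using coeqs unfolding has_coequalizers_def by blast
  obtain Q :: "('o, 'm) modcomon" where Q: "module_comonoid C A Q" "modcomon_morphism C A (regular_module A) Q p"
    by (rule S.quotient_structure[OF p])
  have "galois_related K i Q p"
    using S Q p S.sub_condition_iff[OF p] sc by (simp add: galois_related_def S.translate_def S.translate0_def)
  then show thesis using that XD(1) by blast
qed

text \<open>With \<open>i\<close> formed as the stabilizer of p(1), the Galois condition on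
  \<open>p\<close> says precisely that \<open>p\<close> is the quotient by it.\<close>

lemma galois_quotient_related:
  assumes Y: "Y \<in> galois_quotients C A"
  obtains K i Q p where "galois_related K i Q p" "Y = quotient_class (Comon_coc C A) (regular_module A, p, Q)"
proof -
  interpret H: category "Comon_coc C A" by (rule category_Comon_coc)
  obtain p Q where Ys: "Y \<in> quotients (Comon_coc C A) (regular_module A)" and pY: "(regular_module A, p, Q) \<in> Y" and qc: "quot_condition C A Q p"
    using Y by (auto simp: galois_quotients_def)
  note YD = H.quotientsD[OF Ys pY]
  have Q: "module_comonoid C A Q" "modcomon_morphism C A (regular_module A) Q p" using YD(3) by simp_all
  note QD = module_comonoidD[OF Q(1)]
  interpret M: module_map C A Q p "act Q"
    by unfold_locales (use QD Q in \<open>simp_all add: modcomon_morphism_iff regular_module_cmor\<close>)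
  have "parallel C M.coact M.coact0" by (simp add: parallel_iff)
  then obtain i where i: "is_equalizer C M.coact M.coact0 i"
    using eqs unfolding has_equalizers_def by blast
  obtain K where K: "coc_hopf_monoid C K" "hopf_morphism C K A i" by (rule M.kernel_hopf[OF i])
  have S: "sub_hopf_map C A K i"
    using K i by unfold_locales (auto simp: regular_mono_def)
  interpret S: sub_hopf_map C A K i by (rule S)
  interpret G: galois_pair C A Q p "act Q" K i by unfold_locales
  have "galois_related K i Q p"
    using S Q qc i G.quot_condition_iff[OF i]
    by (simp add: galois_related_def S.translate_def S.translate0_def M.coact_def M.coact0_def)
  then show thesis using that YD(1) by blast
qed

text \<open>A kernel is normal, so the quotient by it is a Hopf monoid and its cokernel there; the
  kernel is recovered by \<open>kernel_equalizer_quotient\<close>.\<close>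

lemma kernel_related:
  assumes X: "X \<in> kernel_subobjects C A"
  obtains K i Q p where "galois_related K i Q p" "X = subobject_class (Hopf_coc C) (K, i, A)"
    "quotient_class (Comon_coc C A) (regular_module A, p, Q) \<in> regular_epi_quotients C A"
proof -
  interpret H: category "Hopf_coc C" by (rule category_Hopf_coc)
  obtain F k where Xs: "X \<in> subobjects (Hopf_coc C) A" and kX: "k \<in> X" and F: "is_kernel C F k"
    using X by (auto simp: kernel_subobjects_def)
  note XD = H.subobjectsD[OF Xs kX]
  obtain K i where k: "k = (K, i, A)" using XD(4) by (cases k) auto
  have FD: "F \<in> Arr (Hopf_coc C)" "Dom (Hopf_coc C) F = A"
    using H.equalizerD(1,6)[OF F[unfolded is_kernel_def Let_def]] XD(4) by simp_all
  obtain f B where F': "F = (A, f, B)" using FD by (cases F) auto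
  interpret f: hopf_map C A B f by unfold_locales (use FD F' in simp_all)
  note kD = f.kernelD[OF F[unfolded F' k]]
  have S: "sub_hopf_map C A K i" by (rule f.kernel_sub_hopf_map[OF kD])
  interpret S: sub_hopf_map C A K i by (rule S)
  have "parallel C S.translate S.translate0" by (simp add: parallel_iff)
  then obtain p where p: "is_coequalizer C S.translate S.translate0 p"
    using coeqs unfolding has_coequalizers_def by blast
  obtain Q :: "('o, 'm) modcomon" where Q: "module_comonoid C A Q" "modcomon_morphism C A (regular_module A) Q p"
    by (rule S.quotient_structure[OF p])
  have r: "galois_related K i Q p"
    using S Q p f.kernel_equalizer_quotient[OF kD p] by (simp add: galois_related_def S.translate_def S.translate0_def)
  obtain L where L: "coc_hopf_monoid C L" "hopf_morphism C A L p"
    by (rule S.hopf_quotient[OF p f.kernel_normal[OF kD]])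
  have re: "regular_epi C p" using p by (auto simp: regular_epi_def)
  have pQ: "cmor A Q p" and pL: "cmor A L p"
    using Q(2) L(2) by (simp_all add: modcomon_morphism_iff regular_module_cmor hopf_morphism_iff)
  have cL: "carr L = carr Q" using cmorD(3)[OF pQ] cmorD(3)[OF pL] by simp
  note cQ = coc_comonoidD(1-7)[OF module_comonoidD(1)[OF Q(1)]]
  note cL' = coc_comonoidD(1-7)[OF coc_hopf.coc[OF coc_hopfI[OF L(1)]]]
  \<comment> \<open>\<open>p\<close> is a comonoid morphism for both structures on its codomain and,
    being epic, determines them. So the Hopf structure extends the comonoid \<open>Q\<close> itself,
    as \<open>regular_epi_in_Hopf\<close> demands.\<close>
  have "comult L = comult Q"
    by (rule regular_epi_cancel[OF re]) (use cmorD[OF pQ] cmorD[OF pL] cL cQ cL' in simp_all)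
  moreover have "counit L = counit Q"
    by (rule regular_epi_cancel[OF re]) (use cmorD[OF pQ] cmorD[OF pL] cL cQ cL' in simp_all)
  moreover have "regular_epi (Hopf_coc C) (A, p, L)"
    using hopf_quotient_regular_epi[OF S p L] unfolding regular_epi_def by blast
  ultimately have "regular_epi_in_Hopf C A Q p"
    unfolding regular_epi_in_Hopf_def using L(1) cL by (intro bexI[of _ L]) simp_all
  then have "quotient_class (Comon_coc C A) (regular_module A, p, Q) \<in> regular_epi_quotients C A"
    using galois_relatedD(4,6)[OF r] unfolding regular_epi_quotients_def galois_quotients_def by blast
  then show thesis using that r XD(1) k by blast
qed

text \<open>The kernel of \<open>p\<close> is taken for the Hopf structure on \<open>Q\<close>; it
  is related to \<open>p\<close> because \<open>p\<close> is then the quotient by it in M as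
  well.\<close>

lemma regular_epi_related:
  assumes Y: "Y \<in> regular_epi_quotients C A"
  obtains K i Q p where "galois_related K i Q p" "Y = quotient_class (Comon_coc C A) (regular_module A, p, Q)"
    "subobject_class (Hopf_coc C) (K, i, A) \<in> kernel_subobjects C A"
proof -
  interpret H: category "Comon_coc C A" by (rule category_Comon_coc)
  obtain p Q where Ys: "Y \<in> quotients (Comon_coc C A) (regular_module A)" and pY: "(regular_module A, p, Q) \<in> Y"
    and re: "regular_epi_in_Hopf C A Q p"
    using Y by (auto simp: regular_epi_quotients_def)
  note YD = H.quotientsD[OF Ys pY]
  have Q: "module_comonoid C A Q" "modcomon_morphism C A (regular_module A) Q p" using YD(3) by simp_all
  obtain L where L: "coc_hopf_monoid C L" "regular_epi (Hopf_coc C) (A, p, L)"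
    using re by (auto simp: regular_epi_in_Hopf_def)
  obtain K i where S: "sub_hopf_map C A K i" and k: "is_kernel C (A, p, L) (K, i, A)"
    and eq: "is_equalizer C ((p \<boxtimes> \<I> (carr A)) \<cdot> comult A) (((p \<cdot> munit A) \<boxtimes> \<I> (carr A)) \<cdot> inv_arrow C (\<lambda>\<^bold>l (carr A))) i"
    and c: "is_coequalizer C (sub_hopf_map.translate C A i) (sub_hopf_map.translate0 C A K) p"
    by (rule regular_epi_is_kernel_quotient[OF L])
  interpret S: sub_hopf_map C A K i by (rule S)
  have r: "galois_related K i Q p"
    using S Q c eq by (simp add: galois_related_def S.translate_def S.translate0_def)
  then have "subobject_class (Hopf_coc C) (K, i, A) \<in> kernel_subobjects C A"
    using galois_relatedD(3,5)[OF r] k unfolding kernel_subobjects_def galois_subobjects_def by blast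
  then show thesis using that r YD(1) by blast
qed

lemma galois_correspondence:
  "(\<forall>X \<in> galois_subobjects C A. phi C A X \<in> galois_quotients C A \<and> psi C A (phi C A X) = X)"
  "(\<forall>Y \<in> galois_quotients C A. psi C A Y \<in> galois_subobjects C A \<and> phi C A (psi C A Y) = Y)"
  "(\<forall>X \<in> kernel_subobjects C A. X \<in> galois_subobjects C A \<and> phi C A X \<in> regular_epi_quotients C A)"
  "(\<forall>Y \<in> regular_epi_quotients C A. Y \<in> galois_quotients C A \<and> psi C A Y \<in> kernel_subobjects C A)"
     apply (metis galois_subobject_related galois_relatedD(1,2,4))
    apply (metis galois_quotient_related galois_relatedD(1,2,3))
   apply (metis kernel_related galois_relatedD(1,3))
  apply (metis regular_epi_related galois_relatedD(2,4))
  done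

end

theorem corollary6p10:
  fixes C :: "('o, 'm) braided_cat" and A :: "('o, 'm) hopf"
  assumes "braided_monoidal_category C"
    and "has_equalizers C" and "has_coequalizers C"
    and "tensor_preserves_equalizers C" and "tensor_preserves_coequalizers C"
    and "A \<in> Obj (Hopf_coc C)"
  shows
    "(bij_betw (phi C A) (galois_subobjects C A) (galois_quotients C A) \<and>
      bij_betw (psi C A) (galois_quotients C A) (galois_subobjects C A) \<and>
      (\<forall>X \<in> galois_subobjects C A. psi C A (phi C A X) = X) \<and>
      (\<forall>Y \<in> galois_quotients C A. phi C A (psi C A Y) = Y)) \<and>
     (kernel_subobjects C A \<subseteq> galois_subobjects C A \<and>
      regular_epi_quotients C A \<subseteq> galois_quotients C A \<and>
      bij_betw (phi C A) (kernel_subobjects C A) (regular_epi_quotients C A) \<and>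
      bij_betw (psi C A) (regular_epi_quotients C A) (kernel_subobjects C A))"
proof -
  interpret braided_monoidal_category C by (rule assms(1))
  interpret exact_hopf C A
    by unfold_locales (use assms in simp_all)
  note g = galois_correspondence
  have "bij_betw (phi C A) (galois_subobjects C A) (galois_quotients C A)"
    by (rule bij_betw_byWitness[where f' = "psi C A"]) (use g in auto)
  moreover have "bij_betw (psi C A) (galois_quotients C A) (galois_subobjects C A)"
    by (rule bij_betw_byWitness[where f' = "phi C A"]) (use g in auto)
  moreover have "bij_betw (phi C A) (kernel_subobjects C A) (regular_epi_quotients C A)"
    by (rule bij_betw_byWitness[where f' = "psi C A"]) (use g in auto)
  moreover have "bij_betw (psi C A) (regular_epi_quotients C A) (kernel_subobjects C A)"
    by (rule bij_betw_byWitness[where f' = "phi C A"]) (use g in auto)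
  ultimately show ?thesis using g by blast
qed

end
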